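(* Let $s\in\overline{\mathbf R_\flat}$ be such that $s<\frac12$, $W=\mathbf C^d\times\mathbf C^d$, and let $T_\#$ be the map from $\widehat{\mathcal A}_0(W)\times\widehat{\mathcal A}_0(W)$ to $\widehat A(W)$ given by $T_\#(a_1,a_2)=a_1\#_{\mathfrak V}a_2$, where $\#_{\mathfrak V}$ is the twisted product of Wick symbols. Then $T_\#$ is uniquely extendable to continuous mappings $$\widehat{\mathcal A}_s(W)\times\widehat{\mathcal A}_s(W)\to\widehat{\mathcal A}_s(W),$$ $$\widehat{\mathcal A}_s'(W)\times\widehat{\mathcal B}_s(W)\to\widehat{\mathcal A}_s'(W),\qquad \widehat{\mathcal B}_s^\star(W)\times\widehat{\mathcal A}_s'(W)\to\widehat{\mathcal A}_s'(W),$$ $$\widehat{\mathcal B}_s(W)\times\widehat{\mathcal B}_s(W)\to\widehat{\mathcal B}_s(W),\qquad \widehat{\mathcal B}_s^\star(W)\times\widehat{\mathcal B}_s^\star(W)\to\widehat{\mathcal B}_s^\star(W),$$ $$\widehat{\mathcal C}_s(W)\times\widehat{\mathcal C}_s(W)\to\widehat{\mathcal C}_s(W),\qquad \widehat{\mathcal C}_s^\star(W)\times\widehat{\mathcal C}_s^\star(W)\to\widehat{\mathcal C}_s^\star(W).$$ If instead $0<s\le\frac12$, then the same holds true with $\widehat{\mathcal A}_{0,s}$, $\widehat{\mathcal B}_{0,s}$ and $\widehat{\mathcal C}_{0,s}$ in place of $\widehat{\mathcal A}_s$, $\widehat{\mathcal B}_s$ and $\widehat{\mathcal C}_s$, respectively,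 at each occurrence (and likewise for the dual and $\star$-versions).
   Context: **Indices and weights.** $\mathbf N=\{0,1,2,\dots\}$. $\overline{\mathbf R_\flat}=[0,\infty)\cup\{\flat_\sigma:\sigma>0\}$, where the $\flat_\sigma$ are formal symbols, ordered so that $x_1<\flat_{\sigma_1}<\flat_{\sigma_2}<x_2$ whenever $x_1<\frac12\le x_2$ and $\sigma_1<\sigma_2$. For $r>0$ and $\alpha\in\mathbf N^d$: $\vartheta_{r,s}(\alpha)=e^{r|\alpha|^{1/(2s)}}$ if $s\in(0,\infty)$; $\vartheta_{r,s}(\alpha)=r^{|\alpha|}(\alpha!)^{1/(2\sigma)}$ if $s=\flat_\sigma$; $\vartheta_{r,0}(\alpha)=1$ if $|\alpha|\le r$ and $=\infty$ if $|\alpha|>r$. Conventions: $a/\infty=0$ for all $a\in(0,\infty]$, $\infty\cdot0=0$. For $\omega:\mathbf N^{2d}\to[0,\infty]$, $\ell_{[\omega]}$ is the set of $c:\mathbf N^{2d}\to\mathbf C$ with $\|c\,\omega\|_{\ell^p}<\infty$, with this (quasi-/semi-)norm, $p\in(0,\infty]$ fixed (the limit spaces below do not depend on $p$). **Spaces.** On $\mathbf N^{2d}=\mathbf N^d\times\mathbf N^d\ni(\alpha,\beta)$ put $\vartheta_r(\alpha,\beta)=\vartheta_{r,s}(\alpha)\vartheta_{r,s}(\beta)$, $\omega_{r_2,r_1}(\alpha,\beta)=\vartheta_{r_2,s}(\alpha)/\vartheta_{r_1,s}(\beta)$, $\omega^\star_{r_2,r_1}(\alpha,\beta)=\vartheta_{r_1,s}(\beta)/\vartheta_{r_2,s}(\alpha)$.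 With limits over positive parameters: $\ell_{\mathcal A,s}=\operatorname{ind\,lim}_r\ell_{[\vartheta_r]}$, $\ell_{\mathcal A,s}^\star=\operatorname{proj\,lim}_r\ell_{[1/\vartheta_r]}$, $\ell_{\mathcal A,0,s}=\operatorname{proj\,lim}_r\ell_{[\vartheta_r]}$, $\ell_{\mathcal A,0,s}^\star=\operatorname{ind\,lim}_r\ell_{[1/\vartheta_r]}$; $\ell_{\mathcal B,s}=\operatorname{proj\,lim}_{r_1}\operatorname{ind\,lim}_{r_2}\ell_{[\omega_{r_2,r_1}]}$, $\ell_{\mathcal B,0,s}=\operatorname{proj\,lim}_{r_2}\operatorname{ind\,lim}_{r_1}\ell_{[\omega_{r_2,r_1}]}$, $\ell_{\mathcal B,s}^\star=\operatorname{proj\,lim}_{r_2}\operatorname{ind\,lim}_{r_1}\ell_{[\omega^\star_{r_2,r_1}]}$, $\ell_{\mathcal B,0,s}^\star=\operatorname{proj\,lim}_{r_1}\operatorname{ind\,lim}_{r_2}\ell_{[\omega^\star_{r_2,r_1}]}$; $\ell_{\mathcal C,s}=\operatorname{ind\,lim}_{r_2}\operatorname{proj\,lim}_{r_1}\ell_{[\omega_{r_2,r_1}]}$, $\ell_{\mathcal C,0,s}=\operatorname{ind\,lim}_{r_1}\operatorname{proj\,lim}_{r_2}\ell_{[\omega_{r_2,r_1}]}$, $\ell_{\mathcal C,s}^\star=\operatorname{ind\,lim}_{r_1}\operatorname{proj\,lim}_{r_2}\ell_{[\omega^\star_{r_2,r_1}]}$, $\ell_{\mathcal C,0,s}^\star=\operatorname{ind\,lim}_{r_2}\operatorname{proj\,lim}_{r_1}\ell_{[\omega^\star_{r_2,r_1}]}$.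 As sets, projective/inductive limits are intersections/unions. With $e_\alpha(z)=z^\alpha/\sqrt{\alpha!}$, the spaces $\widehat{\mathcal A}_s(W),\widehat{\mathcal B}_s(W),\widehat{\mathcal B}_s^\star(W)$, etc. consist of the formal series $a(z,w)=\sum c(a;\alpha,\beta)e_\alpha(z)e_\beta(\overline w)$ with coefficients in the sequence space with the same decorations, with transported topology; $\widehat{\mathcal A}_s'(W)$ and $\widehat{\mathcal A}_{0,s}'(W)$ correspond to $\ell_{\mathcal A,s}^\star$ and $\ell_{\mathcal A,0,s}^\star$. $\widehat{\mathcal A}_0(W)$ is the space of such series with finitely many non-zero coefficients; $\widehat A(W)$ is the set of functions $a(z,w)$ such that $(z,w)\mapsto a(z,\overline w)$ is entire. **Twisted product.** For $a\in\widehat{\mathcal A}_0(W)$ and a polynomial $F$ on $\mathbf C^d$, the Wick operator is $\operatorname{Op}_{\mathfrak V}(a)F(z)=\pi^{-d}\int_{\mathbf C^d}a(z,w)F(w)e^{(z-w,w)}\,d\lambda(w)$, where $(z,w)=\sum_jz_j\overline{w_j}$ and $d\lambda$ is Lebesgue measure. The twisted product is defined by $\operatorname{Op}_{\mathfrak V}(a_1)\circ\operatorname{Op}_{\mathfrak V}(a_2)=\operatorname{Op}_{\mathfrak V}(a_1\#_{\mathfrak V}a_2)$, i.e. $a_1\#_{\mathfrak V}a_2(z,w)=\pi^{-d}\int_{\mathbf C^d}a_1(z,u)a_2(u,w)e^{-(z-u,w-u)}\,d\lambda(u)$.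
   Formalization: "Continuous" is joint continuity only for the first mapping (and its 0-version); for the other six, where joint continuity fails because they contain the pairing of a non-normable space with its dual, it means bilinear and hypocontinuous with respect to bounded sets of both factors. *)

theory Defs
  imports "HOL-Analysis.Analysis"
begin

section \<open>The extended parameter set\<close>

text \<open>\<open>Flat \<sigma>\<close> is the formal symbol flat-sigma. It lies above every \<open>Num x\<close> with \<open>x < 1/2\<close>
  and below every \<open>Num x\<close> with \<open>x \<ge> 1/2\<close>.\<close>

datatype rflat = Num real | Flat real

instantiation rflat :: linorder
begin

fun less_rflat :: "rflat \<Rightarrow> rflat \<Rightarrow> bool" where
  "less_rflat (Num x) (Num y) \<longleftrightarrow> x < y"
| "less_rflat (Num x) (Flat \<tau>) \<longleftrightarrow> x < 1/2"
| "less_rflat (Flat \<sigma>) (Num y) \<longleftrightarrow> 1/2 \<le> y"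
| "less_rflat (Flat \<sigma>) (Flat \<tau>) \<longleftrightarrow> \<sigma> < \<tau>"

definition less_eq_rflat :: "rflat \<Rightarrow> rflat \<Rightarrow> bool" where
  "less_eq_rflat x y \<longleftrightarrow> x < y \<or> x = y"

instance
proof
  fix x y z :: rflat
  show "(x < y) = (x \<le> y \<and> \<not> y \<le> x)"
    by (cases x; cases y) (auto simp: less_eq_rflat_def)
  show "x \<le> x"
    by (simp add: less_eq_rflat_def)
  show "x \<le> z" if "x \<le> y" "y \<le> z"
    using that by (cases x; cases y; cases z) (auto simp: less_eq_rflat_def)
  show "x = y" if "x \<le> y" "y \<le> x"
    using that by (cases x; cases y) (auto simp: less_eq_rflat_def)
  show "x \<le> y \<or> y \<le> x"
    by (cases x; cases y) (auto simp: less_eq_rflat_def)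
qed

end

definition Rflat :: "rflat set" where
  "Rflat = Num ` {0..} \<union> Flat ` {0<..}"

section \<open>Weights and weighted sequence spaces\<close>

definition midx_abs :: "nat ^ 'n::finite \<Rightarrow> nat" where
  "midx_abs \<alpha> = (\<Sum>i\<in>UNIV. \<alpha> $ i)"

definition midx_fact :: "nat ^ 'n::finite \<Rightarrow> real" where
  "midx_fact \<alpha> = (\<Prod>i\<in>UNIV. fact (\<alpha> $ i))"

text \<open>Weights take values in \<^typ>\<open>ennreal\<close>, where \<open>a / top = 0\<close> for all \<open>a\<close> (including \<open>top\<close>) and
  \<open>top * 0 = 0\<close>.\<close>

fun vtheta :: "rflat \<Rightarrow> real \<Rightarrow> nat ^ 'n::finite \<Rightarrow> ennreal" where
  "vtheta (Num t) r \<alpha> =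
     (if t = 0 then (if real (midx_abs \<alpha>) \<le> r then 1 else top)
      else ennreal (exp (r * real (midx_abs \<alpha>) powr (1 / (2 * t)))))"
| "vtheta (Flat \<sigma>) r \<alpha> = ennreal (r ^ midx_abs \<alpha> * midx_fact \<alpha> powr (1 / (2 * \<sigma>)))"

text \<open>A family \<open>c\<close> of this type is the formal power series
  \<open>\<Sum>\<^sub>\<alpha>\<^sub>,\<^sub>\<beta> c (\<alpha>, \<beta>) e\<^sub>\<alpha>(z) e\<^sub>\<beta>(w\<^sup>*)\<close>, where \<open>w\<^sup>*\<close> is the complex conjugate of \<open>w\<close>.\<close>

type_synonym 'n wseries = "(nat ^ 'n) \<times> (nat ^ 'n) \<Rightarrow> complex"

definition ennreal_powr :: "ennreal \<Rightarrow> real \<Rightarrow> ennreal" where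
  "ennreal_powr x q = (if x = top then top else ennreal (enn2real x powr q))"

definition lp_norm :: "ennreal \<Rightarrow> ('x \<Rightarrow> ennreal) \<Rightarrow> ennreal" where
  "lp_norm p f =
     (if p = top then (SUP x. f x)
      else ennreal_powr (\<integral>\<^sup>+x. ennreal_powr (f x) (enn2real p) \<partial>count_space UNIV) (1 / enn2real p))"

definition wnorm :: "ennreal \<Rightarrow> ('x \<Rightarrow> ennreal) \<Rightarrow> ('x \<Rightarrow> complex) \<Rightarrow> ennreal" where
  "wnorm p \<omega> c = lp_norm p (\<lambda>x. ennreal (cmod (c x)) * \<omega> x)"

definition wspace :: "ennreal \<Rightarrow> ('x \<Rightarrow> ennreal) \<Rightarrow> ('x \<Rightarrow> complex) set" where
  "wspace p \<omega> = {c. wnorm p \<omega> c < top}"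

definition wopen :: "ennreal \<Rightarrow> ('x \<Rightarrow> ennreal) \<Rightarrow> ('x \<Rightarrow> complex) set \<Rightarrow> bool" where
  "wopen p \<omega> U \<longleftrightarrow> U \<subseteq> wspace p \<omega> \<and>
     (\<forall>c\<in>U. \<exists>\<epsilon>>0. \<forall>d\<in>wspace p \<omega>. wnorm p \<omega> (\<lambda>x. d x - c x) < \<epsilon> \<longrightarrow> d \<in> U)"

definition wtop :: "ennreal \<Rightarrow> ('x \<Rightarrow> ennreal) \<Rightarrow> ('x \<Rightarrow> complex) topology" where
  "wtop p \<omega> = topology (wopen p \<omega>)"

lemma istopology_wopen: "istopology (wopen p \<omega>)"
  unfolding istopology_def
proof (intro conjI allI impI)
  fix S T assume S: "wopen p \<omega> S" and T: "wopen p \<omega> T"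
  show "wopen p \<omega> (S \<inter> T)"
    unfolding wopen_def
  proof (intro conjI ballI)
    show "S \<inter> T \<subseteq> wspace p \<omega>" using S by (auto simp: wopen_def)
    fix c assume c: "c \<in> S \<inter> T"
    obtain \<epsilon> where \<epsilon>: "\<epsilon> > 0" "\<And>d. d \<in> wspace p \<omega> \<Longrightarrow> wnorm p \<omega> (\<lambda>x. d x - c x) < \<epsilon> \<Longrightarrow> d \<in> S"
      using S c unfolding wopen_def by blast
    obtain \<delta> where \<delta>: "\<delta> > 0" "\<And>d. d \<in> wspace p \<omega> \<Longrightarrow> wnorm p \<omega> (\<lambda>x. d x - c x) < \<delta> \<Longrightarrow> d \<in> T"
      using T c unfolding wopen_def by blast
    show "\<exists>\<epsilon>>0. \<forall>d\<in>wspace p \<omega>. wnorm p \<omega> (\<lambda>x. d x - c x) < \<epsilon> \<longrightarrow> d \<in> S \<inter> T"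
      by (rule exI[of _ "min \<epsilon> \<delta>"]) (use \<epsilon> \<delta> in auto)
  qed
next
  fix K assume "\<forall>U\<in>K. wopen p \<omega> U"
  then have sub: "\<And>U. U \<in> K \<Longrightarrow> U \<subseteq> wspace p \<omega>"
    and nb: "\<And>U c. U \<in> K \<Longrightarrow> c \<in> U \<Longrightarrow>
      \<exists>\<epsilon>>0. \<forall>d\<in>wspace p \<omega>. wnorm p \<omega> (\<lambda>x. d x - c x) < \<epsilon> \<longrightarrow> d \<in> U"
    by (simp_all add: wopen_def)
  show "wopen p \<omega> (\<Union>K)"
    unfolding wopen_def
  proof (intro conjI ballI)
    show "\<Union>K \<subseteq> wspace p \<omega>" using sub by blast
    fix c assume "c \<in> \<Union>K"
    then obtain U where U: "U \<in> K" "c \<in> U" by blast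
    from nb[OF this] U(1) show "\<exists>\<epsilon>>0. \<forall>d\<in>wspace p \<omega>. wnorm p \<omega> (\<lambda>x. d x - c x) < \<epsilon> \<longrightarrow> d \<in> \<Union>K"
      by blast
  qed
qed

lemma openin_wtop: "openin (wtop p \<omega>) = wopen p \<omega>"
  unfolding wtop_def by (rule topology_inverse'[OF istopology_wopen])

lemma topspace_wtop: "topspace (wtop p \<omega>) = wspace p \<omega>"
proof
  show "topspace (wtop p \<omega>) \<subseteq> wspace p \<omega>"
    by (auto simp: topspace_def openin_wtop wopen_def)
  have "wopen p \<omega> (wspace p \<omega>)"
    unfolding wopen_def using zero_less_one by blast
  then show "wspace p \<omega> \<subseteq> topspace (wtop p \<omega>)"
    by (auto simp: topspace_def openin_wtop)
qed

section \<open>Projective and inductive limits\<close>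

text \<open>The coarsest topology on the intersection making all inclusions continuous.\<close>

definition proj_lim :: "'i set \<Rightarrow> ('i \<Rightarrow> 'a topology) \<Rightarrow> 'a topology" where
  "proj_lim I T = topology_generated_by
     (\<Union>i\<in>I. {U \<inter> (\<Inter>j\<in>I. topspace (T j)) |U. openin (T i) U})"

lemma topspace_proj_lim:
  assumes "I \<noteq> {}"
  shows "topspace (proj_lim I T) = (\<Inter>j\<in>I. topspace (T j))"
  unfolding proj_lim_def topology_generated_by_topspace
  using assms by blast

lemma continuous_map_proj_lim:
  assumes "i \<in> I"
  shows "continuous_map (proj_lim I T) (T i) (\<lambda>x. x)"
proof -
  let ?X = "\<Inter>j\<in>I. topspace (T j)"
  have ts: "topspace (proj_lim I T) = ?X"
    using assms by (intro topspace_proj_lim) blast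
  have "openin (proj_lim I T) (U \<inter> ?X)" if "openin (T i) U" for U
    unfolding proj_lim_def
    by (rule topology_generated_by_Basis) (use that assms in blast)
  moreover have "{x \<in> ?X. x \<in> U} = U \<inter> ?X" for U by blast
  ultimately show ?thesis
    unfolding continuous_map_def ts using assms by auto
qed

definition abs_convex :: "('x \<Rightarrow> complex) set \<Rightarrow> bool" where
  "abs_convex V \<longleftrightarrow>
     (\<forall>f\<in>V. \<forall>g\<in>V. \<forall>a b. cmod a + cmod b \<le> 1 \<longrightarrow> (\<lambda>x. a * f x + b * g x) \<in> V)"

text \<open>Inductive limits are those of locally convex spaces: the union carries the finest locally
  convex topology making all inclusions continuous, which has as neighbourhood base at \<open>0\<close> the
  absolutely convex sets whose trace on every step is a neighbourhood of \<open>0\<close> in that step.\<close>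

definition ind_nhd :: "'i set \<Rightarrow> ('i \<Rightarrow> ('x \<Rightarrow> complex) topology) \<Rightarrow> ('x \<Rightarrow> complex) set \<Rightarrow> bool" where
  "ind_nhd I T V \<longleftrightarrow> abs_convex V \<and> V \<subseteq> (\<Union>i\<in>I. topspace (T i)) \<and>
     (\<forall>i\<in>I. \<exists>U. openin (T i) U \<and> (\<lambda>_. 0) \<in> U \<and> U \<subseteq> V)"

definition ind_open :: "'i set \<Rightarrow> ('i \<Rightarrow> ('x \<Rightarrow> complex) topology) \<Rightarrow> ('x \<Rightarrow> complex) set \<Rightarrow> bool" where
  "ind_open I T U \<longleftrightarrow> U \<subseteq> (\<Union>i\<in>I. topspace (T i)) \<and>
     (\<forall>c\<in>U. \<exists>V. ind_nhd I T V \<and> (\<forall>v\<in>V. (\<lambda>x. c x + v x) \<in> U))"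

definition ind_lim :: "'i set \<Rightarrow> ('i \<Rightarrow> ('x \<Rightarrow> complex) topology) \<Rightarrow> ('x \<Rightarrow> complex) topology" where
  "ind_lim I T = topology (ind_open I T)"

lemma ind_nhd_Int:
  assumes V: "ind_nhd I T V" and W: "ind_nhd I T W"
  shows "ind_nhd I T (V \<inter> W)"
  unfolding ind_nhd_def
proof (intro conjI ballI)
  show "abs_convex (V \<inter> W)"
    using V W unfolding ind_nhd_def abs_convex_def by blast
  show "V \<inter> W \<subseteq> (\<Union>i\<in>I. topspace (T i))"
    using V unfolding ind_nhd_def by blast
  fix i assume i: "i \<in> I"
  obtain U1 where U1: "openin (T i) U1" "(\<lambda>_. 0) \<in> U1" "U1 \<subseteq> V"
    using V i unfolding ind_nhd_def by blast
  obtain U2 where U2: "openin (T i) U2" "(\<lambda>_. 0) \<in> U2" "U2 \<subseteq> W"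
    using W i unfolding ind_nhd_def by blast
  show "\<exists>U. openin (T i) U \<and> (\<lambda>_. 0) \<in> U \<and> U \<subseteq> V \<inter> W"
    by (rule exI[of _ "U1 \<inter> U2"]) (use U1 U2 in auto)
qed

lemma istopology_ind_open: "istopology (ind_open I T)"
  unfolding istopology_def
proof (intro conjI allI impI)
  fix S R assume S: "ind_open I T S" and R: "ind_open I T R"
  show "ind_open I T (S \<inter> R)"
    unfolding ind_open_def
  proof (intro conjI ballI)
    show "S \<inter> R \<subseteq> (\<Union>i\<in>I. topspace (T i))"
      using S unfolding ind_open_def by blast
    fix c assume c: "c \<in> S \<inter> R"
    obtain V where V: "ind_nhd I T V" "\<forall>v\<in>V. (\<lambda>x. c x + v x) \<in> S"
      using S c unfolding ind_open_def by blast
    obtain W where W: "ind_nhd I T W" "\<forall>v\<in>W. (\<lambda>x. c x + v x) \<in> R"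
      using R c unfolding ind_open_def by blast
    show "\<exists>V. ind_nhd I T V \<and> (\<forall>v\<in>V. (\<lambda>x. c x + v x) \<in> S \<inter> R)"
      by (rule exI[of _ "V \<inter> W"]) (use V W ind_nhd_Int in auto)
  qed
next
  fix K assume K: "\<forall>U\<in>K. ind_open I T U"
  show "ind_open I T (\<Union>K)"
    unfolding ind_open_def
  proof (intro conjI ballI)
    show "\<Union>K \<subseteq> (\<Union>i\<in>I. topspace (T i))"
      using K unfolding ind_open_def by blast
    fix c assume "c \<in> \<Union>K"
    then obtain U where U: "U \<in> K" "c \<in> U" by blast
    then obtain V where "ind_nhd I T V" "\<forall>v\<in>V. (\<lambda>x. c x + v x) \<in> U"
      using K unfolding ind_open_def by blast
    then show "\<exists>V. ind_nhd I T V \<and> (\<forall>v\<in>V. (\<lambda>x. c x + v x) \<in> \<Union>K)"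
      using U(1) by blast
  qed
qed

lemma openin_ind_lim: "openin (ind_lim I T) = ind_open I T"
  unfolding ind_lim_def by (rule topology_inverse'[OF istopology_ind_open])

lemma topspace_ind_lim:
  assumes lin: "\<And>f g a b. f \<in> (\<Union>i\<in>I. topspace (T i)) \<Longrightarrow> g \<in> (\<Union>i\<in>I. topspace (T i)) \<Longrightarrow>
      (\<lambda>x. a * f x + b * g x) \<in> (\<Union>i\<in>I. topspace (T i))"
    and zero: "\<And>i. i \<in> I \<Longrightarrow> (\<lambda>_. 0) \<in> topspace (T i)"
  shows "topspace (ind_lim I T) = (\<Union>i\<in>I. topspace (T i))" (is "_ = ?X")
proof
  show "topspace (ind_lim I T) \<subseteq> ?X"
    unfolding topspace_def openin_ind_lim ind_open_def by blast
  have "ind_nhd I T ?X"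
    unfolding ind_nhd_def abs_convex_def using lin zero by (meson UN_upper openin_topspace order_refl)
  moreover have "(\<lambda>x. c x + v x) \<in> ?X" if "c \<in> ?X" "v \<in> ?X" for c v
    using lin[OF that, of 1 1] by simp
  ultimately have "ind_open I T ?X"
    unfolding ind_open_def by blast
  then show "?X \<subseteq> topspace (ind_lim I T)"
    unfolding topspace_def openin_ind_lim by blast
qed

section \<open>The spaces of formal power series\<close>

definition wt :: "rflat \<Rightarrow> real \<Rightarrow> (nat ^ 'n::finite) \<times> (nat ^ 'n) \<Rightarrow> ennreal" where
  "wt s r = (\<lambda>(\<alpha>, \<beta>). vtheta s r \<alpha> * vtheta s r \<beta>)"

definition wt_inv :: "rflat \<Rightarrow> real \<Rightarrow> (nat ^ 'n::finite) \<times> (nat ^ 'n) \<Rightarrow> ennreal" where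
  "wt_inv s r = (\<lambda>ab. 1 / wt s r ab)"

definition wt_om :: "rflat \<Rightarrow> real \<Rightarrow> real \<Rightarrow> (nat ^ 'n::finite) \<times> (nat ^ 'n) \<Rightarrow> ennreal" where
  "wt_om s r2 r1 = (\<lambda>(\<alpha>, \<beta>). vtheta s r2 \<alpha> / vtheta s r1 \<beta>)"

definition wt_om_star :: "rflat \<Rightarrow> real \<Rightarrow> real \<Rightarrow> (nat ^ 'n::finite) \<times> (nat ^ 'n) \<Rightarrow> ennreal" where
  "wt_om_star s r2 r1 = (\<lambda>(\<alpha>, \<beta>). vtheta s r1 \<beta> / vtheta s r2 \<alpha>)"

abbreviation ilim :: "(real \<Rightarrow> ('x \<Rightarrow> complex) topology) \<Rightarrow> ('x \<Rightarrow> complex) topology"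
    (binder "INDLIM " 10) where
  "ilim \<equiv> ind_lim {0<..}"

abbreviation plim :: "(real \<Rightarrow> ('x \<Rightarrow> complex) topology) \<Rightarrow> ('x \<Rightarrow> complex) topology"
    (binder "PROJLIM " 10) where
  "plim \<equiv> proj_lim {0<..}"

text \<open>The suffix \<open>_dual\<close> stands for the prime, and the infix \<open>0\<close> for the subscript \<open>0, s\<close>.\<close>

definition A_hat :: "ennreal \<Rightarrow> rflat \<Rightarrow> 'n::finite wseries topology" where
  "A_hat p s = (INDLIM r. wtop p (wt s r))"

definition A_hat_dual :: "ennreal \<Rightarrow> rflat \<Rightarrow> 'n::finite wseries topology" where
  "A_hat_dual p s = (PROJLIM r. wtop p (wt_inv s r))"

definition A0_hat :: "ennreal \<Rightarrow> rflat \<Rightarrow> 'n::finite wseries topology" where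
  "A0_hat p s = (PROJLIM r. wtop p (wt s r))"

definition A0_hat_dual :: "ennreal \<Rightarrow> rflat \<Rightarrow> 'n::finite wseries topology" where
  "A0_hat_dual p s = (INDLIM r. wtop p (wt_inv s r))"

definition B_hat :: "ennreal \<Rightarrow> rflat \<Rightarrow> 'n::finite wseries topology" where
  "B_hat p s = (PROJLIM r1. INDLIM r2. wtop p (wt_om s r2 r1))"

definition B0_hat :: "ennreal \<Rightarrow> rflat \<Rightarrow> 'n::finite wseries topology" where
  "B0_hat p s = (PROJLIM r2. INDLIM r1. wtop p (wt_om s r2 r1))"

definition B_hat_star :: "ennreal \<Rightarrow> rflat \<Rightarrow> 'n::finite wseries topology" where
  "B_hat_star p s = (PROJLIM r2. INDLIM r1. wtop p (wt_om_star s r2 r1))"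

definition B0_hat_star :: "ennreal \<Rightarrow> rflat \<Rightarrow> 'n::finite wseries topology" where
  "B0_hat_star p s = (PROJLIM r1. INDLIM r2. wtop p (wt_om_star s r2 r1))"

definition C_hat :: "ennreal \<Rightarrow> rflat \<Rightarrow> 'n::finite wseries topology" where
  "C_hat p s = (INDLIM r2. PROJLIM r1. wtop p (wt_om s r2 r1))"

definition C0_hat :: "ennreal \<Rightarrow> rflat \<Rightarrow> 'n::finite wseries topology" where
  "C0_hat p s = (INDLIM r1. PROJLIM r2. wtop p (wt_om s r2 r1))"

definition C_hat_star :: "ennreal \<Rightarrow> rflat \<Rightarrow> 'n::finite wseries topology" where
  "C_hat_star p s = (INDLIM r1. PROJLIM r2. wtop p (wt_om_star s r2 r1))"

definition C0_hat_star :: "ennreal \<Rightarrow> rflat \<Rightarrow> 'n::finite wseries topology" where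
  "C0_hat_star p s = (INDLIM r2. PROJLIM r1. wtop p (wt_om_star s r2 r1))"

definition A_fin :: "'n::finite wseries set" where
  "A_fin = {c. finite {ab. c ab \<noteq> 0}}"

section \<open>The twisted product\<close>

definition herm :: "complex ^ 'n::finite \<Rightarrow> complex ^ 'n \<Rightarrow> complex" where
  "herm z w = (\<Sum>j\<in>UNIV. z $ j * cnj (w $ j))"

definition cnj_vec :: "complex ^ 'n::finite \<Rightarrow> complex ^ 'n" where
  "cnj_vec w = (\<chi> j. cnj (w $ j))"

definition e_mon :: "nat ^ 'n::finite \<Rightarrow> complex ^ 'n \<Rightarrow> complex" where
  "e_mon \<alpha> z = (\<Prod>j\<in>UNIV. z $ j ^ (\<alpha> $ j)) / complex_of_real (sqrt (midx_fact \<alpha>))"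

definition wterm :: "'n::finite wseries \<Rightarrow> complex ^ 'n \<Rightarrow> complex ^ 'n \<Rightarrow>
    (nat ^ 'n) \<times> (nat ^ 'n) \<Rightarrow> complex" where
  "wterm c z w = (\<lambda>(\<alpha>, \<beta>). c (\<alpha>, \<beta>) * e_mon \<alpha> z * e_mon \<beta> (cnj_vec w))"

definition fin_symbol :: "'n::finite wseries \<Rightarrow> complex ^ 'n \<Rightarrow> complex ^ 'n \<Rightarrow> complex" where
  "fin_symbol c z w = (\<Sum>ab\<in>{ab. c ab \<noteq> 0}. wterm c z w ab)"

definition twisted_prod :: "(complex ^ 'n::finite \<Rightarrow> complex ^ 'n \<Rightarrow> complex) \<Rightarrow>
    (complex ^ 'n \<Rightarrow> complex ^ 'n \<Rightarrow> complex) \<Rightarrow> complex ^ 'n \<Rightarrow> complex ^ 'n \<Rightarrow> complex" where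
  "twisted_prod a1 a2 z w = complex_of_real (1 / pi ^ CARD('n)) *
     (LINT u|lborel. a1 z u * a2 u w * exp (- herm (z - u) (w - u)))"

text \<open>\<open>T (c1, c2)\<close> is the power series of the function \<open>a1 # a2\<close>, whenever \<open>c1\<close>, \<open>c2\<close> are the
  coefficients of the polynomial symbols \<open>a1\<close>, \<open>a2\<close>. This is the inclusion of functions \<open>a\<close> with
  \<open>a(z, w\<^sup>*)\<close> entire into the formal power series; the unconditional convergence at every point
  includes that \<open>a1 # a2\<close> is such a function.\<close>

definition extends_twisted :: "('n::finite wseries \<times> 'n wseries \<Rightarrow> 'n wseries) \<Rightarrow> bool" where
  "extends_twisted T \<longleftrightarrow> (\<forall>c1\<in>A_fin. \<forall>c2\<in>A_fin. \<forall>z w.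
     (wterm (T (c1, c2)) z w has_sum twisted_prod (fin_symbol c1) (fin_symbol c2) z w) UNIV)"

section \<open>Continuity of bilinear mappings and unique extension\<close>

text \<open>Evaluation-type pairings
  between a non-normable space and its dual, which occur as restrictions of the twisted product to
  the mixed spaces, are never jointly continuous; there continuity of a bilinear mapping means
  hypocontinuity with respect to the bounded sets of both factors, which entails separate
  continuity and joint sequential continuity.\<close>

definition jointly_continuous ::
    "'a topology \<Rightarrow> 'b topology \<Rightarrow> 'c topology \<Rightarrow> ('a \<times> 'b \<Rightarrow> 'c) \<Rightarrow> bool" where
  "jointly_continuous E F G f \<longleftrightarrow> continuous_map (prod_topology E F) G f"

definition separately_continuous ::
    "'a topology \<Rightarrow> 'b topology \<Rightarrow> 'c topology \<Rightarrow> ('a \<times> 'b \<Rightarrow> 'c) \<Rightarrow> bool" where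
  "separately_continuous E F G f \<longleftrightarrow>
     (\<forall>x\<in>topspace E. continuous_map F G (\<lambda>y. f (x, y))) \<and>
     (\<forall>y\<in>topspace F. continuous_map E G (\<lambda>x. f (x, y)))"

definition tvs_bounded :: "('x \<Rightarrow> complex) topology \<Rightarrow> ('x \<Rightarrow> complex) set \<Rightarrow> bool" where
  "tvs_bounded E S \<longleftrightarrow> S \<subseteq> topspace E \<and>
     (\<forall>U. openin E U \<and> (\<lambda>_. 0) \<in> U \<longrightarrow>
        (\<exists>t::real>0. \<forall>c\<in>S. (\<lambda>x. c x / complex_of_real t) \<in> U))"

definition bilinear_map_on :: "('x \<Rightarrow> complex) set \<Rightarrow> ('y \<Rightarrow> complex) set \<Rightarrow>
    (('x \<Rightarrow> complex) \<times> ('y \<Rightarrow> complex) \<Rightarrow> ('z \<Rightarrow> complex)) \<Rightarrow> bool" where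
  "bilinear_map_on X Y f \<longleftrightarrow>
     (\<forall>c\<in>X. \<forall>c'\<in>X. \<forall>d\<in>Y. \<forall>a b.
        f (\<lambda>x. a * c x + b * c' x, d) = (\<lambda>x. a * f (c, d) x + b * f (c', d) x)) \<and>
     (\<forall>c\<in>X. \<forall>d\<in>Y. \<forall>d'\<in>Y. \<forall>a b.
        f (c, \<lambda>x. a * d x + b * d' x) = (\<lambda>x. a * f (c, d) x + b * f (c, d') x))"

definition hypocontinuous :: "('x \<Rightarrow> complex) topology \<Rightarrow> ('y \<Rightarrow> complex) topology \<Rightarrow>
    ('z \<Rightarrow> complex) topology \<Rightarrow> (('x \<Rightarrow> complex) \<times> ('y \<Rightarrow> complex) \<Rightarrow> ('z \<Rightarrow> complex)) \<Rightarrow> bool" where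
  "hypocontinuous E F G f \<longleftrightarrow>
     bilinear_map_on (topspace E) (topspace F) f \<and>
     separately_continuous E F G f \<and>
     (\<forall>S W. tvs_bounded E S \<and> openin G W \<and> (\<lambda>_. 0) \<in> W \<longrightarrow>
        (\<exists>V. openin F V \<and> (\<lambda>_. 0) \<in> V \<and> (\<forall>c\<in>S. \<forall>d\<in>V. f (c, d) \<in> W))) \<and>
     (\<forall>S W. tvs_bounded F S \<and> openin G W \<and> (\<lambda>_. 0) \<in> W \<longrightarrow>
        (\<exists>V. openin E V \<and> (\<lambda>_. 0) \<in> V \<and> (\<forall>c\<in>V. \<forall>d\<in>S. f (c, d) \<in> W)))"

text \<open>The extension is required to be unique even among the merely separately continuous ones.\<close>

definition uniquely_extends ::
    "('n::finite wseries topology \<Rightarrow> 'n wseries topology \<Rightarrow> 'n wseries topology \<Rightarrow>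
        ('n wseries \<times> 'n wseries \<Rightarrow> 'n wseries) \<Rightarrow> bool) \<Rightarrow>
     'n wseries topology \<Rightarrow> 'n wseries topology \<Rightarrow> 'n wseries topology \<Rightarrow> bool" where
  "uniquely_extends Cont E F G \<longleftrightarrow> A_fin \<subseteq> topspace E \<and> A_fin \<subseteq> topspace F \<and>
     (\<exists>T. extends_twisted T \<and> Cont E F G T \<and>
        (\<forall>T'. extends_twisted T' \<and> separately_continuous E F G T' \<longrightarrow>
           (\<forall>c\<in>topspace E. \<forall>d\<in>topspace F. T' (c, d) = T (c, d))))"

end

theory Submission
  imports Defs "HOL-Probability.Characteristic_Functions"
begin

text \<open>On coefficients the twisted product is a bilinear map
  \<open>T(c, d)(z) = \<Sum>\<^sub>t k(z, t) c(X(z, t)) d(Y(z, t))\<close> with a nonnegative kernel \<open>k\<close>, which is read off from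
  the Gaussian integral of the generating functions of the monomials. All sequence spaces are limits of
  weighted sup-normed spaces: consecutive weights differ by factors that are summable to every power, so
  that \<open>p\<close> is irrelevant, and the limits may be taken over the natural numbers. Neighbourhoods of \<open>0\<close> may be
  taken solid, and as \<open>k \<ge> 0\<close>, continuity of \<open>T\<close> reduces to pointwise estimates between triples of weights.
  These follow from the fact that \<open>\<theta>\<^sub>r(\<alpha> + \<beta>)\<close> and \<open>\<theta>\<^sub>r(\<alpha>) \<theta>\<^sub>r(\<beta>)\<close> dominate each other after a change of \<open>r\<close>,
  even with an additional factor \<open>4\<close> to the power \<open>|\<alpha> + \<beta>|\<close>; this is where \<open>s < 1/2\<close>, respectively \<open>s \<le> 1/2\<close>, enters.
  Hypocontinuity follows from separate continuity because bounded sets are order bounded or, for the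
  spaces \<open>C\<close>, by a barrel argument. Uniqueness holds since finitely supported families are dense and a
  power series is determined by its values.\<close>

section \<open>Locally convex spaces with solid neighbourhoods\<close>

text \<open>The condition on \<open>s\<close> comes from absorbing a factor \<open>4 ^ n\<close>
  into a change of \<open>r\<close> in \<open>exp (r * n powr (1 / (2 * s)))\<close>. In the Roumieu
  spaces \<open>r\<close> may be arbitrarily small, so the exponent of \<open>n\<close> must exceed
  1; in the Beurling spaces \<open>r\<close> may be taken as large as desired, and exponent 1
  suffices. For the flat symbols multiplying \<open>r\<close> by a constant absorbs any geometric
  factor. The obstacle in the inductive limits is that a neighbourhood of 0 is known only as an
  absolutely convex set with large traces on the steps, while the maps to be tested are linear only
  on the limit space and not on whole steps. Solid cores of preimages overcome this; they are
  absolutely convex by the Riesz decomposition property. In the product the contraction index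
  \<gamma> occurs in both factors but not in the result, so the growth of one factor in \<gamma> has
  to be beaten by the decay of the other. This fixes the order in which the indices of the weights
  can be chosen.\<close>

definition dominated :: "('x \<Rightarrow> complex) \<Rightarrow> ('x \<Rightarrow> complex) \<Rightarrow> bool" where
  "dominated d c \<longleftrightarrow> (\<forall>x. cmod (d x) \<le> cmod (c x))"

definition solid :: "('x \<Rightarrow> complex) set \<Rightarrow> bool" where
  "solid V \<longleftrightarrow> (\<forall>c\<in>V. \<forall>d. dominated d c \<longrightarrow> d \<in> V)"

definition solid_space :: "('x \<Rightarrow> complex) set \<Rightarrow> bool" where
  "solid_space L \<longleftrightarrow> (\<lambda>_. 0) \<in> L \<and> solid L \<and>
     (\<forall>c\<in>L. \<forall>d\<in>L. \<forall>a b. (\<lambda>x. a * c x + b * d x) \<in> L)"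

definition linear_on_space :: "('x \<Rightarrow> complex) set \<Rightarrow> (('x \<Rightarrow> complex) \<Rightarrow> ('y \<Rightarrow> complex)) \<Rightarrow> bool" where
  "linear_on_space L f \<longleftrightarrow>
     (\<forall>c\<in>L. \<forall>d\<in>L. \<forall>a b. f (\<lambda>x. a * c x + b * d x) = (\<lambda>x. a * f c x + b * f d x))"

lemma solidD: "solid V \<Longrightarrow> c \<in> V \<Longrightarrow> dominated d c \<Longrightarrow> d \<in> V"
  by (auto simp: solid_def)

lemma dominated_refl [simp]: "dominated c c"
  by (simp add: dominated_def)

lemma dominated_trans: "dominated c d \<Longrightarrow> dominated d e \<Longrightarrow> dominated c e"
  unfolding dominated_def using order_trans by blast

lemma dominated_cmod [simp]: "dominated (\<lambda>x. complex_of_real (cmod (c x))) d \<longleftrightarrow> dominated c d"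
  "dominated c (\<lambda>x. complex_of_real (cmod (d x))) \<longleftrightarrow> dominated c d"
  by (auto simp: dominated_def)

lemma abs_convexD:
  "abs_convex V \<Longrightarrow> f \<in> V \<Longrightarrow> g \<in> V \<Longrightarrow> cmod a + cmod b \<le> 1 \<Longrightarrow> (\<lambda>x. a * f x + b * g x) \<in> V"
  by (auto simp: abs_convex_def)

lemma abs_convex_scale: "abs_convex V \<Longrightarrow> f \<in> V \<Longrightarrow> cmod a \<le> 1 \<Longrightarrow> (\<lambda>x. a * f x) \<in> V"
  using abs_convexD[of V f f a 0] by simp

lemma abs_convex_divide:
  assumes "abs_convex V" "f \<in> V" "0 < s" "\<bar>t\<bar> \<ge> s" "(\<lambda>x. g x / complex_of_real s) = f"
  shows "(\<lambda>x. g x / complex_of_real t) \<in> V"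
proof -
  have "(\<lambda>x. complex_of_real (s/t) * f x) \<in> V"
    using assms by (intro abs_convex_scale) (auto simp: norm_divide)
  moreover have "(\<lambda>x. complex_of_real (s/t) * f x) = (\<lambda>x. g x / complex_of_real t)"
    using assms(3) by (auto simp: assms(5)[symmetric])
  ultimately show ?thesis by simp
qed

lemma abs_convex_Int: "abs_convex V \<Longrightarrow> abs_convex W \<Longrightarrow> abs_convex (V \<inter> W)"
  by (auto simp: abs_convex_def)

lemma solid_Int: "solid V \<Longrightarrow> solid W \<Longrightarrow> solid (V \<inter> W)"
  by (auto simp: solid_def)

lemma solid_space_zero: "solid_space L \<Longrightarrow> (\<lambda>_. 0) \<in> L"
  and solid_space_solid: "solid_space L \<Longrightarrow> solid L"
  and solid_space_lin: "solid_space L \<Longrightarrow> c \<in> L \<Longrightarrow> d \<in> L \<Longrightarrow> (\<lambda>x. a * c x + b * d x) \<in> L"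
  by (auto simp: solid_space_def)

lemma solid_space_add: "solid_space L \<Longrightarrow> c \<in> L \<Longrightarrow> d \<in> L \<Longrightarrow> (\<lambda>x. c x + d x) \<in> L"
  using solid_space_lin[of L c d 1 1] by simp

lemma solid_space_scale: "solid_space L \<Longrightarrow> c \<in> L \<Longrightarrow> (\<lambda>x. a * c x) \<in> L"
  using solid_space_lin[of L c c a 0] by simp

lemma solid_space_divide: "solid_space L \<Longrightarrow> c \<in> L \<Longrightarrow> (\<lambda>x. c x / a) \<in> L"
  using solid_space_scale[of L c "inverse a"] by (simp add: field_simps)

lemma solid_space_abs_convex: "solid_space L \<Longrightarrow> abs_convex L"
  by (auto simp: solid_space_def abs_convex_def)

lemma solid_space_UNIV [simp]: "solid_space UNIV"
  by (auto simp: solid_space_def solid_def)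

lemma solid_space_INT: "(\<And>i. i \<in> I \<Longrightarrow> solid_space (L i)) \<Longrightarrow> solid_space (\<Inter>i\<in>I. L i)"
  unfolding solid_space_def by (auto simp: solid_def)

lemma linear_on_spaceD:
  "linear_on_space L f \<Longrightarrow> c \<in> L \<Longrightarrow> d \<in> L \<Longrightarrow> f (\<lambda>x. a * c x + b * d x) = (\<lambda>x. a * f c x + b * f d x)"
  by (auto simp: linear_on_space_def)

lemma linear_on_space_add:
  "linear_on_space L f \<Longrightarrow> c \<in> L \<Longrightarrow> d \<in> L \<Longrightarrow> f (\<lambda>x. c x + d x) = (\<lambda>x. f c x + f d x)"
  using linear_on_spaceD[of L f c d 1 1] by simp

lemma linear_on_space_scale:
  "linear_on_space L f \<Longrightarrow> c \<in> L \<Longrightarrow> f (\<lambda>x. a * c x) = (\<lambda>x. a * f c x)"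
  using linear_on_spaceD[of L f c c a 0] by simp

lemma linear_on_space_divide:
  "linear_on_space L f \<Longrightarrow> c \<in> L \<Longrightarrow> f (\<lambda>x. c x / a) = (\<lambda>x. f c x / a)"
  using linear_on_space_scale[of L f c "inverse a"] by (simp add: field_simps)

text \<open>Riesz decomposition: at each point \<open>d\<close> is divided in proportion to the
  moduli of \<open>a * f\<close> and \<open>b * g\<close>. Each share is dominated by
  \<open>d\<close>, which keeps it in \<open>L\<close>, and after division by its coefficient also
  by \<open>f\<close> or \<open>g\<close>.\<close>

lemma riesz_split:
  assumes L: "solid_space L" and d: "d \<in> L" and dom: "dominated d (\<lambda>x. a * f x + b * g x)"
  obtains d1 d2 where "d = (\<lambda>x. a * d1 x + b * d2 x)" "d1 \<in> L" "d2 \<in> L" "dominated d1 f" "dominated d2 g"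
proof -
  define s where "s x = cmod a * cmod (f x) + cmod b * cmod (g x)" for x
  have s0: "s x \<ge> 0" for x by (simp add: s_def)
  have ds: "cmod (d x) \<le> s x" for x
    using dom norm_triangle_ineq[of "a * f x" "b * g x"]
    by (auto simp: dominated_def s_def norm_mult intro: order_trans)
  \<comment> \<open>The share of \<open>d\<close> belonging to \<open>k * h\<close>, divided by
    \<open>k\<close>. Where \<open>s x = 0\<close> the function \<open>d\<close> itself vanishes, so
    0 is the right value there.\<close>
  define part where "part k h x = (if k = 0 \<or> s x = 0 then 0
      else d x * complex_of_real (cmod k * cmod (h x)) / (k * complex_of_real (s x)))"
    for k :: complex and h :: "'a \<Rightarrow> complex" and x
  have bound: "dominated (part k h) h" for k h
  proof -
    have "cmod (part k h x) \<le> cmod (h x)" for x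
    proof (cases "k = 0 \<or> s x = 0")
      case False
      then have "cmod (part k h x) = cmod (d x) / s x * cmod (h x)"
        using s0[of x] by (simp add: part_def norm_mult norm_divide)
      also have "\<dots> \<le> 1 * cmod (h x)"
        using ds[of x] s0[of x] False by (intro mult_right_mono) (auto simp: divide_le_eq_1)
      finally show ?thesis by simp
    qed (auto simp: part_def)
    then show ?thesis by (auto simp: dominated_def)
  qed
  have mem: "part k h \<in> L" if le: "\<And>x. cmod k * cmod (h x) \<le> s x" for k h
  proof (cases "k = 0")
    case True
    then have "part k h = (\<lambda>_. 0)" by (auto simp: part_def)
    then show ?thesis using L by (simp add: solid_space_def)
  next
    case False
    have "dominated (\<lambda>x. k * part k h x) d"
      unfolding dominated_def
    proof
      fix x
      show "cmod (k * part k h x) \<le> cmod (d x)"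
      proof (cases "s x = 0")
        case nz: False
        then have "cmod (k * part k h x) = cmod (d x) * (cmod k * cmod (h x) / s x)"
          using s0[of x] False by (simp add: part_def norm_mult norm_divide)
        also have "\<dots> \<le> cmod (d x) * 1"
          using le[of x] s0[of x] nz by (intro mult_left_mono) (auto simp: divide_le_eq_1)
        finally show ?thesis by simp
      qed (auto simp: part_def)
    qed
    then have "(\<lambda>x. k * part k h x) \<in> L"
      using solidD[OF solid_space_solid[OF L] d] by blast
    from solid_space_divide[OF L this, of k] False show ?thesis by simp
  qed
  have "d x = a * part a f x + b * part b g x" for x
  proof (cases "s x = 0")
    case True
    then show ?thesis using ds[of x] by (simp add: part_def)
  next
    case False
    have "a * part a f x = d x * complex_of_real (cmod a * cmod (f x)) / complex_of_real (s x)"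
      using False by (auto simp: part_def)
    moreover have "b * part b g x = d x * complex_of_real (cmod b * cmod (g x)) / complex_of_real (s x)"
      using False by (auto simp: part_def)
    ultimately have "a * part a f x + b * part b g x =
        d x * complex_of_real (s x) / complex_of_real (s x)"
      by (simp add: s_def add_divide_distrib[symmetric] distrib_left[symmetric])
    then show ?thesis using False by simp
  qed
  moreover have "part a f \<in> L" "part b g \<in> L"
    by (auto intro!: mem simp: s_def)
  ultimately show thesis
    using bound by (intro that[of "part a f" "part b g"]) auto
qed

text \<open>A function dominated by a combination of \<open>c\<close> and \<open>c'\<close> splits
  into pieces dominated by \<open>c\<close> and by \<open>c'\<close>, and these pieces stay in
  \<open>L\<close>, where \<open>f\<close> is linear. With the identity for \<open>f\<close> this
  yields solid neighbourhoods in inductive limits, in general it yields continuity of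
  \<open>f\<close> on them.\<close>

lemma abs_convex_solid_core:
  assumes X: "solid_space X" and L: "solid_space L" and lin: "linear_on_space L f" and W: "abs_convex W"
  shows "abs_convex {c \<in> X. \<forall>d\<in>L. dominated d c \<longrightarrow> f d \<in> W}" (is "abs_convex ?V")
  unfolding abs_convex_def
proof (intro ballI allI impI)
  fix c c' a b assume c: "c \<in> ?V" "c' \<in> ?V" and ab: "cmod a + cmod b \<le> 1"
  have "f d \<in> W" if d: "d \<in> L" "dominated d (\<lambda>x. a * c x + b * c' x)" for d
  proof -
    obtain d1 d2 where s: "d = (\<lambda>x. a * d1 x + b * d2 x)" "d1 \<in> L" "d2 \<in> L"
        "dominated d1 c" "dominated d2 c'"
      using riesz_split[OF L d] by metis
    then have "f d = (\<lambda>x. a * f d1 x + b * f d2 x)"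
      using linear_on_spaceD[OF lin] by blast
    moreover have "f d1 \<in> W" "f d2 \<in> W" using c s by auto
    ultimately show ?thesis using abs_convexD[OF W _ _ ab] by simp
  qed
  then show "(\<lambda>x. a * c x + b * c' x) \<in> ?V"
    using c solid_space_lin[OF X] by auto
qed

lemma solid_solid_core: "solid X \<Longrightarrow> solid {c \<in> X. \<forall>d\<in>L. dominated d c \<longrightarrow> f d \<in> W}"
  unfolding solid_def using dominated_trans by blast

section \<open>Locally convex topologies described by solid neighbourhoods of 0\<close>

definition nbhd0 :: "('x \<Rightarrow> complex) topology \<Rightarrow> ('x \<Rightarrow> complex) set \<Rightarrow> bool" where
  "nbhd0 X V \<longleftrightarrow> V \<subseteq> topspace X \<and> abs_convex V \<and> solid V \<and> (\<exists>U. openin X U \<and> (\<lambda>_. 0) \<in> U \<and> U \<subseteq> V)"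

text \<open>\<open>openin_iff\<close> makes the topology translation invariant with the sets
  \<open>nbhd0\<close> as a base at 0. Halving a neighbourhood through \<open>nbhd0_scale\<close>
  and convexity takes the place of continuity of addition.\<close>

locale solid_lcs =
  fixes X :: "('x \<Rightarrow> complex) topology"
  assumes space: "solid_space (topspace X)"
    and openin_iff: "openin X U \<longleftrightarrow>
      U \<subseteq> topspace X \<and> (\<forall>c\<in>U. \<exists>V. nbhd0 X V \<and> (\<forall>v\<in>V. (\<lambda>x. c x + v x) \<in> U))"
    and absorbing: "nbhd0 X V \<Longrightarrow> c \<in> topspace X \<Longrightarrow> \<exists>t::real>0. (\<lambda>x. c x / complex_of_real t) \<in> V"
    and nbhd0_scale: "nbhd0 X V \<Longrightarrow> 0 < t \<Longrightarrow> nbhd0 X {c. (\<lambda>x. complex_of_real t * c x) \<in> V}"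

lemma nbhd0_zero: "nbhd0 X V \<Longrightarrow> (\<lambda>_. 0) \<in> V"
  by (auto simp: nbhd0_def)

lemma nbhd0_subset: "nbhd0 X V \<Longrightarrow> V \<subseteq> topspace X"
  and nbhd0_abs_convex: "nbhd0 X V \<Longrightarrow> abs_convex V"
  and nbhd0_solid: "nbhd0 X V \<Longrightarrow> solid V"
  by (auto simp: nbhd0_def)

lemma nbhd0_Int: "nbhd0 X V \<Longrightarrow> nbhd0 X W \<Longrightarrow> nbhd0 X (V \<inter> W)"
  unfolding nbhd0_def by (meson IntI Int_mono abs_convex_Int le_infI1 openin_Int solid_Int)

lemma nbhd0_half:
  assumes V: "nbhd0 X V" and "(\<lambda>x. complex_of_real 2 * c x) \<in> V" "(\<lambda>x. complex_of_real 2 * d x) \<in> V"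
  shows "(\<lambda>x. c x + d x) \<in> V"
  using abs_convexD[OF nbhd0_abs_convex[OF V] assms(2,3), of "1/2" "1/2"] by simp

text \<open>The limits come with an explicit family \<open>P\<close> of neighbourhoods; this locale
  turns such a family into the structure \<open>solid_lcs\<close>.\<close>

locale solid_base =
  fixes X :: "('x \<Rightarrow> complex) topology" and P :: "('x \<Rightarrow> complex) set \<Rightarrow> bool"
  assumes space: "solid_space (topspace X)"
    and P_subset: "P V \<Longrightarrow> V \<subseteq> topspace X" and P_abs_convex: "P V \<Longrightarrow> abs_convex V"
    and P_solid: "P V \<Longrightarrow> solid V"
    and P_absorbing: "P V \<Longrightarrow> c \<in> topspace X \<Longrightarrow> \<exists>t::real>0. (\<lambda>x. c x / complex_of_real t) \<in> V"
    and P_scale: "P V \<Longrightarrow> 0 < t \<Longrightarrow> P {c. (\<lambda>x. complex_of_real t * c x) \<in> V}"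
    and P_openin: "openin X U \<longleftrightarrow>
      U \<subseteq> topspace X \<and> (\<forall>c\<in>U. \<exists>V. P V \<and> (\<forall>v\<in>V. (\<lambda>x. c x + v x) \<in> U))"
begin

lemma P_zero: "P V \<Longrightarrow> (\<lambda>_. 0) \<in> V"
  using P_absorbing[OF _ solid_space_zero[OF space]] by fastforce

text \<open>The set \<open>U\<close> is the interior of \<open>V\<close>. It is open because half of
  the \<open>V'\<close> that works at \<open>e\<close> still works at every point of
  \<open>e\<close> plus that half.\<close>

lemma P_nbhd0:
  assumes V: "P V" shows "nbhd0 X V"
proof -
  define U where "U = {e \<in> topspace X. \<exists>V'. P V' \<and> (\<forall>v\<in>V'. (\<lambda>x. e x + v x) \<in> V)}"
  have "openin X U"
    unfolding P_openin
  proof (intro conjI ballI)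
    fix e assume "e \<in> U"
    then obtain V' where e: "e \<in> topspace X" and V': "P V'" "\<And>v. v \<in> V' \<Longrightarrow> (\<lambda>x. e x + v x) \<in> V"
      unfolding U_def by blast
    let ?H = "{c. (\<lambda>x. complex_of_real 2 * c x) \<in> V'}"
    have H: "P ?H" using P_scale[OF V'(1), of 2] by simp
    have "(\<lambda>x. e x + v x) \<in> U" if v: "v \<in> ?H" for v
    proof -
      have "(\<lambda>x. (e x + v x) + u x) \<in> V" if u: "u \<in> ?H" for u
      proof -
        have "(\<lambda>x. v x + u x) \<in> V'"
          using abs_convexD[OF P_abs_convex[OF V'(1)], of _ _ "1/2" "1/2"] u v by force
        from V'(2)[OF this] show ?thesis by (simp add: add.assoc)
      qed
      moreover have "v \<in> topspace X" using v H P_subset by blast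
      ultimately show ?thesis
        unfolding U_def using H solid_space_add[OF space e] by blast
    qed
    then show "\<exists>V. P V \<and> (\<forall>v\<in>V. (\<lambda>x. e x + v x) \<in> U)" using H by blast
  qed (auto simp: U_def)
  moreover have "(\<lambda>_. 0) \<in> U"
    unfolding U_def using V solid_space_zero[OF space] by auto
  moreover have "U \<subseteq> V"
    using P_zero unfolding U_def by fastforce
  ultimately show ?thesis
    unfolding nbhd0_def using V P_subset P_abs_convex P_solid by blast
qed

lemma nbhd0_iff:
  "nbhd0 X V \<longleftrightarrow> V \<subseteq> topspace X \<and> abs_convex V \<and> solid V \<and> (\<exists>V'. P V' \<and> V' \<subseteq> V)"
proof
  assume V: "nbhd0 X V"
  then obtain U where U: "openin X U" "(\<lambda>_. 0) \<in> U" "U \<subseteq> V"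
    by (auto simp: nbhd0_def)
  then obtain V' where "P V'" "\<forall>v\<in>V'. (\<lambda>x. 0 + v x) \<in> U"
    using P_openin[of U] by blast
  then have "P V' \<and> V' \<subseteq> V" using U by auto
  then show "V \<subseteq> topspace X \<and> abs_convex V \<and> solid V \<and> (\<exists>V'. P V' \<and> V' \<subseteq> V)"
    using V by (auto simp: nbhd0_def)
next
  assume V: "V \<subseteq> topspace X \<and> abs_convex V \<and> solid V \<and> (\<exists>V'. P V' \<and> V' \<subseteq> V)"
  then obtain V' where "P V'" "V' \<subseteq> V" by blast
  then obtain U where "openin X U" "(\<lambda>_. 0) \<in> U" "U \<subseteq> V"
    using P_nbhd0[of V'] by (auto simp: nbhd0_def)
  then show "nbhd0 X V" using V by (auto simp: nbhd0_def)
qed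

sublocale solid_lcs X
proof
  show "solid_space (topspace X)" by (rule space)
  show "openin X U \<longleftrightarrow>
      U \<subseteq> topspace X \<and> (\<forall>c\<in>U. \<exists>V. nbhd0 X V \<and> (\<forall>v\<in>V. (\<lambda>x. c x + v x) \<in> U))" for U
    unfolding P_openin using P_nbhd0 nbhd0_iff by (meson subsetD)
  show "\<exists>t::real>0. (\<lambda>x. c x / complex_of_real t) \<in> V" if "nbhd0 X V" "c \<in> topspace X" for V c
    using that P_absorbing unfolding nbhd0_iff by blast
  show "nbhd0 X {c. (\<lambda>x. complex_of_real t * c x) \<in> V}" if V: "nbhd0 X V" and t: "0 < t" for V t
  proof -
    obtain V' where V': "P V'" "V' \<subseteq> V" using V nbhd0_iff by blast
    have "c \<in> topspace X" if "(\<lambda>x. complex_of_real t * c x) \<in> V" for c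
    proof -
      have "(\<lambda>x. complex_of_real t * c x) \<in> topspace X" using that V by (auto simp: nbhd0_def)
      from solid_space_divide[OF space this, of "complex_of_real t"] t show ?thesis by simp
    qed
    moreover have "abs_convex {c. (\<lambda>x. complex_of_real t * c x) \<in> V}"
      unfolding abs_convex_def
    proof (safe)
      fix f g a b
      assume "(\<lambda>x. complex_of_real t * f x) \<in> V" "(\<lambda>x. complex_of_real t * g x) \<in> V"
        "cmod a + cmod b \<le> 1"
      from abs_convexD[OF nbhd0_abs_convex[OF V] this]
      show "(\<lambda>x. complex_of_real t * (a * f x + b * g x)) \<in> V"
        by (simp add: algebra_simps)
    qed
    moreover have "solid {c. (\<lambda>x. complex_of_real t * c x) \<in> V}"
      using nbhd0_solid[OF V] t unfolding solid_def dominated_def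
      by (auto simp: norm_mult)
    moreover have "P {c. (\<lambda>x. complex_of_real t * c x) \<in> V'}" using P_scale[OF V'(1) t] .
    moreover have "{c. (\<lambda>x. complex_of_real t * c x) \<in> V'} \<subseteq> {c. (\<lambda>x. complex_of_real t * c x) \<in> V}"
      using V' by blast
    ultimately show ?thesis unfolding nbhd0_iff by blast
  qed
qed

end

context solid_lcs
begin

lemma nbhd0_in_open: "openin X U \<Longrightarrow> (\<lambda>_. 0) \<in> U \<Longrightarrow> \<exists>V. nbhd0 X V \<and> V \<subseteq> U"
  unfolding openin_iff by force

lemma absorbing_ge:
  assumes "nbhd0 X V" "c \<in> topspace X"
  obtains s where "s > 0" "\<And>t. t \<ge> s \<Longrightarrow> (\<lambda>x. c x / complex_of_real t) \<in> V"
proof -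
  obtain s where s: "s > 0" "(\<lambda>x. c x / complex_of_real s) \<in> V" using absorbing[OF assms] by blast
  then show thesis
    using abs_convex_divide[OF nbhd0_abs_convex[OF assms(1)] s(2,1), of _ c]
    by (intro that[of s]) auto
qed

lemma nbhd0_topspace: "nbhd0 X (topspace X)"
  unfolding nbhd0_def using space
  by (auto simp: solid_space_abs_convex solid_space_solid intro: solid_space_zero exI[of _ "topspace X"])

lemma nbhd0_superset:
  "nbhd0 X V' \<Longrightarrow> V' \<subseteq> V \<Longrightarrow> V \<subseteq> topspace X \<Longrightarrow> abs_convex V \<Longrightarrow> solid V \<Longrightarrow> nbhd0 X V"
  unfolding nbhd0_def by blast

text \<open>\<open>openin_iff\<close> only says that an open set contains translates of
  neighbourhoods of 0. Conversely, the interior of the translate of \<open>V\<close> to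
  \<open>c\<close> is open, again by halving.\<close>

lemma open_translate:
  assumes c: "c \<in> topspace X" and V: "nbhd0 X V"
  obtains U where "openin X U" "c \<in> U" "\<And>e. e \<in> U \<Longrightarrow> (\<lambda>x. e x - c x) \<in> V"
proof -
  define U where "U = {e \<in> topspace X. \<exists>V'. nbhd0 X V' \<and> (\<forall>v\<in>V'. (\<lambda>x. e x + v x - c x) \<in> V)}"
  have "openin X U"
    unfolding openin_iff
  proof (intro conjI ballI)
    fix e assume "e \<in> U"
    then obtain V' where e: "e \<in> topspace X" and V': "nbhd0 X V'" "\<And>v. v \<in> V' \<Longrightarrow> (\<lambda>x. e x + v x - c x) \<in> V"
      unfolding U_def by blast
    let ?H = "{c. (\<lambda>x. complex_of_real 2 * c x) \<in> V'}"
    have H: "nbhd0 X ?H" using nbhd0_scale[OF V'(1), of 2] by simp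
    have "(\<lambda>x. e x + v x) \<in> U" if v: "v \<in> ?H" for v
    proof -
      have "(\<lambda>x. (e x + v x) + u x - c x) \<in> V" if u: "u \<in> ?H" for u
      proof -
        have "(\<lambda>x. v x + u x) \<in> V'" using nbhd0_half[OF V'(1)] u v by simp
        from V'(2)[OF this] show ?thesis by (simp add: add.assoc)
      qed
      moreover have "v \<in> topspace X" using v H nbhd0_subset by blast
      ultimately show ?thesis
        unfolding U_def using H solid_space_add[OF space e] by blast
    qed
    then show "\<exists>V. nbhd0 X V \<and> (\<forall>v\<in>V. (\<lambda>x. e x + v x) \<in> U)" using H by blast
  qed (auto simp: U_def)
  moreover have "c \<in> U" unfolding U_def using V c by auto
  moreover have "(\<lambda>x. e x - c x) \<in> V" if "e \<in> U" for e
    using that nbhd0_zero unfolding U_def by fastforce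
  ultimately show thesis by (rule that)
qed

end

lemma continuous_map_linear:
  assumes "solid_lcs X" "solid_lcs Y" and lin: "linear_on_space (topspace X) f"
    and im: "\<And>c. c \<in> topspace X \<Longrightarrow> f c \<in> topspace Y"
    and nb: "\<And>W. nbhd0 Y W \<Longrightarrow> \<exists>V. nbhd0 X V \<and> (\<forall>c\<in>V. f c \<in> W)"
  shows "continuous_map X Y f"
proof -
  interpret X: solid_lcs X by fact
  interpret Y: solid_lcs Y by fact
  have "openin X {c \<in> topspace X. f c \<in> U}" if U: "openin Y U" for U
    unfolding X.openin_iff
  proof (intro conjI ballI)
    fix c assume "c \<in> {c \<in> topspace X. f c \<in> U}"
    then have c: "c \<in> topspace X" "f c \<in> U" by auto
    then obtain W where W: "nbhd0 Y W" "\<And>v. v \<in> W \<Longrightarrow> (\<lambda>x. f c x + v x) \<in> U"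
      using Y.openin_iff[of U] U by blast
    obtain V where V: "nbhd0 X V" "\<And>c. c \<in> V \<Longrightarrow> f c \<in> W" using nb[OF W(1)] by blast
    have "(\<lambda>x. c x + v x) \<in> {c \<in> topspace X. f c \<in> U}" if "v \<in> V" for v
    proof -
      have v: "v \<in> topspace X" using that V nbhd0_subset by blast
      show ?thesis
        using linear_on_space_add[OF lin c(1) v] W(2)[OF V(2)[OF that]] solid_space_add[OF X.space c(1) v]
        by simp
    qed
    then show "\<exists>V. nbhd0 X V \<and> (\<forall>v\<in>V. (\<lambda>x. c x + v x) \<in> {c \<in> topspace X. f c \<in> U})"
      using V by blast
  qed auto
  then show ?thesis using im by (auto simp: continuous_map_def)
qed

section \<open>Weighted sup-normed spaces and their balls\<close>

definition wball :: "('x \<Rightarrow> ennreal) \<Rightarrow> real \<Rightarrow> ('x \<Rightarrow> complex) set" where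
  "wball w N = {c. \<forall>x. ennreal (cmod (c x)) * w x \<le> ennreal N}"

lemma wballD: "c \<in> wball w N \<Longrightarrow> ennreal (cmod (c x)) * w x \<le> ennreal N"
  by (simp add: wball_def)

lemma wball_mono: "N \<le> M \<Longrightarrow> wball w N \<subseteq> wball w M"
  unfolding wball_def using ennreal_leI order_trans by blast

lemma wball_antimono: "(\<And>x. w x \<le> w' x) \<Longrightarrow> wball w' N \<subseteq> wball w N"
  unfolding wball_def by (clarsimp, meson mult_left_mono order_trans zero_le)

lemma solid_wball: "solid (wball w N)"
  unfolding solid_def dominated_def wball_def
  by (clarsimp, meson ennreal_leI mult_right_mono order_trans zero_le)

lemma wball_lin:
  assumes "c \<in> wball w N" "d \<in> wball w M" "N \<ge> 0" "M \<ge> 0"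
  shows "(\<lambda>x. a * c x + b * d x) \<in> wball w (cmod a * N + cmod b * M)"
  unfolding wball_def
proof (safe)
  fix x
  have "ennreal (cmod (a * c x + b * d x)) * w x \<le> ennreal (cmod a * cmod (c x) + cmod b * cmod (d x)) * w x"
    by (intro mult_right_mono ennreal_leI) (auto simp: norm_mult intro: norm_triangle_le)
  also have "\<dots> = ennreal (cmod a) * (ennreal (cmod (c x)) * w x) + ennreal (cmod b) * (ennreal (cmod (d x)) * w x)"
    by (simp add: ennreal_mult distrib_right mult.assoc)
  also have "\<dots> \<le> ennreal (cmod a) * ennreal N + ennreal (cmod b) * ennreal M"
    using assms by (intro add_mono mult_left_mono) (auto dest: wballD)
  also have "\<dots> = ennreal (cmod a * N + cmod b * M)"
    using assms by (simp add: ennreal_mult)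
  finally show "ennreal (cmod (a * c x + b * d x)) * w x \<le> ennreal (cmod a * N + cmod b * M)" .
qed

lemma wball_scale: "c \<in> wball w N \<Longrightarrow> N \<ge> 0 \<Longrightarrow> (\<lambda>x. a * c x) \<in> wball w (cmod a * N)"
  using wball_lin[of c w N c N a 0] by simp

lemma wball_scale_iff:
  assumes "t > 0" "N \<ge> 0"
  shows "(\<lambda>x. complex_of_real t * c x) \<in> wball w N \<longleftrightarrow> c \<in> wball w (N / t)"
proof
  assume "(\<lambda>x. complex_of_real t * c x) \<in> wball w N"
  from wball_scale[OF this, of "complex_of_real (1/t)"] assms show "c \<in> wball w (N / t)" by (simp add: norm_divide)
next
  assume "c \<in> wball w (N / t)"
  from wball_scale[OF this, of "complex_of_real t"] assms
  show "(\<lambda>x. complex_of_real t * c x) \<in> wball w N" by simp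
qed

lemma wball_divide_iff:
  "t > 0 \<Longrightarrow> N \<ge> 0 \<Longrightarrow> (\<lambda>x. c x / complex_of_real t) \<in> wball w N \<longleftrightarrow> c \<in> wball w (N * t)"
  using wball_scale_iff[of "1/t" N c w] by simp

lemma abs_convex_wball: "N \<ge> 0 \<Longrightarrow> abs_convex (wball w N)"
  unfolding abs_convex_def
proof (safe)
  fix f g a b assume h: "N \<ge> 0" "f \<in> wball w N" "g \<in> wball w N" "cmod a + cmod b \<le> 1"
  have "cmod a * N + cmod b * N \<le> N"
    using mult_right_mono[OF h(4,1)] by (simp add: distrib_right)
  then show "(\<lambda>x. a * f x + b * g x) \<in> wball w N"
    using wball_lin[OF h(2,3,1,1)] wball_mono by blast
qed

lemma wnorm_top_le: "wnorm top w c \<le> ennreal N \<longleftrightarrow> c \<in> wball w N"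
  by (simp add: wnorm_def lp_norm_def wball_def SUP_le_iff)

lemma wspace_top: "wspace top w = (\<Union>N\<in>{0<..}. wball w N)"
proof (intro equalityI subsetI)
  fix c assume "c \<in> wspace top w"
  then have "wnorm top w c < top" by (simp add: wspace_def)
  then obtain r where r: "r \<ge> 0" "wnorm top w c = ennreal r" by (cases "wnorm top w c") auto
  then have "wnorm top w c \<le> ennreal (r + 1)" by (simp add: ennreal_leI)
  then show "c \<in> (\<Union>N\<in>{0<..}. wball w N)" using r unfolding wnorm_top_le by force
next
  fix c assume "c \<in> (\<Union>N\<in>{0<..}. wball w N)"
  then obtain N where "wnorm top w c \<le> ennreal N" unfolding wnorm_top_le by blast
  then show "c \<in> wspace top w" using le_less_trans[OF _ ennreal_less_top] by (auto simp: wspace_def)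
qed

lemma solid_space_wspace: "solid_space (wspace top w)"
  unfolding solid_space_def
proof (intro conjI ballI allI)
  show "(\<lambda>_. 0) \<in> wspace top w" by (auto simp: wspace_top wball_def intro: exI[of _ 1])
  show "solid (wspace top w)" unfolding wspace_top using solid_wball unfolding solid_def by blast
  fix c d a b assume "c \<in> wspace top w" "d \<in> wspace top w"
  then obtain N M where h: "N > 0" "M > 0" "c \<in> wball w N" "d \<in> wball w M" by (auto simp: wspace_top)
  then have "(\<lambda>x. a * c x + b * d x) \<in> wball w (cmod a * N + cmod b * M)"
    by (intro wball_lin) auto
  also have "\<dots> \<subseteq> wball w (cmod a * N + cmod b * M + 1)" by (rule wball_mono) simp
  finally have "(\<lambda>x. a * c x + b * d x) \<in> wball w (cmod a * N + cmod b * M + 1)" .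
  moreover have "cmod a * N + cmod b * M + 1 > 0" using h by (simp add: add_nonneg_pos)
  ultimately show "(\<lambda>x. a * c x + b * d x) \<in> wspace top w" unfolding wspace_top by blast
qed

text \<open>Passes from strict norm inequalities with radius in \<open>[0, \<infinity>]\<close> to
  closed balls of positive real radius, which are solid and absolutely convex and hence serve as the
  base at 0.\<close>

lemma wopen_top_iff:
  "wopen top w U \<longleftrightarrow> U \<subseteq> wspace top w \<and> (\<forall>c\<in>U. \<exists>\<epsilon>>0. \<forall>v\<in>wball w \<epsilon>. (\<lambda>x. c x + v x) \<in> U)"
    (is "_ \<longleftrightarrow> _ \<and> ?R")
proof (cases "U \<subseteq> wspace top w")
  case True
  have "(\<exists>\<epsilon>>0. \<forall>d\<in>wspace top w. wnorm top w (\<lambda>x. d x - c x) < \<epsilon> \<longrightarrow> d \<in> U) \<longleftrightarrow>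
      (\<exists>\<epsilon>>0. \<forall>v\<in>wball w \<epsilon>. (\<lambda>x. c x + v x) \<in> U)" if c: "c \<in> U" for c
  proof
    assume "\<exists>\<epsilon>>0. \<forall>d\<in>wspace top w. wnorm top w (\<lambda>x. d x - c x) < \<epsilon> \<longrightarrow> d \<in> U"
    then obtain \<epsilon> where e: "\<epsilon> > 0" "\<And>d. d \<in> wspace top w \<Longrightarrow> wnorm top w (\<lambda>x. d x - c x) < \<epsilon> \<Longrightarrow> d \<in> U"
      by blast
    \<comment> \<open>The radius \<epsilon> may be infinite, and a closed ball has to fit inside a
      strict inequality; hence a real number strictly below it.\<close>
    obtain \<delta> where d: "\<delta> > 0" "ennreal \<delta> < \<epsilon>"
    proof -
      obtain y where y: "0 < y" "y < \<epsilon>" using dense[OF e(1)] by blast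
      then have "y < top" using less_le_trans[OF _ top_greatest] by blast
      then show thesis using y that[of "enn2real y"] by (simp add: enn2real_positive_iff)
    qed
    have "(\<lambda>x. c x + v x) \<in> U" if v: "v \<in> wball w \<delta>" for v
    proof -
      have "v \<in> wspace top w" using v d by (auto simp: wspace_top)
      then have "(\<lambda>x. c x + v x) \<in> wspace top w"
        using c True solid_space_add[OF solid_space_wspace] by blast
      then show ?thesis using v d e(2) by (simp add: wnorm_top_le[symmetric] le_less_trans)
    qed
    then show "\<exists>\<epsilon>>0. \<forall>v\<in>wball w \<epsilon>. (\<lambda>x. c x + v x) \<in> U" using d by blast
  next
    assume "\<exists>\<epsilon>>0. \<forall>v\<in>wball w \<epsilon>. (\<lambda>x. c x + v x) \<in> U"
    then obtain \<epsilon> where e: "\<epsilon> > 0" "\<And>v. v \<in> wball w \<epsilon> \<Longrightarrow> (\<lambda>x. c x + v x) \<in> U" by blast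
    have "d \<in> U" if "wnorm top w (\<lambda>x. d x - c x) < ennreal \<epsilon>" for d
    proof -
      have "(\<lambda>x. d x - c x) \<in> wball w \<epsilon>" using that wnorm_top_le by (metis less_imp_le)
      from e(2)[OF this] show ?thesis by simp
    qed
    then show "\<exists>\<epsilon>>0. \<forall>d\<in>wspace top w. wnorm top w (\<lambda>x. d x - c x) < \<epsilon> \<longrightarrow> d \<in> U"
      using e(1) by (intro exI[of _ "ennreal \<epsilon>"]) auto
  qed
  then show ?thesis unfolding wopen_def by blast
qed (auto simp: wopen_def)

lemma solid_base_wtop: "solid_base (wtop top w) (\<lambda>V. \<exists>\<epsilon>>0. V = wball w \<epsilon>)"
proof
  show "solid_space (topspace (wtop top w))" by (simp add: topspace_wtop solid_space_wspace)
  show "V \<subseteq> topspace (wtop top w)" if "\<exists>\<epsilon>>0. V = wball w \<epsilon>" for V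
    using that by (auto simp: topspace_wtop wspace_top)
  show "abs_convex V" if "\<exists>\<epsilon>>0. V = wball w \<epsilon>" for V
    using that abs_convex_wball by (metis less_imp_le)
  show "solid V" if "\<exists>\<epsilon>>0. V = wball w \<epsilon>" for V
    using that solid_wball by blast
  show "\<exists>t::real>0. (\<lambda>x. c x / complex_of_real t) \<in> V"
    if V: "\<exists>\<epsilon>>0. V = wball w \<epsilon>" and c: "c \<in> topspace (wtop top w)" for V c
  proof -
    obtain \<epsilon> where e: "\<epsilon> > 0" "V = wball w \<epsilon>" using V by blast
    obtain N where "N > 0" "c \<in> wball w N" using c by (auto simp: topspace_wtop wspace_top)
    then have "N / \<epsilon> > 0" "(\<lambda>x. c x / complex_of_real (N / \<epsilon>)) \<in> wball w \<epsilon>"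
      using e wball_divide_iff[of "N / \<epsilon>" \<epsilon> c w] by auto
    then show ?thesis using e by blast
  qed
  show "\<exists>\<epsilon>>0. {c. (\<lambda>x. complex_of_real t * c x) \<in> V} = wball w \<epsilon>"
    if V: "\<exists>\<epsilon>>0. V = wball w \<epsilon>" and t: "0 < t" for V t
  proof -
    obtain \<epsilon> where e: "\<epsilon> > 0" "V = wball w \<epsilon>" using V by blast
    then show ?thesis using t by (intro exI[of _ "\<epsilon> / t"]) (simp add: wball_scale_iff)
  qed
  show "openin (wtop top w) U \<longleftrightarrow> U \<subseteq> topspace (wtop top w) \<and>
      (\<forall>c\<in>U. \<exists>V. (\<exists>\<epsilon>>0. V = wball w \<epsilon>) \<and> (\<forall>v\<in>V. (\<lambda>x. c x + v x) \<in> U))" for U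
    unfolding openin_wtop wopen_top_iff topspace_wtop by blast
qed

lemma solid_lcs_wtop: "solid_lcs (wtop top w)"
proof -
  interpret solid_base "wtop top w" "\<lambda>V. \<exists>\<epsilon>>0. V = wball w \<epsilon>" by (rule solid_base_wtop)
  show ?thesis by (rule solid_lcs_axioms)
qed

lemma nbhd0_wtop_iff:
  "nbhd0 (wtop top w) V \<longleftrightarrow> V \<subseteq> wspace top w \<and> abs_convex V \<and> solid V \<and> (\<exists>\<epsilon>>0. wball w \<epsilon> \<subseteq> V)"
proof -
  interpret solid_base "wtop top w" "\<lambda>V. \<exists>\<epsilon>>0. V = wball w \<epsilon>" by (rule solid_base_wtop)
  show ?thesis unfolding nbhd0_iff topspace_wtop by blast
qed

lemma nbhd0_wball: "\<epsilon> > 0 \<Longrightarrow> nbhd0 (wtop top w) (wball w \<epsilon>)"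
  unfolding nbhd0_wtop_iff wspace_top using abs_convex_wball[of \<epsilon> w] solid_wball by auto

section \<open>Projective and inductive limits of solid spaces\<close>

locale solid_proj_lim =
  fixes I :: "'i set" and T :: "'i \<Rightarrow> ('x \<Rightarrow> complex) topology"
  assumes nonempty: "I \<noteq> {}" and lcs: "\<And>i. i \<in> I \<Longrightarrow> solid_lcs (T i)"
begin

lemma topspace: "topspace (proj_lim I T) = (\<Inter>i\<in>I. topspace (T i))"
  by (rule topspace_proj_lim[OF nonempty])

lemma space: "solid_space (\<Inter>i\<in>I. topspace (T i))"
  by (intro solid_space_INT solid_lcs.space lcs)

definition basic :: "('x \<Rightarrow> complex) set \<Rightarrow> bool" where
  "basic V \<longleftrightarrow> (\<exists>F Vs. finite F \<and> F \<subseteq> I \<and> (\<forall>i\<in>F. nbhd0 (T i) (Vs i)) \<and>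
     V = (\<Inter>i\<in>I. topspace (T i)) \<inter> (\<Inter>i\<in>F. Vs i))"

lemma basicI: "finite F \<Longrightarrow> F \<subseteq> I \<Longrightarrow> (\<And>i. i \<in> F \<Longrightarrow> nbhd0 (T i) (Vs i)) \<Longrightarrow>
    basic ((\<Inter>i\<in>I. topspace (T i)) \<inter> (\<Inter>i\<in>F. Vs i))"
  unfolding basic_def by blast

lemma basicE:
  assumes "basic V"
  obtains F Vs where "finite F" "F \<subseteq> I" "\<And>i. i \<in> F \<Longrightarrow> nbhd0 (T i) (Vs i)"
     "V = (\<Inter>i\<in>I. topspace (T i)) \<inter> (\<Inter>i\<in>F. Vs i)"
  using assms unfolding basic_def by blast

lemma openin_basic:
  assumes "openin (proj_lim I T) U" "c \<in> U"
  shows "\<exists>V. basic V \<and> (\<forall>v\<in>V. (\<lambda>x. c x + v x) \<in> U)"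
proof -
  let ?L = "\<Inter>i\<in>I. topspace (T i)"
  have "generate_topology_on (\<Union>i\<in>I. {U \<inter> ?L |U. openin (T i) U}) U"
    using assms(1) unfolding proj_lim_def openin_topology_generated_by_iff .
  then show ?thesis using assms(2)
  proof (induction arbitrary: c rule: generate_topology_on.induct)
    case (Int A B)
    obtain V where V: "basic V" "\<forall>v\<in>V. (\<lambda>x. c x + v x) \<in> A" using Int by blast
    obtain W where W: "basic W" "\<forall>v\<in>W. (\<lambda>x. c x + v x) \<in> B" using Int by blast
    obtain F Vs where F: "finite F" "F \<subseteq> I" "\<And>i. i \<in> F \<Longrightarrow> nbhd0 (T i) (Vs i)" "V = ?L \<inter> (\<Inter>i\<in>F. Vs i)"
      using basicE[OF V(1)] by metis
    obtain G Ws where G: "finite G" "G \<subseteq> I" "\<And>i. i \<in> G \<Longrightarrow> nbhd0 (T i) (Ws i)" "W = ?L \<inter> (\<Inter>i\<in>G. Ws i)"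
      using basicE[OF W(1)] by metis
    \<comment> \<open>An index present in only one of the two finite sets receives the whole step as
      its constraint from the other one.\<close>
    define Us where "Us i = (if i \<in> F then Vs i else topspace (T i)) \<inter> (if i \<in> G then Ws i else topspace (T i))" for i
    have "basic (?L \<inter> (\<Inter>i\<in>F \<union> G. Us i))"
    proof (rule basicI)
      show "nbhd0 (T i) (Us i)" if "i \<in> F \<union> G" for i
        using that F G solid_lcs.nbhd0_topspace[OF lcs] by (auto simp: Us_def intro!: nbhd0_Int)
    qed (use F G in auto)
    moreover have "?L \<inter> (\<Inter>i\<in>F \<union> G. Us i) \<subseteq> V \<inter> W"
      unfolding F(4) G(4) by (auto simp: Us_def split: if_splits)
    ultimately show ?case using V(2) W(2) by blast
  next
    case (UN K)
    then show ?case by blast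
  next
    case (Basis s)
    then obtain i U where i: "i \<in> I" "s = U \<inter> ?L" "openin (T i) U" by blast
    interpret i: solid_lcs "T i" using lcs i by blast
    obtain V where V: "nbhd0 (T i) V" "\<forall>v\<in>V. (\<lambda>x. c x + v x) \<in> U"
      using i.openin_iff[of U] i(3) Basis(2) unfolding i(2) by blast
    have "basic (?L \<inter> (\<Inter>i\<in>{i}. V))" using V i by (intro basicI) auto
    moreover have "(\<lambda>x. c x + v x) \<in> s" if "v \<in> ?L \<inter> (\<Inter>i\<in>{i}. V)" for v
      using that V Basis(2) solid_space_add[OF space, of c v] unfolding i(2) by blast
    ultimately show ?case by blast
  qed simp
qed

sublocale solid_base "proj_lim I T" basic
proof
  let ?L = "\<Inter>i\<in>I. topspace (T i)"
  show "solid_space (topspace (proj_lim I T))" using space topspace by simp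
  show "V \<subseteq> topspace (proj_lim I T)" if "basic V" for V
    using that unfolding topspace by (auto elim: basicE)
  show "abs_convex V" if "basic V" for V
    using that
  proof (cases rule: basicE)
    case (1 F Vs)
    have "abs_convex (\<Inter>i\<in>F. Vs i)"
      using nbhd0_abs_convex[OF 1(3)] by (auto simp: abs_convex_def)
    then show ?thesis using 1 solid_space_abs_convex[OF space] abs_convex_Int by blast
  qed
  show "solid V" if "basic V" for V
    using that
  proof (cases rule: basicE)
    case (1 F Vs)
    have "solid (\<Inter>i\<in>F. Vs i)"
      using nbhd0_solid[OF 1(3)] by (auto simp: solid_def)
    then show ?thesis using 1 solid_space_solid[OF space] solid_Int by blast
  qed
  show "\<exists>t::real>0. (\<lambda>x. c x / complex_of_real t) \<in> V" if "basic V" and c: "c \<in> topspace (proj_lim I T)" for V c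
    using that(1)
  proof (cases rule: basicE)
    case (1 F Vs)
    have "\<forall>i\<in>F. \<exists>s>0. \<forall>t\<ge>s. (\<lambda>x. c x / complex_of_real t) \<in> Vs i"
    proof
      fix i assume i: "i \<in> F"
      then interpret i: solid_lcs "T i" using lcs 1 by blast
      have "c \<in> topspace (T i)" using c i 1(2) unfolding topspace by blast
      from i.absorbing_ge[OF 1(3)[OF i] this]
      show "\<exists>s>0. \<forall>t\<ge>s. (\<lambda>x. c x / complex_of_real t) \<in> Vs i" by metis
    qed
    then obtain s where s: "\<And>i. i \<in> F \<Longrightarrow> s i > 0"
        "\<And>i t. i \<in> F \<Longrightarrow> t \<ge> s i \<Longrightarrow> (\<lambda>x. c x / complex_of_real t) \<in> Vs i" by metis
    define t where "t = 1 + sum s F"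
    have "s i \<le> t" if "i \<in> F" for i
      using member_le_sum[of i F s] that s(1) 1(1) by (force simp: t_def less_imp_le)
    moreover have "sum s F \<ge> 0" using s(1) by (intro sum_nonneg) (auto intro: less_imp_le)
    then have "t > 0" by (simp add: t_def)
    moreover have "(\<lambda>x. c x / complex_of_real t) \<in> ?L"
      using c solid_space_divide[OF space] unfolding topspace by blast
    ultimately show ?thesis using s(2) 1(4) by blast
  qed
  show "basic {c. (\<lambda>x. complex_of_real t * c x) \<in> V}" if "basic V" and t: "0 < t" for V t
    using that(1)
  proof (cases rule: basicE)
    case (1 F Vs)
    have "(\<lambda>x. complex_of_real t * c x) \<in> ?L \<longleftrightarrow> c \<in> ?L" for c
      using solid_space_divide[OF space, of "\<lambda>x. complex_of_real t * c x" "complex_of_real t"]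
        solid_space_scale[OF space, of c "complex_of_real t"] t by auto
    then have "{c. (\<lambda>x. complex_of_real t * c x) \<in> V} =
        ?L \<inter> (\<Inter>i\<in>F. {c. (\<lambda>x. complex_of_real t * c x) \<in> Vs i})"
      unfolding 1(4) by blast
    moreover have "basic \<dots>"
      by (rule basicI[OF 1(1,2)]) (use 1(2,3) t lcs in \<open>auto intro!: solid_lcs.nbhd0_scale\<close>)
    ultimately show ?thesis by simp
  qed
  show "openin (proj_lim I T) U \<longleftrightarrow> U \<subseteq> topspace (proj_lim I T) \<and>
      (\<forall>c\<in>U. \<exists>V. basic V \<and> (\<forall>v\<in>V. (\<lambda>x. c x + v x) \<in> U))" (is "?l \<longleftrightarrow> ?r") for U
  proof
    assume ?l
    then show ?r using openin_basic openin_subset by blast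
  next
    assume r: ?r
    have "\<exists>O'. openin (proj_lim I T) O' \<and> c \<in> O' \<and> O' \<subseteq> U" if cU: "c \<in> U" for c
    proof -
      obtain V where V: "basic V" "\<forall>v\<in>V. (\<lambda>x. c x + v x) \<in> U" using r cU by blast
      obtain F Vs where F: "finite F" "F \<subseteq> I" "\<And>i. i \<in> F \<Longrightarrow> nbhd0 (T i) (Vs i)" "V = ?L \<inter> (\<Inter>i\<in>F. Vs i)"
        using basicE[OF V(1)] by metis
      have cL: "c \<in> ?L" using r cU unfolding topspace by blast
      have "\<forall>i\<in>F. \<exists>U. openin (T i) U \<and> c \<in> U \<and> (\<forall>e\<in>U. (\<lambda>x. e x - c x) \<in> Vs i)"
      proof
        fix i assume i: "i \<in> F"
        then have "c \<in> topspace (T i)" using cL F(2) by blast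
        from solid_lcs.open_translate[OF lcs this F(3)[OF i]] i F(2)
        show "\<exists>U. openin (T i) U \<and> c \<in> U \<and> (\<forall>e\<in>U. (\<lambda>x. e x - c x) \<in> Vs i)"
          by (metis subsetD)
      qed
      then obtain Us where Us: "\<And>i. i \<in> F \<Longrightarrow> openin (T i) (Us i)" "\<And>i. i \<in> F \<Longrightarrow> c \<in> Us i"
        "\<And>i e. i \<in> F \<Longrightarrow> e \<in> Us i \<Longrightarrow> (\<lambda>x. e x - c x) \<in> Vs i" by metis
      have op: "openin (proj_lim I T) (Us i \<inter> ?L)" if "i \<in> F" for i
        unfolding proj_lim_def by (rule topology_generated_by_Basis) (use that Us F(2) in blast)
      have "openin (proj_lim I T) (?L \<inter> (\<Inter>i\<in>F. Us i \<inter> ?L))"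
      \<comment> \<open>For empty \<open>F\<close> the intersection over \<open>F\<close> is the
        universe of the type and not an open set; the intersection with the space itself has to be
        used.\<close>
      proof (cases "F = {}")
        case True
        then show ?thesis using openin_topspace[of "proj_lim I T"] unfolding topspace by simp
      next
        case False
        then have "openin (proj_lim I T) (\<Inter>i\<in>F. Us i \<inter> ?L)"
          using F(1) op by blast
        then show ?thesis using openin_topspace[of "proj_lim I T"] unfolding topspace by blast
      qed
      moreover have "c \<in> ?L \<inter> (\<Inter>i\<in>F. Us i \<inter> ?L)" using cL Us by blast
      moreover have "e \<in> U" if e: "e \<in> ?L \<inter> (\<Inter>i\<in>F. Us i \<inter> ?L)" for e
      proof -
        have "(\<lambda>x. 1 * e x + (-1) * c x) \<in> ?L" using e cL by (intro solid_space_lin[OF space]) auto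
        moreover have "\<forall>i\<in>F. e \<in> Us i" using e by blast
        ultimately have "(\<lambda>x. e x - c x) \<in> V" unfolding F(4) using Us(3) by auto
        then have "(\<lambda>x. c x + (e x - c x)) \<in> U" by (rule V(2)[rule_format])
        then show ?thesis by simp
      qed
      ultimately show ?thesis by (intro exI[of _ "?L \<inter> (\<Inter>i\<in>F. Us i \<inter> ?L)"] conjI subsetI)
    qed
    then have "\<forall>c\<in>U. \<exists>O'. openin (proj_lim I T) O' \<and> c \<in> O' \<and> O' \<subseteq> U" by simp
    then show ?l by (rule openin_subopen[THEN iffD2])
  qed
qed

lemmas proj_lcs = solid_lcs_axioms

lemma nbhd0_component:
  assumes "i \<in> I" "nbhd0 (T i) V"
  shows "nbhd0 (proj_lim I T) (V \<inter> (\<Inter>i\<in>I. topspace (T i)))"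
proof -
  have "basic ((\<Inter>i\<in>I. topspace (T i)) \<inter> (\<Inter>i\<in>{i}. V))" using assms by (intro basicI) auto
  from P_nbhd0[OF this] show ?thesis by (simp add: Int_commute)
qed

end

text \<open>Directedness of the underlying sets makes their union a vector space, on which the
  absolutely convex sets of the limit topology live.\<close>

locale solid_ind_lim =
  fixes J :: "'i set" and T :: "'i \<Rightarrow> ('x \<Rightarrow> complex) topology"
  assumes nonempty: "J \<noteq> {}" and lcs: "\<And>j. j \<in> J \<Longrightarrow> solid_lcs (T j)"
    and directed: "\<And>i j. i \<in> J \<Longrightarrow> j \<in> J \<Longrightarrow> \<exists>k\<in>J. topspace (T i) \<union> topspace (T j) \<subseteq> topspace (T k)"
begin

lemma space: "solid_space (\<Union>j\<in>J. topspace (T j))"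
  unfolding solid_space_def
proof (intro conjI ballI allI)
  show "(\<lambda>_. 0) \<in> (\<Union>j\<in>J. topspace (T j))"
    using nonempty solid_lcs.space[OF lcs] solid_space_zero by blast
  show "solid (\<Union>j\<in>J. topspace (T j))"
    using solid_space_solid[OF solid_lcs.space[OF lcs]] unfolding solid_def by blast
  fix c d a b assume "c \<in> (\<Union>j\<in>J. topspace (T j))" "d \<in> (\<Union>j\<in>J. topspace (T j))"
  then obtain i j where "i \<in> J" "j \<in> J" "c \<in> topspace (T i)" "d \<in> topspace (T j)" by blast
  with directed[of i j] obtain k where "k \<in> J" "c \<in> topspace (T k)" "d \<in> topspace (T k)" by blast
  then show "(\<lambda>x. a * c x + b * d x) \<in> (\<Union>j\<in>J. topspace (T j))"
    using solid_space_lin[OF solid_lcs.space[OF lcs]] by blast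
qed

lemma topspace: "topspace (ind_lim J T) = (\<Union>j\<in>J. topspace (T j))"
  by (rule topspace_ind_lim)
    (fact solid_space_lin[OF space], fact solid_space_zero[OF solid_lcs.space[OF lcs]])

definition basic :: "('x \<Rightarrow> complex) set \<Rightarrow> bool" where
  "basic V \<longleftrightarrow> V \<subseteq> (\<Union>j\<in>J. topspace (T j)) \<and> abs_convex V \<and> solid V \<and>
     (\<forall>j\<in>J. \<exists>V'. nbhd0 (T j) V' \<and> V' \<subseteq> V)"

lemma basic_ind_nhd: "basic V \<Longrightarrow> ind_nhd J T V"
  unfolding basic_def ind_nhd_def nbhd0_def by (meson order_trans)

text \<open>The solid core of \<open>V\<close> is still absolutely convex by the Riesz
  decomposition, and it contains every solid neighbourhood of a step that lies in \<open>V\<close>.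
  So the solid sets form a base of the inductive limit at 0.\<close>

lemma ind_nhd_basic:
  assumes V: "ind_nhd J T V"
  obtains V' where "basic V'" "V' \<subseteq> V"
proof -
  let ?X = "\<Union>j\<in>J. topspace (T j)"
  define V' where "V' = {c \<in> ?X. \<forall>d\<in>UNIV. dominated d c \<longrightarrow> d \<in> V}"
  have "abs_convex V'"
    unfolding V'_def
    by (rule abs_convex_solid_core[where f = "\<lambda>c. c", OF space solid_space_UNIV])
      (use V in \<open>auto simp: linear_on_space_def ind_nhd_def\<close>)
  moreover have "solid V'"
    unfolding V'_def
    by (rule solid_solid_core[where f = "\<lambda>c. c"]) (use space solid_space_solid in blast)
  moreover have "\<exists>W. nbhd0 (T j) W \<and> W \<subseteq> V'" if j: "j \<in> J" for j
  proof -
    have "\<exists>U. openin (T j) U \<and> (\<lambda>_. 0) \<in> U \<and> U \<subseteq> V"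
      using V j by (simp add: ind_nhd_def)
    then obtain U where U: "openin (T j) U" "(\<lambda>_. 0) \<in> U" "U \<subseteq> V" by metis
    then obtain W where W: "nbhd0 (T j) W" "W \<subseteq> V"
      using solid_lcs.nbhd0_in_open[OF lcs[OF j] U(1,2)] by (meson order_trans)
    then have "W \<subseteq> V'"
      using nbhd0_subset[OF W(1)] nbhd0_solid[OF W(1)] j unfolding V'_def solid_def by blast
    then show ?thesis using W by blast
  qed
  ultimately have "basic V'" unfolding basic_def V'_def by blast
  moreover have "V' \<subseteq> V" unfolding V'_def using dominated_refl by blast
  ultimately show thesis by (rule that)
qed

sublocale solid_base "ind_lim J T" basic
proof
  show "solid_space (topspace (ind_lim J T))" using space topspace by simp
  show "V \<subseteq> topspace (ind_lim J T)" if "basic V" for V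
    using that unfolding topspace basic_def by blast
  show "abs_convex V" "solid V" if "basic V" for V
    using that unfolding basic_def by auto
  show "\<exists>t::real>0. (\<lambda>x. c x / complex_of_real t) \<in> V" if V: "basic V" and c: "c \<in> topspace (ind_lim J T)" for V c
  proof -
    obtain j where j: "j \<in> J" "c \<in> topspace (T j)" using c unfolding topspace by blast
    obtain W where "nbhd0 (T j) W" "W \<subseteq> V" using V j unfolding basic_def by blast
    then show ?thesis using solid_lcs.absorbing[OF lcs[OF j(1)] _ j(2)] by blast
  qed
  show "basic {c. (\<lambda>x. complex_of_real t * c x) \<in> V}" if V: "basic V" and t: "0 < t" for V t
    unfolding basic_def
  proof (intro conjI ballI)
    show "{c. (\<lambda>x. complex_of_real t * c x) \<in> V} \<subseteq> (\<Union>j\<in>J. topspace (T j))"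
    proof safe
      fix c assume "(\<lambda>x. complex_of_real t * c x) \<in> V"
      then have "(\<lambda>x. complex_of_real t * c x) \<in> (\<Union>j\<in>J. topspace (T j))"
        using V unfolding basic_def by blast
      from solid_space_divide[OF space this, of "complex_of_real t"] t
      show "c \<in> (\<Union>j\<in>J. topspace (T j))" by simp
    qed
    have conv: "abs_convex V" and sol: "solid V" using V unfolding basic_def by auto
    show "abs_convex {c. (\<lambda>x. complex_of_real t * c x) \<in> V}"
      unfolding abs_convex_def
    proof (safe)
      fix f g a b
      assume "(\<lambda>x. complex_of_real t * f x) \<in> V" "(\<lambda>x. complex_of_real t * g x) \<in> V"
        "cmod a + cmod b \<le> 1"
      from abs_convexD[OF conv this]
      show "(\<lambda>x. complex_of_real t * (a * f x + b * g x)) \<in> V"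
        by (simp add: algebra_simps)
    qed
    show "solid {c. (\<lambda>x. complex_of_real t * c x) \<in> V}"
      using sol t unfolding solid_def dominated_def by (auto simp: norm_mult)
    fix j assume j: "j \<in> J"
    then obtain W where W: "nbhd0 (T j) W" "W \<subseteq> V" using V unfolding basic_def by blast
    have "nbhd0 (T j) {c. (\<lambda>x. complex_of_real t * c x) \<in> W}"
      using solid_lcs.nbhd0_scale[OF lcs[OF j] W(1) t] .
    then show "\<exists>V'. nbhd0 (T j) V' \<and> V' \<subseteq> {c. (\<lambda>x. complex_of_real t * c x) \<in> V}"
      using W(2) by blast
  qed
  show "openin (ind_lim J T) U \<longleftrightarrow> U \<subseteq> topspace (ind_lim J T) \<and>
      (\<forall>c\<in>U. \<exists>V. basic V \<and> (\<forall>v\<in>V. (\<lambda>x. c x + v x) \<in> U))" for U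
  proof -
    have "(\<exists>V. ind_nhd J T V \<and> (\<forall>v\<in>V. (\<lambda>x. c x + v x) \<in> U)) \<longleftrightarrow>
        (\<exists>V. basic V \<and> (\<forall>v\<in>V. (\<lambda>x. c x + v x) \<in> U))" (is "?l \<longleftrightarrow> ?r") for c
    proof
      assume ?l
      then obtain V where V: "ind_nhd J T V" "\<forall>v\<in>V. (\<lambda>x. c x + v x) \<in> U" by metis
      obtain V' where "basic V'" "V' \<subseteq> V" by (rule ind_nhd_basic[OF V(1)])
      then have "basic V' \<and> (\<forall>v\<in>V'. (\<lambda>x. c x + v x) \<in> U)" using V(2) by auto
      then show ?r ..
    next
      assume ?r
      then obtain V where "basic V" "\<forall>v\<in>V. (\<lambda>x. c x + v x) \<in> U" by metis
      then have "ind_nhd J T V \<and> (\<forall>v\<in>V. (\<lambda>x. c x + v x) \<in> U)" using basic_ind_nhd by simp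
      then show ?l ..
    qed
    then show ?thesis unfolding openin_ind_lim ind_open_def topspace by simp
  qed
qed

lemmas ind_lcs = solid_lcs_axioms

lemma nbhd0_ind_iff: "nbhd0 (ind_lim J T) V \<longleftrightarrow> basic V"
proof
  assume V: "nbhd0 (ind_lim J T) V"
  then obtain V' where V': "basic V'" "V' \<subseteq> V" unfolding nbhd0_iff by metis
  have "\<exists>V'. nbhd0 (T j) V' \<and> V' \<subseteq> V" if "j \<in> J" for j
    using V' that unfolding basic_def by (meson order_trans)
  then show "basic V" using V unfolding nbhd0_iff topspace basic_def by simp
qed (rule P_nbhd0)

end

text \<open>Continuity at 0 tested only on \<open>L\<close>. In the application \<open>f\<close> is
  the product with a fixed factor, given by an infinite sum that may diverge for elements of a step
  outside the limit space; \<open>L\<close> is the space where \<open>f\<close> is linear.\<close>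

definition cont0 :: "('x \<Rightarrow> complex) set \<Rightarrow> ('x \<Rightarrow> complex) topology \<Rightarrow> ('y \<Rightarrow> complex) topology \<Rightarrow>
    (('x \<Rightarrow> complex) \<Rightarrow> ('y \<Rightarrow> complex)) \<Rightarrow> bool" where
  "cont0 L X Y f \<longleftrightarrow> (\<forall>W. nbhd0 Y W \<longrightarrow> (\<exists>V. nbhd0 X V \<and> (\<forall>c\<in>V \<inter> L. f c \<in> W)))"

lemma cont0_maps:
  assumes "cont0 L X Y f" "solid_lcs X" "solid_lcs Y" "solid_space L" "linear_on_space L f"
    and c: "c \<in> L" "c \<in> topspace X"
  shows "f c \<in> topspace Y"
proof -
  obtain V where V: "nbhd0 X V" "\<And>c. c \<in> V \<Longrightarrow> c \<in> L \<Longrightarrow> f c \<in> topspace Y"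
    using assms(1) solid_lcs.nbhd0_topspace[OF assms(3)] unfolding cont0_def by blast
  obtain t :: real where t: "t > 0" "(\<lambda>x. c x / complex_of_real t) \<in> V"
    using solid_lcs.absorbing[OF assms(2) V(1) c(2)] by blast
  have "f (\<lambda>x. c x / complex_of_real t) \<in> topspace Y"
    using V(2)[OF t(2)] solid_space_divide[OF assms(4) c(1)] by blast
  then have "(\<lambda>x. f c x / complex_of_real t) \<in> topspace Y"
    using linear_on_space_divide[OF assms(5) c(1)] by simp
  from solid_space_scale[OF solid_lcs.space[OF assms(3)] this, of "complex_of_real t"] t
  show ?thesis by simp
qed

lemma cont0_continuous_map:
  assumes "cont0 (topspace X) X Y f" "solid_lcs X" "solid_lcs Y" "linear_on_space (topspace X) f"
  shows "continuous_map X Y f"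
proof (rule continuous_map_linear[OF assms(2-4)])
  show "f c \<in> topspace Y" if "c \<in> topspace X" for c
    by (rule cont0_maps[OF assms(1-3) solid_lcs.space[OF assms(2)] assms(4) that that])
  show "\<exists>V. nbhd0 X V \<and> (\<forall>c\<in>V. f c \<in> W)" if "nbhd0 Y W" for W
    using assms(1) that nbhd0_subset unfolding cont0_def by (metis inf.absorb_iff1)
qed

text \<open>The preimage of \<open>W\<close> is known only on \<open>L\<close> and cannot serve
  directly as a neighbourhood in the limit. Its solid core contains the solid neighbourhoods
  \<open>V'\<close> of all steps and is absolutely convex.\<close>

lemma (in solid_ind_lim) cont0_source:
  assumes L: "solid_space L" "linear_on_space L f" and f: "\<And>j. j \<in> J \<Longrightarrow> cont0 L (T j) Y f"
  shows "cont0 L (ind_lim J T) Y f"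
  unfolding cont0_def
proof (intro allI impI)
  fix W assume W: "nbhd0 Y W"
  let ?X = "\<Union>j\<in>J. topspace (T j)"
  define V where "V = {c \<in> ?X. \<forall>d\<in>L. dominated d c \<longrightarrow> f d \<in> W}"
  have "basic V"
    unfolding basic_def
  proof (intro conjI ballI)
    show "V \<subseteq> ?X" by (auto simp: V_def)
    show "abs_convex V"
      unfolding V_def by (rule abs_convex_solid_core[OF space L nbhd0_abs_convex[OF W]])
    show "solid V"
      unfolding V_def by (rule solid_solid_core) (use space solid_space_solid in blast)
    fix j assume j: "j \<in> J"
    obtain V' where V': "nbhd0 (T j) V'" "\<And>c. c \<in> V' \<Longrightarrow> c \<in> L \<Longrightarrow> f c \<in> W"
      using f[OF j] W unfolding cont0_def by blast
    have "V' \<subseteq> V"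
      using V'(2) nbhd0_solid[OF V'(1)] nbhd0_subset[OF V'(1)] j unfolding V_def solid_def by blast
    then show "\<exists>V'. nbhd0 (T j) V' \<and> V' \<subseteq> V" using V' by blast
  qed
  moreover have "f c \<in> W" if "c \<in> V \<inter> L" for c
    using that unfolding V_def by auto
  ultimately show "\<exists>V. nbhd0 (ind_lim J T) V \<and> (\<forall>c\<in>V \<inter> L. f c \<in> W)"
    unfolding nbhd0_ind_iff by blast
qed

lemma (in solid_ind_lim) cont0_target:
  assumes "j \<in> J" "cont0 L X (T j) f"
  shows "cont0 L X (ind_lim J T) f"
  using assms unfolding cont0_def nbhd0_ind_iff basic_def by (meson subsetD)

lemma (in solid_proj_lim) cont0_source:
  assumes "i \<in> I" "cont0 L (T i) Y f"
  shows "cont0 L (proj_lim I T) Y f"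
  using assms nbhd0_component unfolding cont0_def by (meson IntD1 IntD2 IntI)

lemma (in solid_proj_lim) cont0_target:
  assumes X: "solid_lcs X" and L: "solid_space L" "linear_on_space L f"
    and f: "\<And>i. i \<in> I \<Longrightarrow> cont0 L X (T i) f"
  shows "cont0 L X (proj_lim I T) f"
  unfolding cont0_def
proof (intro allI impI)
  fix W assume "nbhd0 (proj_lim I T) W"
  then obtain W' where W': "basic W'" "W' \<subseteq> W" unfolding nbhd0_iff by blast
  obtain F Ws where F: "finite F" "F \<subseteq> I" "\<And>i. i \<in> F \<Longrightarrow> nbhd0 (T i) (Ws i)"
      "W' = (\<Inter>i\<in>I. topspace (T i)) \<inter> (\<Inter>i\<in>F. Ws i)"
    using basicE[OF W'(1)] by metis
  have im: "f c \<in> (\<Inter>i\<in>I. topspace (T i))" if "c \<in> L" "c \<in> topspace X" for c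
    using cont0_maps[OF f X lcs L that] by blast
  have "\<exists>V. nbhd0 X V \<and> (\<forall>c\<in>V \<inter> L. f c \<in> (\<Inter>i\<in>F. Ws i))"
    using F(1-3)
  proof (induction F)
    case empty
    then show ?case using solid_lcs.nbhd0_topspace[OF X] by auto
  next
    case (insert i F)
    then obtain V where V: "nbhd0 X V" "\<forall>c\<in>V \<inter> L. f c \<in> (\<Inter>i\<in>F. Ws i)" by auto
    obtain V' where V': "nbhd0 X V'" "\<forall>c\<in>V' \<inter> L. f c \<in> Ws i"
      using f[of i] insert.prems unfolding cont0_def by (metis insert_subset insertI1)
    show ?case using nbhd0_Int[OF V(1) V'(1)] V(2) V'(2) by (intro exI[of _ "V \<inter> V'"]) auto
  qed
  then obtain V where V: "nbhd0 X V" "\<forall>c\<in>V \<inter> L. f c \<in> (\<Inter>i\<in>F. Ws i)" by (elim exE conjE)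
  have "f c \<in> W" if c: "c \<in> V \<inter> L" for c
  proof -
    have "f c \<in> W'" unfolding F(4) using im[of c] c V nbhd0_subset[OF V(1)] by blast
    then show ?thesis using W'(2) by auto
  qed
  then show "\<exists>V. nbhd0 X V \<and> (\<forall>c\<in>V \<inter> L. f c \<in> W)" using V(1) by blast
qed

lemma cont0_wtop:
  assumes "\<And>c N. N > 0 \<Longrightarrow> c \<in> wball w N \<Longrightarrow> c \<in> L \<Longrightarrow> f c \<in> wball w' (C * N)"
  shows "cont0 L (wtop top w) (wtop top w') f"
  unfolding cont0_def
proof (intro allI impI)
  fix W assume "nbhd0 (wtop top w') W"
  then obtain \<epsilon> where e: "\<epsilon> > 0" "wball w' \<epsilon> \<subseteq> W" unfolding nbhd0_wtop_iff by blast
  \<comment> \<open>The denominator is positive for every real \<open>C\<close>, and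
    \<open>C * N\<close> is at most \<epsilon> whatever the sign of \<open>C\<close>.\<close>
  define N where "N = \<epsilon> / (\<bar>C\<bar> + 1)"
  have N: "N > 0" using e by (simp add: N_def)
  have "C * N \<le> (\<bar>C\<bar> + 1) * N" using N by (intro mult_right_mono) auto
  also have "\<dots> = \<epsilon>" by (simp add: N_def)
  finally have "wball w' (C * N) \<subseteq> W" using wball_mono e(2) by blast
  then show "\<exists>V. nbhd0 (wtop top w) V \<and> (\<forall>c\<in>V \<inter> L. f c \<in> W)"
    using assms[OF N] nbhd0_wball[OF N] by blast
qed

text \<open>The spaces of type A are single limits. They are treated as double limits with a dummy
  index; this lemma and \<open>ind_lim_const\<close> remove the dummy limit.\<close>

lemma proj_lim_const:
  assumes "I \<noteq> {}" shows "proj_lim I (\<lambda>_. X) = X"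
proof -
  have "(\<Union>i\<in>I. {U \<inter> (\<Inter>j\<in>I. topspace X) |U. openin X U}) = {U. openin X U}"
    using assms openin_subset by (auto simp: inf.absorb1)
  then have "proj_lim I (\<lambda>_. X) = topology_generated_by {U. openin X U}"
    by (simp add: proj_lim_def)
  also have "\<dots> = X"
  proof (rule topology_eq[THEN iffD2], intro allI iffI)
    fix U assume "openin (topology_generated_by {U. openin X U}) U"
    then have "generate_topology_on {U. openin X U} U" by (simp add: openin_topology_generated_by_iff)
    then show "openin X U" by induction auto
  qed (simp add: topology_generated_by_Basis)
  finally show ?thesis .
qed

lemma (in solid_lcs) ind_lim_const:
  assumes "J \<noteq> {}" shows "ind_lim J (\<lambda>_. X) = X"
proof -
  interpret i: solid_ind_lim J "\<lambda>_. X"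
    using assms by unfold_locales auto
  have "nbhd0 (ind_lim J (\<lambda>_. X)) V \<longleftrightarrow> nbhd0 X V" for V
    unfolding i.nbhd0_ind_iff i.basic_def using assms nbhd0_superset nbhd0_def by auto
  then show ?thesis
    unfolding topology_eq i.openin_iff openin_iff i.topspace using assms by auto
qed

section \<open>Limits over grids of weights\<close>

lemma ennreal_pos_lower_bound:
  fixes w :: ennreal assumes "w > 0"
  obtains v :: real where "v > 0" "ennreal v \<le> w"
proof -
  obtain y where y: "0 < y" "y < w" using dense[OF assms] by blast
  then have "y < top" using less_le_trans[OF _ top_greatest] by blast
  then show thesis using y that[of "enn2real y"] by (simp add: enn2real_positive_iff less_imp_le)
qed

lemma finite_large_terms:
  fixes q :: "'x \<Rightarrow> real"
  assumes q: "\<And>x. 0 \<le> q x" "q summable_on UNIV" and e: "0 < \<epsilon>"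
  shows "finite {x. \<epsilon> < q x}"
proof (rule ccontr)
  assume inf: "infinite {x. \<epsilon> < q x}"
  obtain n :: nat where n: "infsum q UNIV < of_nat n * \<epsilon>" using reals_Archimedean3[OF e] by blast
  obtain F where F: "F \<subseteq> {x. \<epsilon> < q x}" "finite F" "card F = n"
    using infinite_arbitrarily_large[OF inf, of n] by blast
  have "of_nat n * \<epsilon> = (\<Sum>x\<in>F. \<epsilon>)" using F by simp
  also have "\<dots> \<le> sum q F" using F by (intro sum_mono) auto
  also have "\<dots> \<le> infsum q UNIV" using F q by (intro finite_sum_le_infsum) auto
  finally show False using n by simp
qed

text \<open>Summability of every positive power of the quotient \<open>q\<close> handles all
  exponents \<open>p\<close> at once, including \<open>p < 1\<close>; it also makes \<open>q\<close>
  small outside finite sets.\<close>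

definition summably_below :: "('x \<Rightarrow> ennreal) \<Rightarrow> ('x \<Rightarrow> ennreal) \<Rightarrow> bool" where
  "summably_below w' w \<longleftrightarrow> (\<exists>q. (\<forall>x. 0 \<le> q x) \<and> (\<forall>p>0. (\<lambda>x. q x powr p) summable_on UNIV) \<and>
     (\<forall>x. w' x \<le> ennreal (q x) * w x))"

text \<open>Only finitely many points have \<open>q x > \<epsilon> / N\<close>. At all others the
  passage from \<open>w\<close> to \<open>w'\<close> reduces the bound \<open>N\<close> to
  \<epsilon>.\<close>

lemma summably_below_tail:
  assumes "summably_below w' w" and c: "c \<in> wball w N" and N: "N > 0" and e: "\<epsilon> > 0"
  shows "\<exists>F. finite F \<and> (\<lambda>x. if x \<in> F then 0 else c x) \<in> wball w' \<epsilon>"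
proof -
  obtain q where q: "\<And>x. 0 \<le> q x" "\<And>p. p > 0 \<Longrightarrow> (\<lambda>x. q x powr p) summable_on UNIV"
    "\<And>x. w' x \<le> ennreal (q x) * w x" using assms(1) unfolding summably_below_def by blast
  have q1: "q summable_on UNIV" using q(2)[of 1] q(1) by simp
  let ?F = "{x. \<epsilon> / N < q x}"
  have "finite ?F" by (rule finite_large_terms[OF q(1) q1]) (use N e in simp)
  moreover have "(\<lambda>x. if x \<in> ?F then 0 else c x) \<in> wball w' \<epsilon>"
    unfolding wball_def
  proof safe
    fix x
    show "ennreal (cmod (if x \<in> ?F then 0 else c x)) * w' x \<le> ennreal \<epsilon>"
    proof (cases "x \<in> ?F")
      case False
      then have le: "q x \<le> \<epsilon> / N" by simp
      have "ennreal (cmod (c x)) * w' x \<le> ennreal (cmod (c x)) * (ennreal (q x) * w x)"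
        by (intro mult_left_mono q) simp
      also have "\<dots> = ennreal (q x) * (ennreal (cmod (c x)) * w x)" by (simp add: mult_ac)
      also have "\<dots> \<le> ennreal (\<epsilon> / N) * ennreal N"
        using wballD[OF c] le by (intro mult_mono ennreal_leI) auto
      also have "\<dots> = ennreal \<epsilon>" using N e by (simp add: ennreal_mult[symmetric])
      finally show ?thesis using False by simp
    qed simp
  qed
  ultimately show ?thesis by blast
qed

text \<open>The pointwise supremum of the moduli. It is finite because at every point some weight of
  the family is positive, and a bound valid for all members of \<open>S\<close> passes to the
  supremum. A negative radius counts as 0.\<close>

lemma wball_Sup:
  fixes S :: "('x \<Rightarrow> complex) set"
  assumes pos: "\<And>x. \<exists>w\<in>\<W>. 0 < w x" and bd: "\<And>w. w \<in> \<W> \<Longrightarrow> \<exists>N>0. S \<subseteq> wball w N"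
  obtains f where "\<And>c. c \<in> S \<Longrightarrow> dominated c f"
    "\<And>w N. w \<in> \<W> \<Longrightarrow> S \<subseteq> wball w N \<Longrightarrow> f \<in> wball w N"
proof -
  \<comment> \<open>The inserted 0 keeps the supremum meaningful and nonnegative when
    \<open>S\<close> is empty.\<close>
  define R where "R x = insert 0 ((\<lambda>c. cmod (c x)) ` S)" for x
  have bound: "r * v \<le> N" if r: "r \<in> R x" and "S \<subseteq> wball w N" "N \<ge> 0" "ennreal v \<le> w x" "v \<ge> 0" for r x w N v
  proof (cases "r = 0")
    case False
    then obtain c where c: "c \<in> S" "r = cmod (c x)" using r by (auto simp: R_def)
    have "ennreal (cmod (c x)) * ennreal v \<le> ennreal (cmod (c x)) * w x"
      by (intro mult_left_mono that) simp
    also have "\<dots> \<le> ennreal N" using c that(2) by (auto dest: wballD)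
    finally show ?thesis using that c by (simp add: ennreal_mult[symmetric])
  qed (use that in simp)
  have bdd: "bdd_above (R x)" for x
  proof -
    obtain w where w: "w \<in> \<W>" "0 < w x" using pos by blast
    obtain N where N: "N > 0" "S \<subseteq> wball w N" using bd[OF w(1)] by blast
    obtain v where v: "v > 0" "ennreal v \<le> w x" using ennreal_pos_lower_bound[OF w(2)] .
    show ?thesis
      by (rule bdd_aboveI[of _ "N / v"]) (use bound[OF _ N(2)] N v in \<open>auto simp: field_simps\<close>)
  qed
  define f where "f x = complex_of_real (Sup (R x))" for x
  have ge: "r \<le> Sup (R x)" if "r \<in> R x" for r x by (rule cSup_upper[OF that bdd])
  have f0: "Sup (R x) \<ge> 0" for x by (rule ge) (simp add: R_def)
  show thesis
  proof
    show "dominated c f" if "c \<in> S" for c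
      unfolding dominated_def f_def using ge f0 that by (auto simp: R_def)
    show "f \<in> wball w N" if "w \<in> \<W>" and S: "S \<subseteq> wball w N" for w N
    proof (cases "N \<ge> 0 ")
      case True
      have "ennreal (Sup (R x)) * w x \<le> ennreal N" for x
      proof (cases "Sup (R x) = 0")
        case False
        then have pos: "Sup (R x) > 0" using f0[of x] by simp
        then obtain r where r: "r \<in> R x" "r > 0" using less_cSupD[OF _ pos] by (force simp: R_def)
        \<comment> \<open>An infinite weight would force every member of \<open>S\<close> to vanish
          at \<open>x\<close>, contrary to the positive supremum.\<close>
        have fin: "w x < top"
        proof (rule ccontr)
          assume "\<not> w x < top"
          then have t: "w x = top" by (simp add: not_less top_unique)
          obtain c where c: "c \<in> S" "r = cmod (c x)" using r by (auto simp: R_def)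
          have "ennreal r * top \<le> ennreal N" using c S wballD[of c w N x] t by auto
          then show False using r by (simp add: ennreal_mult_top top_unique)
        qed
        define v where "v = enn2real (w x)"
        have v: "w x = ennreal v" "v \<ge> 0" using fin by (auto simp: v_def)
        have "Sup (R x) * v \<le> N"
        proof (cases "v = 0")
          case False
          have "Sup (R x) \<le> N / v"
            by (rule cSup_least) (use bound[OF _ S True] v False in \<open>auto simp: R_def field_simps\<close>)
          then show ?thesis using v False by (simp add: field_simps)
        qed (use True in simp)
        then show ?thesis using v f0 by (simp add: ennreal_mult[symmetric] ennreal_leI)
      qed simp
      then show ?thesis using f0 by (simp add: wball_def f_def)
    next
      case False
      then have N0: "ennreal N = 0" by (simp add: ennreal_eq_0_iff)
      have "f \<in> wball w 0"
      proof -
        have S0: "S \<subseteq> wball w 0" using S N0 by (simp add: wball_def)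
        have "ennreal (Sup (R x)) * w x = 0" for x
        proof (cases "w x = 0")
          case False
          then have "0 < w x" by (simp add: zero_less_iff_neq_zero)
          then obtain v where v: "v > 0" "ennreal v \<le> w x" by (rule ennreal_pos_lower_bound)
          have "r \<le> 0" if "r \<in> R x" for r
            using bound[OF that S0 _ v(2)] v by (simp add: mult_le_0_iff)
          then have "Sup (R x) \<le> 0" by (intro cSup_least) (auto simp: R_def)
          then show ?thesis by (simp add: ennreal_eq_0_iff)
        qed simp
        then show ?thesis using f0 by (simp add: wball_def f_def)
      qed
      then show ?thesis using N0 by (simp add: wball_def)
    qed
  qed
qed

section \<open>Double limits over a grid of weights\<close>

lemma wspace_top_iff: "c \<in> wspace top w \<longleftrightarrow> (\<exists>N>0. c \<in> wball w N)"
  unfolding wspace_top by auto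

text \<open>In both double limits \<open>i\<close> is the projective and \<open>j\<close> the
  inductive index. One grid thus gives a space of type B and, with the limits interchanged, one of
  type C.\<close>

definition proj_ind :: "(nat \<Rightarrow> nat \<Rightarrow> 'x \<Rightarrow> ennreal) \<Rightarrow> ('x \<Rightarrow> complex) topology" where
  "proj_ind w = proj_lim UNIV (\<lambda>i. ind_lim UNIV (\<lambda>j. wtop top (w i j)))"

definition ind_proj :: "(nat \<Rightarrow> nat \<Rightarrow> 'x \<Rightarrow> ennreal) \<Rightarrow> ('x \<Rightarrow> complex) topology" where
  "ind_proj w = ind_lim UNIV (\<lambda>j. proj_lim UNIV (\<lambda>i. wtop top (w i j)))"

definition finitely_supported :: "('x \<Rightarrow> complex) set" where
  "finitely_supported = {c. finite {x. c x \<noteq> 0}}"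

text \<open>This is density of the finitely supported families: removing a small tail from
  \<open>c\<close> leaves a finite family close to \<open>c\<close>.\<close>

definition has_tails :: "('x \<Rightarrow> complex) topology \<Rightarrow> bool" where
  "has_tails X \<longleftrightarrow> (\<forall>c\<in>topspace X. \<forall>V. nbhd0 X V \<longrightarrow>
     (\<exists>F. finite F \<and> (\<lambda>x. if x \<in> F then 0 else c x) \<in> V))"

text \<open>Continuity of the coordinate functionals; it plays the part of the Hausdorff property in
  uniqueness arguments.\<close>

definition has_coordinates :: "('x \<Rightarrow> complex) topology \<Rightarrow> bool" where
  "has_coordinates X \<longleftrightarrow> (\<forall>x. \<exists>V. nbhd0 X V \<and> (\<forall>c\<in>V. cmod (c x) \<le> 1))"

text \<open>The maps are not assumed linear, since a competing extension is known only to be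
  separately continuous. Hence the argument works in neighbourhoods of \<open>c\<close> and of its
  two images and compares one coordinate.\<close>

lemma continuous_maps_agree:
  assumes X: "solid_lcs X" "has_tails X" and Y: "solid_lcs Y" "has_coordinates Y"
    and f: "continuous_map X Y f" and g: "continuous_map X Y g"
    and eq: "\<And>c. c \<in> finitely_supported \<Longrightarrow> f c = g c" and c: "c \<in> topspace X"
  shows "f c = g c"
proof (rule ccontr)
  interpret X: solid_lcs X by (rule X)
  interpret Y: solid_lcs Y by (rule Y)
  assume "f c \<noteq> g c"
  then obtain x where x: "f c x \<noteq> g c x" by blast
  \<comment> \<open>Elements of \<open>V\<close> have modulus at most \<open>1 / t\<close> at
    \<open>x\<close>. Two such errors add up to \<open>2 / t\<close>, less than the gap
    \<open>3 / t\<close> between the two values.\<close>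
  define t where "t = 3 / cmod (f c x - g c x)"
  have t: "t > 0" using x by (simp add: t_def)
  obtain V0 where V0: "nbhd0 Y V0" "\<forall>c\<in>V0. cmod (c x) \<le> 1"
    using Y(2) unfolding has_coordinates_def by blast
  define V where "V = {c. (\<lambda>x. complex_of_real t * c x) \<in> V0}"
  have V: "nbhd0 Y V" unfolding V_def by (rule Y.nbhd0_scale[OF V0(1) t])
  have Vx: "t * cmod (e x) \<le> 1" if "e \<in> V" for e
    using that V0(2) t by (fastforce simp: V_def norm_mult)
  have fc: "f c \<in> topspace Y" "g c \<in> topspace Y"
    using f g c by (auto simp: continuous_map_def)
  obtain U1 where U1: "openin Y U1" "f c \<in> U1" "\<And>e. e \<in> U1 \<Longrightarrow> (\<lambda>x. e x - f c x) \<in> V"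
    using Y.open_translate[OF fc(1) V] by metis
  obtain U2 where U2: "openin Y U2" "g c \<in> U2" "\<And>e. e \<in> U2 \<Longrightarrow> (\<lambda>x. e x - g c x) \<in> V"
    using Y.open_translate[OF fc(2) V] by metis
  let ?U = "{c \<in> topspace X. f c \<in> U1} \<inter> {c \<in> topspace X. g c \<in> U2}"
  have "openin X ?U" using f g U1(1) U2(1) by (intro openin_Int) (auto simp: continuous_map_def)
  moreover have "c \<in> ?U" using c U1 U2 by simp
  ultimately obtain W where W: "nbhd0 X W" "\<forall>v\<in>W. (\<lambda>x. c x + v x) \<in> ?U"
    using X.openin_iff[of ?U, THEN iffD1] by fast
  obtain F where F: "finite F" "(\<lambda>x. if x \<in> F then 0 else c x) \<in> W"
    using X(2) c W(1) unfolding has_tails_def by metis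
  \<comment> \<open>The neighbourhood is solid, so the negative of the tail lies in it too; adding
    it to \<open>c\<close> cuts \<open>c\<close> down to the finite set \<open>F\<close>.\<close>
  have "(\<lambda>x. if x \<in> F then 0 else - c x) \<in> W"
    by (rule solidD[OF nbhd0_solid[OF W(1)] F(2)]) (simp add: dominated_def)
  then have "(\<lambda>x. c x + (if x \<in> F then 0 else - c x)) \<in> ?U" by (rule W(2)[rule_format])
  moreover define d where "d = (\<lambda>x. c x + (if x \<in> F then 0 else - c x))"
  ultimately have d: "f d \<in> U1" "g d \<in> U2" by auto
  have "{x. d x \<noteq> 0} \<subseteq> F" by (auto simp: d_def)
  then have "d \<in> finitely_supported" using F(1) finite_subset by (auto simp: finitely_supported_def)
  then have fg: "f d = g d" by (rule eq)
  have "t * cmod (f d x - f c x) \<le> 1" "t * cmod (g d x - g c x) \<le> 1"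
    using Vx[OF U1(3)[OF d(1)]] Vx[OF U2(3)[OF d(2)]] by auto
  moreover have "cmod (f c x - g c x) \<le> cmod (f d x - f c x) + cmod (g d x - g c x)"
    unfolding fg using norm_triangle_ineq4[of "g d x - g c x" "g d x - f c x"] by (simp add: add.commute)
  ultimately have "t * cmod (f c x - g c x) \<le> 2"
    using t by (smt (verit) distrib_left mult_left_mono)
  then show False using x by (simp add: t_def)
qed

text \<open>\<open>pos\<close> gives continuous coordinates, \<open>fin\<close> puts the finitely
  supported families into the space, and \<open>nuclear\<close> gives density and independence of
  the exponent. Zero weights arise as inverses of infinite ones for \<open>s = 0\<close>;
  \<open>pos_indep\<close> ties the zeros to the projective index.\<close>

locale weight_grid =
  fixes w :: "nat \<Rightarrow> nat \<Rightarrow> 'x \<Rightarrow> ennreal"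
  assumes inc: "i \<le> i' \<Longrightarrow> w i j x \<le> w i' j x"
    and dec: "j \<le> j' \<Longrightarrow> w i j' x \<le> w i j x"
    and pos: "\<exists>i. \<forall>j. 0 < w i j x"
    and pos_indep: "0 < w i j x \<Longrightarrow> 0 < w i j' x"
    and fin: "\<exists>j. \<forall>i. w i j x < top"
    and nuclear: "\<exists>\<phi> \<psi>. \<forall>i j. summably_below (w i (\<psi> j)) (w (\<phi> i) j)"
begin

sublocale ind: solid_ind_lim UNIV "\<lambda>j. wtop top (w i j)" for i
proof (rule solid_ind_lim.intro)
  show "solid_lcs (wtop top (w i j))" for j by (rule solid_lcs_wtop)
  show "\<exists>k\<in>UNIV. topspace (wtop top (w i j)) \<union> topspace (wtop top (w i j')) \<subseteq> topspace (wtop top (w i k))"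
    for j j'
  proof -
    have "wspace top (w i j) \<subseteq> wspace top (w i (max j j'))"
      "wspace top (w i j') \<subseteq> wspace top (w i (max j j'))"
      using wball_antimono[of "w i (max j j')"] dec unfolding wspace_top by (metis UN_mono max.cobounded1 max.cobounded2 order_refl)+
    then show ?thesis unfolding topspace_wtop by blast
  qed
qed simp

sublocale proj_ind: solid_proj_lim UNIV "\<lambda>i. ind_lim UNIV (\<lambda>j. wtop top (w i j))"
  by (rule solid_proj_lim.intro) (simp_all add: ind.ind_lcs)

sublocale proj: solid_proj_lim UNIV "\<lambda>i. wtop top (w i j)" for j
  by (rule solid_proj_lim.intro) (simp_all add: solid_lcs_wtop)

sublocale ind_proj: solid_ind_lim UNIV "\<lambda>j. proj_lim UNIV (\<lambda>i. wtop top (w i j))"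
proof (rule solid_ind_lim.intro)
  show "solid_lcs (proj_lim UNIV (\<lambda>i. wtop top (w i j)))" for j by (rule proj.proj_lcs)
  show "\<exists>k\<in>UNIV. topspace (proj_lim UNIV (\<lambda>i. wtop top (w i j))) \<union>
      topspace (proj_lim UNIV (\<lambda>i. wtop top (w i j'))) \<subseteq> topspace (proj_lim UNIV (\<lambda>i. wtop top (w i k)))"
    for j j'
  proof -
    have "wspace top (w i j) \<subseteq> wspace top (w i (max j j'))"
      "wspace top (w i j') \<subseteq> wspace top (w i (max j j'))" for i
      using wball_antimono[of "w i (max j j')"] dec unfolding wspace_top by (metis UN_mono max.cobounded1 max.cobounded2 order_refl)+
    then show ?thesis unfolding proj.topspace topspace_wtop by blast
  qed
qed simp

lemma proj_ind_lcs: "solid_lcs (proj_ind w)"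
  unfolding proj_ind_def by (rule proj_ind.proj_lcs)

lemma ind_proj_lcs: "solid_lcs (ind_proj w)"
  unfolding ind_proj_def by (rule ind_proj.ind_lcs)

lemma topspace_proj_ind: "topspace (proj_ind w) = {c. \<forall>i. \<exists>j. \<exists>N>0. c \<in> wball (w i j) N}"
  unfolding proj_ind_def proj_ind.topspace ind.topspace topspace_wtop by (simp add: set_eq_iff wspace_top_iff)

lemma topspace_ind_proj: "topspace (ind_proj w) = {c. \<exists>j. \<forall>i. \<exists>N>0. c \<in> wball (w i j) N}"
  unfolding ind_proj_def ind_proj.topspace proj.topspace topspace_wtop by (simp add: set_eq_iff wspace_top_iff)

text \<open>Each of the finitely many components involved has its own finite set outside which
  \<open>c\<close> is small. The union of these sets serves all components, because enlarging the
  set only shrinks the tail and the neighbourhoods are solid.\<close>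

lemma proj_ind_tails: "has_tails (proj_ind w)"
  unfolding has_tails_def
proof (intro ballI allI impI)
  fix c V assume c: "c \<in> topspace (proj_ind w)" and V: "nbhd0 (proj_ind w) V"
  obtain \<phi> \<psi> where nuc: "\<And>i j. summably_below (w i (\<psi> j)) (w (\<phi> i) j)" using nuclear by blast
  obtain V' where V': "proj_ind.basic V'" "V' \<subseteq> V"
    using V unfolding proj_ind_def proj_ind.nbhd0_iff by metis
  obtain I Vs where I: "finite I" "\<And>i. i \<in> I \<Longrightarrow> nbhd0 (ind_lim UNIV (\<lambda>j. wtop top (w i j))) (Vs i)"
      "V' = topspace (proj_ind w) \<inter> (\<Inter>i\<in>I. Vs i)"
    using proj_ind.basicE[OF V'(1)] unfolding proj_ind_def proj_ind.topspace by metis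
  have "\<forall>i\<in>I. \<exists>F. finite F \<and> (\<lambda>x. if x \<in> F then 0 else c x) \<in> Vs i"
  proof
    fix i assume i: "i \<in> I"
    obtain j N where N: "N > 0" "c \<in> wball (w (\<phi> i) j) N"
      using c unfolding topspace_proj_ind by blast
    obtain W where W: "nbhd0 (wtop top (w i (\<psi> j))) W" "W \<subseteq> Vs i"
      using I(2)[OF i] unfolding ind.nbhd0_ind_iff ind.basic_def by blast
    obtain \<epsilon> where "\<epsilon> > 0" "wball (w i (\<psi> j)) \<epsilon> \<subseteq> Vs i"
      using W unfolding nbhd0_wtop_iff by (meson order_trans)
    then show "\<exists>F. finite F \<and> (\<lambda>x. if x \<in> F then 0 else c x) \<in> Vs i"
      using summably_below_tail[OF nuc N(2,1)] by (meson subsetD)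
  qed
  then obtain F where F: "\<And>i. i \<in> I \<Longrightarrow> finite (F i)"
    "\<And>i. i \<in> I \<Longrightarrow> (\<lambda>x. if x \<in> F i then 0 else c x) \<in> Vs i" by metis
  let ?c = "\<lambda>x. if x \<in> (\<Union>i\<in>I. F i) then 0 else c x"
  have "?c \<in> Vs i" if "i \<in> I" for i
    by (rule solidD[OF nbhd0_solid[OF I(2)[OF that]] F(2)[OF that]])
      (use that in \<open>auto simp: dominated_def\<close>)
  moreover have "?c \<in> topspace (proj_ind w)"
    by (rule solidD[OF solid_space_solid[OF solid_lcs.space[OF proj_ind_lcs]] c]) (auto simp: dominated_def)
  ultimately have "?c \<in> V" using V'(2) I(3) by blast
  then show "\<exists>F. finite F \<and> (\<lambda>x. if x \<in> F then 0 else c x) \<in> V"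
    using F(1) I(1) by blast
qed

lemma ind_proj_tails: "has_tails (ind_proj w)"
  unfolding has_tails_def
proof (intro ballI allI impI)
  fix c V assume c: "c \<in> topspace (ind_proj w)" and V: "nbhd0 (ind_proj w) V"
  obtain \<phi> \<psi> where nuc: "\<And>i j. summably_below (w i (\<psi> j)) (w (\<phi> i) j)" using nuclear by blast
  obtain j where j: "\<And>i. \<exists>N>0. c \<in> wball (w i j) N" using c unfolding topspace_ind_proj by blast
  obtain W where W: "nbhd0 (proj_lim UNIV (\<lambda>i. wtop top (w i (\<psi> j)))) W" "W \<subseteq> V"
    using V unfolding ind_proj_def ind_proj.nbhd0_ind_iff ind_proj.basic_def by blast
  obtain V' where V': "proj.basic (\<psi> j) V'" "V' \<subseteq> V"
    using W unfolding proj.nbhd0_iff by (meson order_trans)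
  obtain I Vs where I: "finite I" "\<And>i. i \<in> I \<Longrightarrow> nbhd0 (wtop top (w i (\<psi> j))) (Vs i)"
      "V' = (\<Inter>i. wspace top (w i (\<psi> j))) \<inter> (\<Inter>i\<in>I. Vs i)"
    using proj.basicE[OF V'(1)] unfolding topspace_wtop by metis
  have tail: "\<exists>F. finite F \<and> (\<lambda>x. if x \<in> F then 0 else c x) \<in> wball (w i (\<psi> j)) \<epsilon>" if "\<epsilon> > 0" for i \<epsilon>
    using summably_below_tail[OF nuc] j that by metis
  have "\<forall>i\<in>I. \<exists>F. finite F \<and> (\<lambda>x. if x \<in> F then 0 else c x) \<in> Vs i"
  proof
    fix i assume i: "i \<in> I"
    obtain \<epsilon> where "\<epsilon> > 0" "wball (w i (\<psi> j)) \<epsilon> \<subseteq> Vs i"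
      using I(2)[OF i] unfolding nbhd0_wtop_iff by meson
    then show "\<exists>F. finite F \<and> (\<lambda>x. if x \<in> F then 0 else c x) \<in> Vs i"
      using tail by (meson subsetD)
  qed
  then obtain F where F: "\<And>i. i \<in> I \<Longrightarrow> finite (F i)"
    "\<And>i. i \<in> I \<Longrightarrow> (\<lambda>x. if x \<in> F i then 0 else c x) \<in> Vs i" by metis
  let ?c = "\<lambda>x. if x \<in> (\<Union>i\<in>I. F i) then 0 else c x"
  have "?c \<in> Vs i" if "i \<in> I" for i
    by (rule solidD[OF nbhd0_solid[OF I(2)[OF that]] F(2)[OF that]])
      (use that in \<open>auto simp: dominated_def\<close>)
  moreover have "?c \<in> wspace top (w i (\<psi> j))" for i
  proof -
    obtain N where N: "N > 0" "c \<in> wball (w (\<phi> i) j) N" using j by blast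
    obtain q where q: "\<And>x. 0 \<le> q x" "\<And>p. p > 0 \<Longrightarrow> (\<lambda>x. q x powr p) summable_on UNIV"
      "\<And>x. w i (\<psi> j) x \<le> ennreal (q x) * w (\<phi> i) j x" using nuc[of i j] unfolding summably_below_def by blast
    have q1: "q summable_on UNIV" using q(2)[of 1] q(1) by simp
    \<comment> \<open>Each \<open>q x\<close> is bounded by the total sum, so \<open>c\<close> lies
      in every weighted space of the new step; adding 1 makes the radius positive.\<close>
    define B where "B = infsum q UNIV"
    have B: "q x \<le> B" for x
      using finite_sum_le_infsum[OF q1, of "{x}"] q(1) by (simp add: B_def)
    have B0: "B \<ge> 0" using B[of undefined] q(1)[of undefined] by simp
    have "c \<in> wball (w i (\<psi> j)) (B * N + 1)"
      unfolding wball_def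
    proof safe
      fix x
      have "ennreal (cmod (c x)) * w i (\<psi> j) x \<le> ennreal (cmod (c x)) * (ennreal (q x) * w (\<phi> i) j x)"
        by (intro mult_left_mono q) simp
      also have "\<dots> = ennreal (q x) * (ennreal (cmod (c x)) * w (\<phi> i) j x)" by (simp add: mult_ac)
      also have "\<dots> \<le> ennreal B * ennreal N"
        using wballD[OF N(2)] B by (intro mult_mono ennreal_leI) auto
      also have "\<dots> \<le> ennreal (B * N + 1)" using N B0 by (simp add: ennreal_mult[symmetric] ennreal_leI)
      finally show "ennreal (cmod (c x)) * w i (\<psi> j) x \<le> ennreal (B * N + 1)" .
    qed
    then have "?c \<in> wball (w i (\<psi> j)) (B * N + 1)"
      by (rule solidD[OF solid_wball]) (auto simp: dominated_def)
    moreover have "B * N + 1 > 0" using B0 N by (simp add: add_nonneg_pos)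
    ultimately show ?thesis unfolding wspace_top by blast
  qed
  ultimately have "?c \<in> V" using V'(2) I(3) by blast
  then show "\<exists>F. finite F \<and> (\<lambda>x. if x \<in> F then 0 else c x) \<in> V"
    using F(1) I(1) by blast
qed

end

lemma wball_coordinate:
  fixes w :: "'x \<Rightarrow> ennreal"
  assumes "0 < w x" "\<delta> > 0"
  obtains \<epsilon> where "\<epsilon> > 0" "\<And>c. c \<in> wball w \<epsilon> \<Longrightarrow> cmod (c x) \<le> \<delta>"
proof -
  obtain v where v: "v > 0" "ennreal v \<le> w x" using ennreal_pos_lower_bound[OF assms(1)] .
  have "cmod (c x) \<le> \<delta>" if c: "c \<in> wball w (\<delta> * v)" for c
  proof -
    have "ennreal (cmod (c x)) * ennreal v \<le> ennreal (cmod (c x)) * w x"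
      by (intro mult_left_mono v) simp
    also have "\<dots> \<le> ennreal (\<delta> * v)" by (rule wballD[OF c])
    finally show ?thesis using v assms by (simp add: ennreal_mult[symmetric])
  qed
  then show thesis using v assms by (intro that[of "\<delta> * v"]) auto
qed

text \<open>A sequence of points with prescribed bounds is allowed for the regularity argument; with
  a constant sequence this is a bound at a single coordinate.\<close>

lemma abs_convex_coordinate:
  assumes "solid_space X" shows "abs_convex {c \<in> X. \<forall>n. cmod (c (x n)) \<le> r n}" "solid {c \<in> X. \<forall>n. cmod (c (x n)) \<le> r n}"
proof -
  show "abs_convex {c \<in> X. \<forall>n. cmod (c (x n)) \<le> r n}"
    unfolding abs_convex_def
  proof (intro ballI allI impI)
    fix f g a b assume f: "f \<in> {c \<in> X. \<forall>n. cmod (c (x n)) \<le> r n}" and g: "g \<in> {c \<in> X. \<forall>n. cmod (c (x n)) \<le> r n}"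
      and ab: "cmod a + cmod b \<le> 1"
    have "cmod (a * f (x n) + b * g (x n)) \<le> r n" for n
    proof -
      have r: "cmod (f (x n)) \<le> r n" "cmod (g (x n)) \<le> r n" using f g by auto
      then have r0: "r n \<ge> 0" using norm_ge_zero order_trans by blast
      have "cmod (a * f (x n) + b * g (x n)) \<le> cmod a * cmod (f (x n)) + cmod b * cmod (g (x n))"
        by (metis norm_mult norm_triangle_ineq)
      also have "\<dots> \<le> cmod a * r n + cmod b * r n" using r by (intro add_mono mult_left_mono) auto
      also have "\<dots> \<le> r n" using mult_right_mono[OF ab r0] by (simp add: distrib_right)
      finally show ?thesis .
    qed
    then show "(\<lambda>x. a * f x + b * g x) \<in> {c \<in> X. \<forall>n. cmod (c (x n)) \<le> r n}"
      using solid_space_lin[OF assms] f g by auto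
  qed
  show "solid {c \<in> X. \<forall>n. cmod (c (x n)) \<le> r n}"
    using solid_space_solid[OF assms] unfolding solid_def dominated_def
    by (auto intro: order_trans)
qed

context weight_grid
begin

lemma proj_ind_coordinates: "has_coordinates (proj_ind w)"
  unfolding has_coordinates_def
proof
  fix x
  obtain i where i: "\<And>j. 0 < w i j x" using pos by blast
  let ?V = "{c \<in> \<Union>j. topspace (wtop top (w i j)). \<forall>n::nat. cmod (c x) \<le> 1}"
  have "ind.basic i ?V"
    unfolding ind.basic_def
  proof (intro conjI ballI)
    show "abs_convex ?V" "solid ?V"
      using abs_convex_coordinate[OF ind.space, of i "\<lambda>_. x" "\<lambda>_. 1"] by auto
    fix j
    obtain \<epsilon> where e: "\<epsilon> > 0" "\<And>c. c \<in> wball (w i j) \<epsilon> \<Longrightarrow> cmod (c x) \<le> 1"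
      using wball_coordinate[where w = "w i j" and x = x and \<delta> = 1] i[of j] by auto
    have "wball (w i j) \<epsilon> \<subseteq> ?V" using e unfolding topspace_wtop wspace_top by blast
    then show "\<exists>V'. nbhd0 (wtop top (w i j)) V' \<and> V' \<subseteq> ?V" using nbhd0_wball[OF e(1)] by blast
  qed auto
  then have "nbhd0 (ind_lim UNIV (\<lambda>j. wtop top (w i j))) ?V" by (rule ind.P_nbhd0)
  from proj_ind.nbhd0_component[OF _ this]
  have "nbhd0 (proj_ind w) (?V \<inter> (\<Inter>i. topspace (ind_lim UNIV (\<lambda>j. wtop top (w i j)))))"
    unfolding proj_ind_def by simp
  then show "\<exists>V. nbhd0 (proj_ind w) V \<and> (\<forall>c\<in>V. cmod (c x) \<le> 1)" by blast
qed

lemma ind_proj_coordinates: "has_coordinates (ind_proj w)"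
  unfolding has_coordinates_def
proof
  fix x
  obtain i where i: "\<And>j. 0 < w i j x" using pos by blast
  let ?V = "{c \<in> topspace (ind_proj w). \<forall>n::nat. cmod (c x) \<le> 1}"
  have ts: "topspace (ind_proj w) = (\<Union>j. topspace (proj_lim UNIV (\<lambda>i. wtop top (w i j))))"
    unfolding ind_proj_def ind_proj.topspace ..
  have "ind_proj.basic ?V"
    unfolding ind_proj.basic_def
  proof (intro conjI ballI)
    show "abs_convex ?V" "solid ?V"
      using abs_convex_coordinate[OF solid_lcs.space[OF ind_proj_lcs], of "\<lambda>_. x" "\<lambda>_. 1"] by auto
    show "?V \<subseteq> (\<Union>j. topspace (proj_lim UNIV (\<lambda>i. wtop top (w i j))))" using ts by blast
    fix j
    obtain \<epsilon> where e: "\<epsilon> > 0" "\<And>c. c \<in> wball (w i j) \<epsilon> \<Longrightarrow> cmod (c x) \<le> 1"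
      using wball_coordinate[where w = "w i j" and x = x and \<delta> = 1] i[of j] by auto
    have "nbhd0 (proj_lim UNIV (\<lambda>i. wtop top (w i j)))
        (wball (w i j) \<epsilon> \<inter> (\<Inter>i. topspace (wtop top (w i j))))"
      by (rule proj.nbhd0_component) (use nbhd0_wball[OF e(1)] in auto)
    moreover have "wball (w i j) \<epsilon> \<inter> (\<Inter>i. topspace (wtop top (w i j))) \<subseteq> ?V"
      using e(2) unfolding ts proj.topspace by blast
    ultimately show "\<exists>V'. nbhd0 (proj_lim UNIV (\<lambda>i. wtop top (w i j))) V' \<and> V' \<subseteq> ?V" by blast
  qed
  then have "nbhd0 (ind_proj w) ?V" unfolding ind_proj_def by (rule ind_proj.P_nbhd0)
  then show "\<exists>V. nbhd0 (ind_proj w) V \<and> (\<forall>c\<in>V. cmod (c x) \<le> 1)" by blast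
qed

text \<open>Each point of the support has an index \<open>j\<close> with finite weights; as the
  weights decrease in \<open>j\<close>, the maximum over the support serves all of it.\<close>

lemma finitely_supported_wball:
  assumes "c \<in> finitely_supported" shows "\<exists>j. \<forall>i. \<exists>N>0. c \<in> wball (w i j) N"
proof -
  let ?S = "{x. c x \<noteq> 0}"
  have S: "finite ?S" using assms by (simp add: finitely_supported_def)
  obtain J where J: "\<And>x i. w i (J x) x < top" using fin by metis
  define j where "j = Max (insert 0 (J ` ?S))"
  have "J x \<le> j" if "x \<in> ?S" for x unfolding j_def using S that by simp
  then have lt: "w i j x < top" if "x \<in> ?S" for x i
    using le_less_trans[OF dec J] that by blast
  have "\<exists>N>0. c \<in> wball (w i j) N" for i
  proof -
    define N where "N = 1 + (\<Sum>x\<in>?S. cmod (c x) * enn2real (w i j x))"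
    have "ennreal (cmod (c x)) * w i j x \<le> ennreal N" for x
    proof (cases "x \<in> ?S")
      case True
      then have "cmod (c x) * enn2real (w i j x) \<le> N"
        using member_le_sum[of x ?S "\<lambda>x. cmod (c x) * enn2real (w i j x)"] S by (simp add: N_def)
      moreover have "ennreal (cmod (c x)) * w i j x = ennreal (cmod (c x) * enn2real (w i j x))"
        using lt[OF True] by (simp add: ennreal_mult)
      ultimately show ?thesis by (simp add: ennreal_leI)
    qed simp
    moreover have "N > 0" unfolding N_def by (intro add_pos_nonneg sum_nonneg) auto
    ultimately show ?thesis by (auto simp: wball_def)
  qed
  then show ?thesis by blast
qed

lemma finitely_supported_proj_ind: "finitely_supported \<subseteq> topspace (proj_ind w)"
  using finitely_supported_wball unfolding topspace_proj_ind by blast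

lemma finitely_supported_ind_proj: "finitely_supported \<subseteq> topspace (ind_proj w)"
  using finitely_supported_wball unfolding topspace_ind_proj by blast

end

section \<open>Bounded sets and bilinear maps with nonnegative kernel\<close>

lemma tvs_bounded_nbhd0:
  assumes X: "solid_lcs X" and S: "tvs_bounded X S" and V: "nbhd0 X V"
  obtains t :: real where "t > 0" "\<And>c s. c \<in> S \<Longrightarrow> s \<ge> t \<Longrightarrow> (\<lambda>x. c x / complex_of_real s) \<in> V"
proof -
  obtain U where U: "openin X U" "(\<lambda>_. 0) \<in> U" "U \<subseteq> V" using V unfolding nbhd0_def by metis
  then obtain t :: real where t: "t > 0" "\<forall>c\<in>S. (\<lambda>x. c x / complex_of_real t) \<in> U"
    using S unfolding tvs_bounded_def by metis
  show thesis
  proof (rule that[OF t(1)])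
    fix c s assume c: "c \<in> S" "s \<ge> t"
    then have "(\<lambda>x. c x / complex_of_real t) \<in> V" using t(2) U(3) by auto
    then show "(\<lambda>x. c x / complex_of_real s) \<in> V"
      by (rule abs_convex_divide[OF nbhd0_abs_convex[OF V]]) (use t(1) c(2) in auto)
  qed
qed

context weight_grid
begin

text \<open>Regularity of the inductive limit: a set that is bounded in no step violates infinitely many
  pointwise constraints, and the set of families satisfying these constraints is a neighbourhood of
  \<open>0\<close> because the weights decrease along the limit.\<close>

lemma bounded_ind_lim:
  assumes S: "tvs_bounded (ind_lim UNIV (\<lambda>j. wtop top (w i j))) S"
  shows "\<exists>j. \<exists>N>0. S \<subseteq> wball (w i j) N"
proof (rule ccontr)
  assume "\<not> ?thesis"
  then have "\<forall>n. \<exists>c. c \<in> S \<and> c \<notin> wball (w i n) (real (Suc n) ^ 2)" by (auto simp: subset_iff)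
  then obtain c where c: "\<And>n. c n \<in> S" "\<And>n. c n \<notin> wball (w i n) (real (Suc n) ^ 2)" by metis
  then have "\<forall>n. \<exists>x. ennreal (real (Suc n) ^ 2) < ennreal (cmod (c n x)) * w i n x"
    by (auto simp: wball_def not_le)
  then obtain x where x: "\<And>n. ennreal (real (Suc n) ^ 2) < ennreal (cmod (c n (x n))) * w i n (x n)"
    by metis
  \<comment> \<open>The violated radius is the square of \<open>n + 1\<close>. After division by
    \<open>n + 1\<close> the product \<open>r n * w i n (x n)\<close> still exceeds
    \<open>n + 1\<close>, while \<open>c n\<close> divided by \<open>n\<close> exceeds
    \<open>r n\<close> at \<open>x n\<close>.\<close>
  define r where "r n = cmod (c n (x n)) / real (Suc n)" for n
  have wpos: "0 < w i j (x n)" for n j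
  proof -
    have "0 < w i n (x n)"
      using x[of n] by (metis mult_zero_right not_less_zero zero_less_iff_neq_zero)
    then show ?thesis by (rule pos_indep)
  qed
  have cpos: "0 < cmod (c n (x n))" for n
    using x[of n] by (metis ennreal_0 mult_zero_left not_less_zero zero_less_norm_iff norm_eq_zero)
  have rpos: "r n > 0" for n using cpos[of n] by (simp add: r_def)
  let ?X = "\<Union>j. topspace (wtop top (w i j))"
  define V where "V = {d \<in> ?X. \<forall>n. cmod (d (x n)) \<le> r n}"
  have "ind.basic i V"
    unfolding ind.basic_def
  proof (intro conjI ballI)
    show "abs_convex V" "solid V"
      unfolding V_def by (rule abs_convex_coordinate[OF ind.space])+
    show "V \<subseteq> ?X" by (auto simp: V_def)
    fix m
    have "\<forall>n. \<exists>\<epsilon>>0. \<forall>d. d \<in> wball (w i m) \<epsilon> \<longrightarrow> cmod (d (x n)) \<le> r n"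
    proof
      fix n
      show "\<exists>\<epsilon>>0. \<forall>d. d \<in> wball (w i m) \<epsilon> \<longrightarrow> cmod (d (x n)) \<le> r n"
        using wball_coordinate[where w = "w i m" and x = "x n" and \<delta> = "r n"] wpos rpos by metis
    qed
    then obtain \<epsilon> where e: "\<And>n. \<epsilon> n > 0" "\<And>n d. d \<in> wball (w i m) (\<epsilon> n) \<Longrightarrow> cmod (d (x n)) \<le> r n"
      by metis
    \<comment> \<open>For \<open>n < m\<close> the radii are taken from finitely many constraints.
      For \<open>n \<ge> m\<close> the constraint is automatic on the unit ball, since
      \<open>w i m\<close> dominates \<open>w i n\<close>.\<close>
    define \<delta> where "\<delta> = Min (insert 1 (\<epsilon> ` {..<m}))"
    have d: "\<delta> > 0" "\<delta> \<le> 1" unfolding \<delta>_def using e(1) by (auto simp: Min_gr_iff)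
    have d2: "\<delta> \<le> \<epsilon> n" if "n < m" for n unfolding \<delta>_def using that by (intro Min_le) auto
    have "cmod (d (x n)) \<le> r n" if dW: "d \<in> wball (w i m) \<delta>" for d n
    proof (cases "n < m")
      case True
      then show ?thesis using e(2) wball_mono[OF d2] dW by blast
    next
      case False
      show ?thesis
      proof (rule ccontr)
        assume "\<not> ?thesis"
        then have gt: "r n < cmod (d (x n))" by simp
        have "ennreal (real (Suc n) ^ 2) < ennreal (cmod (c n (x n))) * w i n (x n)" by (rule x)
        also have "ennreal (cmod (c n (x n))) = ennreal (real (Suc n)) * ennreal (r n)"
          unfolding r_def by (subst ennreal_mult[symmetric]) (simp_all del: of_nat_Suc)
        also have "\<dots> * w i n (x n) = ennreal (real (Suc n)) * (ennreal (r n) * w i n (x n))"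
          by (rule mult.assoc)
        also have "\<dots> \<le> ennreal (real (Suc n)) * (ennreal (cmod (d (x n))) * w i m (x n))"
          using gt False by (intro mult_mono ennreal_leI dec) auto
        also have "\<dots> \<le> ennreal (real (Suc n)) * ennreal 1"
          using wballD[OF dW, of "x n"] d(2) by (intro mult_left_mono) (auto intro: order_trans ennreal_leI)
        finally have "ennreal (real (Suc n) ^ 2) < ennreal (real (Suc n))" by simp
        then have "real (Suc n) ^ 2 < real (Suc n)" by (subst (asm) ennreal_less_iff) auto
        then show False using self_le_power[of "real (Suc n)" 2] by simp
      qed
    qed
    moreover have "wball (w i m) \<delta> \<subseteq> ?X"
      unfolding topspace_wtop wspace_top using d(1) by blast
    ultimately have "wball (w i m) \<delta> \<subseteq> V" unfolding V_def by blast
    then show "\<exists>V'. nbhd0 (wtop top (w i m)) V' \<and> V' \<subseteq> V" using nbhd0_wball[OF d(1)] by blast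
  qed
  then have "nbhd0 (ind_lim UNIV (\<lambda>j. wtop top (w i j))) V" by (rule ind.P_nbhd0)
  then obtain t :: real where t: "t > 0"
    "\<And>c s. c \<in> S \<Longrightarrow> s \<ge> t \<Longrightarrow> (\<lambda>x. c x / complex_of_real s) \<in> V"
    using tvs_bounded_nbhd0[OF ind.ind_lcs S] by metis
  obtain n :: nat where n: "t \<le> real n" using real_arch_simple by blast
  have "(\<lambda>x. c n x / complex_of_real (real n)) \<in> V" using t(2)[OF c(1) n] .
  then have "cmod (c n (x n)) / real n \<le> r n" by (simp add: V_def norm_divide)
  moreover have "real n > 0" using n t(1) by simp
  ultimately show False using cpos[of n] by (simp add: r_def field_simps)
qed

text \<open>By regularity the set is bounded in one step \<open>J i\<close> for every
  \<open>i\<close>. The pointwise supremum obeys the same bounds, so it lies in the space.\<close>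

lemma proj_ind_bounded:
  assumes S: "tvs_bounded (proj_ind w) S"
  shows "\<exists>f\<in>topspace (proj_ind w). \<forall>c\<in>S. dominated c f"
proof -
  have "\<exists>j. \<exists>N>0. S \<subseteq> wball (w i j) N" for i
  proof (rule bounded_ind_lim)
    let ?Y = "ind_lim UNIV (\<lambda>j. wtop top (w i j))"
    have cont: "continuous_map (proj_ind w) ?Y (\<lambda>c. c)"
      unfolding proj_ind_def by (rule continuous_map_proj_lim[where T = "\<lambda>i. ind_lim UNIV (\<lambda>j. wtop top (w i j))"]) simp
    then have sub: "topspace (proj_ind w) \<subseteq> topspace ?Y"
      by (auto simp: continuous_map_def)
    show "tvs_bounded ?Y S"
      unfolding tvs_bounded_def
    proof (intro conjI allI impI)
      show "S \<subseteq> topspace ?Y" using S sub unfolding tvs_bounded_def by blast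
      fix U assume U: "openin ?Y U \<and> (\<lambda>_. 0) \<in> U"
      let ?U = "{c \<in> topspace (proj_ind w). c \<in> U}"
      have "openin (proj_ind w) ?U" using cont U by (auto simp: continuous_map_def)
      moreover have "(\<lambda>_. 0) \<in> ?U"
        using U solid_space_zero[OF solid_lcs.space[OF proj_ind_lcs]] by simp
      ultimately have "\<exists>t>0. \<forall>c\<in>S. (\<lambda>x. c x / complex_of_real t) \<in> ?U"
        using S[unfolded tvs_bounded_def, THEN conjunct2, rule_format, of ?U] by simp
      then show "\<exists>t>0. \<forall>c\<in>S. (\<lambda>x. c x / complex_of_real t) \<in> U" by auto
    qed
  qed
  then obtain J where J: "\<And>i. \<exists>N>0. S \<subseteq> wball (w i (J i)) N" by metis
  obtain f where f: "\<And>c. c \<in> S \<Longrightarrow> dominated c f"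
    "\<And>v N. v \<in> range (\<lambda>i. w i (J i)) \<Longrightarrow> S \<subseteq> wball v N \<Longrightarrow> f \<in> wball v N"
  proof (rule wball_Sup[of "range (\<lambda>i. w i (J i))" S])
    show "\<exists>w\<in>range (\<lambda>i. w i (J i)). 0 < w x" for x using pos[of x] by auto
    show "\<exists>N>0. S \<subseteq> wball v N" if "v \<in> range (\<lambda>i. w i (J i))" for v using J that by blast
  qed metis
  have "f \<in> topspace (proj_ind w)" unfolding topspace_proj_ind using J f(2) by blast
  then show ?thesis using f(1) by blast
qed

text \<open>\<open>U n\<close> is the unit ball of the \<open>n\<close>-th weight. Since the weights
  increase, for fixed \<open>i\<close> all members with \<open>n \<ge> i\<close> lie in the unit
  ball of weight \<open>i\<close>, and the finitely many others each have finite norm; so the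
  supremum of the sequence belongs to the step.\<close>

lemma proj_dominating:
  "\<exists>U. (\<forall>n::nat. nbhd0 (proj_lim UNIV (\<lambda>i. wtop top (w i j))) (U n)) \<and>
     (\<forall>e. (\<forall>n. e n \<in> U n) \<longrightarrow>
        (\<exists>f\<in>topspace (proj_lim UNIV (\<lambda>i. wtop top (w i j))). \<forall>n. dominated (e n) f))"
proof -
  define L where "L = (\<Inter>i. topspace (wtop top (w i j)))"
  define U where "U n = wball (w n j) 1 \<inter> L" for n
  have "nbhd0 (proj_lim UNIV (\<lambda>i. wtop top (w i j))) (U n)" for n
    unfolding U_def L_def by (rule proj.nbhd0_component[where i = n]) (simp_all add: nbhd0_wball)
  moreover have "\<exists>f\<in>topspace (proj_lim UNIV (\<lambda>i. wtop top (w i j))). \<forall>n. dominated (e n) f"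
    if e: "\<And>n. e n \<in> U n" for e
  proof -
    have bd: "\<exists>N>0. range e \<subseteq> wball (w i j) N" for i
    proof -
      have "\<forall>n. \<exists>N>0. e n \<in> wball (w i j) N"
        using e unfolding U_def L_def topspace_wtop wspace_top_iff[symmetric] by blast
      then obtain N where N: "\<And>n. N n > 0" "\<And>n. e n \<in> wball (w i j) (N n)" by metis
      define M where "M = Max (insert 1 (N ` {..<i}))"
      have "e n \<in> wball (w i j) M" for n
      proof (cases "n < i")
        case True
        then have "N n \<le> M" unfolding M_def by (intro Max_ge) auto
        then show ?thesis using N(2) wball_mono by blast
      next
        case False
        have "e n \<in> wball (w i j) 1"
          using e[of n] False wball_antimono[of "w i j" "w n j" 1] inc[of i n j] unfolding U_def by auto
        moreover have "1 \<le> M" unfolding M_def by (intro Max_ge) auto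
        ultimately show ?thesis using wball_mono by blast
      qed
      moreover have "M > 0"
      proof -
        have "1 \<le> M" unfolding M_def by (intro Max_ge) auto
        then show ?thesis by simp
      qed
      ultimately show ?thesis by blast
    qed
    obtain f where f: "\<And>c. c \<in> range e \<Longrightarrow> dominated c f"
      "\<And>v N. v \<in> range (\<lambda>i. w i j) \<Longrightarrow> range e \<subseteq> wball v N \<Longrightarrow> f \<in> wball v N"
    proof (rule wball_Sup[of "range (\<lambda>i. w i j)" "range e"])
      show "\<exists>w\<in>range (\<lambda>i. w i j). 0 < w x" for x using pos[of x] by auto
      show "\<exists>N>0. range e \<subseteq> wball v N" if "v \<in> range (\<lambda>i. w i j)" for v using bd that by blast
    qed metis
    have "f \<in> topspace (proj_lim UNIV (\<lambda>i. wtop top (w i j)))"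
      unfolding proj.topspace topspace_wtop using bd f(2) wspace_top_iff by fast
    then show ?thesis using f(1) by blast
  qed
  ultimately show ?thesis by blast
qed

end

section \<open>Bilinear maps with a nonnegative kernel\<close>

locale positive_kernel =
  fixes k :: "'z \<Rightarrow> 't \<Rightarrow> real" and X :: "'z \<Rightarrow> 't \<Rightarrow> 'x" and Y :: "'z \<Rightarrow> 't \<Rightarrow> 'y"
  assumes k_nonneg: "0 \<le> k z t"
begin

definition prod :: "('x \<Rightarrow> complex) \<Rightarrow> ('y \<Rightarrow> complex) \<Rightarrow> 'z \<Rightarrow> complex" where
  "prod c d z = (\<Sum>\<^sub>\<infinity>t. complex_of_real (k z t) * (c (X z t) * d (Y z t)))"

definition pairable_at :: "('x \<Rightarrow> complex) \<Rightarrow> ('y \<Rightarrow> complex) \<Rightarrow> 'z \<Rightarrow> bool" where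
  "pairable_at c d z \<longleftrightarrow> (\<lambda>t. k z t * (cmod (c (X z t)) * cmod (d (Y z t)))) summable_on UNIV"

text \<open>The largest elements of the unit balls are the inverses of \<open>w1\<close> and
  \<open>w2\<close>; their product must be bounded by the inverse of \<open>w3\<close>. Finite
  partial sums keep the statement meaningful before convergence is known.\<close>

definition est :: "('x \<Rightarrow> ennreal) \<Rightarrow> ('y \<Rightarrow> ennreal) \<Rightarrow> ('z \<Rightarrow> ennreal) \<Rightarrow> bool" where
  "est w1 w2 w3 \<longleftrightarrow> (\<exists>C\<ge>0. \<forall>z F. finite F \<longrightarrow>
     w3 z * (\<Sum>t\<in>F. ennreal (k z t) * (inverse (w1 (X z t)) * inverse (w2 (Y z t)))) \<le> ennreal C)"

lemma pairable_abs:
  "pairable_at c d z \<longleftrightarrow> (\<lambda>t. cmod (complex_of_real (k z t) * (c (X z t) * d (Y z t)))) summable_on UNIV"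
  by (simp add: pairable_at_def norm_mult k_nonneg)

lemma pairable_dominated:
  assumes "pairable_at c d z" "dominated c' c" "dominated d' d"
  shows "pairable_at c' d' z"
  unfolding pairable_at_def
  by (rule summable_on_comparison_test[OF assms(1)[unfolded pairable_at_def]])
    (use assms(2,3) k_nonneg in \<open>auto simp: dominated_def intro!: mult_left_mono mult_mono\<close>)

text \<open>Nonnegativity of the kernel makes the product of the moduli the largest one. Pairability
  is essential, because a divergent infinite sum has the value 0 and would dominate nothing.\<close>

lemma prod_dominated:
  assumes "\<And>z. pairable_at c d z" "dominated c' c" "dominated d' d"
  shows "dominated (prod c' d') (prod (\<lambda>x. complex_of_real (cmod (c x))) (\<lambda>x. complex_of_real (cmod (d x))))"
  unfolding dominated_def
proof
  fix z
  let ?g = "\<lambda>t. k z t * (cmod (c (X z t)) * cmod (d (Y z t)))"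
  have g: "?g summable_on UNIV" using assms(1) by (simp add: pairable_at_def)
  have g': "(\<lambda>t. k z t * (cmod (c' (X z t)) * cmod (d' (Y z t)))) summable_on UNIV"
    using pairable_dominated[OF assms(1-3)] by (simp add: pairable_at_def)
  have "cmod (prod c' d' z) \<le> infsum (\<lambda>t. cmod (complex_of_real (k z t) * (c' (X z t) * d' (Y z t)))) UNIV"
    unfolding prod_def by (rule norm_infsum_bound)
      (use g' in \<open>simp add: norm_mult k_nonneg\<close>)
  also have "\<dots> \<le> infsum ?g UNIV"
    using g g' assms(2,3) k_nonneg
    by (intro infsum_mono) (auto simp: norm_mult dominated_def intro!: mult_left_mono mult_mono)
  also have "\<dots> = cmod (complex_of_real (infsum ?g UNIV))"
    using k_nonneg by (simp add: infsum_nonneg)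
  also have "complex_of_real (infsum ?g UNIV) =
      prod (\<lambda>x. complex_of_real (cmod (c x))) (\<lambda>x. complex_of_real (cmod (d x))) z"
    unfolding prod_def infsumI[OF has_sum_of_real[OF has_sum_infsum[OF g]], symmetric] by simp
  finally show "cmod (prod c' d' z) \<le>
      cmod (prod (\<lambda>x. complex_of_real (cmod (c x))) (\<lambda>x. complex_of_real (cmod (d x))) z)" .
qed

lemma prod_linear_right:
  assumes "\<And>z. pairable_at c d z" "\<And>z. pairable_at c d' z"
  shows "prod c (\<lambda>x. a * d x + b * d' x) = (\<lambda>z. a * prod c d z + b * prod c d' z)"
proof
  fix z
  let ?f = "\<lambda>d t. complex_of_real (k z t) * (c (X z t) * d (Y z t))"
  have s: "?f d summable_on UNIV" "?f d' summable_on UNIV"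
    using assms unfolding pairable_abs by (auto intro: abs_summable_summable)
  have "prod c (\<lambda>x. a * d x + b * d' x) z = infsum (\<lambda>t. a * ?f d t + b * ?f d' t) UNIV"
    unfolding prod_def by (simp add: algebra_simps)
  also have "\<dots> = infsum (\<lambda>t. a * ?f d t) UNIV + infsum (\<lambda>t. b * ?f d' t) UNIV"
    using s by (intro infsum_add summable_on_cmult_right) auto
  also have "\<dots> = a * prod c d z + b * prod c d' z"
    unfolding prod_def using s by (simp add: infsum_cmult_right)
  finally show "prod c (\<lambda>x. a * d x + b * d' x) z = a * prod c d z + b * prod c d' z" .
qed

text \<open>Insert the bounds \<open>N / w1\<close> and \<open>M / w2\<close> for the factors into
  the finite sums, then pass to the supremum over finite sets. Where \<open>w3\<close> vanishes the
  estimate carries no information on convergence.\<close>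

lemma est_bound:
  assumes C: "C \<ge> 0" "\<And>z F. finite F \<Longrightarrow>
      w3 z * (\<Sum>t\<in>F. ennreal (k z t) * (inverse (w1 (X z t)) * inverse (w2 (Y z t)))) \<le> ennreal C"
    and c: "c \<in> wball w1 N" "N > 0" and d: "d \<in> wball w2 M" "M > 0"
  shows "0 < w3 z \<Longrightarrow> pairable_at c d z" and "prod c d \<in> wball w3 (C * M * N)"
proof -
  \<comment> \<open>A zero weight makes the right side infinite because \<open>K > 0\<close>; an
    infinite weight forces \<open>u x = 0\<close>.\<close>
  have inv: "ennreal (cmod (u x)) \<le> ennreal K * inverse (v x)" if "u \<in> wball v K" "K > 0" for u :: "'q \<Rightarrow> complex" and v K x
  proof (cases "v x = 0 \<or> v x = top")
    case True
    then show ?thesis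
    proof
      assume "v x = 0"
      then show ?thesis using that(2) by (simp add: ennreal_mult_top)
    next
      assume t: "v x = top"
      have "ennreal (cmod (u x)) * top \<le> ennreal K" using wballD[OF that(1), of x] t by simp
      then have "u x = 0" by (auto simp: ennreal_mult_top top_unique split: if_splits)
      then show ?thesis by simp
    qed
  next
    case False
    then obtain r where r: "v x = ennreal r" "r > 0"
      by (cases "v x") (auto simp: less_le)
    have "cmod (u x) * r \<le> K"
      using wballD[OF that(1), of x] r that(2) by (simp add: ennreal_mult[symmetric])
    then have "cmod (u x) \<le> K * inverse r" using r by (simp add: field_simps)
    then have "ennreal (cmod (u x)) \<le> ennreal (K * inverse r)" by (rule ennreal_leI)
    then show ?thesis using r that(2) by (simp add: ennreal_mult inverse_ennreal)
  qed
  let ?g = "\<lambda>z t. k z t * (cmod (c (X z t)) * cmod (d (Y z t)))"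
  have fin: "w3 z * ennreal (sum (?g z) F) \<le> ennreal (C * M * N)" if "finite F" for z F
  proof -
    have "ennreal (sum (?g z) F) = (\<Sum>t\<in>F. ennreal (k z t) * (ennreal (cmod (c (X z t))) * ennreal (cmod (d (Y z t)))))"
      using k_nonneg by (simp add: sum_ennreal[symmetric] ennreal_mult del: sum_ennreal)
    also have "\<dots> \<le> (\<Sum>t\<in>F. ennreal (k z t) *
        ((ennreal N * inverse (w1 (X z t))) * (ennreal M * inverse (w2 (Y z t)))))"
      by (intro sum_mono mult_left_mono mult_mono inv c d) auto
    also have "\<dots> = ennreal (M * N) * (\<Sum>t\<in>F. ennreal (k z t) * (inverse (w1 (X z t)) * inverse (w2 (Y z t))))"
      using c d by (simp add: sum_distrib_left ennreal_mult mult_ac)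
    finally have "w3 z * ennreal (sum (?g z) F) \<le> w3 z * \<dots>" by (rule mult_left_mono) simp
    also have "\<dots> = ennreal (M * N) * (w3 z * (\<Sum>t\<in>F. ennreal (k z t) * (inverse (w1 (X z t)) * inverse (w2 (Y z t)))))"
      by (simp add: mult_ac)
    also have "\<dots> \<le> ennreal (M * N) * ennreal C" by (intro mult_left_mono C that) simp
    also have "\<dots> = ennreal (C * M * N)" using C c d by (simp add: ennreal_mult[symmetric] mult_ac)
    finally show ?thesis .
  qed
  have K: "C * M * N \<ge> 0" using C c d by simp
  have summ: "pairable_at c d z" if w3: "0 < w3 z" for z
  proof -
    obtain v where v: "v > 0" "ennreal v \<le> w3 z" using ennreal_pos_lower_bound[OF w3] .
    have "sum (?g z) F \<le> C * M * N / v" if F: "finite F" for F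
    proof -
      have g0: "sum (?g z) F \<ge> 0" using k_nonneg by (intro sum_nonneg) auto
      have "ennreal (v * sum (?g z) F) = ennreal v * ennreal (sum (?g z) F)" using v g0 by (simp add: ennreal_mult)
      also have "\<dots> \<le> w3 z * ennreal (sum (?g z) F)" by (intro mult_right_mono v) simp
      also have "\<dots> \<le> ennreal (C * M * N)" by (rule fin[OF F])
      finally have "v * sum (?g z) F \<le> C * M * N" using K by simp
      then show ?thesis using v by (simp add: field_simps)
    qed
    then show ?thesis
      unfolding pairable_at_def using k_nonneg
      by (intro nonneg_bdd_above_summable_on bdd_aboveI[of _ "C * M * N / v"]) auto
  qed
  then show "0 < w3 z \<Longrightarrow> pairable_at c d z" .
  have "ennreal (cmod (prod c d z)) * w3 z \<le> ennreal (C * M * N)" for z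
  proof (cases "w3 z = 0")
    case False
    then have g: "?g z summable_on UNIV" using summ[of z] by (simp add: zero_less_iff_neq_zero pairable_at_def)
    have "cmod (prod c d z) \<le> infsum (\<lambda>t. cmod (complex_of_real (k z t) * (c (X z t) * d (Y z t)))) UNIV"
      unfolding prod_def by (rule norm_infsum_bound) (use g in \<open>simp add: norm_mult k_nonneg\<close>)
    also have "\<dots> = infsum (?g z) UNIV" by (simp add: norm_mult k_nonneg)
    finally have "ennreal (cmod (prod c d z)) \<le> ennreal (infsum (?g z) UNIV)" by (rule ennreal_leI)
    also have "\<dots> = (SUP F\<in>{F. finite F \<and> F \<subseteq> UNIV}. ennreal (sum (?g z) F))"
      by (rule infsum_nonneg_is_SUPREMUM_ennreal[OF g]) (simp add: k_nonneg)
    finally have "w3 z * ennreal (cmod (prod c d z)) \<le> w3 z * \<dots>" by (rule mult_left_mono) simp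
    also have "\<dots> = (SUP F\<in>{F. finite F \<and> F \<subseteq> UNIV}. w3 z * ennreal (sum (?g z) F))"
      by (rule SUP_mult_left_ennreal)
    also have "\<dots> \<le> ennreal (C * M * N)" by (rule SUP_least) (use fin in auto)
    finally show ?thesis by (simp add: mult.commute)
  qed simp
  then show "prod c d \<in> wball w3 (C * M * N)" by (simp add: wball_def)
qed

lemma est_wball:
  assumes "est w1 w2 w3" "c \<in> wball w1 N" "N > 0"
  obtains C where "\<And>d M. M > 0 \<Longrightarrow> d \<in> wball w2 M \<Longrightarrow> prod c d \<in> wball w3 (C * M)"
proof -
  obtain C where C: "C \<ge> 0" "\<And>z F. finite F \<Longrightarrow>
      w3 z * (\<Sum>t\<in>F. ennreal (k z t) * (inverse (w1 (X z t)) * inverse (w2 (Y z t)))) \<le> ennreal C"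
    using assms(1) unfolding est_def by metis
  show thesis
    using est_bound(2)[of C w3 w1 w2, OF C assms(2,3)] by (intro that[of "C * N"]) (auto simp: mult_ac)
qed

lemma est_pairable:
  assumes "est w1 w2 w3" "c \<in> wball w1 N" "N > 0" "d \<in> wball w2 M" "M > 0" "0 < w3 z"
  shows "pairable_at c d z"
proof -
  obtain C where C: "C \<ge> 0" "\<And>z F. finite F \<Longrightarrow>
      w3 z * (\<Sum>t\<in>F. ennreal (k z t) * (inverse (w1 (X z t)) * inverse (w2 (Y z t)))) \<le> ennreal C"
    using assms(1) unfolding est_def by metis
  show ?thesis by (rule est_bound(1)[of C w3 w1 w2, OF C assms(2-6)])
qed

end

text \<open>Exchanging the index maps exchanges the factors, so every result on the right factor has
  its counterpart on the left.\<close>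

lemma positive_kernel_swap:
  assumes "positive_kernel k"
  shows "positive_kernel.prod k Y X d c = positive_kernel.prod k X Y c d"
    and "positive_kernel.pairable_at k Y X d c z = positive_kernel.pairable_at k X Y c d z"
    and "positive_kernel.est k Y X w2 w1 w3 = positive_kernel.est k X Y w1 w2 w3"
  by (simp_all add: fun_eq_iff positive_kernel.prod_def[OF assms] positive_kernel.pairable_at_def[OF assms]
      positive_kernel.est_def[OF assms] mult.commute)

lemma nbhd0_finite_INT:
  assumes "solid_lcs X" "finite F" "\<And>i. i \<in> F \<Longrightarrow> nbhd0 X (V i)"
  shows "nbhd0 X (topspace X \<inter> (\<Inter>i\<in>F. V i))"
  using assms(2,3)
proof (induction F)
  case empty
  then show ?case using solid_lcs.nbhd0_topspace[OF assms(1)] by simp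
next
  case (insert i F)
  have "nbhd0 X (V i)" "nbhd0 X (topspace X \<inter> (\<Inter>i\<in>F. V i))" using insert by auto
  from nbhd0_Int[OF this] show ?case by (simp add: Int_left_commute)
qed

abbreviation cabs :: "('x \<Rightarrow> complex) \<Rightarrow> 'x \<Rightarrow> complex" where
  "cabs c \<equiv> (\<lambda>x. complex_of_real (cmod (c x)))"

lemma cabs_solid: "solid V \<Longrightarrow> c \<in> V \<Longrightarrow> cabs c \<in> V"
  using solidD[of V c "cabs c"] by simp

locale kernel_pair = positive_kernel k X Y
  for k :: "'z \<Rightarrow> 't \<Rightarrow> real" and X :: "'z \<Rightarrow> 't \<Rightarrow> 'x" and Y :: "'z \<Rightarrow> 't \<Rightarrow> 'y" +
  fixes E :: "('x \<Rightarrow> complex) topology" and F :: "('y \<Rightarrow> complex) topology"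
  assumes E: "solid_lcs E" and F: "solid_lcs F"
    and pairable: "c \<in> topspace E \<Longrightarrow> d \<in> topspace F \<Longrightarrow> pairable_at c d z"
begin

lemma swap: "kernel_pair k Y X F E"
  using E F pairable
  by (auto simp: kernel_pair_def kernel_pair_axioms_def positive_kernel_axioms
      positive_kernel_swap(2)[OF positive_kernel_axioms, where X = X and Y = Y])

lemma prod_swap: "positive_kernel.prod k Y X d = (\<lambda>c. prod c d)"
  by (rule ext) (rule positive_kernel_swap(1)[OF positive_kernel_axioms])

lemma linear_right: "c \<in> topspace E \<Longrightarrow> linear_on_space (topspace F) (prod c)"
  unfolding linear_on_space_def using prod_linear_right pairable by blast

lemma linear_left: "d \<in> topspace F \<Longrightarrow> linear_on_space (topspace E) (\<lambda>c. prod c d)"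
  using kernel_pair.linear_right[OF swap, of d] by (simp add: prod_swap)

lemma dominated_prod:
  assumes "c \<in> topspace E" "d \<in> topspace F" "dominated c' c" "dominated d' d"
  shows "dominated (prod c' d') (prod (cabs c) (cabs d))"
  using assms pairable by (intro prod_dominated) auto

text \<open>A polar relative to the bilinear map, tested on moduli so that it is solid whenever
  \<open>W\<close> is.\<close>

definition polar :: "('x \<Rightarrow> complex) set \<Rightarrow> ('z \<Rightarrow> complex) set \<Rightarrow> ('y \<Rightarrow> complex) set" where
  "polar S W = {d \<in> topspace F. \<forall>c\<in>S. prod (cabs c) (cabs d) \<in> W}"

text \<open>Convexity is not inherited directly through the moduli. The combination is dominated by
  \<open>h\<close>, the sum of the moduli of its two terms, and the product with \<open>h\<close> is
  an absolutely convex combination of elements of \<open>W\<close>.\<close>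

lemma polar_abs_convex:
  assumes S: "S \<subseteq> topspace E" and W: "abs_convex W" "solid W"
  shows "abs_convex (polar S W)"
  unfolding abs_convex_def
proof (intro ballI allI impI)
  fix d d' a b assume d: "d \<in> polar S W" "d' \<in> polar S W" and ab: "cmod a + cmod b \<le> 1"
  note sF = solid_lcs.space[OF F]
  have dF: "d \<in> topspace F" "d' \<in> topspace F" using d by (auto simp: polar_def)
  define h where "h x = complex_of_real (cmod a) * cabs d x + complex_of_real (cmod b) * cabs d' x" for x
  have hF: "h \<in> topspace F"
    unfolding h_def using dF by (intro solid_space_lin[OF sF] cabs_solid[OF solid_space_solid[OF sF]])
  have h_real: "h x = complex_of_real (cmod a * cmod (d x) + cmod b * cmod (d' x))" for x
    by (simp add: h_def)
  have habs: "cabs h = h"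
    unfolding h_real by (auto simp only: norm_of_real) (simp add: abs_of_nonneg)
  have dom: "dominated (\<lambda>x. a * d x + b * d' x) h"
    unfolding dominated_def
  proof
    fix x
    have "cmod (a * d x + b * d' x) \<le> cmod a * cmod (d x) + cmod b * cmod (d' x)"
      by (metis norm_mult norm_triangle_ineq)
    also have "\<dots> = cmod (h x)" unfolding h_real norm_of_real by (simp add: abs_of_nonneg)
    finally show "cmod (a * d x + b * d' x) \<le> cmod (h x)" .
  qed
  have "prod (cabs c) (cabs (\<lambda>x. a * d x + b * d' x)) \<in> W" if c: "c \<in> S" for c
  proof -
    have cE: "c \<in> topspace E" using c S by blast
    then have cE': "cabs c \<in> topspace E" by (rule cabs_solid[OF solid_space_solid[OF solid_lcs.space[OF E]]])
    have dE': "cabs d \<in> topspace F" "cabs d' \<in> topspace F"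
      using dF cabs_solid[OF solid_space_solid[OF sF]] by auto
    have "prod (cabs c) h = (\<lambda>z. complex_of_real (cmod a) * prod (cabs c) (cabs d) z +
        complex_of_real (cmod b) * prod (cabs c) (cabs d') z)"
      unfolding h_def by (rule linear_on_spaceD[OF linear_right[OF cE'] dE'])
    also have "\<dots> \<in> W"
      using d c ab by (intro abs_convexD[OF W(1)]) (auto simp: polar_def)
    finally have "prod (cabs c) h \<in> W" .
    moreover have "dominated (prod (cabs c) (cabs (\<lambda>x. a * d x + b * d' x))) (prod (cabs c) (cabs h))"
      using dominated_prod[OF cE hF, of "cabs c" "cabs (\<lambda>x. a * d x + b * d' x)"] dom by simp
    ultimately show ?thesis using solidD[OF W(2)] habs by simp
  qed
  then show "(\<lambda>x. a * d x + b * d' x) \<in> polar S W"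
    unfolding polar_def using solid_space_lin[OF sF] dF by blast
qed

lemma polar_solid:
  assumes S: "S \<subseteq> topspace E" and W: "solid W"
  shows "solid (polar S W)"
  unfolding solid_def
proof (intro ballI allI impI)
  fix d d' assume d: "d \<in> polar S W" and dom: "dominated d' d"
  then have dF: "d \<in> topspace F" by (auto simp: polar_def)
  have "prod (cabs c) (cabs d') \<in> W" if c: "c \<in> S" for c
  proof -
    have "dominated (prod (cabs c) (cabs d')) (prod (cabs c) (cabs d))"
      using dominated_prod[OF _ dF, of c "cabs c" "cabs d'"] S c dom by auto
    then show ?thesis using solidD[OF W] d c by (auto simp: polar_def)
  qed
  then show "d' \<in> polar S W"
    using dF solidD[OF solid_space_solid[OF solid_lcs.space[OF F]] _ dom] by (auto simp: polar_def)
qed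

lemma polarD:
  assumes W: "solid W" and S: "S \<subseteq> topspace E" and c: "c \<in> S" and d: "d \<in> polar S W"
  shows "prod c d \<in> W"
proof -
  have "prod (cabs c) (cabs d) \<in> W" using c d by (auto simp: polar_def)
  moreover have "dominated (prod c d) (prod (cabs c) (cabs d))"
    using c d S by (intro dominated_prod) (auto simp: polar_def)
  ultimately show ?thesis by (rule solidD[OF W])
qed

section \<open>Equicontinuity over bounded sets\<close>

definition equicontinuous_right :: "('z \<Rightarrow> complex) topology \<Rightarrow> bool" where
  "equicontinuous_right G \<longleftrightarrow> (\<forall>S W. tvs_bounded E S \<longrightarrow> nbhd0 G W \<longrightarrow>
     (\<exists>V. nbhd0 F V \<and> (\<forall>c\<in>S. \<forall>d\<in>V. prod c d \<in> W)))"

text \<open>If \<open>f\<close> dominates \<open>S\<close>, the product with the modulus of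
  \<open>f\<close> dominates all products with members of \<open>S\<close>; a neighbourhood chosen
  for this single element works for the whole set.\<close>

lemma equicontinuous_right_order_bounded:
  assumes ob: "\<And>S. tvs_bounded E S \<Longrightarrow> \<exists>f\<in>topspace E. \<forall>c\<in>S. dominated c f"
    and cont: "\<And>c. c \<in> topspace E \<Longrightarrow> cont0 (topspace F) F G (prod c)"
  shows "equicontinuous_right G"
  unfolding equicontinuous_right_def
proof (intro allI impI)
  fix S W assume S: "tvs_bounded E S" and W: "nbhd0 G W"
  obtain f where f: "f \<in> topspace E" "\<And>c. c \<in> S \<Longrightarrow> dominated c f" using ob[OF S] by blast
  have "cabs f \<in> topspace E" by (rule cabs_solid[OF solid_space_solid[OF solid_lcs.space[OF E]] f(1)])
  then obtain V where V: "nbhd0 F V" "\<And>d. d \<in> V \<Longrightarrow> d \<in> topspace F \<Longrightarrow> prod (cabs f) d \<in> W"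
    using cont W unfolding cont0_def by blast
  have "prod c d \<in> W" if "c \<in> S" "d \<in> V" for c d
  proof -
    have d: "d \<in> topspace F" "cabs d \<in> V"
      using that(2) nbhd0_subset[OF V(1)] cabs_solid[OF nbhd0_solid[OF V(1)]] by auto
    then have "prod (cabs f) (cabs d) \<in> W" using V nbhd0_subset by blast
    then show ?thesis
      using solidD[OF nbhd0_solid[OF W] _ dominated_prod[OF f(1) d(1) f(2)[OF that(1)] dominated_refl]] by simp
  qed
  then show "\<exists>V. nbhd0 F V \<and> (\<forall>c\<in>S. \<forall>d\<in>V. prod c d \<in> W)" using V(1) by blast
qed

text \<open>The spaces \<open>ind_proj w\<close> are in general not regular, so a bounded set need not be bounded in a
  step. Instead of Baire's theorem, the barrel argument uses that a sequence drawn from suitable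
  neighbourhoods of a step is dominated by a single element of that step.\<close>

lemma equicontinuous_right_ind_proj:
  assumes w: "weight_grid w" and Fw: "F = ind_proj w" and G: "solid_lcs G"
    and cont: "\<And>d. d \<in> topspace F \<Longrightarrow> cont0 (topspace E) E G (\<lambda>c. prod c d)"
  shows "equicontinuous_right G"
  unfolding equicontinuous_right_def
proof (intro allI impI)
  fix S W assume S: "tvs_bounded E S" and W: "nbhd0 G W"
  interpret w: weight_grid w by (rule w)
  have SE: "S \<subseteq> topspace E" using S by (simp add: tvs_bounded_def)
  let ?T = "\<lambda>j. proj_lim UNIV (\<lambda>i. wtop top (w i j))"
  have ts: "topspace F = (\<Union>j. topspace (?T j))"
    unfolding Fw ind_proj_def w.ind_proj.topspace ..
  have step: "\<exists>V'. nbhd0 (?T j) V' \<and> V' \<subseteq> polar S W" for j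
  proof (rule ccontr)
    assume neg: "\<not> ?thesis"
    obtain U where U: "\<And>n::nat. nbhd0 (?T j) (U n)"
      "\<And>e. (\<And>n. e n \<in> U n) \<Longrightarrow> \<exists>f\<in>topspace (?T j). \<forall>n. dominated (e n) f"
      using w.proj_dominating[of j] by metis
    \<comment> \<open>Scaling by \<open>n + 1\<close> makes the dominating element \<open>f\<close>
      satisfy the stronger bound that \<open>e n\<close> is dominated by
      \<open>f / (n + 1)\<close>.\<close>
    have "\<forall>n. \<exists>e. (\<lambda>x. complex_of_real (real (Suc n)) * e x) \<in> U n \<and> e \<in> topspace (?T j) \<and> e \<notin> polar S W"
    proof
      fix n
      have "nbhd0 (?T j) {e. (\<lambda>x. complex_of_real (real (Suc n)) * e x) \<in> U n}"
        by (rule solid_lcs.nbhd0_scale[OF w.proj.proj_lcs U(1)]) simp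
      with neg nbhd0_subset[OF this]
      show "\<exists>e. (\<lambda>x. complex_of_real (real (Suc n)) * e x) \<in> U n \<and> e \<in> topspace (?T j) \<and> e \<notin> polar S W"
        by blast
    qed
    then obtain e where e: "\<And>n. (\<lambda>x. complex_of_real (real (Suc n)) * e n x) \<in> U n"
      "\<And>n. e n \<in> topspace (?T j)" "\<And>n. e n \<notin> polar S W" by metis
    obtain f where f: "f \<in> topspace (?T j)" "\<And>n. dominated (\<lambda>x. complex_of_real (real (Suc n)) * e n x) f"
      using U(2)[of "\<lambda>n x. complex_of_real (real (Suc n)) * e n x"] e(1) by metis
    have fF: "f \<in> topspace F" and eF: "e n \<in> topspace F" for n using f e(2) ts by auto
    have "\<exists>c\<in>S. prod (cabs c) (cabs (e n)) \<notin> W" for n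
      using e(3)[of n] eF by (auto simp: polar_def)
    then obtain c where c: "\<And>n. c n \<in> S" "\<And>n. prod (cabs (c n)) (cabs (e n)) \<notin> W" by metis
    have afF: "cabs f \<in> topspace F"
      by (rule cabs_solid[OF solid_space_solid[OF solid_lcs.space[OF F]] fF])
    obtain V where V: "nbhd0 E V" "\<And>c. c \<in> V \<Longrightarrow> c \<in> topspace E \<Longrightarrow> prod c (cabs f) \<in> W"
      using cont[OF afF] W unfolding cont0_def by blast
    obtain t :: real where t: "t > 0" "\<And>c s. c \<in> S \<Longrightarrow> s \<ge> t \<Longrightarrow> (\<lambda>x. c x / complex_of_real s) \<in> V"
      using tvs_bounded_nbhd0[OF E S V(1)] by metis
    obtain n :: nat where n: "t \<le> real n" using real_arch_simple by blast
    define s where "s = real (Suc n)"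
    have s: "t \<le> s" "s > 0" using n by (auto simp: s_def)
    have cE: "c n \<in> topspace E" using c SE by blast
    have acE: "cabs (c n) \<in> topspace E"
      by (rule cabs_solid[OF solid_space_solid[OF solid_lcs.space[OF E]] cE])
    have "(\<lambda>x. c n x / complex_of_real s) \<in> V" by (rule t(2)[OF c(1) s(1)])
    then have "(\<lambda>x. cabs (c n) x / complex_of_real s) \<in> V"
      by (rule solidD[OF nbhd0_solid[OF V(1)]]) (simp add: dominated_def norm_divide)
    then have "prod (\<lambda>x. cabs (c n) x / complex_of_real s) (cabs f) \<in> W"
      using V nbhd0_subset by blast
    \<comment> \<open>The factor \<open>1 / s\<close> needed to bring the bounded set into
      \<open>V\<close> is moved by bilinearity to the other side, where \<open>f / s\<close>
      dominates \<open>e n\<close>.\<close>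
    also have "prod (\<lambda>x. cabs (c n) x / complex_of_real s) (cabs f) =
        (\<lambda>z. prod (cabs (c n)) (cabs f) z / complex_of_real s)"
      by (rule linear_on_space_divide[OF linear_left[OF afF] acE])
    also have "\<dots> = prod (cabs (c n)) (\<lambda>x. cabs f x / complex_of_real s)"
      by (rule linear_on_space_divide[OF linear_right[OF acE] afF, symmetric])
    finally have inW: "prod (cabs (c n)) (\<lambda>x. cabs f x / complex_of_real s) \<in> W" .
    let ?h = "\<lambda>x. cabs f x / complex_of_real s"
    have hF: "?h \<in> topspace F" by (rule solid_space_divide[OF solid_lcs.space[OF F] afF])
    have habs: "cabs ?h = ?h" using s by (simp add: norm_divide)
    have "dominated (e n) ?h"
      unfolding dominated_def
    proof
      fix x
      have "s * cmod (e n x) \<le> cmod (f x)"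
        using f(2)[of n] unfolding dominated_def s_def norm_mult norm_of_real by (metis abs_of_nat)
      then show "cmod (e n x) \<le> cmod (?h x)" using s by (simp add: norm_divide field_simps)
    qed
    then have "dominated (prod (cabs (c n)) (cabs (e n))) (prod (cabs (c n)) (cabs ?h))"
      using dominated_prod[OF cE hF, of "cabs (c n)" "cabs (e n)"] by simp
    then have "prod (cabs (c n)) (cabs (e n)) \<in> W"
      unfolding habs by (rule solidD[OF nbhd0_solid[OF W] inW])
    then show False using c(2) by blast
  qed
  have "w.ind_proj.basic (polar S W)"
    unfolding w.ind_proj.basic_def
  proof (intro conjI ballI)
    show "polar S W \<subseteq> (\<Union>j. topspace (?T j))" unfolding ts[symmetric] by (auto simp: polar_def)
    show "abs_convex (polar S W)" by (rule polar_abs_convex[OF SE nbhd0_abs_convex[OF W] nbhd0_solid[OF W]])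
    show "solid (polar S W)" by (rule polar_solid[OF SE nbhd0_solid[OF W]])
  qed (rule step)
  then have "nbhd0 F (polar S W)" unfolding Fw ind_proj_def by (rule w.ind_proj.P_nbhd0)
  then show "\<exists>V. nbhd0 F V \<and> (\<forall>c\<in>S. \<forall>d\<in>V. prod c d \<in> W)"
    using polarD[OF nbhd0_solid[OF W] SE] by blast
qed

lemma separately_continuousI:
  assumes G: "solid_lcs G"
    and right: "\<And>c. c \<in> topspace E \<Longrightarrow> cont0 (topspace F) F G (prod c)"
    and left: "\<And>d. d \<in> topspace F \<Longrightarrow> cont0 (topspace E) E G (\<lambda>c. prod c d)"
  shows "separately_continuous E F G (\<lambda>(c, d). prod c d)"
  unfolding separately_continuous_def
  using cont0_continuous_map[OF right F G linear_right] cont0_continuous_map[OF left E G linear_left]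
  by simp

lemma hypocontinuousI:
  assumes G: "solid_lcs G"
    and right: "\<And>c. c \<in> topspace E \<Longrightarrow> cont0 (topspace F) F G (prod c)"
    and left: "\<And>d. d \<in> topspace F \<Longrightarrow> cont0 (topspace E) E G (\<lambda>c. prod c d)"
    and "equicontinuous_right G" and "kernel_pair.equicontinuous_right k Y X F E G"
  shows "hypocontinuous E F G (\<lambda>(c, d). prod c d)"
  unfolding hypocontinuous_def
proof (intro conjI allI impI)
  show "separately_continuous E F G (\<lambda>(c, d). prod c d)"
    by (rule separately_continuousI[OF G right left])
  show "bilinear_map_on (topspace E) (topspace F) (\<lambda>(c, d). prod c d)"
    unfolding bilinear_map_on_def
    using linear_left linear_right unfolding linear_on_space_def by simp
  fix S W assume SW: "tvs_bounded E S \<and> openin G W \<and> (\<lambda>_. 0) \<in> W"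
  then obtain W' where W': "nbhd0 G W'" "W' \<subseteq> W" using solid_lcs.nbhd0_in_open[OF G] by metis
  obtain V where V: "nbhd0 F V" "\<forall>c\<in>S. \<forall>d\<in>V. prod c d \<in> W'"
    using assms(4) SW W' unfolding equicontinuous_right_def by metis
  obtain U where "openin F U" "(\<lambda>_. 0) \<in> U" "U \<subseteq> V" using V(1) unfolding nbhd0_def by metis
  then show "\<exists>V. openin F V \<and> (\<lambda>_. 0) \<in> V \<and> (\<forall>c\<in>S. \<forall>d\<in>V. (case (c, d) of (c, d) \<Rightarrow> prod c d) \<in> W)"
    using V(2) W'(2) by (intro exI[of _ U]) auto
next
  fix S W assume SW: "tvs_bounded F S \<and> openin G W \<and> (\<lambda>_. 0) \<in> W"
  then obtain W' where W': "nbhd0 G W'" "W' \<subseteq> W" using solid_lcs.nbhd0_in_open[OF G] by metis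
  obtain V where V: "nbhd0 E V" "\<forall>c\<in>S. \<forall>d\<in>V. prod d c \<in> W'"
    using assms(5) SW W' unfolding kernel_pair.equicontinuous_right_def[OF swap] prod_swap by metis
  obtain U where "openin E U" "(\<lambda>_. 0) \<in> U" "U \<subseteq> V" using V(1) unfolding nbhd0_def by metis
  then show "\<exists>V. openin E V \<and> (\<lambda>_. 0) \<in> V \<and> (\<forall>c\<in>V. \<forall>d\<in>S. (case (c, d) of (c, d) \<Rightarrow> prod c d) \<in> W)"
    using V(2) W'(2) by (intro exI[of _ U]) auto
qed

lemma jointly_continuousI:
  assumes G: "solid_lcs G"
    and right: "\<And>c. c \<in> topspace E \<Longrightarrow> cont0 (topspace F) F G (prod c)"
    and left: "\<And>d. d \<in> topspace F \<Longrightarrow> cont0 (topspace E) E G (\<lambda>c. prod c d)"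
    and zero: "\<And>W. nbhd0 G W \<Longrightarrow> \<exists>U V. nbhd0 E U \<and> nbhd0 F V \<and> (\<forall>c\<in>U. \<forall>d\<in>V. prod c d \<in> W)"
  shows "jointly_continuous E F G (\<lambda>(c, d). prod c d)"
  unfolding jointly_continuous_def continuous_map_def
proof (intro conjI allI impI)
  interpret E: solid_lcs E by (rule E)
  interpret F: solid_lcs F by (rule F)
  interpret G: solid_lcs G by (rule G)
  have maps: "prod c d \<in> topspace G" if "c \<in> topspace E" "d \<in> topspace F" for c d
    by (rule cont0_maps[OF right F G F.space linear_right that(2,2)]) (rule that(1))+
  then show "(\<lambda>(c, d). prod c d) \<in> topspace (prod_topology E F) \<rightarrow> topspace G" by auto
  fix O' assume O': "openin G O'"
  show "openin (prod_topology E F) {p \<in> topspace (prod_topology E F). (case p of (c, d) \<Rightarrow> prod c d) \<in> O'}"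
    unfolding openin_prod_topology_alt
  proof (intro allI impI)
    fix c d assume "(c, d) \<in> {p \<in> topspace (prod_topology E F). (case p of (c, d) \<Rightarrow> prod c d) \<in> O'}"
    then have c: "c \<in> topspace E" and d: "d \<in> topspace F" and cd: "prod c d \<in> O'" by auto
    obtain W where W: "nbhd0 G W" "\<forall>v\<in>W. (\<lambda>x. prod c d x + v x) \<in> O'"
      using G.openin_iff[of O', THEN iffD1, OF O'] cd by metis
    \<comment> \<open>In the expansion of the product at \<open>(c + u, d + v)\<close> three terms
      must be small. They are combined as \<open>(2 u + 2 v) / 2 + (4 v') / 4\<close>, and fourfold
      multiples in \<open>W\<close> suffice for this.\<close>
    define W' where "W' = {v. (\<lambda>x. complex_of_real 4 * v x) \<in> W}"
    have W': "nbhd0 G W'" unfolding W'_def by (rule G.nbhd0_scale[OF W(1)]) simp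
    have sum3: "(\<lambda>x. (u x + v x) + v' x) \<in> W" if "u \<in> W'" "v \<in> W'" "v' \<in> W'" for u v v'
    proof -
      note conv = abs_convexD[OF nbhd0_abs_convex[OF W(1)]]
      have mem: "(\<lambda>x. complex_of_real 4 * u x) \<in> W" "(\<lambda>x. complex_of_real 4 * v x) \<in> W"
        "(\<lambda>x. complex_of_real 4 * v' x) \<in> W" using that by (auto simp: W'_def)
      have "(\<lambda>x. (1/2) * (complex_of_real 4 * u x) + (1/2) * (complex_of_real 4 * v x)) \<in> W"
        by (rule conv[OF mem(1,2)]) simp
      from conv[OF this mem(3), of "1/2" "1/4"] show ?thesis by (simp add: add_divide_distrib)
    qed
    obtain U1 V1 where 1: "nbhd0 E U1" "nbhd0 F V1" "\<And>c d. c \<in> U1 \<Longrightarrow> d \<in> V1 \<Longrightarrow> prod c d \<in> W'"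
      using zero[OF W'] by metis
    obtain U2 where 2: "nbhd0 E U2" "\<And>c. c \<in> U2 \<inter> topspace E \<Longrightarrow> prod c d \<in> W'"
      using left[OF d] W' unfolding cont0_def by metis
    obtain V2 where 3: "nbhd0 F V2" "\<And>d. d \<in> V2 \<inter> topspace F \<Longrightarrow> prod c d \<in> W'"
      using right[OF c] W' unfolding cont0_def by metis
    obtain A where A: "openin E A" "c \<in> A" "\<And>e. e \<in> A \<Longrightarrow> (\<lambda>x. e x - c x) \<in> U1 \<inter> U2"
      using E.open_translate[OF c nbhd0_Int[OF 1(1) 2(1)]] by metis
    obtain B where B: "openin F B" "d \<in> B" "\<And>e. e \<in> B \<Longrightarrow> (\<lambda>x. e x - d x) \<in> V1 \<inter> V2"
      using F.open_translate[OF d nbhd0_Int[OF 1(2) 3(1)]] by metis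
    have "prod e f \<in> O'" if "e \<in> A" "f \<in> B" for e f
    proof -
      let ?u = "\<lambda>x. e x - c x" and ?v = "\<lambda>x. f x - d x"
      have u: "?u \<in> U1" "?u \<in> U2" "?u \<in> topspace E"
        using A(3)[OF that(1)] nbhd0_subset[OF 1(1)] by auto
      have v: "?v \<in> V1" "?v \<in> V2" "?v \<in> topspace F"
        using B(3)[OF that(2)] nbhd0_subset[OF 1(2)] by auto
      have f: "f \<in> topspace F" using B(1) that(2) openin_subset by blast
      have "prod e f = prod (\<lambda>x. c x + ?u x) f" by simp
      also have "\<dots> = (\<lambda>z. prod c f z + prod ?u f z)"
        by (rule linear_on_space_add[OF linear_left[OF f] c u(3)])
      also have "prod c f = prod c (\<lambda>x. d x + ?v x)" by simp
      also have "\<dots> = (\<lambda>z. prod c d z + prod c ?v z)"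
        by (rule linear_on_space_add[OF linear_right[OF c] d v(3)])
      also have "prod ?u f = prod ?u (\<lambda>x. d x + ?v x)" by simp
      also have "\<dots> = (\<lambda>z. prod ?u d z + prod ?u ?v z)"
        by (rule linear_on_space_add[OF linear_right[OF u(3)] d v(3)])
      finally have "prod e f = (\<lambda>z. prod c d z + ((prod c ?v z + prod ?u d z) + prod ?u ?v z))"
        by (simp add: add.assoc)
      moreover have "(\<lambda>z. (prod c ?v z + prod ?u d z) + prod ?u ?v z) \<in> W"
        using sum3 3(2)[of ?v] 2(2)[of ?u] 1(3)[of ?u ?v] u v by blast
      ultimately show ?thesis using W(2) by simp
    qed
    then show "\<exists>U V. openin E U \<and> openin F V \<and> c \<in> U \<and> d \<in> V \<and>
        U \<times> V \<subseteq> {p \<in> topspace (prod_topology E F). (case p of (c, d) \<Rightarrow> prod c d) \<in> O'}"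
      using A(1,2) B(1,2) openin_subset[OF A(1)] openin_subset[OF B(1)]
      by (intro exI[of _ A] exI[of _ B]) auto
  qed
qed

end

lemma cont0_scale_ball:
  assumes "nbhd0 (wtop top w) W"
  obtains \<epsilon> where "\<epsilon> > 0" "wball w \<epsilon> \<subseteq> W"
  using assms unfolding nbhd0_wtop_iff by metis

lemma cabs_wball: "c \<in> wball w N \<Longrightarrow> cabs c \<in> wball w N"
  by (rule cabs_solid[OF solid_wball])

lemma (in weight_grid) proj_ind_const_proj:
  assumes "\<And>i. w i = w 0"
  shows "proj_ind w = ind_lim UNIV (\<lambda>j. wtop top (w 0 j))"
proof -
  have "proj_ind w = proj_lim UNIV (\<lambda>i::nat. ind_lim UNIV (\<lambda>j. wtop top (w 0 j)))"
    unfolding proj_ind_def by (subst assms) (rule refl)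
  then show ?thesis by (simp add: proj_lim_const)
qed

lemma (in weight_grid) proj_ind_const_ind:
  assumes "\<And>i j. w i j = w i 0"
  shows "proj_ind w = proj_lim UNIV (\<lambda>i. wtop top (w i 0))"
proof -
  have "proj_ind w = proj_lim UNIV (\<lambda>i. ind_lim UNIV (\<lambda>j::nat. wtop top (w i 0)))"
    unfolding proj_ind_def by (subst assms) (rule refl)
  then show ?thesis by (simp add: solid_lcs.ind_lim_const[OF solid_lcs_wtop])
qed

section \<open>From estimates between steps to continuity on the double limits\<close>

context positive_kernel
begin

text \<open>An element \<open>c\<close> of \<open>proj_ind w1\<close> lies, for every \<open>i1\<close>, in some step \<open>s i1\<close> of the inductive limit; the
  condition makes \<open>T(c, \<cdot>)\<close> continuous for all \<open>c\<close> with the same \<open>s\<close>.\<close>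

definition est_proj_ind :: "(nat \<Rightarrow> nat \<Rightarrow> 'x \<Rightarrow> ennreal) \<Rightarrow> (nat \<Rightarrow> nat \<Rightarrow> 'y \<Rightarrow> ennreal) \<Rightarrow>
    (nat \<Rightarrow> nat \<Rightarrow> 'z \<Rightarrow> ennreal) \<Rightarrow> bool" where
  "est_proj_ind w1 w2 w3 \<longleftrightarrow>
     (\<forall>s i3. \<exists>i2. \<forall>j2. \<exists>i1 j3. est (w1 i1 (s i1)) (w2 i2 j2) (w3 i3 j3))"

text \<open>Elements of \<open>ind_proj\<close> lie in one inductive step for all projective
  indices. So \<open>j1\<close> and \<open>j2\<close> are given first and one \<open>j3\<close> must
  serve every \<open>i3\<close>. Unlike \<open>est_proj_ind\<close>, the condition is symmetric in
  the two factors.\<close>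

definition est_ind_proj :: "(nat \<Rightarrow> nat \<Rightarrow> 'x \<Rightarrow> ennreal) \<Rightarrow> (nat \<Rightarrow> nat \<Rightarrow> 'y \<Rightarrow> ennreal) \<Rightarrow>
    (nat \<Rightarrow> nat \<Rightarrow> 'z \<Rightarrow> ennreal) \<Rightarrow> bool" where
  "est_ind_proj w1 w2 w3 \<longleftrightarrow>
     (\<forall>j1 j2. \<exists>j3. \<forall>i3. \<exists>i1 i2. est (w1 i1 j1) (w2 i2 j2) (w3 i3 j3))"

lemma est_cont0:
  assumes "est w1 w2 w3" "c \<in> wball w1 N" "N > 0"
  shows "cont0 L (wtop top w2) (wtop top w3) (prod c)"
proof -
  obtain C where "\<And>d M. M > 0 \<Longrightarrow> d \<in> wball w2 M \<Longrightarrow> prod c d \<in> wball w3 (C * M)"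
    using est_wball[OF assms] by metis
  then show ?thesis by (intro cont0_wtop[where C = C])
qed

lemma proj_ind_pairable:
  assumes w1: "weight_grid w1" and w2: "weight_grid w2" and w3: "weight_grid w3"
    and est: "est_proj_ind w1 w2 w3"
    and c: "c \<in> topspace (proj_ind w1)" and d: "d \<in> topspace (proj_ind w2)"
  shows "pairable_at c d z"
proof -
  obtain i3 where i3: "\<And>j. 0 < w3 i3 j z" using weight_grid.pos[OF w3] by metis
  have "\<forall>i. \<exists>j. \<exists>N>0. c \<in> wball (w1 i j) N" using c by (simp add: weight_grid.topspace_proj_ind[OF w1])
  then obtain s where s: "\<And>i. \<exists>N>0. c \<in> wball (w1 i (s i)) N" by metis
  obtain i2 where i2: "\<And>j2. \<exists>i1 j3. est (w1 i1 (s i1)) (w2 i2 j2) (w3 i3 j3)"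
    using est unfolding est_proj_ind_def by metis
  obtain j2 M where M: "M > 0" "d \<in> wball (w2 i2 j2) M"
    using d unfolding weight_grid.topspace_proj_ind[OF w2] by blast
  obtain i1 j3 where e: "est (w1 i1 (s i1)) (w2 i2 j2) (w3 i3 j3)" using i2 by metis
  obtain N where "N > 0" "c \<in> wball (w1 i1 (s i1)) N" using s by metis
  then show ?thesis using est_pairable[OF e _ _ M(2,1) i3] by metis
qed

lemma proj_ind_cont0:
  assumes w1: "weight_grid w1" and w2: "weight_grid w2" and w3: "weight_grid w3"
    and est: "est_proj_ind w1 w2 w3"
    and c: "c \<in> topspace (proj_ind w1)" and lin: "linear_on_space (topspace (proj_ind w2)) (prod c)"
  shows "cont0 (topspace (proj_ind w2)) (proj_ind w2) (proj_ind w3) (prod c)"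
proof -
  interpret w2: weight_grid w2 by (rule w2)
  interpret w3: weight_grid w3 by (rule w3)
  let ?L = "topspace (proj_ind w2)"
  note L = solid_lcs.space[OF w2.proj_ind_lcs]
  have "\<forall>i. \<exists>j. \<exists>N>0. c \<in> wball (w1 i j) N" using c by (simp add: weight_grid.topspace_proj_ind[OF w1])
  then obtain s where s: "\<And>i. \<exists>N>0. c \<in> wball (w1 i (s i)) N" by metis
  have comp: "cont0 ?L (proj_ind w2) (ind_lim UNIV (\<lambda>j. wtop top (w3 i3 j))) (prod c)" for i3
  proof -
    obtain i2 where i2: "\<And>j2. \<exists>i1 j3. est (w1 i1 (s i1)) (w2 i2 j2) (w3 i3 j3)"
      using est unfolding est_proj_ind_def by metis
    have "cont0 ?L (wtop top (w2 i2 j2)) (ind_lim UNIV (\<lambda>j. wtop top (w3 i3 j))) (prod c)" for j2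
    proof -
      obtain i1 j3 where e: "est (w1 i1 (s i1)) (w2 i2 j2) (w3 i3 j3)" using i2 by metis
      obtain N where "N > 0" "c \<in> wball (w1 i1 (s i1)) N" using s by metis
      then have "cont0 ?L (wtop top (w2 i2 j2)) (wtop top (w3 i3 j3)) (prod c)"
        using est_cont0[OF e] by metis
      then show ?thesis by (intro w3.ind.cont0_target[where j = j3]) simp_all
    qed
    then have "cont0 ?L (ind_lim UNIV (\<lambda>j. wtop top (w2 i2 j))) (ind_lim UNIV (\<lambda>j. wtop top (w3 i3 j))) (prod c)"
      by (intro w2.ind.cont0_source[OF L lin])
    then show ?thesis unfolding proj_ind_def by (intro w2.proj_ind.cont0_source[where i = i2]) simp_all
  qed
  show ?thesis
    unfolding proj_ind_def[of w3] by (rule w3.proj_ind.cont0_target[OF w2.proj_ind_lcs L lin comp])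
qed

lemma ind_proj_pairable:
  assumes w1: "weight_grid w1" and w2: "weight_grid w2" and w3: "weight_grid w3"
    and est: "est_ind_proj w1 w2 w3"
    and c: "c \<in> topspace (ind_proj w1)" and d: "d \<in> topspace (ind_proj w2)"
  shows "pairable_at c d z"
proof -
  obtain i3 where i3: "\<And>j. 0 < w3 i3 j z" using weight_grid.pos[OF w3] by metis
  obtain j1 where j1: "\<And>i. \<exists>N>0. c \<in> wball (w1 i j1) N" using c by (auto simp: weight_grid.topspace_ind_proj[OF w1])
  obtain j2 where j2: "\<And>i. \<exists>N>0. d \<in> wball (w2 i j2) N" using d by (auto simp: weight_grid.topspace_ind_proj[OF w2])
  obtain j3 i1 i2 where e: "est (w1 i1 j1) (w2 i2 j2) (w3 i3 j3)"
    using est unfolding est_ind_proj_def by metis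
  obtain N M where "N > 0" "c \<in> wball (w1 i1 j1) N" "M > 0" "d \<in> wball (w2 i2 j2) M" using j1 j2 by metis
  then show ?thesis using est_pairable[OF e _ _ _ _ i3] by metis
qed

lemma ind_proj_cont0:
  assumes w1: "weight_grid w1" and w2: "weight_grid w2" and w3: "weight_grid w3"
    and est: "est_ind_proj w1 w2 w3"
    and c: "c \<in> topspace (ind_proj w1)" and lin: "linear_on_space (topspace (ind_proj w2)) (prod c)"
  shows "cont0 (topspace (ind_proj w2)) (ind_proj w2) (ind_proj w3) (prod c)"
proof -
  interpret w2: weight_grid w2 by (rule w2)
  interpret w3: weight_grid w3 by (rule w3)
  let ?L = "topspace (ind_proj w2)"
  note L = solid_lcs.space[OF w2.ind_proj_lcs]
  obtain j1 where j1: "\<And>i. \<exists>N>0. c \<in> wball (w1 i j1) N"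
    using c by (auto simp: weight_grid.topspace_ind_proj[OF w1])
  have "cont0 ?L (proj_lim UNIV (\<lambda>i. wtop top (w2 i j2))) (ind_proj w3) (prod c)" for j2
  proof -
    obtain j3 where j3: "\<And>i3. \<exists>i1 i2. est (w1 i1 j1) (w2 i2 j2) (w3 i3 j3)"
      using est unfolding est_ind_proj_def by metis
    have "cont0 ?L (proj_lim UNIV (\<lambda>i. wtop top (w2 i j2))) (wtop top (w3 i3 j3)) (prod c)" for i3
    proof -
      obtain i1 i2 where e: "est (w1 i1 j1) (w2 i2 j2) (w3 i3 j3)" using j3 by metis
      obtain N where "N > 0" "c \<in> wball (w1 i1 j1) N" using j1 by metis
      then have "cont0 ?L (wtop top (w2 i2 j2)) (wtop top (w3 i3 j3)) (prod c)"
        using est_cont0[OF e] by metis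
      then show ?thesis by (intro w2.proj.cont0_source[where i = i2]) simp_all
    qed
    then have "cont0 ?L (proj_lim UNIV (\<lambda>i. wtop top (w2 i j2))) (proj_lim UNIV (\<lambda>i. wtop top (w3 i j3))) (prod c)"
      by (intro w3.proj.cont0_target[OF w2.proj.proj_lcs L lin])
    then show ?thesis
      unfolding ind_proj_def by (intro w3.ind_proj.cont0_target[where j = j3]) simp_all
  qed
  then show ?thesis
    unfolding ind_proj_def[of w2] by (intro w2.ind_proj.cont0_source[OF L[unfolded ind_proj_def] lin[unfolded ind_proj_def]])
qed

end

locale proj_ind_pair = positive_kernel k X Y + w1: weight_grid w1 + w2: weight_grid w2 + w3: weight_grid w3
  for k :: "'z \<Rightarrow> 't \<Rightarrow> real" and X :: "'z \<Rightarrow> 't \<Rightarrow> 'x" and Y :: "'z \<Rightarrow> 't \<Rightarrow> 'y"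
    and w1 :: "nat \<Rightarrow> nat \<Rightarrow> 'x \<Rightarrow> ennreal" and w2 :: "nat \<Rightarrow> nat \<Rightarrow> 'y \<Rightarrow> ennreal"
    and w3 :: "nat \<Rightarrow> nat \<Rightarrow> 'z \<Rightarrow> ennreal" +
  assumes est_right: "est_proj_ind w1 w2 w3" and est_left: "positive_kernel.est_proj_ind k Y X w2 w1 w3"
begin

sublocale kernel_pair k X Y "proj_ind w1" "proj_ind w2"
  by (rule kernel_pair.intro[OF positive_kernel_axioms kernel_pair_axioms.intro])
    (fact w1.proj_ind_lcs w2.proj_ind_lcs
      proj_ind_pairable[OF w1.weight_grid_axioms w2.weight_grid_axioms w3.weight_grid_axioms est_right])+

lemma cont0_right: "c \<in> topspace (proj_ind w1) \<Longrightarrow>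
    cont0 (topspace (proj_ind w2)) (proj_ind w2) (proj_ind w3) (prod c)"
  by (rule proj_ind_cont0[OF w1.weight_grid_axioms w2.weight_grid_axioms w3.weight_grid_axioms est_right _ linear_right])

lemma cont0_left: "d \<in> topspace (proj_ind w2) \<Longrightarrow>
    cont0 (topspace (proj_ind w1)) (proj_ind w1) (proj_ind w3) (\<lambda>c. prod c d)"
  using positive_kernel.proj_ind_cont0[OF positive_kernel_axioms w2.weight_grid_axioms w1.weight_grid_axioms
      w3.weight_grid_axioms est_left, of d] linear_left[of d] unfolding prod_swap by simp

lemma hypocontinuous: "hypocontinuous (proj_ind w1) (proj_ind w2) (proj_ind w3) (\<lambda>(c, d). prod c d)"
proof (rule hypocontinuousI[OF w3.proj_ind_lcs cont0_right cont0_left])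
  show "equicontinuous_right (proj_ind w3)"
    by (rule equicontinuous_right_order_bounded[OF w1.proj_ind_bounded cont0_right])
  show "kernel_pair.equicontinuous_right k Y X (proj_ind w2) (proj_ind w1) (proj_ind w3)"
    by (rule kernel_pair.equicontinuous_right_order_bounded[OF swap w2.proj_ind_bounded])
      (simp_all add: prod_swap cont0_left)
qed

end

locale ind_proj_pair = positive_kernel k X Y + w1: weight_grid w1 + w2: weight_grid w2 + w3: weight_grid w3
  for k :: "'z \<Rightarrow> 't \<Rightarrow> real" and X :: "'z \<Rightarrow> 't \<Rightarrow> 'x" and Y :: "'z \<Rightarrow> 't \<Rightarrow> 'y"
    and w1 :: "nat \<Rightarrow> nat \<Rightarrow> 'x \<Rightarrow> ennreal" and w2 :: "nat \<Rightarrow> nat \<Rightarrow> 'y \<Rightarrow> ennreal"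
    and w3 :: "nat \<Rightarrow> nat \<Rightarrow> 'z \<Rightarrow> ennreal" +
  assumes est: "est_ind_proj w1 w2 w3"
begin

lemma est_swap: "positive_kernel.est_ind_proj k Y X w2 w1 w3"
  using est unfolding est_ind_proj_def positive_kernel.est_ind_proj_def[OF positive_kernel_axioms]
    positive_kernel_swap(3)[OF positive_kernel_axioms, where X = X and Y = Y] by metis

sublocale kernel_pair k X Y "ind_proj w1" "ind_proj w2"
  by (rule kernel_pair.intro[OF positive_kernel_axioms kernel_pair_axioms.intro])
    (fact w1.ind_proj_lcs w2.ind_proj_lcs
      ind_proj_pairable[OF w1.weight_grid_axioms w2.weight_grid_axioms w3.weight_grid_axioms est])+

lemma cont0_right: "c \<in> topspace (ind_proj w1) \<Longrightarrow>
    cont0 (topspace (ind_proj w2)) (ind_proj w2) (ind_proj w3) (prod c)"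
  by (rule ind_proj_cont0[OF w1.weight_grid_axioms w2.weight_grid_axioms w3.weight_grid_axioms est _ linear_right])

lemma cont0_left: "d \<in> topspace (ind_proj w2) \<Longrightarrow>
    cont0 (topspace (ind_proj w1)) (ind_proj w1) (ind_proj w3) (\<lambda>c. prod c d)"
  using positive_kernel.ind_proj_cont0[OF positive_kernel_axioms w2.weight_grid_axioms w1.weight_grid_axioms
      w3.weight_grid_axioms est_swap, of d] linear_left[of d] unfolding prod_swap by simp

lemma hypocontinuous: "hypocontinuous (ind_proj w1) (ind_proj w2) (ind_proj w3) (\<lambda>(c, d). prod c d)"
proof (rule hypocontinuousI[OF w3.ind_proj_lcs cont0_right cont0_left])
  show "equicontinuous_right (ind_proj w3)"
    by (rule equicontinuous_right_ind_proj[OF w2.weight_grid_axioms refl w3.ind_proj_lcs cont0_left])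
  show "kernel_pair.equicontinuous_right k Y X (ind_proj w2) (ind_proj w1) (ind_proj w3)"
    by (rule kernel_pair.equicontinuous_right_ind_proj[OF swap w1.weight_grid_axioms refl w3.ind_proj_lcs])
      (simp add: prod_swap cont0_right)
qed

end

locale joint_pair = proj_ind_pair k X Y w w w
  for k :: "'x \<Rightarrow> 't \<Rightarrow> real" and X :: "'x \<Rightarrow> 't \<Rightarrow> 'x" and Y :: "'x \<Rightarrow> 't \<Rightarrow> 'x"
    and w :: "nat \<Rightarrow> nat \<Rightarrow> 'x \<Rightarrow> ennreal"
begin

text \<open>One small factor suffices when the other is in its unit ball. The bound \<delta> is at
  most 1 to nest the small ball in the unit ball, and \<open>C + 1\<close> avoids division by
  0.\<close>

lemma ball_product:
  assumes e: "est v1 v2 v3" and \<epsilon>: "\<epsilon> > 0"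
  obtains \<delta> where "\<delta> > 0" "\<delta> \<le> 1"
    "\<And>c d. c \<in> wball v1 \<delta> \<Longrightarrow> d \<in> wball v2 1 \<Longrightarrow> prod c d \<in> wball v3 \<epsilon>"
    "\<And>c d. c \<in> wball v1 1 \<Longrightarrow> d \<in> wball v2 \<delta> \<Longrightarrow> prod c d \<in> wball v3 \<epsilon>"
proof -
  obtain C where C: "C \<ge> 0" "\<And>z F. finite F \<Longrightarrow>
      v3 z * (\<Sum>t\<in>F. ennreal (k z t) * (inverse (v1 (X z t)) * inverse (v2 (Y z t)))) \<le> ennreal C"
    using e unfolding est_def by metis
  define \<delta> where "\<delta> = min 1 (\<epsilon> / (C + 1))"
  have d: "\<delta> > 0" "\<delta> \<le> 1" using \<epsilon> C(1) by (auto simp: \<delta>_def)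
  have "C * \<delta> \<le> (C + 1) * (\<epsilon> / (C + 1))" using C(1) \<epsilon> d by (intro mult_mono) (auto simp: \<delta>_def)
  then have le: "C * \<delta> \<le> \<epsilon>" using C(1) by simp
  show thesis
  proof (rule that[OF d])
    show "prod c d \<in> wball v3 \<epsilon>" if "c \<in> wball v1 \<delta>" "d \<in> wball v2 1" for c d
      using est_bound(2)[of C v3 v1 v2, OF C that(1) d(1) that(2)] wball_mono[OF le] by auto
    show "prod c d \<in> wball v3 \<epsilon>" if "c \<in> wball v1 1" "d \<in> wball v2 \<delta>" for c d
      using est_bound(2)[of C v3 v1 v2, OF C that(1) _ that(2) d(1)] wball_mono[OF le] by auto
  qed
qed

text \<open>The union \<open>Q\<close> of sufficiently small balls of the steps satisfies \<open>T(Q, Q) \<subseteq> W\<close>, but it is not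
  convex. Its polar \<open>V\<close> and the polar \<open>U\<close> of \<open>V\<close> contain \<open>Q\<close> and are neighbourhoods of \<open>0\<close> with
  \<open>T(U, V) \<subseteq> W\<close>.\<close>

lemma ind_zero:
  assumes const: "\<And>i. w i = w 0" and e: "\<And>n. \<exists>m. est (w 0 n) (w 0 n) (w 0 m)"
    and W: "nbhd0 (proj_ind w) W"
  shows "\<exists>U V. nbhd0 (proj_ind w) U \<and> nbhd0 (proj_ind w) V \<and> (\<forall>c\<in>U. \<forall>d\<in>V. prod c d \<in> W)"
proof -
  let ?E = "proj_ind w"
  have Ew: "?E = ind_lim UNIV (\<lambda>j. wtop top (w 0 j))" by (rule w1.proj_ind_const_proj[OF const])
  have ts: "topspace ?E = (\<Union>j. wspace top (w 0 j))"
    unfolding Ew w1.ind.topspace topspace_wtop ..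
  have "\<forall>n. \<exists>\<delta>>0. \<delta> \<le> 1 \<and> (\<forall>c d. c \<in> wball (w 0 n) \<delta> \<longrightarrow> d \<in> wball (w 0 n) 1 \<longrightarrow> prod c d \<in> W) \<and>
      (\<forall>c d. c \<in> wball (w 0 n) 1 \<longrightarrow> d \<in> wball (w 0 n) \<delta> \<longrightarrow> prod c d \<in> W)"
  proof
    fix n
    obtain m where m: "est (w 0 n) (w 0 n) (w 0 m)" using e by metis
    obtain W' where "nbhd0 (wtop top (w 0 m)) W'" "W' \<subseteq> W"
      using W unfolding Ew w1.ind.nbhd0_ind_iff w1.ind.basic_def by blast
    then obtain \<epsilon> where \<epsilon>: "\<epsilon> > 0" "wball (w 0 m) \<epsilon> \<subseteq> W"
      using cont0_scale_ball by (metis order_trans)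
    show "\<exists>\<delta>>0. \<delta> \<le> 1 \<and> (\<forall>c d. c \<in> wball (w 0 n) \<delta> \<longrightarrow> d \<in> wball (w 0 n) 1 \<longrightarrow> prod c d \<in> W) \<and>
      (\<forall>c d. c \<in> wball (w 0 n) 1 \<longrightarrow> d \<in> wball (w 0 n) \<delta> \<longrightarrow> prod c d \<in> W)"
    proof (rule ball_product[OF m \<epsilon>(1)])
      fix \<delta> assume "\<delta> > 0" "\<delta> \<le> 1"
        "\<And>c d. c \<in> wball (w 0 n) \<delta> \<Longrightarrow> d \<in> wball (w 0 n) 1 \<Longrightarrow> prod c d \<in> wball (w 0 m) \<epsilon>"
        "\<And>c d. c \<in> wball (w 0 n) 1 \<Longrightarrow> d \<in> wball (w 0 n) \<delta> \<Longrightarrow> prod c d \<in> wball (w 0 m) \<epsilon>"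
      then show ?thesis using \<epsilon>(2) by (intro exI[of _ \<delta>]) auto
    qed
  qed
  then obtain \<delta> where d: "\<And>n. \<delta> n > 0" "\<And>n. \<delta> n \<le> 1"
    "\<And>n c d. c \<in> wball (w 0 n) (\<delta> n) \<Longrightarrow> d \<in> wball (w 0 n) 1 \<Longrightarrow> prod c d \<in> W"
    "\<And>n c d. c \<in> wball (w 0 n) 1 \<Longrightarrow> d \<in> wball (w 0 n) (\<delta> n) \<Longrightarrow> prod c d \<in> W" by metis
  define Q where "Q = (\<Union>n. wball (w 0 n) (\<delta> n))"
  have mono: "wball (w 0 n) (\<delta> n) \<subseteq> wball (w 0 m) 1" if "n \<le> m" for n m
    using wball_mono[OF d(2), of "w 0 n" n] wball_antimono[of "w 0 m" "w 0 n" 1, OF w1.dec[OF that]] by blast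
  \<comment> \<open>The factor from the step with the smaller index lies in the unit ball of the
    other step, whose own factor is in the small ball; the estimate for that one step
    applies.\<close>
  have QQ: "prod c d \<in> W" if cd: "c \<in> Q" "d \<in> Q" for c d
  proof -
    obtain n m where nm: "c \<in> wball (w 0 n) (\<delta> n)" "d \<in> wball (w 0 m) (\<delta> m)" using cd by (auto simp: Q_def)
    show ?thesis
    proof (cases "n \<le> m")
      case True
      then show ?thesis using d(4) nm mono by blast
    next
      case False
      then have "m \<le> n" by simp
      then show ?thesis using d(3) nm mono by blast
    qed
  qed
  have cQ: "cabs c \<in> Q" if "c \<in> Q" for c using that cabs_wball by (auto simp: Q_def)
  have Qts: "Q \<subseteq> topspace ?E" unfolding Q_def ts using d(1) wspace_top by blast
  note convW = nbhd0_abs_convex[OF W] and solW = nbhd0_solid[OF W]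
  have nb: "nbhd0 ?E V" if "Q \<subseteq> V" "V \<subseteq> topspace ?E" "abs_convex V" "solid V" for V
  proof -
    have "w1.ind.basic 0 V"
      unfolding w1.ind.basic_def
    proof (intro conjI ballI)
      show "V \<subseteq> (\<Union>j. topspace (wtop top (w 0 j)))" using that(2) unfolding ts topspace_wtop .
      show "\<exists>V'. nbhd0 (wtop top (w 0 j)) V' \<and> V' \<subseteq> V" for j
        using nbhd0_wball[OF d(1)] that(1) unfolding Q_def by (meson UNIV_I UN_subset_iff)
    qed (use that in auto)
    then show ?thesis unfolding Ew by (rule w1.ind.P_nbhd0)
  qed
  define V where "V = polar Q W"
  have V: "nbhd0 ?E V"
  proof (rule nb)
    show "Q \<subseteq> V" using Qts QQ cQ by (auto simp: V_def polar_def)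
    show "abs_convex V" "solid V"
      unfolding V_def by (rule polar_abs_convex[OF Qts convW solW] polar_solid[OF Qts solW])+
  qed (auto simp: V_def polar_def)
  interpret sw: kernel_pair k Y X ?E ?E by (rule swap)
  define U where "U = sw.polar V W"
  have Vts: "V \<subseteq> topspace ?E" by (rule nbhd0_subset[OF V])
  have U: "nbhd0 ?E U"
  proof (rule nb)
    show "Q \<subseteq> U"
      using Qts unfolding U_def sw.polar_def prod_swap V_def polar_def by auto
    show "abs_convex U" "solid U"
      unfolding U_def by (rule sw.polar_abs_convex[OF Vts convW solW] sw.polar_solid[OF Vts solW])+
  qed (auto simp: U_def sw.polar_def)
  have "prod c d \<in> W" if "c \<in> U" "d \<in> V" for c d
    using sw.polarD[OF solW Vts that(2)] that(1) unfolding U_def prod_swap by simp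
  then show ?thesis using U V by blast
qed

text \<open>A neighbourhood restricts only finitely many components. Each one asks for one step of
  the source, where a unit ball and a small ball multiply into it.\<close>

lemma proj_zero:
  assumes const: "\<And>i j. w i j = w i 0" and e: "\<And>m. \<exists>n. est (w n 0) (w n 0) (w m 0)"
    and W: "nbhd0 (proj_ind w) W"
  shows "\<exists>U V. nbhd0 (proj_ind w) U \<and> nbhd0 (proj_ind w) V \<and> (\<forall>c\<in>U. \<forall>d\<in>V. prod c d \<in> W)"
proof -
  let ?E = "proj_ind w"
  have Ew: "?E = proj_lim UNIV (\<lambda>i. wtop top (w i 0))" by (rule w1.proj_ind_const_ind[OF const])
  obtain W' where W': "w1.proj.basic 0 W'" "W' \<subseteq> W"
    using W unfolding Ew w1.proj.nbhd0_iff by metis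
  obtain F Ws where F: "finite F" "\<And>i. i \<in> F \<Longrightarrow> nbhd0 (wtop top (w i 0)) (Ws i)"
      "W' = topspace ?E \<inter> (\<Inter>i\<in>F. Ws i)"
    using w1.proj.basicE[OF W'(1)] unfolding Ew w1.proj.topspace by metis
  have "\<forall>i\<in>F. \<exists>n \<delta>. \<delta> > 0 \<and> (\<forall>c d. c \<in> wball (w n 0) 1 \<longrightarrow> d \<in> wball (w n 0) \<delta> \<longrightarrow> prod c d \<in> Ws i)"
  proof
    fix i assume i: "i \<in> F"
    obtain n where n: "est (w n 0) (w n 0) (w i 0)" using e by metis
    obtain \<epsilon> where \<epsilon>: "\<epsilon> > 0" "wball (w i 0) \<epsilon> \<subseteq> Ws i" using cont0_scale_ball[OF F(2)[OF i]] .
    show "\<exists>n \<delta>. \<delta> > 0 \<and> (\<forall>c d. c \<in> wball (w n 0) 1 \<longrightarrow> d \<in> wball (w n 0) \<delta> \<longrightarrow> prod c d \<in> Ws i)"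
      using ball_product[OF n \<epsilon>(1)] \<epsilon>(2) by (metis subsetD)
  qed
  then obtain n \<delta> where nd: "\<And>i. i \<in> F \<Longrightarrow> \<delta> i > 0"
    "\<And>i c d. i \<in> F \<Longrightarrow> c \<in> wball (w (n i) 0) 1 \<Longrightarrow> d \<in> wball (w (n i) 0) (\<delta> i) \<Longrightarrow> prod c d \<in> Ws i" by metis
  have nb: "nbhd0 ?E (topspace ?E \<inter> (\<Inter>i\<in>F. wball (w (n i) 0) (r i) \<inter> topspace ?E))" if "\<And>i. i \<in> F \<Longrightarrow> r i > 0" for r
  proof (rule nbhd0_finite_INT[OF w1.proj_ind_lcs F(1)])
    fix i assume "i \<in> F"
    then have "nbhd0 (wtop top (w (n i) 0)) (wball (w (n i) 0) (r i))" using nbhd0_wball that by metis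
    from w1.proj.nbhd0_component[OF _ this]
    show "nbhd0 ?E (wball (w (n i) 0) (r i) \<inter> topspace ?E)" unfolding Ew w1.proj.topspace by simp
  qed
  let ?B = "\<lambda>r. topspace ?E \<inter> (\<Inter>i\<in>F. wball (w (n i) 0) (r i) \<inter> topspace ?E)"
  have "prod c d \<in> W" if "c \<in> ?B (\<lambda>_. 1)" "d \<in> ?B \<delta>" for c d
  proof -
    have "c \<in> topspace ?E" "d \<in> topspace ?E" using that by auto
    then have "prod c d \<in> topspace ?E"
      using cont0_maps[OF cont0_right w1.proj_ind_lcs w1.proj_ind_lcs solid_lcs.space[OF w1.proj_ind_lcs] linear_right]
      by metis
    moreover have "prod c d \<in> Ws i" if "i \<in> F" for i using nd(2)[OF that] \<open>c \<in> ?B _\<close> \<open>d \<in> ?B _\<close> that by blast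
    ultimately show ?thesis using F(3) W'(2) by blast
  qed
  moreover have "nbhd0 ?E (?B (\<lambda>_. 1))" by (rule nb) simp
  moreover have "nbhd0 ?E (?B \<delta>)" by (rule nb[OF nd(1)])
  ultimately show ?thesis by (intro exI[of _ "?B (\<lambda>_. 1)"] exI[of _ "?B \<delta>"] conjI ballI)
qed

lemma jointly_continuous:
  assumes "(\<forall>i. w i = w 0) \<and> (\<forall>n. \<exists>m. est (w 0 n) (w 0 n) (w 0 m)) \<or>
      (\<forall>i j. w i j = w i 0) \<and> (\<forall>m. \<exists>n. est (w n 0) (w n 0) (w m 0))"
  shows "jointly_continuous (proj_ind w) (proj_ind w) (proj_ind w) (\<lambda>(c, d). prod c d)"
  using assms by (intro jointly_continuousI[OF w1.proj_ind_lcs cont0_right cont0_left])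
    (blast intro: ind_zero proj_zero)+

end

section \<open>Independence of the exponent\<close>

lemma ennreal_powr_mono: "x \<le> y \<Longrightarrow> 0 < q \<Longrightarrow> ennreal_powr x q \<le> ennreal_powr y q"
  by (cases x; cases y) (auto simp: ennreal_powr_def top_unique intro!: ennreal_leI powr_mono2)

lemma ennreal_powr_ennreal: "0 \<le> x \<Longrightarrow> ennreal_powr (ennreal x) q = ennreal (x powr q)"
  by (simp add: ennreal_powr_def)

lemma ennreal_powr_mult: "0 < q \<Longrightarrow> ennreal_powr (x * y) q = ennreal_powr x q * ennreal_powr y q"
proof (cases "x = top \<or> y = top")
  case True
  assume q: "0 < q"
  have "ennreal_powr (top * z) q = top * ennreal_powr z q" for z
    using q by (cases z) (auto simp: ennreal_powr_def ennreal_top_mult)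
  note top = this
  have tt: "ennreal_powr top q = top" by (simp add: ennreal_powr_def)
  show ?thesis
  proof (cases "x = top")
    case True
    then show ?thesis using top[of y] tt by simp
  next
    case False
    then have "y = top" using True by simp
    then show ?thesis using top[of x] tt by (simp add: mult.commute)
  qed
next
  case False
  then show ?thesis
    by (cases x; cases y) (auto simp: ennreal_powr_ennreal ennreal_mult[symmetric] powr_mult)
qed

lemma ennreal_powr_inverse: "0 < q \<Longrightarrow> ennreal_powr (ennreal_powr x q) (1 / q) = x"
  by (cases x) (auto simp: ennreal_powr_def powr_powr)

lemma ennreal_powr_less_top: "ennreal_powr x q < top \<longleftrightarrow> x < top"
  by (simp add: ennreal_powr_def less_top)

lemma wnorm_finite:
  assumes "p \<noteq> top"
  shows "wnorm p w c = ennreal_powr (\<integral>\<^sup>+x. ennreal_powr (ennreal (cmod (c x)) * w x) (enn2real p) \<partial>count_space UNIV)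
    (1 / enn2real p)"
  using assms by (simp add: wnorm_def lp_norm_def)

lemma enn2real_pos: "0 < p \<Longrightarrow> p \<noteq> top \<Longrightarrow> 0 < enn2real p"
  by (simp add: enn2real_positive_iff less_top)

lemma coordinate_le_wnorm:
  assumes p: "0 < p"
  shows "ennreal (cmod (c x)) * w x \<le> wnorm p w c"
proof (cases "p = top")
  case True
  then show ?thesis by (auto simp: wnorm_def lp_norm_def intro: SUP_upper)
next
  case False
  define q where "q = enn2real p"
  have q: "q > 0" unfolding q_def by (rule enn2real_pos[OF p False])
  let ?f = "\<lambda>x. ennreal_powr (ennreal (cmod (c x)) * w x) q"
  have "?f x = (\<integral>\<^sup>+y. ?f y * indicator {x} y \<partial>count_space UNIV)"
    by (subst nn_integral_count_space'[where A = "{x}"]) auto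
  also have "\<dots> \<le> (\<integral>\<^sup>+y. ?f y \<partial>count_space UNIV)"
    by (intro nn_integral_mono) (auto simp: indicator_def)
  finally have "ennreal_powr (?f x) (1 / q) \<le> wnorm p w c"
    unfolding wnorm_finite[OF False] q_def[symmetric] using q by (intro ennreal_powr_mono) auto
  then show ?thesis using q by (simp add: ennreal_powr_inverse)
qed

lemma wnorm_mono:
  assumes p: "0 < p" and le: "\<And>x. ennreal (cmod (c x)) * w x \<le> ennreal (cmod (c' x)) * w' x"
  shows "wnorm p w c \<le> wnorm p w' c'"
proof (cases "p = top")
  case True
  then show ?thesis using le by (auto simp: wnorm_def lp_norm_def intro!: SUP_mono)
next
  case False
  then show ?thesis
    unfolding wnorm_finite[OF False] using enn2real_pos[OF p False] le
    by (intro ennreal_powr_mono nn_integral_mono) auto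
qed

lemma wnorm_less_top_iff:
  assumes "p \<noteq> top"
  shows "wnorm p w c < top \<longleftrightarrow>
    (\<integral>\<^sup>+x. ennreal_powr (ennreal (cmod (c x)) * w x) (enn2real p) \<partial>count_space UNIV) < top"
  unfolding wnorm_finite[OF assms] by (rule ennreal_powr_less_top)

text \<open>For \<open>p < 1\<close> there is no triangle inequality. Instead the modulus of a sum
  is at most the larger of twice the two moduli, and the corresponding power is bounded by the sum
  of both powers for every \<open>q > 0\<close>.\<close>

lemma solid_space_wspace_p:
  assumes p: "0 < p"
  shows "solid_space (wspace p w)"
proof (cases "p = top")
  case True
  then show ?thesis using solid_space_wspace by simp
next
  case False
  define q where "q = enn2real p"
  have q: "q > 0" unfolding q_def by (rule enn2real_pos[OF p False])
  show ?thesis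
    unfolding solid_space_def
  proof (intro conjI ballI allI)
    show "(\<lambda>_. 0) \<in> wspace p w"
      using q by (simp add: wspace_def wnorm_less_top_iff[OF False] q_def[symmetric] ennreal_powr_def)
    show "solid (wspace p w)"
      unfolding solid_def wspace_def dominated_def
    proof (intro ballI allI impI CollectI)
      fix c d assume "c \<in> {c. wnorm p w c < top}" "\<forall>x. cmod (d x) \<le> cmod (c x)"
      then show "wnorm p w d < top"
        using le_less_trans[OF wnorm_mono[OF p, of d w c w]] by (simp add: mult_right_mono ennreal_leI)
    qed
    fix c d a b assume c: "c \<in> wspace p w" and d: "d \<in> wspace p w"
    let ?I = "\<lambda>c. \<integral>\<^sup>+x. ennreal_powr (ennreal (cmod (c x)) * w x) q \<partial>count_space UNIV"
    have fin: "?I c < top" "?I d < top"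
      using c d by (auto simp: wspace_def wnorm_less_top_iff[OF False] q_def)
    define A where "A = ennreal_powr (ennreal (2 * cmod a)) q"
    define B where "B = ennreal_powr (ennreal (2 * cmod b)) q"
    have AB: "A < top" "B < top" by (auto simp: A_def B_def ennreal_powr_less_top)
    have "?I (\<lambda>x. a * c x + b * d x) \<le>
        (\<integral>\<^sup>+x. A * ennreal_powr (ennreal (cmod (c x)) * w x) q + B * ennreal_powr (ennreal (cmod (d x)) * w x) q \<partial>count_space UNIV)"
    proof (rule nn_integral_mono)
      fix x
      have le: "cmod (a * c x + b * d x) \<le> max (2 * cmod a * cmod (c x)) (2 * cmod b * cmod (d x))"
        using norm_triangle_ineq[of "a * c x" "b * d x"] by (auto simp: norm_mult max_def)
      have A: "ennreal_powr (ennreal (2 * cmod a * cmod (c x)) * w x) q = A * ennreal_powr (ennreal (cmod (c x)) * w x) q"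
        unfolding A_def using q by (simp add: ennreal_mult ennreal_powr_mult mult.assoc)
      have B: "ennreal_powr (ennreal (2 * cmod b * cmod (d x)) * w x) q = B * ennreal_powr (ennreal (cmod (d x)) * w x) q"
        unfolding B_def using q by (simp add: ennreal_mult ennreal_powr_mult mult.assoc)
      show "ennreal_powr (ennreal (cmod (a * c x + b * d x)) * w x) q \<le>
          A * ennreal_powr (ennreal (cmod (c x)) * w x) q + B * ennreal_powr (ennreal (cmod (d x)) * w x) q"
      proof (cases "2 * cmod b * cmod (d x) \<le> 2 * cmod a * cmod (c x)")
        case True
        then have "ennreal_powr (ennreal (cmod (a * c x + b * d x)) * w x) q \<le> ennreal_powr (ennreal (2 * cmod a * cmod (c x)) * w x) q"
          using le q by (intro ennreal_powr_mono mult_right_mono ennreal_leI) auto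
        then show ?thesis unfolding A by (simp add: add_increasing2)
      next
        case False
        then have "ennreal_powr (ennreal (cmod (a * c x + b * d x)) * w x) q \<le> ennreal_powr (ennreal (2 * cmod b * cmod (d x)) * w x) q"
          using le q by (intro ennreal_powr_mono mult_right_mono ennreal_leI) auto
        then show ?thesis unfolding B by (simp add: add_increasing)
      qed
    qed
    also have "\<dots> = A * ?I c + B * ?I d"
      by (simp add: nn_integral_add nn_integral_cmult)
    also have "\<dots> < top" using fin AB by (simp add: ennreal_mult_less_top)
    finally show "(\<lambda>x. a * c x + b * d x) \<in> wspace p w"
      by (simp add: wspace_def wnorm_less_top_iff[OF False] q_def)
  qed
qed

lemma wtop_continuous_id:
  assumes K: "K > 0" "\<And>c. wnorm p' w' c \<le> ennreal K * wnorm p w c"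
  shows "continuous_map (wtop p w) (wtop p' w') (\<lambda>c. c)"
proof -
  have sub: "wspace p w \<subseteq> wspace p' w'"
  proof
    fix c assume "c \<in> wspace p w"
    then have "ennreal K * wnorm p w c < top" by (simp add: wspace_def ennreal_mult_less_top)
    then show "c \<in> wspace p' w'" using le_less_trans[OF K(2)] by (auto simp: wspace_def)
  qed
  have "wopen p w {c \<in> wspace p w. c \<in> U}" if U: "wopen p' w' U" for U
    unfolding wopen_def
  proof (intro conjI ballI)
    fix c assume "c \<in> {c \<in> wspace p w. c \<in> U}"
    then obtain \<epsilon> where e: "\<epsilon> > 0" "\<And>d. d \<in> wspace p' w' \<Longrightarrow> wnorm p' w' (\<lambda>x. d x - c x) < \<epsilon> \<Longrightarrow> d \<in> U"
      using U unfolding wopen_def by blast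
    obtain e' where e': "e' > 0" "ennreal e' \<le> \<epsilon>" using ennreal_pos_lower_bound[OF e(1)] .
    have "d \<in> U" if d: "d \<in> wspace p w" "wnorm p w (\<lambda>x. d x - c x) < ennreal (e' / (2 * K))" for d
    proof (rule e(2))
      show "d \<in> wspace p' w'" using d sub by blast
      have "wnorm p' w' (\<lambda>x. d x - c x) \<le> ennreal K * ennreal (e' / (2 * K))"
        using K(2) d(2) by (meson less_imp_le mult_left_mono order_trans zero_le)
      also have "\<dots> = ennreal (e' / 2)" using K(1) e'(1) by (simp add: ennreal_mult[symmetric])
      also have "\<dots> < ennreal e'" using e'(1) by (simp add: ennreal_less_iff)
      also have "\<dots> \<le> \<epsilon>" by (rule e'(2))
      finally show "wnorm p' w' (\<lambda>x. d x - c x) < \<epsilon>" .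
    qed
    then show "\<exists>\<epsilon>>0. \<forall>d\<in>wspace p w. wnorm p w (\<lambda>x. d x - c x) < \<epsilon> \<longrightarrow> d \<in> {c \<in> wspace p w. c \<in> U}"
      using K(1) e'(1) by (intro exI[of _ "ennreal (e' / (2 * K))"]) auto
  qed auto
  then show ?thesis using sub by (auto simp: continuous_map_def topspace_wtop openin_wtop)
qed

lemma wtop_p_to_top:
  assumes p: "0 < p" and le: "\<And>x. w' x \<le> w x"
  shows "continuous_map (wtop p w) (wtop top w') (\<lambda>c. c)"
proof (rule wtop_continuous_id[where K = 1])
  fix c
  have "ennreal (cmod (c x)) * w' x \<le> wnorm p w c" for x
    using coordinate_le_wnorm[OF p, of c x w] le[of x] by (meson mult_left_mono order_trans zero_le)
  then show "wnorm top w' c \<le> ennreal 1 * wnorm p w c"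
    by (simp add: wnorm_def lp_norm_def SUP_le_iff)
qed simp

text \<open>The sup norm for \<open>w\<close> bounds the terms for \<open>w'\<close> by the summable
  factor \<open>r\<close>, so the norm of \<open>r\<close> in the relevant sequence space is the
  operator bound. The additional 1 only makes this bound positive.\<close>

lemma wtop_top_to_p:
  assumes p: "0 < p" and nuc: "summably_below w' w"
  shows "continuous_map (wtop top w) (wtop p w') (\<lambda>c. c)"
proof -
  obtain r where r: "\<And>x. 0 \<le> r x" "\<And>p. p > 0 \<Longrightarrow> (\<lambda>x. r x powr p) summable_on UNIV"
    "\<And>x. w' x \<le> ennreal (r x) * w x" using nuc unfolding summably_below_def by blast
  have le: "ennreal (cmod (c x)) * w' x \<le> ennreal (r x) * wnorm top w c" for c x
  proof -
    have "ennreal (cmod (c x)) * w' x \<le> ennreal (cmod (c x)) * (ennreal (r x) * w x)"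
      by (intro mult_left_mono r) simp
    also have "\<dots> = ennreal (r x) * (ennreal (cmod (c x)) * w x)" by (simp add: mult_ac)
    also have "\<dots> \<le> ennreal (r x) * wnorm top w c"
      by (intro mult_left_mono coordinate_le_wnorm) simp_all
    finally show ?thesis .
  qed
  show ?thesis
  proof (cases "p = top")
    case True
    have "r summable_on UNIV" using r(1) r(2)[of 1] by simp
    then have b: "r x \<le> infsum r UNIV" for x
      using finite_sum_le_infsum[of r UNIV "{x}"] r(1) by simp
    have "wnorm p w' c \<le> ennreal (infsum r UNIV + 1) * wnorm top w c" for c
    proof -
      have "ennreal (cmod (c x)) * w' x \<le> ennreal (infsum r UNIV + 1) * wnorm top w c" for x
      proof -
      have "ennreal (r x) * wnorm top w c \<le> ennreal (infsum r UNIV + 1) * wnorm top w c"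
        using b[of x] by (intro mult_right_mono ennreal_leI) auto
        then show ?thesis using le order_trans by blast
      qed
      then show ?thesis by (simp add: True wnorm_def[of top w'] lp_norm_def SUP_le_iff)
    qed
    moreover have "infsum r UNIV + 1 > 0" using r(1) by (simp add: infsum_nonneg add_nonneg_pos)
    ultimately show ?thesis by (intro wtop_continuous_id)
  next
    case False
    define q where "q = enn2real p"
    have q: "q > 0" unfolding q_def by (rule enn2real_pos[OF p False])
    define S where "S = infsum (\<lambda>x. r x powr q) UNIV"
    have S0: "S \<ge> 0" unfolding S_def by (intro infsum_nonneg) simp
    have "(\<lambda>x. norm (r x powr q)) summable_on UNIV" using r(2)[OF q] by simp
    then have as: "Infinite_Set_Sum.abs_summable_on (\<lambda>x. r x powr q) UNIV"
      by (simp only: abs_summable_equivalent)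
    have int: "(\<integral>\<^sup>+x. ennreal (r x powr q) \<partial>count_space UNIV) = ennreal S"
      unfolding S_def infsetsum_infsum[OF as, symmetric]
      by (rule nn_integral_conv_infsetsum[OF as]) simp
    have bound: "wnorm p w' c \<le> ennreal (S powr (1 / q)) * wnorm top w c" for c
    proof -
      have "(\<integral>\<^sup>+x. ennreal_powr (ennreal (cmod (c x)) * w' x) q \<partial>count_space UNIV) \<le>
          (\<integral>\<^sup>+x. ennreal (r x powr q) * ennreal_powr (wnorm top w c) q \<partial>count_space UNIV)"
      proof (rule nn_integral_mono)
        fix x
        have "ennreal_powr (ennreal (cmod (c x)) * w' x) q \<le> ennreal_powr (ennreal (r x) * wnorm top w c) q"
          using q le by (intro ennreal_powr_mono)
        then show "ennreal_powr (ennreal (cmod (c x)) * w' x) q \<le> ennreal (r x powr q) * ennreal_powr (wnorm top w c) q"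
          using q r(1) by (simp add: ennreal_powr_mult ennreal_powr_ennreal)
      qed
      also have "\<dots> = ennreal S * ennreal_powr (wnorm top w c) q"
        by (simp add: nn_integral_multc int)
      finally have "wnorm p w' c \<le> ennreal_powr (ennreal S * ennreal_powr (wnorm top w c) q) (1 / q)"
        unfolding wnorm_finite[OF False] q_def[symmetric] using q by (intro ennreal_powr_mono) auto
      then show ?thesis using q S0 by (simp add: ennreal_powr_mult ennreal_powr_ennreal ennreal_powr_inverse)
    qed
    have "wnorm p w' c \<le> ennreal (S powr (1 / q) + 1) * wnorm top w c" for c
    proof -
      have "ennreal (S powr (1 / q)) * wnorm top w c \<le> ennreal (S powr (1 / q) + 1) * wnorm top w c"
        by (intro mult_right_mono ennreal_leI) auto
      then show ?thesis using bound order_trans by blast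
    qed
    moreover have "S powr (1 / q) + 1 > 0" by (simp add: add_nonneg_pos)
    ultimately show ?thesis by (intro wtop_continuous_id)
  qed
qed

section \<open>Equality of limits by mutual cofinality\<close>

lemma topology_eq_id:
  assumes "continuous_map X Y (\<lambda>c. c)" "continuous_map Y X (\<lambda>c. c)"
  shows "X = Y"
proof -
  have ts: "topspace X = topspace Y" using assms by (auto simp: continuous_map_def)
  have "openin X U = openin Y U" for U
  proof
    assume "openin X U"
    then have "openin Y {c \<in> topspace Y. c \<in> U}" "U \<subseteq> topspace X"
      using assms(2) openin_subset by (auto simp: continuous_map_def)
    moreover have "{c \<in> topspace Y. c \<in> U} = U" using calculation(2) ts by blast
    ultimately show "openin Y U" by simp
  next
    assume "openin Y U"
    then have "openin X {c \<in> topspace X. c \<in> U}" "U \<subseteq> topspace Y"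
      using assms(1) openin_subset by (auto simp: continuous_map_def)
    moreover have "{c \<in> topspace X. c \<in> U} = U" using calculation(2) ts by blast
    ultimately show "openin X U" by simp
  qed
  then show ?thesis by (simp add: topology_eq)
qed

lemma proj_lim_id_continuous:
  fixes T :: "'i \<Rightarrow> ('x \<Rightarrow> complex) topology" and T' :: "'j \<Rightarrow> ('x \<Rightarrow> complex) topology"
  assumes "I \<noteq> {}" "J \<noteq> {}" and cont: "\<And>j. j \<in> J \<Longrightarrow> \<exists>i\<in>I. continuous_map (T i) (T' j) (\<lambda>c. c)"
  shows "continuous_map (proj_lim I T) (proj_lim J T') (\<lambda>c. c)"
proof -
  have c: "continuous_map (proj_lim I T) (T' j) (\<lambda>c. c)" if "j \<in> J" for j
  proof -
    obtain i where i: "i \<in> I" "continuous_map (T i) (T' j) (\<lambda>c. c)" using cont[OF \<open>j \<in> J\<close>] by blast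
    from continuous_map_compose[OF continuous_map_proj_lim[where T = T, OF i(1)] i(2)] show ?thesis by (simp add: o_def)
  qed
  then have sub: "topspace (proj_lim I T) \<subseteq> (\<Inter>j\<in>J. topspace (T' j))"
    by (auto simp: continuous_map_def)
  show ?thesis
    unfolding proj_lim_def[of J]
  proof (rule continuous_on_generated_topo)
    fix U assume "U \<in> (\<Union>i\<in>J. {U \<inter> (\<Inter>j\<in>J. topspace (T' j)) |U. openin (T' i) U})"
    then obtain j V where j: "j \<in> J" "openin (T' j) V" "U = V \<inter> (\<Inter>j\<in>J. topspace (T' j))" by blast
    have "openin (proj_lim I T) {x \<in> topspace (proj_lim I T). x \<in> V}"
      using c[OF j(1)] j(2) by (auto simp: continuous_map_def)
    moreover have "(\<lambda>c. c) -` U \<inter> topspace (proj_lim I T) = {x \<in> topspace (proj_lim I T). x \<in> V}"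
      using j(3) sub by auto
    ultimately show "openin (proj_lim I T) ((\<lambda>c. c) -` U \<inter> topspace (proj_lim I T))" by simp
  next
    obtain j where j: "j \<in> J" using assms(2) by blast
    have "topspace (T' j) \<inter> (\<Inter>j\<in>J. topspace (T' j)) \<in> (\<Union>i\<in>J. {U \<inter> (\<Inter>j\<in>J. topspace (T' j)) |U. openin (T' i) U})"
      using j by blast
    then show "(\<lambda>c. c) ` topspace (proj_lim I T) \<subseteq> \<Union> (\<Union>i\<in>J. {U \<inter> (\<Inter>j\<in>J. topspace (T' j)) |U. openin (T' i) U})"
      using sub j by blast
  qed
qed

lemma ind_lim_id_continuous:
  fixes T :: "'i \<Rightarrow> ('x \<Rightarrow> complex) topology" and T' :: "'j \<Rightarrow> ('x \<Rightarrow> complex) topology"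
  assumes lin: "solid_space (\<Union>i\<in>I. topspace (T i))" "solid_space (\<Union>j\<in>J. topspace (T' j))"
    and zero: "\<And>i. i \<in> I \<Longrightarrow> (\<lambda>_. 0) \<in> topspace (T i)" "\<And>j. j \<in> J \<Longrightarrow> (\<lambda>_. 0) \<in> topspace (T' j)"
    and cont: "\<And>i. i \<in> I \<Longrightarrow> \<exists>j\<in>J. continuous_map (T i) (T' j) (\<lambda>c. c)"
  shows "continuous_map (ind_lim I T) (ind_lim J T') (\<lambda>c. c)"
proof -
  let ?X = "\<Union>i\<in>I. topspace (T i)" and ?Y = "\<Union>j\<in>J. topspace (T' j)"
  have X: "topspace (ind_lim I T) = ?X"
    by (rule topspace_ind_lim) (fact solid_space_lin[OF lin(1)], fact zero(1))
  have Y: "topspace (ind_lim J T') = ?Y"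
    by (rule topspace_ind_lim) (fact solid_space_lin[OF lin(2)], fact zero(2))
  have sub: "?X \<subseteq> ?Y"
  proof
    fix c assume "c \<in> ?X"
    then obtain i where i: "i \<in> I" "c \<in> topspace (T i)" by blast
    obtain j where "j \<in> J" "continuous_map (T i) (T' j) (\<lambda>c. c)" using cont[OF i(1)] by blast
    then show "c \<in> ?Y" using i(2) by (auto simp: continuous_map_def)
  qed
  have nhd: "ind_nhd I T (V \<inter> ?X)" if V: "ind_nhd J T' V" for V
    unfolding ind_nhd_def
  proof (intro conjI ballI)
    show "abs_convex (V \<inter> ?X)"
      using V solid_space_abs_convex[OF lin(1)] abs_convex_Int unfolding ind_nhd_def by blast
    fix i assume i: "i \<in> I"
    obtain j where j: "j \<in> J" "continuous_map (T i) (T' j) (\<lambda>c. c)" using cont[OF i] by blast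
    obtain U where U: "openin (T' j) U" "(\<lambda>_. 0) \<in> U" "U \<subseteq> V"
    proof -
      have "\<exists>U. openin (T' j) U \<and> (\<lambda>_. 0) \<in> U \<and> U \<subseteq> V" using V j(1) by (simp add: ind_nhd_def)
      then show thesis using that by metis
    qed
    have "openin (T i) {c \<in> topspace (T i). c \<in> U}" using j(2) U(1) by (auto simp: continuous_map_def)
    moreover have "(\<lambda>_. 0) \<in> {c \<in> topspace (T i). c \<in> U}" using zero(1)[OF i] U by simp
    moreover have "{c \<in> topspace (T i). c \<in> U} \<subseteq> V \<inter> ?X" using U i by blast
    ultimately show "\<exists>U. openin (T i) U \<and> (\<lambda>_. 0) \<in> U \<and> U \<subseteq> V \<inter> ?X" by metis
  qed auto
  have "ind_open I T {c \<in> ?X. c \<in> U}" if U: "ind_open J T' U" for U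
    unfolding ind_open_def
  proof (intro conjI ballI)
    fix c assume c: "c \<in> {c \<in> ?X. c \<in> U}"
    then have "\<exists>V. ind_nhd J T' V \<and> (\<forall>v\<in>V. (\<lambda>x. c x + v x) \<in> U)" using U unfolding ind_open_def by simp
    then obtain V where V: "ind_nhd J T' V" "\<forall>v\<in>V. (\<lambda>x. c x + v x) \<in> U" by metis
    have "(\<lambda>x. c x + v x) \<in> {c \<in> ?X. c \<in> U}" if "v \<in> V \<inter> ?X" for v
      using solid_space_add[OF lin(1), of c v] c V(2) that by auto
    then show "\<exists>V. ind_nhd I T V \<and> (\<forall>v\<in>V. (\<lambda>x. c x + v x) \<in> {c \<in> ?X. c \<in> U})"
      by (intro exI[of _ "V \<inter> ?X"] conjI ballI nhd[OF V(1)])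
  qed auto
  then show ?thesis
    using sub unfolding continuous_map_def X Y openin_ind_lim by auto
qed

lemma solid_space_UN:
  assumes "J \<noteq> {}" "\<And>j. j \<in> J \<Longrightarrow> solid_space (L j)"
    and "\<And>i j. i \<in> J \<Longrightarrow> j \<in> J \<Longrightarrow> \<exists>k\<in>J. L i \<union> L j \<subseteq> L k"
  shows "solid_space (\<Union>j\<in>J. L j)"
  unfolding solid_space_def
proof (intro conjI ballI allI)
  show "(\<lambda>_. 0) \<in> (\<Union>j\<in>J. L j)"
    using assms(1,2) solid_space_zero by blast
  show "solid (\<Union>j\<in>J. L j)"
    using solid_space_solid[OF assms(2)] unfolding solid_def by blast
  fix c d a b assume "c \<in> (\<Union>j\<in>J. L j)" "d \<in> (\<Union>j\<in>J. L j)"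
  then obtain i j where "i \<in> J" "j \<in> J" "c \<in> L i" "d \<in> L j" by blast
  with assms(3)[of i j] obtain k where "k \<in> J" "c \<in> L k" "d \<in> L k" by blast
  then show "(\<lambda>x. a * c x + b * d x) \<in> (\<Union>j\<in>J. L j)"
    using solid_space_lin[OF assms(2)] by blast
qed

lemma wspace_antimono: "0 < p \<Longrightarrow> (\<And>x. w x \<le> w' x) \<Longrightarrow> wspace p w' \<subseteq> wspace p w"
proof -
  assume p: "0 < p" and le: "\<And>x. w x \<le> w' x"
  have "wnorm p w c \<le> wnorm p w' c" for c by (intro wnorm_mono[OF p] mult_left_mono le) simp
  then show ?thesis unfolding wspace_def using le_less_trans by blast
qed

lemma solid_space_wspace_UN:
  assumes p: "0 < p" and "J \<noteq> {}"
    and chain: "\<And>i j. i \<in> J \<Longrightarrow> j \<in> J \<Longrightarrow> (\<forall>x. W i x \<le> W j x) \<or> (\<forall>x. W j x \<le> W i x)"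
  shows "solid_space (\<Union>j\<in>J. wspace p (W j))"
proof (rule solid_space_UN[OF assms(2)])
  show "\<exists>k\<in>J. wspace p (W i) \<union> wspace p (W j) \<subseteq> wspace p (W k)" if "i \<in> J" "j \<in> J" for i j
    using chain[OF that] wspace_antimono[OF p, of "W i" "W j"] wspace_antimono[OF p, of "W j" "W i"] that
    by (metis Un_subset_iff order_refl)
qed (rule solid_space_wspace_p[OF p])

context weight_grid
begin

text \<open>The pointwise inequality \<open>le\<close> embeds the steps of exponent \<open>p\<close>
  into sup-normed ones, and \<open>nuc\<close> embeds back after a summable loss. Thus both the
  exponent and the real parameters are eliminated, leaving a sup-normed grid over the natural
  numbers.\<close>

lemma proj_ind_eq:
  fixes W :: "'r \<Rightarrow> 's \<Rightarrow> 'x \<Rightarrow> ennreal"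
  assumes p: "0 < p" and ne: "R \<noteq> {}" "S \<noteq> {}"
    and chain: "\<And>r s s'. r \<in> R \<Longrightarrow> s \<in> S \<Longrightarrow> s' \<in> S \<Longrightarrow> (\<forall>x. W r s x \<le> W r s' x) \<or> (\<forall>x. W r s' x \<le> W r s x)"
    and le: "\<And>i. \<exists>r\<in>R. \<forall>s\<in>S. \<exists>j. \<forall>x. w i j x \<le> W r s x"
    and nuc: "\<And>r. r \<in> R \<Longrightarrow> \<exists>i. \<forall>j. \<exists>s\<in>S. summably_below (W r s) (w i j)"
  shows "proj_lim R (\<lambda>r. ind_lim S (\<lambda>s. wtop p (W r s))) = proj_ind w"
proof (rule topology_eq_id)
  have lin: "solid_space (\<Union>s\<in>S. topspace (wtop p (W r s)))" if "r \<in> R" for r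
    unfolding topspace_wtop by (rule solid_space_wspace_UN[OF p ne(2) chain[OF that]])
  have zero: "(\<lambda>_. 0) \<in> topspace (wtop q v)" if "0 < q" for q and v :: "'x \<Rightarrow> ennreal"
    unfolding topspace_wtop by (rule solid_space_zero[OF solid_space_wspace_p[OF that]])
  show "continuous_map (proj_lim R (\<lambda>r. ind_lim S (\<lambda>s. wtop p (W r s)))) (proj_ind w) (\<lambda>c. c)"
    unfolding proj_ind_def
  proof (rule proj_lim_id_continuous[OF ne(1) UNIV_not_empty])
    fix i :: nat
    obtain r where r: "r \<in> R" "\<And>s. s \<in> S \<Longrightarrow> \<exists>j. \<forall>x. w i j x \<le> W r s x" using le by metis
    have "continuous_map (ind_lim S (\<lambda>s. wtop p (W r s))) (ind_lim UNIV (\<lambda>j. wtop top (w i j))) (\<lambda>c. c)"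
    proof (rule ind_lim_id_continuous[OF lin[OF r(1)] ind.space zero[OF p] zero])
      fix s assume "s \<in> S"
      then obtain j where "\<And>x. w i j x \<le> W r s x" using r(2) by metis
      then show "\<exists>j\<in>UNIV. continuous_map (wtop p (W r s)) (wtop top (w i j)) (\<lambda>c. c)"
        using wtop_p_to_top[OF p] by blast
    qed simp
    then show "\<exists>r\<in>R. continuous_map (ind_lim S (\<lambda>s. wtop p (W r s))) (ind_lim UNIV (\<lambda>j. wtop top (w i j))) (\<lambda>c. c)"
      using r(1) by blast
  qed
  show "continuous_map (proj_ind w) (proj_lim R (\<lambda>r. ind_lim S (\<lambda>s. wtop p (W r s)))) (\<lambda>c. c)"
    unfolding proj_ind_def
  proof (rule proj_lim_id_continuous[OF UNIV_not_empty ne(1)])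
    fix r assume r: "r \<in> R"
    obtain i where i: "\<And>j. \<exists>s\<in>S. summably_below (W r s) (w i j)" using nuc[OF r] by metis
    have "continuous_map (ind_lim UNIV (\<lambda>j. wtop top (w i j))) (ind_lim S (\<lambda>s. wtop p (W r s))) (\<lambda>c. c)"
    proof (rule ind_lim_id_continuous[OF ind.space lin[OF r] zero zero[OF p]])
      fix j :: nat
      show "\<exists>s\<in>S. continuous_map (wtop top (w i j)) (wtop p (W r s)) (\<lambda>c. c)"
        using i[of j] wtop_top_to_p[OF p] by blast
    qed simp
    then show "\<exists>i\<in>UNIV. continuous_map (ind_lim UNIV (\<lambda>j. wtop top (w i j))) (ind_lim S (\<lambda>s. wtop p (W r s))) (\<lambda>c. c)"
      by blast
  qed
qed

lemma proj_lim_eq: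
  fixes W :: "'r \<Rightarrow> 'x \<Rightarrow> ennreal"
  assumes p: "0 < p" and ne: "R \<noteq> {}" and const: "\<And>i j. w i j = w i 0"
    and le: "\<And>i. \<exists>r\<in>R. \<forall>x. w i 0 x \<le> W r x"
    and nuc: "\<And>r. r \<in> R \<Longrightarrow> \<exists>i. summably_below (W r) (w i 0)"
  shows "proj_lim R (\<lambda>r. wtop p (W r)) = proj_lim UNIV (\<lambda>i. wtop top (w i 0))"
proof (rule topology_eq_id)
  show "continuous_map (proj_lim R (\<lambda>r. wtop p (W r))) (proj_lim UNIV (\<lambda>i. wtop top (w i 0))) (\<lambda>c. c)"
    by (rule proj_lim_id_continuous[OF ne UNIV_not_empty]) (use le wtop_p_to_top[OF p] in metis)
  show "continuous_map (proj_lim UNIV (\<lambda>i. wtop top (w i 0))) (proj_lim R (\<lambda>r. wtop p (W r))) (\<lambda>c. c)"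
    by (rule proj_lim_id_continuous[OF UNIV_not_empty ne]) (use nuc wtop_top_to_p[OF p] in blast)
qed

lemma ind_proj_eq:
  fixes W :: "'r \<Rightarrow> 's \<Rightarrow> 'x \<Rightarrow> ennreal"
  assumes p: "0 < p" and ne: "R \<noteq> {}" "S \<noteq> {}"
    and chain: "\<And>s s'. s \<in> S \<Longrightarrow> s' \<in> S \<Longrightarrow> (\<forall>r\<in>R. \<forall>x. W r s x \<le> W r s' x) \<or> (\<forall>r\<in>R. \<forall>x. W r s' x \<le> W r s x)"
    and le: "\<And>s. s \<in> S \<Longrightarrow> \<exists>j. \<forall>i. \<exists>r\<in>R. \<forall>x. w i j x \<le> W r s x"
    and nuc: "\<And>j. \<exists>s\<in>S. \<forall>r\<in>R. \<exists>i. summably_below (W r s) (w i j)"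
  shows "ind_lim S (\<lambda>s. proj_lim R (\<lambda>r. wtop p (W r s))) = ind_proj w"
proof (rule topology_eq_id)
  have ts: "topspace (proj_lim R (\<lambda>r. wtop p (W r s))) = (\<Inter>r\<in>R. wspace p (W r s))" for s
    unfolding topspace_proj_lim[OF ne(1)] topspace_wtop ..
  have sp: "solid_space (\<Inter>r\<in>R. wspace p (W r s))" for s
    by (rule solid_space_INT) (rule solid_space_wspace_p[OF p])
  have lin: "solid_space (\<Union>s\<in>S. topspace (proj_lim R (\<lambda>r. wtop p (W r s))))"
    unfolding ts
  proof (rule solid_space_UN[OF ne(2) sp])
    fix s s' assume s: "s \<in> S" "s' \<in> S"
    show "\<exists>k\<in>S. (\<Inter>r\<in>R. wspace p (W r s)) \<union> (\<Inter>r\<in>R. wspace p (W r s')) \<subseteq> (\<Inter>r\<in>R. wspace p (W r k))"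
      using chain[OF s]
    proof
      assume "\<forall>r\<in>R. \<forall>x. W r s x \<le> W r s' x"
      then have "\<And>r. r \<in> R \<Longrightarrow> wspace p (W r s') \<subseteq> wspace p (W r s)" by (intro wspace_antimono[OF p]) simp
      then show ?thesis using s by (intro bexI[of _ s]) (simp_all add: le_INF_iff INF_lower2)
    next
      assume "\<forall>r\<in>R. \<forall>x. W r s' x \<le> W r s x"
      then have "\<And>r. r \<in> R \<Longrightarrow> wspace p (W r s) \<subseteq> wspace p (W r s')" by (intro wspace_antimono[OF p]) simp
      then show ?thesis using s by (intro bexI[of _ s']) (simp_all add: le_INF_iff INF_lower2)
    qed
  qed
  have zero: "(\<lambda>_. 0) \<in> topspace (proj_lim R (\<lambda>r. wtop p (W r s)))" for s
    unfolding ts by (rule solid_space_zero[OF sp])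
  have zero': "(\<lambda>_. 0) \<in> topspace (proj_lim UNIV (\<lambda>i. wtop top (w i j)))" for j
    by (rule solid_space_zero[OF solid_lcs.space[OF proj.proj_lcs]])
  show "continuous_map (ind_lim S (\<lambda>s. proj_lim R (\<lambda>r. wtop p (W r s)))) (ind_proj w) (\<lambda>c. c)"
    unfolding ind_proj_def
  proof (rule ind_lim_id_continuous[OF lin ind_proj.space zero zero'])
    fix s assume "s \<in> S"
    then obtain j where j: "\<And>i. \<exists>r\<in>R. \<forall>x. w i j x \<le> W r s x" using le by metis
    have "continuous_map (proj_lim R (\<lambda>r. wtop p (W r s))) (proj_lim UNIV (\<lambda>i. wtop top (w i j))) (\<lambda>c. c)"
      by (rule proj_lim_id_continuous[OF ne(1) UNIV_not_empty]) (use j wtop_p_to_top[OF p] in metis)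
    then show "\<exists>j\<in>UNIV. continuous_map (proj_lim R (\<lambda>r. wtop p (W r s))) (proj_lim UNIV (\<lambda>i. wtop top (w i j))) (\<lambda>c. c)"
      by blast
  qed
  show "continuous_map (ind_proj w) (ind_lim S (\<lambda>s. proj_lim R (\<lambda>r. wtop p (W r s)))) (\<lambda>c. c)"
    unfolding ind_proj_def
  proof (rule ind_lim_id_continuous[OF ind_proj.space lin zero' zero])
    fix j :: nat
    obtain s where s: "s \<in> S" "\<And>r. r \<in> R \<Longrightarrow> \<exists>i. summably_below (W r s) (w i j)" using nuc by metis
    have "continuous_map (proj_lim UNIV (\<lambda>i. wtop top (w i j))) (proj_lim R (\<lambda>r. wtop p (W r s))) (\<lambda>c. c)"
      by (rule proj_lim_id_continuous[OF UNIV_not_empty ne(1)]) (use s wtop_top_to_p[OF p] in blast)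
    then show "\<exists>s\<in>S. continuous_map (proj_lim UNIV (\<lambda>i. wtop top (w i j))) (proj_lim R (\<lambda>r. wtop p (W r s))) (\<lambda>c. c)"
      using s(1) by blast
  qed
qed

end

section \<open>The kernel of the twisted product\<close>

lemma summable_on_pair_prod:
  fixes f :: "'a \<Rightarrow> real" and g :: "'b \<Rightarrow> real"
  assumes "\<And>x. 0 \<le> f x" "\<And>y. 0 \<le> g y" "f summable_on UNIV" "g summable_on UNIV"
  shows "(\<lambda>(x, y). f x * g y) summable_on UNIV"
proof -
  have "(\<lambda>(x, y). f x * g y) summable_on UNIV \<times> UNIV"
  proof (rule summable_on_SigmaI)
    show "((\<lambda>y. case (x, y) of (x, y) \<Rightarrow> f x * g y) has_sum f x * infsum g UNIV) UNIV" for x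
      using has_sum_cmult_right[OF has_sum_infsum[OF assms(4)]] by simp
    show "(\<lambda>x. f x * infsum g UNIV) summable_on UNIV"
      by (rule summable_on_cmult_left[OF assms(3)])
  qed (use assms in auto)
  then show ?thesis by simp
qed

lemma has_sum_pair_prod:
  fixes f :: "'a \<Rightarrow> complex" and g :: "'b \<Rightarrow> complex"
  assumes f: "(\<lambda>x. cmod (f x)) summable_on UNIV" "(f has_sum F) UNIV"
    and g: "(\<lambda>y. cmod (g y)) summable_on UNIV" "(g has_sum G) UNIV"
  shows "(\<lambda>(x, y). cmod (f x * g y)) summable_on UNIV" "((\<lambda>(x, y). f x * g y) has_sum F * G) UNIV"
proof -
  show s: "(\<lambda>(x, y). cmod (f x * g y)) summable_on UNIV"
    using summable_on_pair_prod[OF _ _ f(1) g(1)] by (simp add: norm_mult)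
  have "(\<lambda>p. cmod (case p of (x, y) \<Rightarrow> f x * g y)) summable_on UNIV"
    using s by (simp add: case_prod_unfold)
  then have s': "(\<lambda>(x, y). f x * g y) summable_on UNIV \<times> UNIV"
    using abs_summable_summable by force
  have "infsum (\<lambda>(x, y). f x * g y) (UNIV \<times> UNIV) = (\<Sum>\<^sub>\<infinity>x. \<Sum>\<^sub>\<infinity>y. f x * g y)"
    using infsum_Sigma'_banach[OF s'] by simp
  also have "\<dots> = (\<Sum>\<^sub>\<infinity>x. f x * G)"
    by (rule infsum_cong) (use infsumI[OF has_sum_cmult_right[OF g(2)]] in blast)
  also have "\<dots> = F * G" by (rule infsumI[OF has_sum_cmult_left[OF f(2)]])
  finally show "((\<lambda>(x, y). f x * g y) has_sum F * G) UNIV"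
    using has_sum_infsum[OF s'] by simp
qed

lemma bij_vec_nth: "bij_betw vec_nth (UNIV :: ('a ^ 'n::finite) set) UNIV"
  by (rule bij_betwI[where g = vec_lambda]) auto

lemma finite_vec_box: "finite {\<alpha> :: nat ^ 'n::finite. \<forall>j. \<alpha> $ j \<le> N}"
proof -
  have "vec_nth ` {\<alpha> :: nat ^ 'n. \<forall>j. \<alpha> $ j \<le> N} \<subseteq> PiE UNIV (\<lambda>_. {..N})" by auto
  then have "finite (vec_nth ` {\<alpha> :: nat ^ 'n. \<forall>j. \<alpha> $ j \<le> N})"
    by (rule finite_subset) (simp add: finite_PiE)
  then show ?thesis
    by (rule finite_imageD) (auto simp: inj_on_def vec_eq_iff)
qed

text \<open>Every finite set of multi-indices lies in a box, and over a box the sum of products is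
  the product of one-dimensional sums.\<close>

lemma summable_on_vec_prod:
  fixes f :: "'n::finite \<Rightarrow> nat \<Rightarrow> real"
  assumes nn: "\<And>j k. 0 \<le> f j k" and s: "\<And>j. f j summable_on UNIV"
  shows "(\<lambda>\<alpha> :: nat ^ 'n. \<Prod>j\<in>UNIV. f j (\<alpha> $ j)) summable_on UNIV"
proof (rule nonneg_bdd_above_summable_on)
  show "bdd_above (sum (\<lambda>\<alpha> :: nat ^ 'n. \<Prod>j\<in>UNIV. f j (\<alpha> $ j)) ` {F. F \<subseteq> UNIV \<and> finite F})"
  proof (rule bdd_aboveI)
    fix x assume "x \<in> sum (\<lambda>\<alpha> :: nat ^ 'n. \<Prod>j\<in>UNIV. f j (\<alpha> $ j)) ` {F. F \<subseteq> UNIV \<and> finite F}"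
    then obtain F :: "(nat ^ 'n) set" where F: "finite F" "x = (\<Sum>\<alpha>\<in>F. \<Prod>j\<in>UNIV. f j (\<alpha> $ j))" by auto
    define N where "N = Max (insert 0 ((\<lambda>(\<alpha>, j). \<alpha> $ j) ` (F \<times> UNIV)))"
    let ?B = "{\<alpha> :: nat ^ 'n. \<forall>j. \<alpha> $ j \<le> N}"
    have "\<alpha> $ j \<le> N" if "\<alpha> \<in> F" for \<alpha> j
      unfolding N_def using F(1) that by (intro Max_ge) force+
    then have "F \<subseteq> ?B" by auto
    then have "x \<le> (\<Sum>\<alpha>\<in>?B. \<Prod>j\<in>UNIV. f j (\<alpha> $ j))"
      unfolding F(2) using nn by (intro sum_mono2 finite_vec_box prod_nonneg) auto
    also have "\<dots> = (\<Sum>g\<in>PiE UNIV (\<lambda>_. {..N}). \<Prod>j\<in>UNIV. f j (g j))"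
    proof (rule sum.reindex_bij_betw)
      show "bij_betw vec_nth ?B (PiE UNIV (\<lambda>_. {..N}))"
        by (rule bij_betwI[where g = vec_lambda]) auto
    qed
    also have "\<dots> = (\<Prod>j\<in>UNIV. \<Sum>k\<in>{..N}. f j k)"
      by (rule prod_sum_PiE[symmetric]) auto
    also have "\<dots> \<le> (\<Prod>j\<in>UNIV. infsum (f j) UNIV)"
      using nn s by (intro prod_mono conjI sum_nonneg finite_sum_le_infsum) auto
    finally show "x \<le> (\<Prod>j\<in>UNIV. infsum (f j) UNIV)" .
  qed
qed (use nn in \<open>auto intro: prod_nonneg\<close>)

lemma has_sum_vec_prod:
  fixes f :: "'n::finite \<Rightarrow> nat \<Rightarrow> complex"
  assumes s: "\<And>j. (\<lambda>k. cmod (f j k)) summable_on UNIV"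
  shows "(\<lambda>\<alpha> :: nat ^ 'n. cmod (\<Prod>j\<in>UNIV. f j (\<alpha> $ j))) summable_on UNIV"
    and "((\<lambda>\<alpha> :: nat ^ 'n. \<Prod>j\<in>UNIV. f j (\<alpha> $ j)) has_sum (\<Prod>j\<in>UNIV. infsum (f j) UNIV)) UNIV"
proof -
  show 1: "(\<lambda>\<alpha> :: nat ^ 'n. cmod (\<Prod>j\<in>UNIV. f j (\<alpha> $ j))) summable_on UNIV"
    using summable_on_vec_prod[OF _ s] by (simp add: prod_norm[symmetric])
  then have 2: "(\<lambda>\<alpha> :: nat ^ 'n. \<Prod>j\<in>UNIV. f j (\<alpha> $ j)) summable_on UNIV"
    using abs_summable_summable by force
  have 3: "(\<lambda>g. \<Prod>j\<in>UNIV. f j (g j)) summable_on UNIV"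
    using 2 summable_on_reindex_bij_betw[OF bij_vec_nth, of "\<lambda>g. \<Prod>j\<in>UNIV. f j (g j)"] by simp
  have "infsum (\<lambda>\<alpha> :: nat ^ 'n. \<Prod>j\<in>UNIV. f j (\<alpha> $ j)) UNIV = infsum (\<lambda>g. \<Prod>j\<in>UNIV. f j (g j)) UNIV"
    using infsum_reindex_bij_betw[OF bij_vec_nth, of "\<lambda>g. \<Prod>j\<in>UNIV. f j (g j)"] by simp
  also have "\<dots> = infsum (\<lambda>g. \<Prod>j\<in>UNIV. f j (g j)) (PiE UNIV (\<lambda>_. UNIV))" by simp
  also have "\<dots> = (\<Prod>j\<in>UNIV. infsum (f j) UNIV)"
    by (rule infsum_prod_PiE) (use 3 s abs_summable_summable in force)+
  finally show "((\<lambda>\<alpha> :: nat ^ 'n. \<Prod>j\<in>UNIV. f j (\<alpha> $ j)) has_sum (\<Prod>j\<in>UNIV. infsum (f j) UNIV)) UNIV"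
    using has_sum_infsum[OF 2] by simp
qed

lemma midx_abs_add: "midx_abs (\<alpha> + \<beta>) = midx_abs \<alpha> + midx_abs \<beta>"
  by (simp add: midx_abs_def sum.distrib)

lemma midx_abs_0 [simp]: "midx_abs 0 = 0"
  by (simp add: midx_abs_def)

lemma summable_on_power_midx:
  assumes "0 \<le> (x::real)" "x < 1"
  shows "(\<lambda>\<alpha> :: nat ^ 'n::finite. x ^ midx_abs \<alpha>) summable_on UNIV"
proof -
  have "(\<lambda>k. x ^ k) summable_on UNIV"
    using assms by (subst summable_on_UNIV_nonneg_real_iff) (auto intro: summable_geometric)
  then have "(\<lambda>\<alpha> :: nat ^ 'n. \<Prod>j\<in>UNIV. x ^ (\<alpha> $ j)) summable_on UNIV"
    using assms by (intro summable_on_vec_prod) auto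
  then show ?thesis by (simp add: midx_abs_def power_sum)
qed

section \<open>The coefficients of the twisted product and their size\<close>

definition vbin :: "nat ^ 'n::finite \<Rightarrow> nat ^ 'n \<Rightarrow> real" where
  "vbin \<alpha> \<beta> = (\<Prod>i\<in>UNIV. real (\<alpha> $ i choose \<beta> $ i))"

lemma vbin_nonneg: "0 \<le> vbin \<alpha> \<beta>"
  by (simp add: vbin_def prod_nonneg)

lemma vbin_le: "vbin \<alpha> \<beta> \<le> 2 ^ midx_abs \<alpha>"
proof -
  have "real (a choose b) \<le> 2 ^ a" for a b
    using binomial_le_pow2[of a b] by (metis of_nat_le_iff of_nat_numeral of_nat_power)
  then have "vbin \<alpha> \<beta> \<le> (\<Prod>i\<in>UNIV. 2 ^ (\<alpha> $ i))"
    unfolding vbin_def by (intro prod_mono) auto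
  then show ?thesis by (simp add: midx_abs_def power_sum)
qed

text \<open>The coefficients of the twisted product are indexed by \<open>(\<gamma>, \<alpha>', \<beta>')\<close>: \<open>\<gamma>\<close> is the order of the
  contraction of the \<open>w\<^sup>*\<close>-variables of the first factor with the \<open>z\<close>-variables of the second one, and
  \<open>\<alpha>'\<close>, \<open>\<beta>'\<close> are the shares of the first factor in the remaining exponents.\<close>

fun tw_coeff :: "(nat ^ 'n::finite) \<times> (nat ^ 'n) \<Rightarrow> (nat ^ 'n) \<times> (nat ^ 'n) \<times> (nat ^ 'n) \<Rightarrow> real" where
  "tw_coeff (\<alpha>, \<beta>) (\<gamma>, \<alpha>', \<beta>') = (if \<alpha>' \<le> \<alpha> \<and> \<beta>' \<le> \<beta>
     then sqrt (vbin (\<beta>' + \<gamma>) \<gamma> * vbin (\<alpha> - \<alpha>' + \<gamma>) \<gamma> * vbin \<alpha> \<alpha>' * vbin \<beta> \<beta>') else 0)"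

fun tw_left :: "(nat ^ 'n::finite) \<times> (nat ^ 'n) \<Rightarrow> (nat ^ 'n) \<times> (nat ^ 'n) \<times> (nat ^ 'n) \<Rightarrow> (nat ^ 'n) \<times> (nat ^ 'n)" where
  "tw_left (\<alpha>, \<beta>) (\<gamma>, \<alpha>', \<beta>') = (\<alpha>', \<beta>' + \<gamma>)"

fun tw_right :: "(nat ^ 'n::finite) \<times> (nat ^ 'n) \<Rightarrow> (nat ^ 'n) \<times> (nat ^ 'n) \<times> (nat ^ 'n) \<Rightarrow> (nat ^ 'n) \<times> (nat ^ 'n)" where
  "tw_right (\<alpha>, \<beta>) (\<gamma>, \<alpha>', \<beta>') = (\<alpha> - \<alpha>' + \<gamma>, \<beta> - \<beta>')"

interpretation tw: positive_kernel tw_coeff tw_left tw_right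
proof
  show "0 \<le> tw_coeff z t" for z :: "(nat ^ 'n) \<times> (nat ^ 'n)" and t
    by (cases "(z, t)" rule: tw_coeff.cases) (auto simp: vbin_nonneg)
qed

lemma vec_diff_add: "\<alpha>' \<le> \<alpha> \<Longrightarrow> \<alpha>' + (\<alpha> - \<alpha>') = (\<alpha> :: nat ^ 'n::finite)"
  by (simp add: vec_eq_iff less_eq_vec_def)

text \<open>Each of the four binomials is at most 2 to its upper index. The upper indices add up to
  at most twice the total degree, because the degrees of \<open>\<beta>'\<close> and
  \<open>\<alpha> - \<alpha>'\<close> together are at most those of \<alpha> and \<beta>; the square
  root removes the factor 2.\<close>

lemma tw_coeff_le: "tw_coeff (\<alpha>, \<beta>) (\<gamma>, \<alpha>', \<beta>') \<le> 2 ^ (midx_abs \<alpha> + midx_abs \<beta> + midx_abs \<gamma>)"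
proof (cases "\<alpha>' \<le> \<alpha> \<and> \<beta>' \<le> \<beta>")
  case True
  have a: "midx_abs \<alpha> = midx_abs \<alpha>' + midx_abs (\<alpha> - \<alpha>')" "midx_abs \<beta> = midx_abs \<beta>' + midx_abs (\<beta> - \<beta>')"
    using True by (metis midx_abs_add vec_diff_add)+
  have "vbin (\<beta>' + \<gamma>) \<gamma> * vbin (\<alpha> - \<alpha>' + \<gamma>) \<gamma> * vbin \<alpha> \<alpha>' * vbin \<beta> \<beta>' \<le>
      2 ^ midx_abs (\<beta>' + \<gamma>) * 2 ^ midx_abs (\<alpha> - \<alpha>' + \<gamma>) * 2 ^ midx_abs \<alpha> * 2 ^ midx_abs \<beta>"
    by (intro mult_mono vbin_le mult_nonneg_nonneg vbin_nonneg) auto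
  also have "\<dots> = 2 ^ (midx_abs (\<beta>' + \<gamma>) + midx_abs (\<alpha> - \<alpha>' + \<gamma>) + midx_abs \<alpha> + midx_abs \<beta>)"
    by (simp add: power_add)
  also have "\<dots> \<le> 2 ^ (2 * (midx_abs \<alpha> + midx_abs \<beta> + midx_abs \<gamma>))"
    using a by (intro power_increasing) (auto simp: midx_abs_add)
  also have "\<dots> = (2 ^ (midx_abs \<alpha> + midx_abs \<beta> + midx_abs \<gamma>))\<^sup>2"
    by (simp add: power_mult[symmetric] mult.commute)
  finally have "tw_coeff (\<alpha>, \<beta>) (\<gamma>, \<alpha>', \<beta>') \<le> sqrt ((2 ^ (midx_abs \<alpha> + midx_abs \<beta> + midx_abs \<gamma>))\<^sup>2)"
    using True by (simp only: tw_coeff.simps if_True real_sqrt_le_iff simp_thms)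
  then show ?thesis by simp
qed auto

text \<open>The kernel is at most \<open>2\<close> to the total degree. Hence the factor \<open>4\<close> to the total degree absorbs the kernel
  and leaves a geometric factor for summation. The arguments of the weights are \<open>tw_left\<close> and
  \<open>tw_right\<close>, with the exponents \<open>(\<alpha>, \<beta>)\<close> of the product written as sums so that no subtraction occurs.\<close>

definition weight_est :: "((nat ^ 'n::finite) \<times> (nat ^ 'n) \<Rightarrow> ennreal) \<Rightarrow> ((nat ^ 'n) \<times> (nat ^ 'n) \<Rightarrow> ennreal) \<Rightarrow>
    ((nat ^ 'n) \<times> (nat ^ 'n) \<Rightarrow> ennreal) \<Rightarrow> bool" where
  "weight_est w1 w2 w3 \<longleftrightarrow> (\<exists>C\<ge>0. \<forall>\<alpha>1 \<alpha>2 \<beta>1 \<beta>2 \<gamma>.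
     ennreal (4 ^ (midx_abs \<alpha>1 + midx_abs \<alpha>2 + midx_abs \<beta>1 + midx_abs \<beta>2 + midx_abs \<gamma>)) *
       (w3 (\<alpha>1 + \<alpha>2, \<beta>1 + \<beta>2) * (inverse (w1 (\<alpha>1, \<beta>1 + \<gamma>)) * inverse (w2 (\<alpha>2 + \<gamma>, \<beta>2)))) \<le> ennreal C)"

text \<open>With \<open>N\<close> the total degree, the kernel is at most
  \<open>2 ^ N = (1/2) ^ N * 4 ^ N\<close>. The factor \<open>4 ^ N\<close> goes into the
  hypothesis, and \<open>(1/2) ^ N\<close> is at most the summable function \<open>r\<close> of the
  summation index.\<close>

lemma weight_est_imp_est:
  fixes w1 :: "(nat ^ 'n::finite) \<times> (nat ^ 'n) \<Rightarrow> ennreal"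
  assumes "weight_est w1 w2 w3" shows "tw.est w1 w2 w3"
proof -
  obtain C where C: "C \<ge> 0" "\<And>\<alpha>1 \<alpha>2 \<beta>1 \<beta>2 \<gamma>.
     ennreal (4 ^ (midx_abs \<alpha>1 + midx_abs \<alpha>2 + midx_abs \<beta>1 + midx_abs \<beta>2 + midx_abs \<gamma>)) *
       (w3 (\<alpha>1 + \<alpha>2, \<beta>1 + \<beta>2) * (inverse (w1 (\<alpha>1, \<beta>1 + \<gamma>)) * inverse (w2 (\<alpha>2 + \<gamma>, \<beta>2)))) \<le> ennreal C"
    using assms unfolding weight_est_def by metis
  define q :: "nat ^ 'n \<Rightarrow> real" where "q \<alpha> = (1/2) ^ midx_abs \<alpha>" for \<alpha>
  define r :: "(nat ^ 'n) \<times> (nat ^ 'n) \<times> (nat ^ 'n) \<Rightarrow> real" where "r = (\<lambda>(\<gamma>, \<alpha>', \<beta>'). q \<gamma> * (q \<alpha>' * q \<beta>'))"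
  have q: "q summable_on UNIV" unfolding q_def by (rule summable_on_power_midx) auto
  have q0: "q \<alpha> \<ge> 0" for \<alpha> by (simp add: q_def)
  have "(\<lambda>(\<gamma>, t). q \<gamma> * (case t of (\<alpha>', \<beta>') \<Rightarrow> q \<alpha>' * q \<beta>')) summable_on UNIV"
    using q q0 by (intro summable_on_pair_prod) auto
  then have r: "r summable_on UNIV" by (simp add: r_def case_prod_unfold)
  have r0: "r t \<ge> 0" for t by (simp add: r_def q0 split: prod.split)
  have term_le: "w3 z * (ennreal (tw_coeff z t) * (inverse (w1 (tw_left z t)) * inverse (w2 (tw_right z t)))) \<le>
      ennreal C * ennreal (r t)" for z t
  proof -
    obtain \<alpha> \<beta> \<gamma> \<alpha>' \<beta>' where zt: "z = (\<alpha>, \<beta>)" "t = (\<gamma>, \<alpha>', \<beta>')" by (metis prod_cases3 surj_pair)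
    show ?thesis
    proof (cases "\<alpha>' \<le> \<alpha> \<and> \<beta>' \<le> \<beta>")
      case True
      define N where "N = midx_abs \<alpha> + midx_abs \<beta> + midx_abs \<gamma>"
      have a: "midx_abs \<alpha> = midx_abs \<alpha>' + midx_abs (\<alpha> - \<alpha>')" "midx_abs \<beta> = midx_abs \<beta>' + midx_abs (\<beta> - \<beta>')"
        using True by (metis midx_abs_add vec_diff_add)+
      define I where "I = w3 z * (inverse (w1 (tw_left z t)) * inverse (w2 (tw_right z t)))"
      have 1: "ennreal (4 ^ N) * I \<le> ennreal C"
        using C(2)[of \<alpha>' "\<alpha> - \<alpha>'" \<beta>' "\<beta> - \<beta>'" \<gamma>] True
        by (simp add: I_def zt vec_diff_add N_def a add_ac)
      have "w3 z * (ennreal (tw_coeff z t) * (inverse (w1 (tw_left z t)) * inverse (w2 (tw_right z t)))) =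
          ennreal (tw_coeff z t) * I" by (simp add: I_def mult_ac)
      also have "\<dots> \<le> ennreal (2 ^ N) * I"
        unfolding zt N_def by (intro mult_right_mono ennreal_leI tw_coeff_le) simp
      also have "\<dots> = ennreal ((1/2) ^ N) * (ennreal (4 ^ N) * I)"
      proof -
        have "(1/2) ^ N * 4 ^ N = (2::real) ^ N" by (simp add: power_mult_distrib[symmetric])
        then show ?thesis by (simp add: mult.assoc[symmetric] ennreal_mult[symmetric])
      qed
      also have "\<dots> \<le> ennreal ((1/2) ^ N) * ennreal C" by (rule mult_left_mono[OF 1]) simp
      also have "\<dots> \<le> ennreal (r t) * ennreal C"
      proof (intro mult_right_mono ennreal_leI)
        have "r t = (1/2) ^ (midx_abs \<gamma> + (midx_abs \<alpha>' + midx_abs \<beta>'))"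
          by (simp only: r_def zt q_def power_add prod.case)
        moreover have "midx_abs \<gamma> + (midx_abs \<alpha>' + midx_abs \<beta>') \<le> N" using a by (simp add: N_def)
        ultimately show "(1/2) ^ N \<le> r t" by (simp add: power_decreasing)
      qed simp
      finally show ?thesis by (simp add: mult.commute)
    qed (auto simp: zt)
  qed
  have "w3 z * (\<Sum>t\<in>F. ennreal (tw_coeff z t) * (inverse (w1 (tw_left z t)) * inverse (w2 (tw_right z t)))) \<le>
      ennreal (C * infsum r UNIV)" if "finite F" for z F
  proof -
    have "w3 z * (\<Sum>t\<in>F. ennreal (tw_coeff z t) * (inverse (w1 (tw_left z t)) * inverse (w2 (tw_right z t)))) \<le>
        (\<Sum>t\<in>F. ennreal C * ennreal (r t))"
      unfolding sum_distrib_left by (intro sum_mono term_le)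
    also have "\<dots> = ennreal (C * sum r F)"
      using C(1) r0 by (simp add: sum_distrib_left ennreal_mult[symmetric])
    also have "\<dots> \<le> ennreal (C * infsum r UNIV)"
      using C(1) r r0 that by (intro ennreal_leI mult_left_mono finite_sum_le_infsum) auto
    finally show ?thesis .
  qed
  moreover have "C * infsum r UNIV \<ge> 0" using C(1) r0 by (simp add: infsum_nonneg)
  ultimately show ?thesis unfolding tw.est_def by blast
qed

text \<open>Exchanging the two multi-indices reverses the order of the factors, as for adjoints of
  operators. This reduces all starred spaces to the unstarred ones.\<close>

lemma weight_est_swap:
  assumes "weight_est w2 w1 w3"
  shows "weight_est (\<lambda>(\<alpha>, \<beta>). w1 (\<beta>, \<alpha>)) (\<lambda>(\<alpha>, \<beta>). w2 (\<beta>, \<alpha>)) (\<lambda>(\<alpha>, \<beta>). w3 (\<beta>, \<alpha>))"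
proof -
  obtain C where C: "C \<ge> 0" "\<And>\<alpha>1 \<alpha>2 \<beta>1 \<beta>2 \<gamma>.
     ennreal (4 ^ (midx_abs \<alpha>1 + midx_abs \<alpha>2 + midx_abs \<beta>1 + midx_abs \<beta>2 + midx_abs \<gamma>)) *
       (w3 (\<alpha>1 + \<alpha>2, \<beta>1 + \<beta>2) * (inverse (w2 (\<alpha>1, \<beta>1 + \<gamma>)) * inverse (w1 (\<alpha>2 + \<gamma>, \<beta>2)))) \<le> ennreal C"
    using assms unfolding weight_est_def by metis
  show "weight_est (\<lambda>(\<alpha>, \<beta>). w1 (\<beta>, \<alpha>)) (\<lambda>(\<alpha>, \<beta>). w2 (\<beta>, \<alpha>)) (\<lambda>(\<alpha>, \<beta>). w3 (\<beta>, \<alpha>))"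
    unfolding weight_est_def
  proof (intro exI[of _ C] conjI allI C(1))
    fix \<alpha>1 \<alpha>2 \<beta>1 \<beta>2 \<gamma>
    show "ennreal (4 ^ (midx_abs \<alpha>1 + midx_abs \<alpha>2 + midx_abs \<beta>1 + midx_abs \<beta>2 + midx_abs \<gamma>)) *
       ((case (\<alpha>1 + \<alpha>2, \<beta>1 + \<beta>2) of (\<alpha>, \<beta>) \<Rightarrow> w3 (\<beta>, \<alpha>)) *
        (inverse (case (\<alpha>1, \<beta>1 + \<gamma>) of (\<alpha>, \<beta>) \<Rightarrow> w1 (\<beta>, \<alpha>)) *
         inverse (case (\<alpha>2 + \<gamma>, \<beta>2) of (\<alpha>, \<beta>) \<Rightarrow> w2 (\<beta>, \<alpha>)))) \<le> ennreal C"
      using C(2)[of \<beta>2 \<beta>1 \<alpha>2 \<alpha>1 \<gamma>] by (simp add: add_ac mult_ac)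
  qed
qed

section \<open>Comparison of weights in one multi-index\<close>

definition strongly_below :: "(nat ^ 'n::finite \<Rightarrow> ennreal) \<Rightarrow> (nat ^ 'n \<Rightarrow> ennreal) \<Rightarrow> bool" where
  "strongly_below u v \<longleftrightarrow> (\<exists>C>0. \<forall>\<alpha> \<beta>.
     ennreal (4 ^ (midx_abs \<alpha> + midx_abs \<beta>)) * (u \<alpha> * u \<beta>) \<le> ennreal C * v (\<alpha> + \<beta>) \<and>
     ennreal (4 ^ (midx_abs \<alpha> + midx_abs \<beta>)) * u (\<alpha> + \<beta>) \<le> ennreal C * (v \<alpha> * v \<beta>))"

lemma strongly_belowE:
  assumes "strongly_below u v"
  obtains C where "C > 0"
    "\<And>\<alpha> \<beta>. ennreal (4 ^ (midx_abs \<alpha> + midx_abs \<beta>)) * (u \<alpha> * u \<beta>) \<le> ennreal C * v (\<alpha> + \<beta>)"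
    "\<And>\<alpha> \<beta>. ennreal (4 ^ (midx_abs \<alpha> + midx_abs \<beta>)) * u (\<alpha> + \<beta>) \<le> ennreal C * (v \<alpha> * v \<beta>)"
  using assms unfolding strongly_below_def by metis

definition decays :: "(nat ^ 'n::finite \<Rightarrow> ennreal) \<Rightarrow> (nat ^ 'n \<Rightarrow> ennreal) \<Rightarrow> bool" where
  "decays u v \<longleftrightarrow> (\<exists>C>0. \<forall>\<alpha>. u \<alpha> \<le> ennreal (C / 4 ^ midx_abs \<alpha>) * v \<alpha>)"

text \<open>Take \<beta> to be 0 in the first inequality of \<open>strongly_below\<close>.\<close>

lemma strongly_below_decays:
  assumes "strongly_below u v" "u 0 = 1"
  shows "decays u v"
proof -
  obtain C where C: "C > 0" "\<And>\<alpha> \<beta>. ennreal (4 ^ (midx_abs \<alpha> + midx_abs \<beta>)) * (u \<alpha> * u \<beta>) \<le> ennreal C * v (\<alpha> + \<beta>)"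
    by (rule strongly_belowE[OF assms(1)]) metis
  have "u \<alpha> \<le> ennreal (C / 4 ^ midx_abs \<alpha>) * v \<alpha>" for \<alpha>
  proof -
    have "u \<alpha> = ennreal (1 / 4 ^ midx_abs \<alpha>) * (ennreal (4 ^ midx_abs \<alpha>) * u \<alpha>)"
      by (simp add: mult.assoc[symmetric] ennreal_mult[symmetric])
    also have "\<dots> \<le> ennreal (1 / 4 ^ midx_abs \<alpha>) * (ennreal C * v \<alpha>)"
      using C(2)[of \<alpha> 0] assms(2) by (intro mult_left_mono) auto
    also have "\<dots> = ennreal (C / 4 ^ midx_abs \<alpha>) * v \<alpha>"
      using C(1) by (simp add: mult.assoc[symmetric] ennreal_mult[symmetric])
    finally show ?thesis .
  qed
  then show ?thesis using C(1) unfolding decays_def by blast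
qed

lemma decays_mono:
  assumes "decays u v" "\<And>\<alpha>. u' \<alpha> \<le> u \<alpha>" "\<And>\<alpha>. v \<alpha> \<le> v' \<alpha>"
  shows "decays u' v'"
proof -
  obtain C where C: "C > 0" "\<And>\<alpha>. u \<alpha> \<le> ennreal (C / 4 ^ midx_abs \<alpha>) * v \<alpha>"
    using assms(1) unfolding decays_def by metis
  have "u' \<alpha> \<le> ennreal (C / 4 ^ midx_abs \<alpha>) * v' \<alpha>" for \<alpha>
    using assms(2)[of \<alpha>] C(2)[of \<alpha>] mult_left_mono[OF assms(3), of "ennreal (C / 4 ^ midx_abs \<alpha>)" \<alpha>]
    by (meson order_trans zero_le)
  then show ?thesis using C(1) unfolding decays_def by blast
qed

lemma ennreal_inverse_antimono: "x \<le> y \<Longrightarrow> inverse y \<le> inverse (x::ennreal)"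
proof (cases "x = 0 \<or> y = top")
  case False
  assume le: "x \<le> y"
  obtain r where r: "x = ennreal r" "r > 0" using False le by (cases x) (auto simp: less_le top_unique)
  obtain s where s: "y = ennreal s" "s \<ge> 0" using False by (cases y) auto
  then have "r \<le> s" using le r by simp
  then show ?thesis using r s by (simp add: inverse_ennreal le_imp_inverse_le ennreal_leI)
qed auto

lemma decays_inverse:
  assumes "decays u v"
  shows "decays (\<lambda>\<alpha>. inverse (v \<alpha>)) (\<lambda>\<alpha>. inverse (u \<alpha>))"
proof -
  obtain C where C: "C > 0" "\<And>\<alpha>. u \<alpha> \<le> ennreal (C / 4 ^ midx_abs \<alpha>) * v \<alpha>"
    using assms unfolding decays_def by metis
  have "inverse (v \<alpha>) \<le> ennreal (C / 4 ^ midx_abs \<alpha>) * inverse (u \<alpha>)" for \<alpha>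
  proof -
    define K where "K = C / 4 ^ midx_abs \<alpha>"
    have K: "K > 0" using C(1) by (simp add: K_def)
    have "inverse (ennreal K * v \<alpha>) \<le> inverse (u \<alpha>)"
      using C(2)[of \<alpha>] by (simp add: K_def ennreal_inverse_antimono)
    moreover have "inverse (ennreal K * v \<alpha>) = ennreal (inverse K) * inverse (v \<alpha>)"
      using K by (subst ennreal_inverse_mult') (auto simp: inverse_ennreal)
    ultimately have "ennreal K * (ennreal (inverse K) * inverse (v \<alpha>)) \<le> ennreal K * inverse (u \<alpha>)"
      by (intro mult_left_mono) auto
    moreover have "ennreal K * (ennreal (inverse K) * inverse (v \<alpha>)) = inverse (v \<alpha>)"
      using K by (simp add: mult.assoc[symmetric] ennreal_mult[symmetric])
    ultimately show ?thesis by (simp add: K_def)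
  qed
  then show ?thesis using C(1) unfolding decays_def by blast
qed

definition tensor :: "(nat ^ 'n::finite \<Rightarrow> ennreal) \<Rightarrow> (nat ^ 'n \<Rightarrow> ennreal) \<Rightarrow> (nat ^ 'n) \<times> (nat ^ 'n) \<Rightarrow> ennreal" where
  "tensor f g = (\<lambda>(\<alpha>, \<beta>). f \<alpha> * g \<beta>)"

lemma tensor_apply [simp]: "tensor f g (\<alpha>, \<beta>) = f \<alpha> * g \<beta>"
  by (simp add: tensor_def)

text \<open>A power \<open>p\<close> turns \<open>1 / 4\<close> to the degree into a geometric
  sequence with ratio \<open>(1/4) powr p < 1\<close>, so every power of the quotient is
  summable.\<close>

lemma summably_below_tensor:
  assumes "decays u v" "decays u' v'"
  shows "summably_below (tensor u u') (tensor v v')"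
proof -
  obtain C where C: "C > 0" "\<And>\<alpha>. u \<alpha> \<le> ennreal (C / 4 ^ midx_abs \<alpha>) * v \<alpha>"
    using assms(1) unfolding decays_def by metis
  obtain D where D: "D > 0" "\<And>\<alpha>. u' \<alpha> \<le> ennreal (D / 4 ^ midx_abs \<alpha>) * v' \<alpha>"
    using assms(2) unfolding decays_def by metis
  define q :: "(nat ^ 'a) \<times> (nat ^ 'a) \<Rightarrow> real" where
    "q = (\<lambda>(\<alpha>, \<beta>). (C / 4 ^ midx_abs \<alpha>) * (D / 4 ^ midx_abs \<beta>))"
  have "(\<lambda>x. q x powr p) summable_on UNIV" if p: "p > 0" for p
  proof -
    define y where "y = (1 / 4 :: real) powr p"
    have y: "0 \<le> y" "y < 1" using p powr01_less_one[of "1/4" p] by (auto simp: y_def)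
    have e: "(E / 4 ^ k) powr p = E powr p * y ^ k" if "E > 0" for E :: real and k
    proof -
      have "(E / 4 ^ k) powr p = (E * (1/4) ^ k) powr p" by (simp add: power_divide)
      also have "\<dots> = E powr p * ((1/4) ^ k) powr p" using that by (simp add: powr_mult)
      also have "((1/4::real) ^ k) powr p = y ^ k"
        unfolding y_def by (simp add: powr_realpow[symmetric] powr_powr mult.commute powr_power)
      finally show ?thesis .
    qed
    have "(\<lambda>(\<alpha> :: nat ^ 'a, \<beta> :: nat ^ 'a). (C powr p * y ^ midx_abs \<alpha>) * (D powr p * y ^ midx_abs \<beta>)) summable_on UNIV"
      using y by (intro summable_on_pair_prod summable_on_cmult_right summable_on_power_midx) auto
    moreover have "q x powr p = (case x of (\<alpha>, \<beta>) \<Rightarrow> (C powr p * y ^ midx_abs \<alpha>) * (D powr p * y ^ midx_abs \<beta>))" for x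
      using C(1) D(1) by (cases x) (simp add: q_def powr_mult e del: times_divide_eq_right times_divide_eq_left divide_divide_eq_left)
    ultimately show ?thesis by presburger
  qed
  moreover have "tensor u u' x \<le> ennreal (q x) * tensor v v' x" for x
  proof (cases x)
    case (Pair \<alpha> \<beta>)
    have "u \<alpha> * u' \<beta> \<le> (ennreal (C / 4 ^ midx_abs \<alpha>) * v \<alpha>) * (ennreal (D / 4 ^ midx_abs \<beta>) * v' \<beta>)"
      by (intro mult_mono C D) auto
    also have "\<dots> = ennreal (q x) * (v \<alpha> * v' \<beta>)"
      using C(1) D(1) unfolding Pair q_def by (simp add: ennreal_mult mult_ac del: times_divide_eq_right times_divide_eq_left)
    finally show ?thesis using Pair by simp
  qed
  moreover have "0 \<le> q x" for x using C(1) D(1) by (cases x) (simp add: q_def)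
  ultimately show ?thesis unfolding summably_below_def by blast
qed

text \<open>One tensor factor of a weight grid. Such a factor depends on only one of the two indices
  in the applications; shifting both indices in \<open>nuclear\<close> covers either case.\<close>

locale half_grid =
  fixes f :: "nat \<Rightarrow> nat \<Rightarrow> nat ^ 'n::finite \<Rightarrow> ennreal"
  assumes inc: "i \<le> i' \<Longrightarrow> f i j x \<le> f i' j x"
    and dec: "j \<le> j' \<Longrightarrow> f i j' x \<le> f i j x"
    and pos: "\<exists>i. \<forall>j. 0 < f i j x"
    and pos_indep: "0 < f i j x \<Longrightarrow> 0 < f i j' x"
    and fin: "\<exists>j. \<forall>i. f i j x < top"
    and nuclear: "decays (f i (Suc j)) (f (Suc i) j)"

lemma weight_grid_tensor:
  assumes "half_grid f" "half_grid g"
  shows "weight_grid (\<lambda>i j. tensor (f i j) (g i j))"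
proof
  interpret f: half_grid f by fact
  interpret g: half_grid g by fact
  show "tensor (f i j) (g i j) x \<le> tensor (f i' j) (g i' j) x" if "i \<le> i'" for i i' j x
    using f.inc[OF that] g.inc[OF that] by (cases x) (simp add: mult_mono)
  show "tensor (f i j') (g i j') x \<le> tensor (f i j) (g i j) x" if "j \<le> j'" for i j j' x
    using f.dec[OF that] g.dec[OF that] by (cases x) (simp add: mult_mono)
  have pos_iff: "0 < a * b \<longleftrightarrow> 0 < a \<and> 0 < b" for a b :: ennreal
    by (simp add: zero_less_iff_neq_zero)
  show "\<exists>i. \<forall>j. 0 < tensor (f i j) (g i j) x" for x
  proof (cases x)
    case (Pair \<alpha> \<beta>)
    obtain i where i: "\<And>j. 0 < f i j \<alpha>" using f.pos by metis
    obtain i' where i': "\<And>j. 0 < g i' j \<beta>" using g.pos by metis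
    have "0 < f (max i i') j \<alpha>" "0 < g (max i i') j \<beta>" for j
      using i i' f.inc[of i "max i i'" j \<alpha>] g.inc[of i' "max i i'" j \<beta>] by (auto intro: less_le_trans)
    then show ?thesis using Pair pos_iff by auto
  qed
  show "0 < tensor (f i j') (g i j') x" if "0 < tensor (f i j) (g i j) x" for i j j' x
    using that f.pos_indep[of i j _ j'] g.pos_indep[of i j _ j'] by (cases x) (simp add: pos_iff)
  show "\<exists>j. \<forall>i. tensor (f i j) (g i j) x < top" for x
  proof (cases x)
    case (Pair \<alpha> \<beta>)
    obtain j where j: "\<And>i. f i j \<alpha> < top" using f.fin by metis
    obtain j' where j': "\<And>i. g i j' \<beta> < top" using g.fin by metis
    have "f i (max j j') \<alpha> < top" "g i (max j j') \<beta> < top" for i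
      using j j' f.dec[of j "max j j'" i \<alpha>] g.dec[of j' "max j j'" i \<beta>] by (auto intro: le_less_trans)
    then show ?thesis using Pair by (auto simp: ennreal_mult_less_top intro!: exI[of _ "max j j'"])
  qed
  show "\<exists>\<phi> \<psi>. \<forall>i j. summably_below (tensor (f i (\<psi> j)) (g i (\<psi> j))) (tensor (f (\<phi> i) j) (g (\<phi> i) j))"
    using summably_below_tensor[OF f.nuclear g.nuclear] by blast
qed

section \<open>Pointwise estimates for triples of weights\<close>

lemma ennreal_obtain_pos:
  assumes "0 < x" "x < (top::ennreal)" obtains r where "r > 0" "x = ennreal r"
  using assms by (cases x) (auto simp: less_le)

text \<open>\<open>E\<close> is the claim cleared of denominators. Infinite values can make this
  irreversible; \<open>H1\<close> and \<open>H2\<close> exclude the bad cases: an infinite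
  \<open>b3\<close>, \<open>a2\<close> or \<open>a1\<close> makes the left side 0, and otherwise all
  six weights are finite.\<close>

lemma ratio_bound:
  fixes a1 a2 a3 b1 b2 b3 :: ennreal
  assumes pos: "0 < a1" "0 < a2" "0 < a3" "0 < b1" "0 < b2" "0 < b3" and K: "0 < K" and C: "0 \<le> C"
    and E: "ennreal K * (a3 * (b1 * b2)) \<le> ennreal C * (a1 * (a2 * b3))"
    and H1: "b3 < top \<Longrightarrow> b2 < top" and H2: "a2 < top \<Longrightarrow> b3 < top \<Longrightarrow> b1 < top"
  shows "ennreal K * ((a3 * inverse b3) * (inverse (a1 * inverse b1) * inverse (a2 * inverse b2))) \<le> ennreal C"
proof (cases "b3 = top")
  case False
  then have b3: "b3 < top" by (simp add: less_top)
  have b2: "b2 < top" by (rule H1[OF b3])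
  show ?thesis
  proof (cases "a2 = top")
    case True
    then have "a2 * inverse b2 = top" using b2 by (simp add: ennreal_top_mult)
    then show ?thesis by simp
  next
    case False
    then have a2: "a2 < top" by (simp add: less_top)
    have b1: "b1 < top" by (rule H2[OF a2 b3])
    show ?thesis
    proof (cases "a1 = top")
      case True
      then have "a1 * inverse b1 = top" using b1 by (simp add: ennreal_top_mult)
      then show ?thesis by simp
    next
      case False
      then have a1: "a1 < top" by (simp add: less_top)
      have "a3 \<noteq> top"
      proof
        assume "a3 = top"
        then have "ennreal K * (a3 * (b1 * b2)) = top"
          using K pos by (auto simp: ennreal_top_mult ennreal_mult_top)
        moreover have "ennreal C * (a1 * (a2 * b3)) < top" using a1 a2 b3 by (simp add: ennreal_mult_less_top)
        ultimately show False using E by (simp add: top_unique)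
      qed
      then have a3: "a3 < top" by (simp add: less_top)
      obtain r1 where r1: "r1 > 0" "a1 = ennreal r1" by (rule ennreal_obtain_pos[OF pos(1) a1])
      obtain r2 where r2: "r2 > 0" "a2 = ennreal r2" by (rule ennreal_obtain_pos[OF pos(2) a2])
      obtain r3 where r3: "r3 > 0" "a3 = ennreal r3" by (rule ennreal_obtain_pos[OF pos(3) a3])
      obtain s1 where s1: "s1 > 0" "b1 = ennreal s1" by (rule ennreal_obtain_pos[OF pos(4) b1])
      obtain s2 where s2: "s2 > 0" "b2 = ennreal s2" by (rule ennreal_obtain_pos[OF pos(5) b2])
      obtain s3 where s3: "s3 > 0" "b3 = ennreal s3" by (rule ennreal_obtain_pos[OF pos(6) b3])
      note r = r1 r2 r3 s1 s2 s3
      have "K * (r3 * (s1 * s2)) \<le> C * (r1 * (r2 * s3))"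
        using E K C r by (simp add: ennreal_mult[symmetric])
      then have "K * ((r3 * inverse s3) * (inverse (r1 * inverse s1) * inverse (r2 * inverse s2))) \<le> C"
        using r by (simp add: field_simps)
      then have "ennreal (K * ((r3 * inverse s3) * (inverse (r1 * inverse s1) * inverse (r2 * inverse s2)))) \<le> ennreal C"
        by (rule ennreal_leI)
      then show ?thesis
        using r K by (simp add: inverse_ennreal ennreal_mult[symmetric])
    qed
  qed
qed simp

lemma mult_less_top_right: "a * b < (top::ennreal) \<Longrightarrow> 0 < a \<Longrightarrow> b < top"
  by (auto simp: ennreal_mult_less_top)

lemma mult_less_top_left: "a * b < (top::ennreal) \<Longrightarrow> 0 < b \<Longrightarrow> a < top"
  by (auto simp: ennreal_mult_less_top)

lemma scaled_mult_less_top: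
  assumes "ennreal (4 ^ N) * (a * b) \<le> ennreal C * c" "c < top" "0 < a" "0 < b"
  shows "a < top" "b < top"
proof -
  have "ennreal C * c < top" using assms(2) by (simp add: ennreal_mult_less_top)
  then have "ennreal (4 ^ N) * (a * b) < top" using assms(1) by (rule le_less_trans[rotated])
  then have "a * b < top" by (rule mult_less_top_right) simp
  then show "a < top" "b < top" using mult_less_top_left mult_less_top_right assms(3,4) by blast+
qed

lemma le_pow4_mult: "(x::ennreal) \<le> ennreal (4 ^ N) * x"
proof -
  have "ennreal 1 * x \<le> ennreal (4 ^ N) * x" by (intro mult_right_mono ennreal_leI) auto
  then show ?thesis by simp
qed

text \<open>The intermediate weight \<open>m\<close> carries \<open>\<alpha>2\<close> and \<gamma>,
  and \<open>n\<close> carries \<open>\<beta>1\<close> and \<open>\<beta>2\<close>. First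
  \<open>a3\<close> and \<open>b1\<close> are split by
  \<open>a3 (\<alpha>1 + \<alpha>2) \<le> a1 \<alpha>1 * m \<alpha>2\<close> and
  \<open>b1 (\<beta>1 + \<gamma>) \<le> n \<beta>1 * m \<gamma>\<close>, up to constants; then the
  \<open>m\<close> are joined into \<open>a2 (\<alpha>2 + \<gamma>)\<close> and the \<open>n\<close>
  into \<open>b3 (\<beta>1 + \<beta>2)\<close>. These inequalities supply enough powers of 4 for all
  five indices.\<close>

lemma weight_est_ratio:
  fixes a1 a2 a3 b1 b2 b3 :: "nat ^ 'n::finite \<Rightarrow> ennreal"
  assumes pos: "\<And>\<alpha>. 0 < a1 \<alpha>" "\<And>\<alpha>. 0 < a2 \<alpha>" "\<And>\<alpha>. 0 < a3 \<alpha>" "\<And>\<alpha>. 0 < b1 \<alpha>" "\<And>\<alpha>. 0 < b2 \<alpha>" "\<And>\<alpha>. 0 < b3 \<alpha>"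
      "\<And>\<alpha>. 0 < m \<alpha>" "\<And>\<alpha>. 0 < n \<alpha>"
    and ma2: "strongly_below m a2" and nb3: "strongly_below n b3"
    and a3k: "strongly_below a3 k" "\<And>\<alpha>. k \<alpha> \<le> a1 \<alpha>" "\<And>\<alpha>. k \<alpha> \<le> m \<alpha>"
    and b1l: "strongly_below b1 l" "\<And>\<alpha>. l \<alpha> \<le> m \<alpha>" "\<And>\<alpha>. l \<alpha> \<le> n \<alpha>"
    and b2n: "\<And>\<alpha>. b2 \<alpha> \<le> n \<alpha>"
  shows "weight_est (tensor a1 (\<lambda>\<alpha>. inverse (b1 \<alpha>))) (tensor a2 (\<lambda>\<alpha>. inverse (b2 \<alpha>))) (tensor a3 (\<lambda>\<alpha>. inverse (b3 \<alpha>)))"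
proof -
  obtain C1 where C1: "C1 > 0" "\<And>\<alpha> \<beta>. ennreal (4 ^ (midx_abs \<alpha> + midx_abs \<beta>)) * (m \<alpha> * m \<beta>) \<le> ennreal C1 * a2 (\<alpha> + \<beta>)"
    by (rule strongly_belowE[OF ma2]) metis
  obtain C2 where C2: "C2 > 0" "\<And>\<alpha> \<beta>. ennreal (4 ^ (midx_abs \<alpha> + midx_abs \<beta>)) * (n \<alpha> * n \<beta>) \<le> ennreal C2 * b3 (\<alpha> + \<beta>)"
    by (rule strongly_belowE[OF nb3]) metis
  obtain C3 where C3: "C3 > 0" "\<And>\<alpha> \<beta>. ennreal (4 ^ (midx_abs \<alpha> + midx_abs \<beta>)) * a3 (\<alpha> + \<beta>) \<le> ennreal C3 * (k \<alpha> * k \<beta>)"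
    by (rule strongly_belowE[OF a3k(1)]) metis
  obtain C4 where C4: "C4 > 0" "\<And>\<alpha> \<beta>. ennreal (4 ^ (midx_abs \<alpha> + midx_abs \<beta>)) * b1 (\<alpha> + \<beta>) \<le> ennreal C4 * (l \<alpha> * l \<beta>)"
    by (rule strongly_belowE[OF b1l(1)]) metis
  define C where "C = C3 * C4 * C1 * C2"
  have C: "C \<ge> 0" using C1 C2 C3 C4 by (simp add: C_def)
  have "ennreal (4 ^ (midx_abs \<alpha>1 + midx_abs \<alpha>2 + midx_abs \<beta>1 + midx_abs \<beta>2 + midx_abs \<gamma>)) *
       ((a3 (\<alpha>1 + \<alpha>2) * inverse (b3 (\<beta>1 + \<beta>2))) *
         (inverse (a1 \<alpha>1 * inverse (b1 (\<beta>1 + \<gamma>))) * inverse (a2 (\<alpha>2 + \<gamma>) * inverse (b2 \<beta>2)))) \<le> ennreal C"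
    for \<alpha>1 \<alpha>2 \<beta>1 \<beta>2 \<gamma>
  proof -
    let ?A1 = "4 ^ (midx_abs \<alpha>2 + midx_abs \<gamma>) :: real"
    let ?A2 = "4 ^ (midx_abs \<beta>1 + midx_abs \<beta>2) :: real"
    let ?A3 = "4 ^ (midx_abs \<alpha>1 + midx_abs \<alpha>2) :: real"
    let ?A4 = "4 ^ (midx_abs \<beta>1 + midx_abs \<gamma>) :: real"
    let ?N = "midx_abs \<alpha>1 + midx_abs \<alpha>2 + midx_abs \<beta>1 + midx_abs \<beta>2 + midx_abs \<gamma>"
    have e1: "ennreal ?A1 * (m \<alpha>2 * m \<gamma>) \<le> ennreal C1 * a2 (\<alpha>2 + \<gamma>)" by (rule C1)
    have e2: "ennreal ?A2 * (n \<beta>1 * n \<beta>2) \<le> ennreal C2 * b3 (\<beta>1 + \<beta>2)" by (rule C2)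
    have e3: "ennreal ?A3 * a3 (\<alpha>1 + \<alpha>2) \<le> ennreal C3 * (a1 \<alpha>1 * m \<alpha>2)"
      using C3(2)[of \<alpha>1 \<alpha>2] mult_left_mono[OF mult_mono[OF a3k(2)[of \<alpha>1] a3k(3)[of \<alpha>2]], of "ennreal C3"]
      by (auto elim: order_trans)
    have e4: "ennreal ?A4 * b1 (\<beta>1 + \<gamma>) \<le> ennreal C4 * (n \<beta>1 * m \<gamma>)"
      using C4(2)[of \<beta>1 \<gamma>] mult_left_mono[OF mult_mono[OF b1l(3)[of \<beta>1] b1l(2)[of \<gamma>]], of "ennreal C4"]
      by (auto elim: order_trans)
    have N: "(4::real) ^ ?N \<le> ?A3 * (?A4 * ?A2)"
      unfolding power_add[symmetric] by (rule power_increasing) auto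
    show ?thesis
    proof (rule ratio_bound)
      have "ennreal (4 ^ ?N) * (a3 (\<alpha>1 + \<alpha>2) * (b1 (\<beta>1 + \<gamma>) * b2 \<beta>2)) \<le>
          ennreal (?A3 * (?A4 * ?A2)) * (a3 (\<alpha>1 + \<alpha>2) * (b1 (\<beta>1 + \<gamma>) * n \<beta>2))"
        using N by (intro mult_mono ennreal_leI b2n order_refl) auto
      also have "\<dots> = (ennreal ?A3 * a3 (\<alpha>1 + \<alpha>2)) * ((ennreal ?A4 * b1 (\<beta>1 + \<gamma>)) * (ennreal ?A2 * n \<beta>2))"
        by (simp add: ennreal_mult mult_ac)
      also have "\<dots> \<le> (ennreal C3 * (a1 \<alpha>1 * m \<alpha>2)) * ((ennreal C4 * (n \<beta>1 * m \<gamma>)) * (ennreal ?A2 * n \<beta>2))"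
        by (intro mult_mono e3 e4 order_refl) auto
      also have "\<dots> = ennreal C3 * ennreal C4 * a1 \<alpha>1 * ((m \<alpha>2 * m \<gamma>) * (ennreal ?A2 * (n \<beta>1 * n \<beta>2)))"
        by (simp add: mult_ac)
      also have "\<dots> \<le> ennreal C3 * ennreal C4 * a1 \<alpha>1 * ((ennreal C1 * a2 (\<alpha>2 + \<gamma>)) * (ennreal C2 * b3 (\<beta>1 + \<beta>2)))"
        by (rule mult_left_mono[OF mult_mono[OF order_trans[OF le_pow4_mult e1] e2]]) auto
      also have "\<dots> = ennreal C * (a1 \<alpha>1 * (a2 (\<alpha>2 + \<gamma>) * b3 (\<beta>1 + \<beta>2)))"
        using C1 C2 C3 C4 by (simp add: C_def ennreal_mult mult_ac)
      finally show "ennreal (4 ^ ?N) * (a3 (\<alpha>1 + \<alpha>2) * (b1 (\<beta>1 + \<gamma>) * b2 \<beta>2)) \<le>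
          ennreal C * (a1 \<alpha>1 * (a2 (\<alpha>2 + \<gamma>) * b3 (\<beta>1 + \<beta>2)))" .
      show "b2 \<beta>2 < top" if "b3 (\<beta>1 + \<beta>2) < top"
        using scaled_mult_less_top(2)[OF e2 that pos(8,8)] b2n le_less_trans by blast
      show "b1 (\<beta>1 + \<gamma>) < top" if "a2 (\<alpha>2 + \<gamma>) < top" "b3 (\<beta>1 + \<beta>2) < top"
      proof -
        have "n \<beta>1 < top" "m \<gamma> < top"
          using scaled_mult_less_top(1)[OF e2 that(2) pos(8,8)] scaled_mult_less_top(2)[OF e1 that(1) pos(7,7)] by auto
        then have "ennreal C4 * (n \<beta>1 * m \<gamma>) < top" by (simp add: ennreal_mult_less_top)
        then show ?thesis using order_trans[OF le_pow4_mult e4] by (rule le_less_trans[rotated])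
      qed
    qed (use pos C in auto)
  qed
  then show ?thesis unfolding weight_est_def tensor_apply using C by blast
qed

text \<open>As for \<open>weight_est_ratio\<close>, but the weight at \<open>\<alpha>1\<close> now
  stands alone in the numerator and \<open>v (\<alpha>1 + \<alpha>2)\<close> has to be produced. The
  missing factor \<open>n \<alpha>2\<close> and the factor \<open>m \<alpha>2\<close> required for
  \<open>a2\<close> are inserted at the cost of the constant \<open>1 / c\<^sup>2\<close>.\<close>

lemma weight_est_dual:
  fixes a2 b b2 v :: "nat ^ 'n::finite \<Rightarrow> ennreal"
  assumes pos: "\<And>\<alpha>. 0 < a2 \<alpha>" "\<And>\<alpha>. 0 < b \<alpha>" "\<And>\<alpha>. 0 < b2 \<alpha>" "\<And>\<alpha>. 0 < v \<alpha>"
    and low: "c > 0" "\<And>\<alpha>. ennreal c \<le> m \<alpha>" "\<And>\<alpha>. ennreal c \<le> n \<alpha>"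
    and ma2: "strongly_below m a2" and nv: "strongly_below n v"
    and bl: "strongly_below b l" "\<And>\<alpha>. l \<alpha> \<le> m \<alpha>" "\<And>\<alpha>. l \<alpha> \<le> n \<alpha>"
    and bn: "\<And>\<alpha>. b \<alpha> \<le> n \<alpha>" and b2n: "\<And>\<alpha>. b2 \<alpha> \<le> n \<alpha>"
  shows "weight_est (tensor (\<lambda>\<alpha>. inverse (b \<alpha>)) (\<lambda>\<alpha>. inverse (b \<alpha>))) (tensor a2 (\<lambda>\<alpha>. inverse (b2 \<alpha>)))
    (tensor (\<lambda>\<alpha>. inverse (v \<alpha>)) (\<lambda>\<alpha>. inverse (v \<alpha>)))"
proof -
  have mpos: "0 < m \<alpha>" "0 < n \<alpha>" for \<alpha>
    using low less_le_trans[of 0 "ennreal c"] by auto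
  obtain C1 where C1: "C1 > 0" "\<And>\<alpha> \<beta>. ennreal (4 ^ (midx_abs \<alpha> + midx_abs \<beta>)) * (m \<alpha> * m \<beta>) \<le> ennreal C1 * a2 (\<alpha> + \<beta>)"
    by (rule strongly_belowE[OF ma2]) metis
  obtain C2 where C2: "C2 > 0" "\<And>\<alpha> \<beta>. ennreal (4 ^ (midx_abs \<alpha> + midx_abs \<beta>)) * (n \<alpha> * n \<beta>) \<le> ennreal C2 * v (\<alpha> + \<beta>)"
    by (rule strongly_belowE[OF nv]) metis
  obtain C4 where C4: "C4 > 0" "\<And>\<alpha> \<beta>. ennreal (4 ^ (midx_abs \<alpha> + midx_abs \<beta>)) * b (\<alpha> + \<beta>) \<le> ennreal C4 * (l \<alpha> * l \<beta>)"
    by (rule strongly_belowE[OF bl(1)]) metis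
  define D where "D = 1 / c\<^sup>2"
  have D: "D > 0" using low(1) by (simp add: D_def)
  define C where "C = D * C4 * C1 * C2 * C2"
  have C: "C \<ge> 0" using C1 C2 C4 D by (simp add: C_def)
  have "ennreal (4 ^ (midx_abs \<alpha>1 + midx_abs \<alpha>2 + midx_abs \<beta>1 + midx_abs \<beta>2 + midx_abs \<gamma>)) *
       ((1 * inverse (v (\<alpha>1 + \<alpha>2) * v (\<beta>1 + \<beta>2))) *
         (inverse (1 * inverse (b \<alpha>1 * b (\<beta>1 + \<gamma>))) * inverse (a2 (\<alpha>2 + \<gamma>) * inverse (b2 \<beta>2)))) \<le> ennreal C"
    for \<alpha>1 \<alpha>2 \<beta>1 \<beta>2 \<gamma>
  proof -
    let ?A1 = "4 ^ (midx_abs \<alpha>2 + midx_abs \<gamma>) :: real"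
    let ?A2 = "4 ^ (midx_abs \<beta>1 + midx_abs \<beta>2) :: real"
    let ?A3 = "4 ^ (midx_abs \<alpha>1 + midx_abs \<alpha>2) :: real"
    let ?A4 = "4 ^ (midx_abs \<beta>1 + midx_abs \<gamma>) :: real"
    let ?N = "midx_abs \<alpha>1 + midx_abs \<alpha>2 + midx_abs \<beta>1 + midx_abs \<beta>2 + midx_abs \<gamma>"
    have e1: "ennreal ?A1 * (m \<alpha>2 * m \<gamma>) \<le> ennreal C1 * a2 (\<alpha>2 + \<gamma>)" by (rule C1)
    have e2: "ennreal ?A2 * (n \<beta>1 * n \<beta>2) \<le> ennreal C2 * v (\<beta>1 + \<beta>2)" by (rule C2)
    have e3: "ennreal ?A3 * (n \<alpha>1 * n \<alpha>2) \<le> ennreal C2 * v (\<alpha>1 + \<alpha>2)" by (rule C2)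
    have e4: "ennreal ?A4 * b (\<beta>1 + \<gamma>) \<le> ennreal C4 * (n \<beta>1 * m \<gamma>)"
      using C4(2)[of \<beta>1 \<gamma>] mult_left_mono[OF mult_mono[OF bl(3)[of \<beta>1] bl(2)[of \<gamma>]], of "ennreal C4"]
      by (auto elim: order_trans)
    have N: "(4::real) ^ ?N \<le> ?A3 * (?A4 * ?A2)"
      unfolding power_add[symmetric] by (rule power_increasing) auto
    have e5: "b \<alpha>1 \<le> ennreal D * (n \<alpha>1 * (n \<alpha>2 * m \<alpha>2))"
    proof -
      have "b \<alpha>1 \<le> ennreal D * (n \<alpha>1 * (ennreal c * ennreal c))"
      proof -
        have "ennreal D * (ennreal c * ennreal c) = 1"
          using low(1) D by (simp add: ennreal_mult[symmetric] D_def power2_eq_square)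
        then have "ennreal D * (n \<alpha>1 * (ennreal c * ennreal c)) = n \<alpha>1"
          by (simp only: mult.left_commute[of "ennreal D"] mult_1_right)
        then show ?thesis using bn by simp
      qed
      also have "\<dots> \<le> ennreal D * (n \<alpha>1 * (n \<alpha>2 * m \<alpha>2))"
        by (intro mult_left_mono mult_mono low) auto
      finally show ?thesis .
    qed
    show ?thesis
    proof (rule ratio_bound)
      have "ennreal (4 ^ ?N) * (1 * ((b \<alpha>1 * b (\<beta>1 + \<gamma>)) * b2 \<beta>2)) \<le>
          ennreal (?A3 * (?A4 * ?A2)) * (1 * (((ennreal D * (n \<alpha>1 * (n \<alpha>2 * m \<alpha>2))) * b (\<beta>1 + \<gamma>)) * n \<beta>2))"
        using N by (intro mult_mono ennreal_leI b2n e5 order_refl) auto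
      also have "\<dots> = ennreal D * ((ennreal ?A3 * (n \<alpha>1 * n \<alpha>2)) * (m \<alpha>2 * ((ennreal ?A4 * b (\<beta>1 + \<gamma>)) * (ennreal ?A2 * n \<beta>2))))"
        by (simp add: ennreal_mult mult_ac)
      also have "\<dots> \<le> ennreal D * ((ennreal C2 * v (\<alpha>1 + \<alpha>2)) * (m \<alpha>2 * ((ennreal C4 * (n \<beta>1 * m \<gamma>)) * (ennreal ?A2 * n \<beta>2))))"
        by (intro mult_mono e3 e4 order_refl) auto
      also have "\<dots> = ennreal D * ennreal C4 * (ennreal C2 * v (\<alpha>1 + \<alpha>2)) * ((m \<alpha>2 * m \<gamma>) * (ennreal ?A2 * (n \<beta>1 * n \<beta>2)))"
        by (simp add: mult_ac)
      also have "\<dots> \<le> ennreal D * ennreal C4 * (ennreal C2 * v (\<alpha>1 + \<alpha>2)) * ((ennreal C1 * a2 (\<alpha>2 + \<gamma>)) * (ennreal C2 * v (\<beta>1 + \<beta>2)))"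
        by (rule mult_left_mono[OF mult_mono[OF order_trans[OF le_pow4_mult e1] e2]]) auto
      also have "\<dots> = ennreal C * (1 * (a2 (\<alpha>2 + \<gamma>) * (v (\<alpha>1 + \<alpha>2) * v (\<beta>1 + \<beta>2))))"
        using C1 C2 C4 D by (simp add: C_def ennreal_mult mult_ac)
      finally show "ennreal (4 ^ ?N) * (1 * ((b \<alpha>1 * b (\<beta>1 + \<gamma>)) * b2 \<beta>2)) \<le>
          ennreal C * (1 * (a2 (\<alpha>2 + \<gamma>) * (v (\<alpha>1 + \<alpha>2) * v (\<beta>1 + \<beta>2))))" .
      have vs: "v (\<alpha>1 + \<alpha>2) < top" "v (\<beta>1 + \<beta>2) < top" if "v (\<alpha>1 + \<alpha>2) * v (\<beta>1 + \<beta>2) < top"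
        using that mult_less_top_left mult_less_top_right pos(4) by blast+
      show "b2 \<beta>2 < top" if "v (\<alpha>1 + \<alpha>2) * v (\<beta>1 + \<beta>2) < top"
        using scaled_mult_less_top(2)[OF e2 vs(2)[OF that] mpos(2,2)] b2n le_less_trans by blast
      show "b \<alpha>1 * b (\<beta>1 + \<gamma>) < top" if "a2 (\<alpha>2 + \<gamma>) < top" "v (\<alpha>1 + \<alpha>2) * v (\<beta>1 + \<beta>2) < top"
      proof -
        have "n \<beta>1 < top" "m \<gamma> < top"
          using scaled_mult_less_top(1)[OF e2 vs(2)[OF that(2)] mpos(2,2)] scaled_mult_less_top(2)[OF e1 that(1) mpos(1,1)] by auto
        then have "ennreal C4 * (n \<beta>1 * m \<gamma>) < top" by (simp add: ennreal_mult_less_top)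
        then have "b (\<beta>1 + \<gamma>) < top" using order_trans[OF le_pow4_mult e4] by (rule le_less_trans[rotated])
        moreover have "b \<alpha>1 < top"
          using scaled_mult_less_top(1)[OF e3 vs(1)[OF that(2)] mpos(2,2)] bn le_less_trans by blast
        ultimately show ?thesis by (simp add: ennreal_mult_less_top)
      qed
    qed (use pos C in \<open>auto simp: ennreal_zero_less_mult_iff\<close>)
  qed
  then show ?thesis
    unfolding weight_est_def tensor_apply using C pos by (auto simp: ennreal_inverse_mult' intro!: exI[of _ C])
qed

text \<open>The index \<gamma> is absent from the target weight but occurs in both source weights.
  Two factors \<open>p \<gamma>\<close> are inserted at the cost of \<open>1 / c\<^sup>2\<close>,
  one for each \<open>a\<close> whose argument contains \<gamma>.\<close>

lemma weight_est_tensor: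
  fixes a u p :: "nat ^ 'n::finite \<Rightarrow> ennreal"
  assumes low: "c > 0" "\<And>\<alpha>. ennreal c \<le> p \<alpha>"
    and pa: "strongly_below p a" "\<And>\<alpha>. p \<alpha> \<le> a \<alpha>" and up: "strongly_below u p"
  shows "weight_est (tensor a a) (tensor a a) (tensor u u)"
proof -
  obtain C1 where C1: "C1 > 0" "\<And>\<alpha> \<beta>. ennreal (4 ^ (midx_abs \<alpha> + midx_abs \<beta>)) * (p \<alpha> * p \<beta>) \<le> ennreal C1 * a (\<alpha> + \<beta>)"
    by (rule strongly_belowE[OF pa(1)]) metis
  obtain C2 where C2: "C2 > 0" "\<And>\<alpha> \<beta>. ennreal (4 ^ (midx_abs \<alpha> + midx_abs \<beta>)) * u (\<alpha> + \<beta>) \<le> ennreal C2 * (p \<alpha> * p \<beta>)"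
    by (rule strongly_belowE[OF up]) metis
  define D where "D = 1 / c\<^sup>2"
  have D: "D > 0" using low(1) by (simp add: D_def)
  define C where "C = D * C1 * C1 * C2 * C2"
  have C: "C \<ge> 0" using C1 C2 D by (simp add: C_def)
  have "ennreal (4 ^ (midx_abs \<alpha>1 + midx_abs \<alpha>2 + midx_abs \<beta>1 + midx_abs \<beta>2 + midx_abs \<gamma>)) *
       ((u (\<alpha>1 + \<alpha>2) * u (\<beta>1 + \<beta>2)) *
         (inverse (a \<alpha>1 * a (\<beta>1 + \<gamma>)) * inverse (a (\<alpha>2 + \<gamma>) * a \<beta>2))) \<le> ennreal C"
    for \<alpha>1 \<alpha>2 \<beta>1 \<beta>2 \<gamma>
  proof -
    let ?A1 = "4 ^ (midx_abs \<beta>1 + midx_abs \<gamma>) :: real"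
    let ?A2 = "4 ^ (midx_abs \<beta>1 + midx_abs \<beta>2) :: real"
    let ?A3 = "4 ^ (midx_abs \<alpha>1 + midx_abs \<alpha>2) :: real"
    let ?N = "midx_abs \<alpha>1 + midx_abs \<alpha>2 + midx_abs \<beta>1 + midx_abs \<beta>2 + midx_abs \<gamma>"
    let ?W = "(a \<alpha>1 * a (\<beta>1 + \<gamma>)) * (a (\<alpha>2 + \<gamma>) * a \<beta>2)"
    have e1: "ennreal ?A1 * (p \<beta>1 * p \<gamma>) \<le> ennreal C1 * a (\<beta>1 + \<gamma>)" by (rule C1)
    have e1': "p \<alpha>2 * p \<gamma> \<le> ennreal C1 * a (\<alpha>2 + \<gamma>)" by (rule order_trans[OF le_pow4_mult C1(2)])
    have e2: "ennreal ?A2 * u (\<beta>1 + \<beta>2) \<le> ennreal C2 * (p \<beta>1 * p \<beta>2)" by (rule C2)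
    have e3: "ennreal ?A3 * u (\<alpha>1 + \<alpha>2) \<le> ennreal C2 * (p \<alpha>1 * p \<alpha>2)" by (rule C2)
    have N: "(4::real) ^ ?N \<le> ?A3 * (?A2 * ?A1)"
      unfolding power_add[symmetric] by (rule power_increasing) auto
    have one: "1 \<le> ennreal D * (p \<gamma> * p \<gamma>)"
    proof -
      have "1 = ennreal D * (ennreal c * ennreal c)"
        using low(1) D by (simp add: ennreal_mult[symmetric] D_def power2_eq_square)
      also have "\<dots> \<le> ennreal D * (p \<gamma> * p \<gamma>)" by (intro mult_left_mono mult_mono low) auto
      finally show ?thesis .
    qed
    have "ennreal (4 ^ ?N) * (u (\<alpha>1 + \<alpha>2) * u (\<beta>1 + \<beta>2)) \<le>
        ennreal (?A3 * (?A2 * ?A1)) * (u (\<alpha>1 + \<alpha>2) * u (\<beta>1 + \<beta>2)) * 1"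
      using N by (simp only: mult_1_right) (intro mult_right_mono ennreal_leI, auto)
    also have "\<dots> \<le> ennreal (?A3 * (?A2 * ?A1)) * (u (\<alpha>1 + \<alpha>2) * u (\<beta>1 + \<beta>2)) * (ennreal D * (p \<gamma> * p \<gamma>))"
      by (rule mult_left_mono[OF one]) simp
    also have "\<dots> = (ennreal ?A3 * u (\<alpha>1 + \<alpha>2)) * ((ennreal ?A2 * u (\<beta>1 + \<beta>2)) * (ennreal ?A1 * (ennreal D * (p \<gamma> * p \<gamma>))))"
      by (simp add: ennreal_mult mult_ac)
    also have "\<dots> \<le> (ennreal C2 * (p \<alpha>1 * p \<alpha>2)) * ((ennreal C2 * (p \<beta>1 * p \<beta>2)) * (ennreal ?A1 * (ennreal D * (p \<gamma> * p \<gamma>))))"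
      by (intro mult_mono e2 e3 order_refl) auto
    also have "\<dots> = (ennreal D * ennreal C2 * ennreal C2) * ((p \<alpha>1 * (ennreal ?A1 * (p \<beta>1 * p \<gamma>))) * ((p \<alpha>2 * p \<gamma>) * p \<beta>2))"
      by (simp add: mult_ac)
    also have "\<dots> \<le> (ennreal D * ennreal C2 * ennreal C2) * ((a \<alpha>1 * (ennreal C1 * a (\<beta>1 + \<gamma>))) * ((ennreal C1 * a (\<alpha>2 + \<gamma>)) * a \<beta>2))"
      by (intro mult_mono e1 e1' pa order_refl) auto
    also have "\<dots> = ennreal C * ?W"
      using C1 C2 D by (simp add: C_def ennreal_mult mult_ac)
    finally have E: "ennreal (4 ^ ?N) * (u (\<alpha>1 + \<alpha>2) * u (\<beta>1 + \<beta>2)) \<le> ennreal C * ?W" .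
    have inv: "x * inverse x \<le> 1" for x :: ennreal
      by (cases "x = 0 \<or> x = top") (auto simp: ennreal_divide_self[unfolded divide_ennreal_def] less_top)
    have "ennreal (4 ^ ?N) * ((u (\<alpha>1 + \<alpha>2) * u (\<beta>1 + \<beta>2)) * (inverse (a \<alpha>1 * a (\<beta>1 + \<gamma>)) * inverse (a (\<alpha>2 + \<gamma>) * a \<beta>2))) \<le>
        ennreal C * ?W * (inverse (a \<alpha>1 * a (\<beta>1 + \<gamma>)) * inverse (a (\<alpha>2 + \<gamma>) * a \<beta>2))"
      unfolding mult.assoc[symmetric, of "ennreal (4 ^ ?N)" "u (\<alpha>1 + \<alpha>2) * u (\<beta>1 + \<beta>2)"]
      by (rule mult_right_mono[OF E]) simp
    also have "\<dots> = ennreal C * (((a \<alpha>1 * a (\<beta>1 + \<gamma>)) * inverse (a \<alpha>1 * a (\<beta>1 + \<gamma>))) *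
        ((a (\<alpha>2 + \<gamma>) * a \<beta>2) * inverse (a (\<alpha>2 + \<gamma>) * a \<beta>2)))"
      by (simp only: mult_ac)
    also have "\<dots> \<le> ennreal C * (1 * 1)" by (intro mult_left_mono mult_mono inv) auto
    finally show ?thesis by simp
  qed
  then show ?thesis unfolding weight_est_def tensor_apply using C by blast
qed

lemma weight_est_mono:
  assumes "weight_est w1 w2 w3" "\<And>x. w1 x \<le> w1' x" "\<And>x. w2 x \<le> w2' x"
  shows "weight_est w1' w2' w3"
proof -
  obtain C where C: "C \<ge> 0" "\<And>\<alpha>1 \<alpha>2 \<beta>1 \<beta>2 \<gamma>.
     ennreal (4 ^ (midx_abs \<alpha>1 + midx_abs \<alpha>2 + midx_abs \<beta>1 + midx_abs \<beta>2 + midx_abs \<gamma>)) *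
       (w3 (\<alpha>1 + \<alpha>2, \<beta>1 + \<beta>2) * (inverse (w1 (\<alpha>1, \<beta>1 + \<gamma>)) * inverse (w2 (\<alpha>2 + \<gamma>, \<beta>2)))) \<le> ennreal C"
    using assms(1) unfolding weight_est_def by metis
  show ?thesis
    unfolding weight_est_def
    by (intro exI[of _ C] conjI allI C(1) order_trans[OF mult_left_mono[OF mult_left_mono[OF mult_mono]] C(2)])
      (auto intro: ennreal_inverse_antimono assms)
qed

section \<open>Uniqueness of power series and Gaussian integrals\<close>

text \<open>The leading-term argument for Dirichlet series: multiply by the \<open>k\<close>-th
  power of the smallest \<open>n x\<close> with a nonzero coefficient. All other terms are bounded
  by a geometric sequence in \<open>k\<close> times the absolute sum of the coefficients, which is
  finite by the case \<open>k = 0\<close>.\<close>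

lemma dirichlet_coefficients_unique:
  fixes c :: "'x \<Rightarrow> complex" and n :: "'x \<Rightarrow> nat"
  assumes n: "\<And>x. 0 < n x" "inj n"
    and s: "\<And>k::nat. ((\<lambda>x. c x * complex_of_real ((1 / real (n x)) ^ k)) has_sum 0) UNIV"
  shows "c x = 0"
proof (rule ccontr)
  assume cx: "c x \<noteq> 0"
  define x0 where "x0 = arg_min n (\<lambda>x. c x \<noteq> 0)"
  have x0: "c x0 \<noteq> 0" using arg_min_natI[of "\<lambda>x. c x \<noteq> 0", OF cx] by (simp add: x0_def)
  have min: "n x0 \<le> n y" if "c y \<noteq> 0" for y
    unfolding x0_def by (rule arg_min_nat_le[of "\<lambda>x. c x \<noteq> 0", OF that])
  define N where "N = real (n x0)"
  have N: "N > 0" using n(1)[of x0] by (simp add: N_def)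
  have "c summable_on UNIV" using s[of 0] by (auto simp: summable_on_def)
  then have c: "(\<lambda>x. cmod (c x)) summable_on UNIV" by (simp add: summable_on_iff_abs_summable_on_complex)
  define M where "M = infsum (\<lambda>x. cmod (c x)) (UNIV - {x0})"
  have c': "(\<lambda>x. cmod (c x)) summable_on (UNIV - {x0})"
    by (rule summable_on_subset_banach[OF c]) simp
  have bound: "cmod (c x0) \<le> M * (N / (N + 1)) ^ k" for k
  proof -
    let ?f = "\<lambda>x. c x * complex_of_real ((N / real (n x)) ^ k)"
    let ?A = "UNIV - {x0}"
    have "((\<lambda>x. complex_of_real (N ^ k) * (c x * complex_of_real ((1 / real (n x)) ^ k))) has_sum
        complex_of_real (N ^ k) * 0) UNIV"
      by (rule has_sum_cmult_right[OF s])
    then have f: "(?f has_sum 0) UNIV" by (simp add: power_divide mult_ac)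
    have le: "cmod (?f x) \<le> cmod (c x) * (N / (N + 1)) ^ k" if "x \<in> ?A" for x
    proof (cases "c x = 0")
      case False
      have "n x0 \<noteq> n x" using that n(2) by (auto simp: inj_def)
      then have "n x0 + 1 \<le> n x" using min[OF False] by simp
      then have "N + 1 \<le> real (n x)" by (simp add: N_def)
      then have "N / real (n x) \<le> N / (N + 1)" using N by (intro divide_left_mono) auto
      then have "(N / real (n x)) ^ k \<le> (N / (N + 1)) ^ k" using N by (intro power_mono) auto
      then show ?thesis using N by (simp add: norm_mult mult_left_mono norm_power norm_divide)
    qed simp
    have g: "(\<lambda>x. cmod (c x) * (N / (N + 1)) ^ k) summable_on ?A"
      by (rule summable_on_cmult_left[OF c'])
    have af: "(\<lambda>x. cmod (?f x)) summable_on ?A"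
      by (rule summable_on_comparison_test[OF g le]) auto
    have "(?f has_sum ?f x0) {x0}" by (rule has_sum_finiteI) auto
    from has_sum_Diff[OF f this] have "(?f has_sum (0 - ?f x0)) ?A" by simp
    moreover have "?f x0 = c x0" using N by (simp add: N_def)
    ultimately have "- c x0 = infsum ?f ?A" by (simp add: infsumI)
    then have "cmod (c x0) = cmod (infsum ?f ?A)" by (metis norm_minus_cancel)
    also have "\<dots> \<le> infsum (\<lambda>x. cmod (?f x)) ?A" by (rule norm_infsum_bound[OF af])
    also have "\<dots> \<le> infsum (\<lambda>x. cmod (c x) * (N / (N + 1)) ^ k) ?A"
      by (rule infsum_mono[OF af g le])
    also have "\<dots> = M * (N / (N + 1)) ^ k"
      unfolding M_def by (rule infsum_cmult_left) (use c' in simp)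
    finally show ?thesis .
  qed
  have "(\<lambda>k. M * (N / (N + 1)) ^ k) \<longlonglongrightarrow> M * 0"
    using N by (intro tendsto_mult tendsto_const LIMSEQ_power_zero) (simp add: abs_of_pos)
  then have "cmod (c x0) \<le> M * 0" by (rule LIMSEQ_le_const) (use bound in blast)
  then show False using x0 by simp
qed

lemma prime_labelling:
  obtains \<pi> :: "'a::finite \<Rightarrow> nat" where "inj \<pi>" "\<And>x. prime (\<pi> x)"
proof -
  obtain h :: "'a \<Rightarrow> nat" and m where h: "inj h"
    using finite_imp_inj_to_nat_seg[of "UNIV :: 'a set"] by auto
  let ?P = "{p::nat. prime p}"
  have "inj (enumerate ?P)"
    using strict_mono_enumerate[OF primes_infinite] by (simp add: strict_mono_imp_inj_on)
  then have "inj (enumerate ?P \<circ> h)" using h by (rule inj_compose)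
  moreover have "prime ((enumerate ?P \<circ> h) x)" for x
    using enumerate_in_set[OF primes_infinite, of "h x"] by simp
  ultimately show thesis by (rule that)
qed

lemma prime_power_products_inj:
  fixes \<pi> :: "'a::finite \<Rightarrow> nat"
  assumes "inj \<pi>" "\<And>x. prime (\<pi> x)" "(\<Prod>x\<in>UNIV. \<pi> x ^ e x) = (\<Prod>x\<in>UNIV. \<pi> x ^ e' x)"
  shows "e = e'"
proof
  fix y
  have "multiplicity (\<pi> y) (\<Prod>x\<in>UNIV. \<pi> x ^ e x) = e y" for e
  proof -
    have eq: "(\<Prod>x\<in>UNIV. \<pi> x ^ e x) = (\<Prod>p\<in>range \<pi>. p ^ e (inv \<pi> p))"
      using assms(1) by (subst prod.reindex) auto
    then show ?thesis
      using assms(1,2) by (subst eq, subst multiplicity_prod_prime_powers) auto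
  qed
  then show "e y = e' y" using assms(3) by metis
qed

section \<open>A power series is determined by its values\<close>

lemma midx_fact_pos: "midx_fact \<alpha> > 0"
  by (simp add: midx_fact_def prod_pos)

lemma cnj_vec_nth [simp]: "cnj_vec w $ j = cnj (w $ j)"
  by (simp add: cnj_vec_def)

text \<open>Evaluating at the points whose coordinates are \<open>k\<close>-th powers of reciprocals of distinct primes turns
  the monomials into \<open>n\<^sup>-\<^sup>k\<close> with distinct integers \<open>n\<close>, as in a Dirichlet series.\<close>

lemma wterm_unique:
  fixes c :: "'n::finite wseries"
  assumes "\<And>z w. (wterm c z w has_sum 0) UNIV"
  shows "c = (\<lambda>_. 0)"
proof
  fix x
  obtain \<pi> :: "'n \<times> bool \<Rightarrow> nat" where \<pi>: "inj \<pi>" "\<And>x. prime (\<pi> x)"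
    by (rule prime_labelling) blast
  have \<pi>0: "\<pi> y > 0" for y using \<pi>(2)[of y] by (simp add: prime_gt_0_nat)
  define e :: "(nat ^ 'n) \<times> (nat ^ 'n) \<Rightarrow> 'n \<times> bool \<Rightarrow> nat" where
    "e = (\<lambda>(\<alpha>, \<beta>) (j, b). if b then \<beta> $ j else \<alpha> $ j)"
  define n where "n x = (\<Prod>y\<in>UNIV. \<pi> y ^ e x y)" for x
  have "inj e"
  proof (rule injI)
    fix x y assume eq: "e x = e y"
    have "fst x $ j = fst y $ j \<and> snd x $ j = snd y $ j" for j
      using fun_cong[OF eq, of "(j, False)"] fun_cong[OF eq, of "(j, True)"] by (simp add: e_def split_beta)
    then show "x = y" by (simp add: prod_eq_iff vec_eq_iff)
  qed
  then have "inj n"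
    unfolding n_def using prime_power_products_inj[OF \<pi>] by (auto intro!: injI dest: injD)
  moreover have "n x > 0" for x unfolding n_def using \<pi>0 by (simp add: prod_pos)
  moreover define s :: "(nat ^ 'n) \<times> (nat ^ 'n) \<Rightarrow> complex" where
    "s = (\<lambda>(\<alpha>, \<beta>). complex_of_real (sqrt (midx_fact \<alpha>)) * complex_of_real (sqrt (midx_fact \<beta>)))"
  moreover have "((\<lambda>x. (c x / s x) * complex_of_real ((1 / real (n x)) ^ k)) has_sum 0) UNIV" for k
  proof -
    \<comment> \<open>The points have real coordinates, so the conjugation of \<open>w\<close>
      disappears. The Boolean in the label separates the primes used for \<open>z\<close> from those
      used for \<open>w\<close>.\<close>
    define z :: "complex ^ 'n" where "z = (\<chi> j. complex_of_real ((1 / real (\<pi> (j, False))) ^ k))"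
    define w :: "complex ^ 'n" where "w = (\<chi> j. complex_of_real ((1 / real (\<pi> (j, True))) ^ k))"
    have "wterm c z w x = (c x / s x) * complex_of_real ((1 / real (n x)) ^ k)" for x
    proof (cases x)
      case (Pair \<alpha> \<beta>)
      have "real (n x) = (\<Prod>y\<in>UNIV \<times> UNIV. real (\<pi> y) ^ e x y)" by (simp add: n_def)
      also have "\<dots> = (\<Prod>j\<in>UNIV. \<Prod>b\<in>UNIV. real (\<pi> (j, b)) ^ e x (j, b))"
        by (subst prod.cartesian_product) simp
      also have "\<dots> = (\<Prod>j\<in>UNIV. real (\<pi> (j, False)) ^ (\<alpha> $ j)) * (\<Prod>j\<in>UNIV. real (\<pi> (j, True)) ^ (\<beta> $ j))"
        by (simp add: UNIV_bool Pair e_def prod.distrib)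
      finally have "(1 / real (n x)) ^ k = (\<Prod>j\<in>UNIV. ((1 / real (\<pi> (j, False))) ^ k) ^ (\<alpha> $ j)) *
          (\<Prod>j\<in>UNIV. ((1 / real (\<pi> (j, True))) ^ k) ^ (\<beta> $ j))"
        by (simp add: power_divide prod_dividef prod_power_distrib power_mult_distrib power_mult[symmetric] mult.commute)
      then show ?thesis
        by (simp add: Pair wterm_def e_mon_def z_def w_def s_def)
    qed
    then have "wterm c z w = (\<lambda>x. (c x / s x) * complex_of_real ((1 / real (n x)) ^ k))" by (rule ext)
    then show ?thesis using assms[of z w] by (simp only:)
  qed
  ultimately have "c x / s x = 0" by (intro dirichlet_coefficients_unique[of n "\<lambda>x. c x / s x"])
  moreover have nz: "midx_fact \<alpha> \<noteq> 0" for \<alpha> :: "nat ^ 'n" using midx_fact_pos[of \<alpha>] by simp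
  have "s x \<noteq> 0" by (auto simp: s_def nz split: prod.split)
  ultimately show "c x = 0" by simp
qed

text \<open>The real shift and scaling \<open>x = a / 2 + y / sqrt 2\<close> completes the square in
  the real part of \<open>s\<close>. The imaginary part survives as a Fourier factor, whose mean is
  the characteristic function of the normal distribution at \<open>b / sqrt 2\<close>.\<close>

lemma gaussian_real:
  fixes s :: complex
  shows "integrable lborel (\<lambda>x::real. exp (s * of_real x - of_real (x\<^sup>2)))" (is "integrable _ ?f")
    and "(\<integral>x. exp (s * of_real x - of_real (x\<^sup>2)) \<partial>lborel) = of_real (sqrt pi) * exp (s\<^sup>2 / 4)"
proof -
  define a b where "a = Re s" and "b = Im s"
  have s: "s = Complex a b" by (simp add: a_def b_def)
  define K where "K = exp (of_real (a\<^sup>2 / 4) + \<i> * of_real (a * b / 2)) * of_real (sqrt (2 * pi))"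
  define g where "g y = std_normal_density y *\<^sub>R iexp (b / sqrt 2 * y)" for y
  have eq: "?f (a / 2 + 1 / sqrt 2 * y) = K * g y" for y
  proof -
    have "s * of_real (a / 2 + 1 / sqrt 2 * y) - of_real ((a / 2 + 1 / sqrt 2 * y)\<^sup>2) =
        (of_real (a\<^sup>2 / 4) + \<i> * of_real (a * b / 2)) + (of_real (- (y\<^sup>2) / 2) + \<i> * of_real (b / sqrt 2 * y))"
      unfolding s by (simp add: complex_eq_iff power2_eq_square field_simps)
    then have "?f (a / 2 + 1 / sqrt 2 * y) = exp (of_real (a\<^sup>2 / 4) + \<i> * of_real (a * b / 2)) *
        (exp (complex_of_real (- (y\<^sup>2) / 2)) * iexp (b / sqrt 2 * y))"
      by (simp only: exp_add)
    also have "exp (complex_of_real (- (y\<^sup>2) / 2)) = of_real (std_normal_density y) * complex_of_real (sqrt (2 * pi))"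
      by (simp only: std_normal_density_def exp_of_real of_real_mult[symmetric]) simp
    finally show ?thesis
      unfolding K_def g_def by (simp only: scaleR_conv_of_real mult_ac)
  qed
  have gi: "integrable lborel g"
  proof (rule Bochner_Integration.integrable_bound)
    show "integrable lborel std_normal_density" using integrable_std_normal_moment[of 0] by simp
    show "AE y in lborel. norm (g y) \<le> norm (std_normal_density y)"
      by (simp add: g_def norm_mult)
  qed (unfold g_def[abs_def], measurable)
  have "integrable lborel (\<lambda>y. ?f (a / 2 + 1 / sqrt 2 * y))"
    unfolding eq using gi by simp
  then show fi: "integrable lborel ?f"
    by (subst (asm) lborel_integrable_real_affine_iff) auto
  have "integral\<^sup>L lborel g = char std_normal_distribution (b / sqrt 2)"
    unfolding char_def g_def by (subst integral_density) (auto simp: normal_density_nonneg)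
  also have "\<dots> = of_real (exp (- (b\<^sup>2) / 4))"
    by (simp add: char_std_normal_distribution power_divide)
  finally have g: "integral\<^sup>L lborel g = of_real (exp (- (b\<^sup>2) / 4))" .
  have "integral\<^sup>L lborel ?f = \<bar>1 / sqrt 2\<bar> *\<^sub>R (\<integral>y. ?f (a / 2 + 1 / sqrt 2 * y) \<partial>lborel)"
    by (rule lborel_integral_real_affine) simp
  also have "(\<integral>y. ?f (a / 2 + 1 / sqrt 2 * y) \<partial>lborel) = K * of_real (exp (- (b\<^sup>2) / 4))"
    unfolding eq using gi by (simp add: g)
  also have "\<bar>1 / sqrt 2\<bar> *\<^sub>R (K * of_real (exp (- (b\<^sup>2) / 4))) =
      of_real (sqrt pi) * (exp (of_real (a\<^sup>2 / 4) + \<i> * of_real (a * b / 2)) * exp (of_real (- (b\<^sup>2) / 4)))"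
    by (simp add: K_def scaleR_conv_of_real real_sqrt_mult flip: exp_of_real)
  also have "exp (of_real (a\<^sup>2 / 4) + \<i> * of_real (a * b / 2)) * exp (of_real (- (b\<^sup>2) / 4)) = exp (s\<^sup>2 / 4)"
    unfolding exp_add[symmetric] s
    by (rule arg_cong[of _ _ exp]) (simp add: complex_eq_iff power2_eq_square field_simps)
  finally show "integral\<^sup>L lborel ?f = of_real (sqrt pi) * exp (s\<^sup>2 / 4)" .
qed

lemma lborel_prod:
  fixes f :: "'a::euclidean_space \<Rightarrow> real \<Rightarrow> 'b::{real_normed_field,banach,second_countable_topology}"
  assumes f: "\<And>b. b \<in> Basis \<Longrightarrow> integrable lborel (f b)"
  shows "integrable lborel (\<lambda>x::'a. \<Prod>b\<in>Basis. f b (x \<bullet> b))"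
    and "(LINT x|lborel. (\<Prod>b\<in>Basis. f b ((x::'a) \<bullet> b))) = (\<Prod>b\<in>Basis. integral\<^sup>L lborel (f b))"
proof -
  interpret product_sigma_finite "\<lambda>_::'a. lborel :: real measure" ..
  let ?M = "\<Pi>\<^sub>M b\<in>Basis. lborel :: real measure" and ?g = "\<lambda>f. \<Sum>b\<in>Basis. f b *\<^sub>R b :: 'a"
  have fm: "f b \<in> borel_measurable borel" if "b \<in> Basis" for b
    using borel_measurable_integrable[OF f[OF that]] by simp
  have m: "(\<lambda>x::'a. \<Prod>b\<in>Basis. f b (x \<bullet> b)) \<in> borel_measurable borel"
  proof (rule borel_measurable_prod)
    fix b :: 'a assume "b \<in> Basis"
    have "(\<lambda>x. x \<bullet> b) \<in> borel_measurable borel" by measurable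
    from measurable_compose[OF this fm[OF \<open>b \<in> Basis\<close>]]
    show "(\<lambda>x. f b (x \<bullet> b)) \<in> borel_measurable borel" .
  qed
  have g: "?g \<in> measurable ?M borel" by measurable
  have eq: "(\<Prod>b\<in>Basis. f b (?g x \<bullet> b)) = (\<Prod>b\<in>Basis. f b (x b))" for x
    by (rule prod.cong) (simp_all add: inner_sum_left_Basis)
  show "integrable lborel (\<lambda>x::'a. \<Prod>b\<in>Basis. f b (x \<bullet> b))"
    unfolding lborel_eq[where 'a = 'a] integrable_distr_eq[OF g m] eq
    by (rule product_integrable_prod[OF finite_Basis f])
  show "(LINT x|lborel. (\<Prod>b\<in>Basis. f b ((x::'a) \<bullet> b))) = (\<Prod>b\<in>Basis. integral\<^sup>L lborel (f b))"
    unfolding lborel_eq[where 'a = 'a] integral_distr[OF g m] eq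
    by (rule product_integral_prod[OF finite_Basis f])
qed

lemma prod_Basis_cvec:
  "(\<Prod>b\<in>(Basis :: (complex ^ 'n::finite) set). F b) = (\<Prod>j\<in>UNIV. F (axis j 1) * F (axis j \<i>))"
proof -
  have B: "(Basis :: (complex ^ 'n) set) = (\<lambda>(j, b). axis j b) ` (UNIV \<times> {1, \<i>})"
    by (auto simp: Basis_vec_def Basis_complex_def)
  have inj: "inj_on (\<lambda>(j, b). axis j b :: complex ^ 'n) (UNIV \<times> {1, \<i>})"
    by (auto simp: inj_on_def axis_eq_axis)
  have "(\<Prod>b\<in>(Basis :: (complex ^ 'n) set). F b) = (\<Prod>(j, b)\<in>UNIV \<times> {1, \<i>}. F (axis j b))"
    unfolding B by (subst prod.reindex[OF inj]) (simp add: case_prod_unfold)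
  also have "\<dots> = (\<Prod>j\<in>UNIV. \<Prod>b\<in>{1, \<i>}. F (axis j b))"
    by (rule prod.cartesian_product[symmetric])
  finally show ?thesis by (simp add: complex_eq_iff)
qed

lemma inner_axis_cvec: "u \<bullet> axis j 1 = Re (u $ j)" "u \<bullet> axis j \<i> = Im (u $ j)"
  by (simp_all add: inner_axis)

lemma gaussian_cvec:
  fixes s t :: "'n::finite \<Rightarrow> complex"
  defines "f \<equiv> \<lambda>u :: complex ^ 'n. exp (\<Sum>j\<in>UNIV. s j * cnj (u $ j) + t j * u $ j - of_real ((cmod (u $ j))\<^sup>2))"
  shows "integrable lborel f" "integral\<^sup>L lborel f = of_real (pi ^ CARD('n)) * exp (\<Sum>j\<in>UNIV. s j * t j)"
proof -
  define \<sigma> where "\<sigma> b = (\<Sum>j\<in>UNIV. s j * cnj (b $ j) + t j * b $ j)" for b :: "complex ^ 'n"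
  have \<sigma>: "\<sigma> (axis j x) = s j * cnj x + t j * x" for j x
    unfolding \<sigma>_def by (subst sum.remove[of _ j]) (auto simp: axis_def intro!: sum.neutral)
  define g where "g b x = exp (\<sigma> b * of_real x - of_real (x\<^sup>2))" for b x
  have f: "f u = (\<Prod>b\<in>Basis. g b (u \<bullet> b))" for u
  proof -
    have "s j * cnj (u $ j) + t j * u $ j - of_real ((cmod (u $ j))\<^sup>2) =
        (\<sigma> (axis j 1) * of_real (Re (u $ j)) - of_real ((Re (u $ j))\<^sup>2)) +
        (\<sigma> (axis j \<i>) * of_real (Im (u $ j)) - of_real ((Im (u $ j))\<^sup>2))" for j
      unfolding \<sigma> cmod_power2 by (simp add: complex_eq_iff algebra_simps)
    then show ?thesis
      unfolding f_def prod_Basis_cvec g_def inner_axis_cvec by (simp add: exp_sum exp_add)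
  qed
  have g: "integrable lborel (g b)" for b unfolding g_def by (rule gaussian_real)
  show "integrable lborel f"
    unfolding f[abs_def] by (rule lborel_prod(1)[OF g])
  have "integral\<^sup>L lborel f = (\<Prod>b\<in>Basis. integral\<^sup>L lborel (g b))"
    unfolding f[abs_def] by (rule lborel_prod(2)[OF g])
  also have "\<dots> = (\<Prod>j\<in>UNIV. of_real pi * exp (s j * t j))"
    unfolding prod_Basis_cvec
  proof (rule prod.cong[OF refl])
    fix j
    have "integral\<^sup>L lborel (g (axis j 1)) * integral\<^sup>L lborel (g (axis j \<i>)) =
        of_real (sqrt pi * sqrt pi) * (exp ((\<sigma> (axis j 1))\<^sup>2 / 4) * exp ((\<sigma> (axis j \<i>))\<^sup>2 / 4))"
      unfolding g_def gaussian_real(2) by (simp only: of_real_mult mult_ac)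
    also have "\<dots> = of_real pi * exp ((\<sigma> (axis j 1))\<^sup>2 / 4 + (\<sigma> (axis j \<i>))\<^sup>2 / 4)"
    proof -
      have sp: "sqrt pi * sqrt pi = pi" by simp
      show ?thesis by (simp only: sp exp_add)
    qed
    \<comment> \<open>The linear coefficients in the real and the imaginary direction are
      \<open>s j + t j\<close> and \<open>\<i> * (t j - s j)\<close>; the sum of their squares is
      \<open>4 * s j * t j\<close>.\<close>
    also have "(\<sigma> (axis j 1))\<^sup>2 / 4 + (\<sigma> (axis j \<i>))\<^sup>2 / 4 = s j * t j"
      unfolding \<sigma> by (simp add: power2_eq_square algebra_simps add_divide_distrib[symmetric] diff_divide_distrib[symmetric])
    finally show "integral\<^sup>L lborel (g (axis j 1)) * integral\<^sup>L lborel (g (axis j \<i>)) = of_real pi * exp (s j * t j)" .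
  qed
  also have "\<dots> = of_real (pi ^ CARD('n)) * exp (\<Sum>j\<in>UNIV. s j * t j)"
    by (simp add: prod.distrib exp_sum)
  finally show "integral\<^sup>L lborel f = of_real (pi ^ CARD('n)) * exp (\<Sum>j\<in>UNIV. s j * t j)" .
qed

text \<open>Dominated termwise integration for unconditional sums: the countable index is moved to
  the natural numbers, with zero terms outside its image, and the bound on all finite sums makes the
  series of integrated norms converge.\<close>

lemma integral_has_sum:
  fixes f :: "'x::countable \<Rightarrow> 'a::euclidean_space \<Rightarrow> complex"
  assumes f: "\<And>x. f x \<in> borel_measurable lborel" and h: "integrable lborel h"
    and bound: "\<And>F u. finite F \<Longrightarrow> (\<Sum>x\<in>F. cmod (f x u)) \<le> h u"
    and g: "\<And>u. ((\<lambda>x. f x u) has_sum g u) UNIV"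
  shows "((\<lambda>x. integral\<^sup>L lborel (f x)) has_sum integral\<^sup>L lborel g) UNIV"
proof -
  define F where "F n u = (if n \<in> range (to_nat :: 'x \<Rightarrow> nat) then f (from_nat n) u else 0)" for n u
  have transfer: "(G has_sum S) UNIV"
    if "((\<lambda>n. if n \<in> range (to_nat :: 'x \<Rightarrow> nat) then G (from_nat n) else 0) has_sum S) UNIV"
    for G :: "'x \<Rightarrow> complex" and S
  proof -
    have "((\<lambda>n. if n \<in> range (to_nat :: 'x \<Rightarrow> nat) then G (from_nat n) else 0) has_sum S) (range (to_nat :: 'x \<Rightarrow> nat))"
      using that by (subst has_sum_cong_neutral[where T = UNIV]) auto
    then show ?thesis by (subst (asm) has_sum_reindex) (auto simp: o_def)
  qed
  have transfer': "((\<lambda>n. if n \<in> range (to_nat :: 'x \<Rightarrow> nat) then G (from_nat n) else 0) has_sum S) UNIV"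
    if "(G has_sum S) UNIV" for G :: "'x \<Rightarrow> complex" and S
  proof -
    have "((\<lambda>n. if n \<in> range (to_nat :: 'x \<Rightarrow> nat) then G (from_nat n) else 0) has_sum S) (range (to_nat :: 'x \<Rightarrow> nat))"
      using that by (subst has_sum_reindex) (auto simp: o_def)
    then show ?thesis by (subst (asm) has_sum_cong_neutral[where T = UNIV]) auto
  qed
  have hb: "(\<Sum>n<N. norm (F n u)) \<le> h u" for N u
  proof -
    have "(\<Sum>n<N. norm (F n u)) = (\<Sum>n\<in>{n. n < N \<and> n \<in> range (to_nat :: 'x \<Rightarrow> nat)}. cmod (f (from_nat n) u))"
      by (rule sum.mono_neutral_cong_right) (auto simp: F_def)
    also have "\<dots> = (\<Sum>x\<in>from_nat ` {n. n < N \<and> n \<in> range (to_nat :: 'x \<Rightarrow> nat)}. cmod (f x u))"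
      by (subst sum.reindex) (auto simp: inj_on_def)
    also have "\<dots> \<le> h u" by (rule bound) auto
    finally show ?thesis .
  qed
  have h0: "h u \<ge> 0" for u using bound[of "{}" u] by simp
  have Fm: "F n \<in> borel_measurable lborel" for n
    using f by (cases "n \<in> range (to_nat :: 'x \<Rightarrow> nat)") (simp_all add: F_def[abs_def])
  have Fh: "norm (F n u) \<le> h u" for n u
    using hb[where N = "Suc n" and u = u] member_le_sum[of n "{..<Suc n}" "\<lambda>n. norm (F n u)"] by simp
  have Fi: "integrable lborel (F n)" for n
    by (rule Bochner_Integration.integrable_bound[OF h Fm]) (use Fh h0 in \<open>auto simp: abs_of_nonneg\<close>)
  have sumF: "summable (\<lambda>n. norm (F n u))" for u
    by (rule summableI_nonneg_bounded[OF _ hb]) simp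
  have sumI: "summable (\<lambda>n. \<integral>u. norm (F n u) \<partial>lborel)"
  proof (rule summableI_nonneg_bounded)
    fix N
    have "(\<Sum>n<N. \<integral>u. norm (F n u) \<partial>lborel) = (\<integral>u. (\<Sum>n<N. norm (F n u)) \<partial>lborel)"
      using Fi by (intro Bochner_Integration.integral_sum[symmetric]) auto
    also have "\<dots> \<le> integral\<^sup>L lborel h"
      using Fi h hb by (intro integral_mono) auto
    finally show "(\<Sum>n<N. \<integral>u. norm (F n u) \<partial>lborel) \<le> integral\<^sup>L lborel h" .
  qed simp
  have gF: "(\<Sum>n. F n u) = g u" for u
    using has_sum_imp_sums[OF transfer'[OF g[of u]]] by (simp add: F_def sums_unique[symmetric])
  have "(\<lambda>n. integral\<^sup>L lborel (F n)) sums (\<integral>u. (\<Sum>n. F n u) \<partial>lborel)"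
    by (rule sums_integral[OF Fi _ sumI]) (simp add: sumF)
  then have "(\<lambda>n. integral\<^sup>L lborel (F n)) sums integral\<^sup>L lborel g" by (simp add: gF)
  moreover have "summable (\<lambda>n. norm (integral\<^sup>L lborel (F n)))"
    by (rule summable_comparison_test'[OF sumI]) (simp add: integral_norm_bound)
  ultimately have "((\<lambda>n. integral\<^sup>L lborel (F n)) has_sum integral\<^sup>L lborel g) UNIV"
    by (intro norm_summable_imp_has_sum)
  moreover have "integral\<^sup>L lborel (F n) = (if n \<in> range (to_nat :: 'x \<Rightarrow> nat) then integral\<^sup>L lborel (f (from_nat n)) else 0)" for n
    by (simp add: F_def[abs_def])
  ultimately show ?thesis by (intro transfer) simp
qed

section \<open>Generating functions of the monomials and Gaussian means\<close>

definition dot :: "complex ^ 'n::finite \<Rightarrow> complex ^ 'n \<Rightarrow> complex" where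
  "dot x y = (\<Sum>j\<in>UNIV. x $ j * y $ j)"

definition cmod_vec :: "complex ^ 'n::finite \<Rightarrow> complex ^ 'n" where
  "cmod_vec x = (\<chi> j. complex_of_real (cmod (x $ j)))"

lemma e_mon_mult_e_mon:
  "e_mon \<alpha> x * e_mon \<alpha> y = (\<Prod>j\<in>UNIV. (x $ j * y $ j) ^ (\<alpha> $ j) / fact (\<alpha> $ j))"
proof -
  have "complex_of_real (sqrt (midx_fact \<alpha>)) * complex_of_real (sqrt (midx_fact \<alpha>)) = of_real (midx_fact \<alpha>)"
    using midx_fact_pos[of \<alpha>] by (metis of_real_mult real_sqrt_mult_self abs_of_pos)
  then have "e_mon \<alpha> x * e_mon \<alpha> y = (\<Prod>j\<in>UNIV. (x $ j) ^ (\<alpha> $ j)) * (\<Prod>j\<in>UNIV. (y $ j) ^ (\<alpha> $ j)) / of_real (midx_fact \<alpha>)"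
    by (simp add: e_mon_def)
  then show ?thesis
    by (simp add: midx_fact_def prod_dividef power_mult_distrib prod.distrib)
qed

text \<open>The normalisation by the square root of the factorial makes the product of two monomials
  the multi-index term of the exponential series; the sum is the reproducing kernel of the Fock
  space.\<close>

lemma e_mon_series:
  shows "(\<lambda>\<alpha>. cmod (e_mon \<alpha> x * e_mon \<alpha> y)) summable_on UNIV"
    and "((\<lambda>\<alpha>. e_mon \<alpha> x * e_mon \<alpha> y) has_sum exp (dot x y)) UNIV"
proof -
  let ?f = "\<lambda>j k. (x $ j * y $ j) ^ k / fact k"
  have n: "summable (\<lambda>k. cmod (?f j k))" for j
    using summable_norm_exp[of "x $ j * y $ j"] by (simp add: scaleR_conv_of_real divide_inverse mult.commute)
  then have s: "(\<lambda>k. cmod (?f j k)) summable_on UNIV" for j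
    by (subst summable_on_UNIV_nonneg_real_iff) auto
  have "?f j sums exp (x $ j * y $ j)" for j
    using exp_converges[of "x $ j * y $ j"] by (simp add: scaleR_conv_of_real divide_inverse mult.commute)
  then have e: "infsum (?f j) UNIV = exp (x $ j * y $ j)" for j
    using n by (intro infsumI norm_summable_imp_has_sum)
  show "(\<lambda>\<alpha>. cmod (e_mon \<alpha> x * e_mon \<alpha> y)) summable_on UNIV"
    unfolding e_mon_mult_e_mon by (rule has_sum_vec_prod(1)[OF s])
  show "((\<lambda>\<alpha>. e_mon \<alpha> x * e_mon \<alpha> y) has_sum exp (dot x y)) UNIV"
    using has_sum_vec_prod(2)[OF s] unfolding e_mon_mult_e_mon e by (simp add: dot_def exp_sum)
qed

lemma e_mon_cmod_vec: "e_mon \<alpha> (cmod_vec x) = complex_of_real (cmod (e_mon \<alpha> x))"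
  using midx_fact_pos[of \<alpha>] by (simp add: e_mon_def cmod_vec_def norm_divide prod_norm[symmetric] norm_power)

text \<open>At the vectors of coordinate moduli the terms of the exponential series are exactly the
  moduli of the original terms.\<close>

lemma e_mon_series_bound:
  assumes "finite F"
  shows "(\<Sum>\<alpha>\<in>F. cmod (e_mon \<alpha> x * e_mon \<alpha> y)) \<le> exp (\<Sum>j\<in>UNIV. cmod (x $ j) * cmod (y $ j))"
proof -
  have "((\<lambda>\<alpha>. complex_of_real (cmod (e_mon \<alpha> x * e_mon \<alpha> y))) has_sum exp (dot (cmod_vec x) (cmod_vec y))) UNIV"
    using e_mon_series(2)[of "cmod_vec x" "cmod_vec y"] by (simp add: e_mon_cmod_vec norm_mult)
  also have "exp (dot (cmod_vec x) (cmod_vec y)) = complex_of_real (exp (\<Sum>j\<in>UNIV. cmod (x $ j) * cmod (y $ j)))"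
    by (simp add: dot_def cmod_vec_def flip: exp_of_real)
  finally have "((\<lambda>\<alpha>. cmod (e_mon \<alpha> x * e_mon \<alpha> y)) has_sum exp (\<Sum>j\<in>UNIV. cmod (x $ j) * cmod (y $ j))) UNIV"
    by (simp only: has_sum_of_real_iff)
  then show ?thesis
    by (rule finite_sum_le_has_sum[OF _ assms]) auto
qed

text \<open>Multiplying normalised monomials costs the square root of a binomial; all four binomials
  in \<open>tw_coeff\<close> come from here.\<close>

lemma e_mon_add:
  "e_mon \<alpha> x * e_mon \<gamma> x = complex_of_real (sqrt (vbin (\<alpha> + \<gamma>) \<gamma>)) * e_mon (\<alpha> + \<gamma>) x"
proof -
  have "real ((a + b) choose b) * (fact a * fact b) = fact (a + b)" for a b
  proof -
    have "fact b * fact a * ((a + b) choose b) = fact (a + b)" using binomial_fact_lemma[of b "a + b"] by simp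
    then have "real (fact b * fact a * ((a + b) choose b)) = real (fact (a + b))" by (rule arg_cong)
    then show ?thesis by (simp add: mult_ac)
  qed
  then have "vbin (\<alpha> + \<gamma>) \<gamma> * (midx_fact \<alpha> * midx_fact \<gamma>) = midx_fact (\<alpha> + \<gamma>)"
    by (simp add: vbin_def midx_fact_def prod.distrib[symmetric])
  then have "sqrt (vbin (\<alpha> + \<gamma>) \<gamma>) * (sqrt (midx_fact \<alpha>) * sqrt (midx_fact \<gamma>)) = sqrt (midx_fact (\<alpha> + \<gamma>))"
    by (simp add: real_sqrt_mult[symmetric])
  then have "complex_of_real (sqrt (vbin (\<alpha> + \<gamma>) \<gamma>)) *
      (complex_of_real (sqrt (midx_fact \<alpha>)) * complex_of_real (sqrt (midx_fact \<gamma>))) = complex_of_real (sqrt (midx_fact (\<alpha> + \<gamma>)))"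
    by (simp flip: of_real_mult)
  moreover have "sqrt (midx_fact \<beta>) \<noteq> 0" for \<beta> :: "nat ^ 'a" using midx_fact_pos[of \<beta>] by simp
  ultimately show ?thesis
    by (simp add: e_mon_def power_add prod.distrib field_simps)
qed

text \<open>The Gaussian mean of \<open>e\<^sub>\<beta>(u\<^sup>*) e\<^sub>\<alpha>(u)\<close> with respect to the kernel \<open>exp (- (z - u, w - u))\<close>.\<close>

definition wick :: "complex ^ 'n::finite \<Rightarrow> complex ^ 'n \<Rightarrow> (nat ^ 'n) \<times> (nat ^ 'n) \<Rightarrow> complex" where
  "wick z w = (\<lambda>(\<alpha>, \<beta>). \<Sum>\<gamma> | \<gamma> \<le> \<alpha> \<and> \<gamma> \<le> \<beta>. complex_of_real (sqrt (vbin \<alpha> \<gamma> * vbin \<beta> \<gamma>)) *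
     (e_mon (\<alpha> - \<gamma>) z * e_mon (\<beta> - \<gamma>) (cnj_vec w)))"

lemma finite_vec_le: "finite {\<gamma> :: nat ^ 'n::finite. \<gamma> \<le> \<alpha>}"
proof (rule finite_subset[OF _ finite_vec_box])
  show "{\<gamma>. \<gamma> \<le> \<alpha>} \<subseteq> {\<gamma>. \<forall>j. \<gamma> $ j \<le> Max (range (\<lambda>j. \<alpha> $ j))}"
    by (auto simp: less_eq_vec_def intro: order_trans[OF _ Max_ge])
qed

lemma vec_add_diff: "\<gamma> \<le> \<alpha> \<Longrightarrow> (\<alpha> - \<gamma>) + \<gamma> = (\<alpha> :: nat ^ 'n::finite)"
  by (simp add: vec_eq_iff less_eq_vec_def)

lemma vec_add_diff_cancel [simp]: "(\<alpha> + \<gamma>) - \<gamma> = (\<alpha> :: nat ^ 'n::finite)" "\<gamma> \<le> \<alpha> + (\<gamma> :: nat ^ 'n::finite)"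
  "\<gamma> \<le> \<gamma> + (\<alpha> :: nat ^ 'n::finite)" "(\<gamma> + \<alpha>) - \<gamma> = (\<alpha> :: nat ^ 'n::finite)"
  by (simp_all add: vec_eq_iff less_eq_vec_def)

text \<open>Expand each of the three exponentials into its own series, with indices \<gamma>,
  \<alpha> and \<beta>. The powers of \<open>Q\<close> and \<open>P\<close> combine to
  \<open>\<alpha> + \<gamma>\<close> and \<open>\<beta> + \<gamma>\<close>; grouping by these sums
  produces the finite sums in \<open>wick\<close>.\<close>

lemma wick_generating:
  "((\<lambda>(\<alpha>, \<beta>). wick z w (\<alpha>, \<beta>) * (e_mon \<alpha> Q * e_mon \<beta> P)) has_sum
     exp (dot P Q + dot z Q + dot P (cnj_vec w))) UNIV"
proof -
  let ?f = "\<lambda>(\<gamma>, \<alpha>, \<beta>). (e_mon \<gamma> P * e_mon \<gamma> Q) * ((e_mon \<alpha> z * e_mon \<alpha> Q) * (e_mon \<beta> P * e_mon \<beta> (cnj_vec w)))"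
  have 1: "(\<lambda>(\<alpha>, \<beta>). cmod ((e_mon \<alpha> z * e_mon \<alpha> Q) * (e_mon \<beta> P * e_mon \<beta> (cnj_vec w)))) summable_on UNIV"
    "((\<lambda>(\<alpha>, \<beta>). (e_mon \<alpha> z * e_mon \<alpha> Q) * (e_mon \<beta> P * e_mon \<beta> (cnj_vec w))) has_sum exp (dot z Q) * exp (dot P (cnj_vec w))) UNIV"
    by (rule has_sum_pair_prod[OF e_mon_series(1) e_mon_series(2) e_mon_series(1) e_mon_series(2)])+
  have "((\<lambda>(\<gamma>, x). (e_mon \<gamma> P * e_mon \<gamma> Q) * (case x of (\<alpha>, \<beta>) \<Rightarrow> (e_mon \<alpha> z * e_mon \<alpha> Q) * (e_mon \<beta> P * e_mon \<beta> (cnj_vec w))))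
      has_sum exp (dot P Q) * (exp (dot z Q) * exp (dot P (cnj_vec w)))) UNIV"
  proof (rule has_sum_pair_prod(2)[OF e_mon_series(1) e_mon_series(2) _ 1(2)])
    show "(\<lambda>x. cmod (case x of (\<alpha>, \<beta>) \<Rightarrow> (e_mon \<alpha> z * e_mon \<alpha> Q) * (e_mon \<beta> P * e_mon \<beta> (cnj_vec w)))) summable_on UNIV"
      using 1(1) by (simp add: case_prod_unfold)
  qed
  then have f: "(?f has_sum exp (dot P Q + dot z Q + dot P (cnj_vec w))) UNIV"
    by (simp add: case_prod_unfold exp_add mult.assoc)
  let ?S = "Sigma UNIV (\<lambda>(\<alpha>, \<beta>). {\<gamma>. \<gamma> \<le> \<alpha> \<and> \<gamma> \<le> \<beta>}) :: (((nat ^ 'a) \<times> (nat ^ 'a)) \<times> (nat ^ 'a)) set"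
  let ?g = "\<lambda>((\<alpha>, \<beta>), \<gamma>). complex_of_real (sqrt (vbin \<alpha> \<gamma> * vbin \<beta> \<gamma>)) *
     (e_mon (\<alpha> - \<gamma>) z * e_mon (\<beta> - \<gamma>) (cnj_vec w)) * (e_mon \<alpha> Q * e_mon \<beta> P)"
  have "(?g has_sum exp (dot P Q + dot z Q + dot P (cnj_vec w))) ?S"
  proof (rule has_sum_reindex_bij_witness[where i = "\<lambda>((\<alpha>, \<beta>), \<gamma>). (\<gamma>, \<alpha> - \<gamma>, \<beta> - \<gamma>)"
        and j = "\<lambda>(\<gamma>, \<alpha>, \<beta>). ((\<alpha> + \<gamma>, \<beta> + \<gamma>), \<gamma>)", THEN iffD1])
    show "(?f has_sum exp (dot P Q + dot z Q + dot P (cnj_vec w))) UNIV" by (rule f)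
    fix a :: "(nat ^ 'a) \<times> (nat ^ 'a) \<times> (nat ^ 'a)"
    obtain \<gamma> \<alpha> \<beta> where a: "a = (\<gamma>, \<alpha>, \<beta>)" by (metis prod_cases3)
    have "(e_mon \<gamma> P * e_mon \<gamma> Q) * ((e_mon \<alpha> z * e_mon \<alpha> Q) * (e_mon \<beta> P * e_mon \<beta> (cnj_vec w))) =
        (e_mon \<alpha> Q * e_mon \<gamma> Q) * (e_mon \<beta> P * e_mon \<gamma> P) * (e_mon \<alpha> z * e_mon \<beta> (cnj_vec w))"
      by (simp only: mult_ac)
    then show "?g ((\<lambda>(\<gamma>, \<alpha>, \<beta>). ((\<alpha> + \<gamma>, \<beta> + \<gamma>), \<gamma>)) a) = ?f a"
      unfolding a by (auto simp: e_mon_add real_sqrt_mult mult_ac)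
  qed (auto simp: vec_add_diff)
  then have "((\<lambda>x. \<Sum>\<gamma>\<in>(case x of (\<alpha>, \<beta>) \<Rightarrow> {\<gamma>. \<gamma> \<le> \<alpha> \<and> \<gamma> \<le> \<beta>}). ?g (x, \<gamma>)) has_sum
      exp (dot P Q + dot z Q + dot P (cnj_vec w))) UNIV"
  proof (rule has_sum_SigmaD)
    fix x :: "(nat ^ 'a) \<times> (nat ^ 'a)"
    have "finite (case x of (\<alpha>, \<beta>) \<Rightarrow> {\<gamma>. \<gamma> \<le> \<alpha> \<and> \<gamma> \<le> \<beta>})"
      by (cases x) (auto intro: finite_subset[OF _ finite_vec_le])
    then show "((\<lambda>\<gamma>. ?g (x, \<gamma>)) has_sum (\<Sum>\<gamma>\<in>(case x of (\<alpha>, \<beta>) \<Rightarrow> {\<gamma>. \<gamma> \<le> \<alpha> \<and> \<gamma> \<le> \<beta>}). ?g (x, \<gamma>)))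
        (case x of (\<alpha>, \<beta>) \<Rightarrow> {\<gamma>. \<gamma> \<le> \<alpha> \<and> \<gamma> \<le> \<beta>})" by (rule has_sum_finite)
  qed
  then show ?thesis
    by (simp add: wick_def case_prod_unfold sum_distrib_right)
qed

lemma continuous_e_mon [continuous_intros]:
  fixes f :: "'a::topological_space \<Rightarrow> complex ^ 'n::finite"
  assumes "continuous_on S f"
  shows "continuous_on S (\<lambda>u. e_mon \<alpha> (f u))"
  unfolding e_mon_def divide_inverse by (intro continuous_intros assms)

lemma continuous_cnj_vec [continuous_intros]:
  fixes f :: "'a::topological_space \<Rightarrow> complex ^ 'n::finite"
  assumes "continuous_on S f"
  shows "continuous_on S (\<lambda>u. cnj_vec (f u))"
  unfolding cnj_vec_def by (intro continuous_intros assms)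

lemma neg_herm:
  "- herm (z - u) (w - u) = - herm z w + (\<Sum>j\<in>UNIV. z $ j * cnj (u $ j) + cnj (w $ j) * u $ j - of_real ((cmod (u $ j))\<^sup>2))"
proof -
  have "(z - u) $ j * cnj ((w - u) $ j) = z $ j * cnj (w $ j) -
      (z $ j * cnj (u $ j) + cnj (w $ j) * u $ j - of_real ((cmod (u $ j))\<^sup>2))" for j
    using complex_norm_square[of "u $ j"] by (simp add: algebra_simps)
  then show ?thesis by (simp add: herm_def sum_subtractf)
qed


text \<open>The linear terms are absorbed by half of the quadratic one,
  \<open>R x - x\<^sup>2 \<le> R\<^sup>2 / 2 - x\<^sup>2 / 2\<close> in every coordinate, which
  leaves an integrable product of one-dimensional Gaussians.\<close>

lemma gaussian_dominating:
  fixes z w P Q :: "complex ^ 'n::finite"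
  shows "integrable lborel (\<lambda>u. exp (\<Sum>j\<in>UNIV. cmod (Q $ j) * cmod (u $ j)) * exp (\<Sum>j\<in>UNIV. cmod (P $ j) * cmod (u $ j)) *
    cmod (exp (- herm (z - u) (w - u))))" (is "integrable _ ?h")
proof (rule Bochner_Integration.integrable_bound)
  define R where "R j = cmod (Q $ j) + cmod (P $ j) + cmod (z $ j) + cmod (w $ j)" for j
  define K where "K = cmod (herm z w) + (\<Sum>j\<in>UNIV. (R j)\<^sup>2 / 2)"
  define g where "g u = exp K * (\<Prod>b\<in>Basis. exp (- ((u \<bullet> b)\<^sup>2) / 2))" for u :: "complex ^ 'n"
  have "integrable lborel (\<lambda>x. sqrt (2 * pi) * (std_normal_density x * x ^ 0))"
    by (intro integrable_mult_right integrable_std_normal_moment)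
  then have "integrable lborel (\<lambda>x::real. exp (- (x\<^sup>2) / 2))"
    by (simp add: std_normal_density_def)
  then show "integrable lborel g"
    unfolding g_def[abs_def] by (intro integrable_mult_right lborel_prod(1)[of "\<lambda>b x. exp (- (x\<^sup>2) / 2)"])
  have gauss: "(\<Prod>b\<in>Basis. exp (- ((u \<bullet> b)\<^sup>2) / 2)) = exp (\<Sum>j\<in>UNIV. - ((cmod (u $ j))\<^sup>2) / 2)" for u :: "complex ^ 'n"
    unfolding prod_Basis_cvec inner_axis_cvec exp_sum[OF finite_class.finite_UNIV]
    by (rule prod.cong) (simp_all add: exp_add[symmetric] cmod_power2 diff_divide_distrib)
  show "AE u in lborel. norm (?h u) \<le> norm (g u)"
  proof (rule AE_I2)
    fix u :: "complex ^ 'n"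
    have "Re (- herm (z - u) (w - u)) \<le> cmod (herm z w) + (\<Sum>j\<in>UNIV. (cmod (z $ j) + cmod (w $ j)) * cmod (u $ j) - (cmod (u $ j))\<^sup>2)"
    proof -
      have "Re (z $ j * cnj (u $ j) + cnj (w $ j) * u $ j - of_real ((cmod (u $ j))\<^sup>2)) \<le>
          (cmod (z $ j) + cmod (w $ j)) * cmod (u $ j) - (cmod (u $ j))\<^sup>2" for j
        using complex_Re_le_cmod[of "z $ j * cnj (u $ j)"] complex_Re_le_cmod[of "cnj (w $ j) * u $ j"]
        by (simp add: norm_mult distrib_right del: times_complex.sel)
      then have "Re (\<Sum>j\<in>UNIV. z $ j * cnj (u $ j) + cnj (w $ j) * u $ j - of_real ((cmod (u $ j))\<^sup>2)) \<le>
          (\<Sum>j\<in>UNIV. (cmod (z $ j) + cmod (w $ j)) * cmod (u $ j) - (cmod (u $ j))\<^sup>2)"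
        unfolding Re_sum by (rule sum_mono)
      moreover have "Re (- herm z w) \<le> cmod (herm z w)" by (metis complex_Re_le_cmod norm_minus_cancel)
      ultimately show ?thesis unfolding neg_herm by simp
    qed
    then have "?h u \<le> exp (\<Sum>j\<in>UNIV. cmod (Q $ j) * cmod (u $ j)) * exp (\<Sum>j\<in>UNIV. cmod (P $ j) * cmod (u $ j)) *
        exp (cmod (herm z w) + (\<Sum>j\<in>UNIV. (cmod (z $ j) + cmod (w $ j)) * cmod (u $ j) - (cmod (u $ j))\<^sup>2))"
      by (simp add: norm_exp_eq_Re)
    also have "\<dots> = exp (cmod (herm z w) + (\<Sum>j\<in>UNIV. R j * cmod (u $ j) - (cmod (u $ j))\<^sup>2))"
      by (simp add: exp_add[symmetric] R_def sum.distrib[symmetric] algebra_simps sum_subtractf)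
    also have "\<dots> \<le> exp (K + (\<Sum>j\<in>UNIV. - ((cmod (u $ j))\<^sup>2) / 2))"
    proof -
      have "R j * cmod (u $ j) - (cmod (u $ j))\<^sup>2 \<le> (R j)\<^sup>2 / 2 + - ((cmod (u $ j))\<^sup>2) / 2" for j
        using sum_squares_ge_zero[of "R j - cmod (u $ j)" 0] by (simp add: power2_eq_square algebra_simps)
      then have "(\<Sum>j\<in>UNIV. R j * cmod (u $ j) - (cmod (u $ j))\<^sup>2) \<le> (\<Sum>j\<in>UNIV. (R j)\<^sup>2 / 2 + - ((cmod (u $ j))\<^sup>2) / 2)"
        by (rule sum_mono)
      then have "(\<Sum>j\<in>UNIV. R j * cmod (u $ j) - (cmod (u $ j))\<^sup>2) \<le> (\<Sum>j\<in>UNIV. (R j)\<^sup>2 / 2) + (\<Sum>j\<in>UNIV. - ((cmod (u $ j))\<^sup>2) / 2)"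
        by (simp only: sum.distrib)
      then show ?thesis by (simp add: K_def)
    qed
    also have "\<dots> = g u" unfolding g_def gauss by (simp add: exp_add)
    finally have "?h u \<le> g u" .
    moreover have "0 \<le> ?h u" by simp
    ultimately show "norm (?h u) \<le> norm (g u)" by simp
  qed
  have "continuous_on UNIV ?h"
    unfolding herm_def by (intro continuous_intros)
  then show "?h \<in> borel_measurable lborel" by (simp add: borel_measurable_continuous_onI)
qed

text \<open>Both sides are coefficients of the same generating function in \<open>Q\<close> and
  \<open>P\<close>: the Gaussian integral of the exponentials is explicit, and the sum may be
  integrated term by term. Uniqueness of power series then equates the coefficients.\<close>

lemma wick_integral:
  fixes z w :: "complex ^ 'n::finite"
  shows "integrable lborel (\<lambda>u. e_mon \<alpha> u * e_mon \<beta> (cnj_vec u) * exp (- herm (z - u) (w - u)))"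
    and "(LINT u|lborel. e_mon \<alpha> u * e_mon \<beta> (cnj_vec u) * exp (- herm (z - u) (w - u))) =
      of_real (pi ^ CARD('n)) * wick z w (\<alpha>, \<beta>)"
proof -
  let ?G = "\<lambda>u. exp (- herm (z - u) (w - u))"
  let ?I = "\<lambda>(\<alpha>, \<beta>). LINT u|lborel. e_mon \<alpha> u * e_mon \<beta> (cnj_vec u) * ?G u"
  define f where "f Q P = (\<lambda>(\<alpha>, \<beta>) u. (e_mon \<alpha> Q * e_mon \<alpha> u) * (e_mon \<beta> P * e_mon \<beta> (cnj_vec u)) * ?G u)" for P Q
  define h where "h Q P = (\<lambda>u. exp (\<Sum>j\<in>UNIV. cmod (Q $ j) * cmod (u $ j)) * exp (\<Sum>j\<in>UNIV. cmod (P $ j) * cmod (u $ j)) *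
    cmod (?G u))" for P Q
  have hi: "integrable lborel (h Q P)" for P Q unfolding h_def by (rule gaussian_dominating)
  have fm: "f Q P x \<in> borel_measurable lborel" for Q P x
  proof (cases x)
    case (Pair \<alpha> \<beta>)
    have "continuous_on UNIV (f Q P x)"
      unfolding Pair f_def prod.case herm_def by (intro continuous_intros)
    then show ?thesis by (simp add: borel_measurable_continuous_onI)
  qed
  have bound: "(\<Sum>x\<in>F. cmod (f Q P x u)) \<le> h Q P u" if F: "finite F" for F Q P u
  proof -
    let ?a = "\<lambda>\<alpha>. cmod (e_mon \<alpha> Q * e_mon \<alpha> u)" and ?b = "\<lambda>\<beta>. cmod (e_mon \<beta> P * e_mon \<beta> (cnj_vec u))"
    \<comment> \<open>Enlarging the finite index set to a rectangle makes the sum factor into two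
      one-index sums, to which the exponential bound applies.\<close>
    have "(\<Sum>x\<in>F. cmod (f Q P x u)) \<le> (\<Sum>x\<in>fst ` F \<times> snd ` F. cmod (f Q P x u))"
      using F by (intro sum_mono2) force+
    also have "\<dots> = (\<Sum>\<alpha>\<in>fst ` F. ?a \<alpha>) * (\<Sum>\<beta>\<in>snd ` F. ?b \<beta>) * cmod (?G u)"
    proof -
      have "(\<Sum>x\<in>fst ` F \<times> snd ` F. cmod (f Q P x u)) = (\<Sum>\<alpha>\<in>fst ` F. \<Sum>\<beta>\<in>snd ` F. cmod (f Q P (\<alpha>, \<beta>) u))"
        by (simp add: sum.cartesian_product)
      also have "\<dots> = (\<Sum>\<alpha>\<in>fst ` F. \<Sum>\<beta>\<in>snd ` F. ?a \<alpha> * ?b \<beta> * cmod (?G u))"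
        by (simp add: f_def norm_mult)
      also have "\<dots> = (\<Sum>\<alpha>\<in>fst ` F. ?a \<alpha>) * (\<Sum>\<beta>\<in>snd ` F. ?b \<beta>) * cmod (?G u)"
        by (simp only: sum_distrib_right, simp only: sum_distrib_left sum_distrib_right)
      finally show ?thesis .
    qed
    also have "\<dots> \<le> exp (\<Sum>j\<in>UNIV. cmod (Q $ j) * cmod (u $ j)) * exp (\<Sum>j\<in>UNIV. cmod (P $ j) * cmod (cnj_vec u $ j)) * cmod (?G u)"
      using F by (intro mult_right_mono mult_mono e_mon_series_bound sum_nonneg) auto
    finally show ?thesis by (simp add: h_def)
  qed
  have fi: "integrable lborel (f Q P x)" for Q P x
    by (rule Bochner_Integration.integrable_bound[OF hi fm])
      (use bound[of "{x}" Q P] in \<open>auto simp: h_def\<close>)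
  \<comment> \<open>A point at which no monomial vanishes, so that integrability of the monomials
    with parameters passes to the monomials themselves.\<close>
  define one :: "complex ^ 'n" where "one = (\<chi> j. 1)"
  have one: "e_mon \<gamma> one \<noteq> 0" for \<gamma>
    using midx_fact_pos[of \<gamma>] by (simp add: e_mon_def one_def)
  have int: "integrable lborel (\<lambda>u. e_mon \<alpha> u * e_mon \<beta> (cnj_vec u) * ?G u)" for \<alpha> \<beta>
  proof -
    have "integrable lborel (\<lambda>u. inverse (e_mon \<alpha> one * e_mon \<beta> one) * f one one (\<alpha>, \<beta>) u)"
      by (intro integrable_mult_right fi)
    moreover have "inverse (e_mon \<alpha> one * e_mon \<beta> one) * f one one (\<alpha>, \<beta>) u = e_mon \<alpha> u * e_mon \<beta> (cnj_vec u) * ?G u" for u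
      using one by (simp add: f_def field_simps)
    ultimately show ?thesis by simp
  qed
  then show "integrable lborel (\<lambda>u. e_mon \<alpha> u * e_mon \<beta> (cnj_vec u) * ?G u)" .
  have "((\<lambda>x. integral\<^sup>L lborel (f Q P x)) has_sum (of_real (pi ^ CARD('n)) * exp (dot P Q + dot z Q + dot P (cnj_vec w)))) UNIV" for Q P
  proof -
    define g where "g u = exp (dot Q u) * exp (dot P (cnj_vec u)) * ?G u" for u
    have g: "((\<lambda>x. f Q P x u) has_sum g u) UNIV" for u
      using has_sum_cmult_left[OF has_sum_pair_prod(2)[OF e_mon_series(1) e_mon_series(2) e_mon_series(1) e_mon_series(2)]]
      unfolding f_def g_def by (simp add: case_prod_unfold)
    have gz: "g u = exp (- herm z w) * exp (\<Sum>j\<in>UNIV. (P $ j + z $ j) * cnj (u $ j) + (Q $ j + cnj (w $ j)) * u $ j - of_real ((cmod (u $ j))\<^sup>2))" for u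
      unfolding g_def neg_herm exp_add[symmetric]
      by (rule arg_cong[of _ _ exp]) (simp add: dot_def sum.distrib sum_subtractf algebra_simps)
    have "integral\<^sup>L lborel g = exp (- herm z w) * (of_real (pi ^ CARD('n)) * exp (\<Sum>j\<in>UNIV. (P $ j + z $ j) * (Q $ j + cnj (w $ j))))"
      unfolding gz[abs_def] integral_mult_right_zero gaussian_cvec(2) ..
    also have "\<dots> = of_real (pi ^ CARD('n)) * exp (- herm z w + (\<Sum>j\<in>UNIV. (P $ j + z $ j) * (Q $ j + cnj (w $ j))))"
      by (simp only: exp_add mult_ac)
    also have "- herm z w + (\<Sum>j\<in>UNIV. (P $ j + z $ j) * (Q $ j + cnj (w $ j))) = dot P Q + dot z Q + dot P (cnj_vec w)"
      by (simp add: herm_def dot_def sum.distrib algebra_simps)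
    finally have gint: "integral\<^sup>L lborel g = of_real (pi ^ CARD('n)) * exp (dot P Q + dot z Q + dot P (cnj_vec w))" .
    show ?thesis
      unfolding gint[symmetric] by (rule integral_has_sum[OF fm hi bound g])
  qed
  moreover have "integral\<^sup>L lborel (f Q P x) = (case x of (\<alpha>, \<beta>) \<Rightarrow> ?I x * (e_mon \<alpha> Q * e_mon \<beta> P))" for Q P x
  proof (cases x)
    case (Pair \<alpha> \<beta>)
    have "f Q P x = (\<lambda>u. (e_mon \<alpha> Q * e_mon \<beta> P) * (e_mon \<alpha> u * e_mon \<beta> (cnj_vec u) * ?G u))"
      by (simp add: Pair f_def fun_eq_iff mult_ac)
    then show ?thesis by (simp add: Pair mult.commute)
  qed
  ultimately have 1: "((\<lambda>(\<alpha>, \<beta>). ?I (\<alpha>, \<beta>) * (e_mon \<alpha> Q * e_mon \<beta> P)) has_sum (of_real (pi ^ CARD('n)) * exp (dot P Q + dot z Q + dot P (cnj_vec w)))) UNIV" for Q P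
    by (simp add: case_prod_unfold)
  define D where "D x = ?I x - of_real (pi ^ CARD('n)) * wick z w x" for x
  have "(wterm D Q R has_sum 0) UNIV" for Q R
  proof -
    \<comment> \<open>\<open>wterm\<close> conjugates its second point; conjugating \<open>R\<close>
      in advance lets the uniqueness lemma test all values of \<open>P\<close>.\<close>
    let ?P = "cnj_vec R"
    have "((\<lambda>x. (case x of (\<alpha>, \<beta>) \<Rightarrow> ?I (\<alpha>, \<beta>) * (e_mon \<alpha> Q * e_mon \<beta> ?P)) +
        (- of_real (pi ^ CARD('n))) * (case x of (\<alpha>, \<beta>) \<Rightarrow> wick z w (\<alpha>, \<beta>) * (e_mon \<alpha> Q * e_mon \<beta> ?P))) has_sum
        (of_real (pi ^ CARD('n)) * exp (dot ?P Q + dot z Q + dot ?P (cnj_vec w)) +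
         (- of_real (pi ^ CARD('n))) * exp (dot ?P Q + dot z Q + dot ?P (cnj_vec w)))) UNIV"
      by (intro has_sum_add has_sum_cmult_right 1 wick_generating)
    moreover have "wterm D Q R = (\<lambda>x. (case x of (\<alpha>, \<beta>) \<Rightarrow> ?I (\<alpha>, \<beta>) * (e_mon \<alpha> Q * e_mon \<beta> ?P)) +
        (- of_real (pi ^ CARD('n))) * (case x of (\<alpha>, \<beta>) \<Rightarrow> wick z w (\<alpha>, \<beta>) * (e_mon \<alpha> Q * e_mon \<beta> ?P)))"
      by (auto simp: wterm_def D_def fun_eq_iff algebra_simps)
    ultimately show ?thesis by simp
  qed
  then have "D = (\<lambda>_. 0)" by (rule wterm_unique)
  from fun_cong[OF this, of "(\<alpha>, \<beta>)"]
  show "(LINT u|lborel. e_mon \<alpha> u * e_mon \<beta> (cnj_vec u) * ?G u) = of_real (pi ^ CARD('n)) * wick z w (\<alpha>, \<beta>)"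
    by (simp add: D_def)
qed

lemma twisted_prod_fin:
  fixes c1 c2 :: "'n::finite wseries"
  assumes c1: "c1 \<in> A_fin" and c2: "c2 \<in> A_fin"
  shows "twisted_prod (fin_symbol c1) (fin_symbol c2) z w =
    (\<Sum>x | c1 x \<noteq> 0. \<Sum>y | c2 y \<noteq> 0. (c1 x * e_mon (fst x) z) * (c2 y * e_mon (snd y) (cnj_vec w)) * wick z w (fst y, snd x))"
proof -
  let ?G = "\<lambda>u. exp (- herm (z - u) (w - u))"
  let ?m = "\<lambda>x y u. e_mon (fst y) u * e_mon (snd x) (cnj_vec u) * ?G u"
  let ?k = "\<lambda>x y. (c1 x * e_mon (fst x) z) * (c2 y * e_mon (snd y) (cnj_vec w))"
  have "(\<lambda>u. fin_symbol c1 z u * fin_symbol c2 u w * ?G u) =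
      (\<lambda>u. \<Sum>x | c1 x \<noteq> 0. \<Sum>y | c2 y \<noteq> 0. ?k x y * ?m x y u)"
  proof
    fix u
    have "fin_symbol c1 z u * fin_symbol c2 u w * ?G u =
        (\<Sum>x | c1 x \<noteq> 0. (\<Sum>y | c2 y \<noteq> 0. wterm c1 z u x * wterm c2 u w y) * ?G u)"
      unfolding fin_symbol_def sum_product by (rule sum_distrib_right)
    also have "\<dots> = (\<Sum>x | c1 x \<noteq> 0. \<Sum>y | c2 y \<noteq> 0. wterm c1 z u x * wterm c2 u w y * ?G u)"
      by (intro sum.cong refl sum_distrib_right)
    also have "\<dots> = (\<Sum>x | c1 x \<noteq> 0. \<Sum>y | c2 y \<noteq> 0. ?k x y * ?m x y u)"
      by (intro sum.cong refl) (simp add: wterm_def case_prod_unfold mult_ac)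
    finally show "fin_symbol c1 z u * fin_symbol c2 u w * ?G u = (\<Sum>x | c1 x \<noteq> 0. \<Sum>y | c2 y \<noteq> 0. ?k x y * ?m x y u)" .
  qed
  then have "(LINT u|lborel. (fin_symbol c1 z u * fin_symbol c2 u w * ?G u)) =
      (\<Sum>x | c1 x \<noteq> 0. \<Sum>y | c2 y \<noteq> 0. ?k x y * (of_real (pi ^ CARD('n)) * wick z w (fst y, snd x)))"
    by (simp only: Bochner_Integration.integral_sum Bochner_Integration.integrable_sum integrable_mult_right
        wick_integral integral_mult_right_zero)
  then have "twisted_prod (fin_symbol c1) (fin_symbol c2) z w = of_real (1 / pi ^ CARD('n)) *
      (\<Sum>x | c1 x \<noteq> 0. \<Sum>y | c2 y \<noteq> 0. ?k x y * (of_real (pi ^ CARD('n)) * wick z w (fst y, snd x)))"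
    by (simp only: twisted_prod_def)
  also have "\<dots> = (\<Sum>x | c1 x \<noteq> 0. \<Sum>y | c2 y \<noteq> 0. ?k x y * wick z w (fst y, snd x))"
    unfolding sum_distrib_left by (intro sum.cong refl) (simp add: field_simps)
  finally show ?thesis .
qed

text \<open>The finite integral formula sums over triples \<open>(x, y, \<gamma>)\<close>, the
  kernel over an exponent \<open>v\<close> of the product and an index \<open>t\<close>. The map
  \<open>h\<close> translates between them; \<open>x\<close>, \<open>y\<close> and \<gamma> are
  recovered as \<open>tw_left\<close>, \<open>tw_right\<close> and the first component of
  \<open>t\<close>. Finite supports leave only finitely many nonzero terms.\<close>

lemma wterm_tw_prod:
  fixes c1 c2 :: "'n::finite wseries"
  assumes c1: "c1 \<in> A_fin" and c2: "c2 \<in> A_fin"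
  shows "(wterm (tw.prod c1 c2) z w has_sum twisted_prod (fin_symbol c1) (fin_symbol c2) z w) UNIV"
proof -
  let ?S1 = "{x. c1 x \<noteq> 0}" and ?S2 = "{y. c2 y \<noteq> 0}"
  have fin: "finite ?S1" "finite ?S2" using c1 c2 by (auto simp: A_fin_def)
  define S where "S = (SIGMA x:?S1. SIGMA y:?S2. {\<gamma>. \<gamma> \<le> fst y \<and> \<gamma> \<le> snd x})"
  have finS: "finite S"
    unfolding S_def using fin by (intro finite_SigmaI finite_subset[OF _ finite_vec_le]) auto
  define h where "h = (\<lambda>(x :: (nat ^ 'n) \<times> (nat ^ 'n), y :: (nat ^ 'n) \<times> (nat ^ 'n), \<gamma> :: nat ^ 'n). ((fst x + (fst y - \<gamma>), (snd x - \<gamma>) + snd y), (\<gamma>, fst x, snd x - \<gamma>)))"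
  define K where "K = (\<lambda>(v, t). complex_of_real (tw_coeff v t) * (c1 (tw_left v t) * c2 (tw_right v t)))"
  define E where "E v = e_mon (fst v) z * e_mon (snd v) (cnj_vec w)" for v
  define V where "V = (\<lambda>(x, y, \<gamma>). (c1 x * e_mon (fst x) z) * (c2 y * e_mon (snd y) (cnj_vec w)) *
    (complex_of_real (sqrt (vbin (fst y) \<gamma> * vbin (snd x) \<gamma>)) * (e_mon (fst y - \<gamma>) z * e_mon (snd x - \<gamma>) (cnj_vec w))))"
  have inj: "inj_on h S"
  proof (rule inj_onI)
    fix a b assume "a \<in> S" "b \<in> S" "h a = h b"
    moreover obtain x y \<gamma> where "a = (x, y, \<gamma>)" by (cases a)
    moreover obtain x' y' \<gamma>' where "b = (x', y', \<gamma>')" by (cases b)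
    ultimately show "a = b"
      by (auto simp: S_def h_def prod_eq_iff) (metis vec_add_diff)+
  qed
  have supp: "(v, t) \<in> h ` S" if "K (v, t) \<noteq> 0" for v t
  proof -
    obtain \<alpha> \<beta> \<gamma> \<alpha>' \<beta>' where v: "v = (\<alpha>, \<beta>)" "t = (\<gamma>, \<alpha>', \<beta>')" by (metis prod.exhaust)
    have le: "\<alpha>' \<le> \<alpha>" "\<beta>' \<le> \<beta>" using that by (auto simp: K_def v split: if_splits)
    show ?thesis
      by (rule image_eqI[of _ _ "((\<alpha>', \<beta>' + \<gamma>), (\<alpha> - \<alpha>' + \<gamma>, \<beta> - \<beta>'), \<gamma>)"])
        (use that le in \<open>auto simp: v h_def S_def K_def vec_diff_add\<close>)
  qed
  have val: "K (h s) * E (fst (h s)) = V s" if "s \<in> S" for s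
  proof -
    obtain x1 x2 y1 y2 \<gamma> where s: "s = ((x1, x2), (y1, y2), \<gamma>)" by (metis prod.exhaust)
    have le: "\<gamma> \<le> y1" "\<gamma> \<le> x2" using that by (auto simp: s S_def)
    have e: "e_mon (y1 - \<gamma>) z * e_mon x1 z = complex_of_real (sqrt (vbin (x1 + (y1 - \<gamma>)) x1)) * e_mon (x1 + (y1 - \<gamma>)) z"
      "e_mon y2 (cnj_vec w) * e_mon (x2 - \<gamma>) (cnj_vec w) =
        complex_of_real (sqrt (vbin (x2 - \<gamma> + y2) (x2 - \<gamma>))) * e_mon (x2 - \<gamma> + y2) (cnj_vec w)"
      using e_mon_add[of "y1 - \<gamma>" z x1] e_mon_add[of y2 "cnj_vec w" "x2 - \<gamma>"] by (simp_all add: add.commute)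
    have "V s = (c1 (x1, x2) * c2 (y1, y2)) * complex_of_real (sqrt (vbin y1 \<gamma> * vbin x2 \<gamma>)) *
        ((e_mon (y1 - \<gamma>) z * e_mon x1 z) * (e_mon y2 (cnj_vec w) * e_mon (x2 - \<gamma>) (cnj_vec w)))"
      by (simp add: s V_def mult_ac)
    also have "\<dots> = (c1 (x1, x2) * c2 (y1, y2)) * complex_of_real (sqrt (vbin x2 \<gamma> * vbin y1 \<gamma> *
        vbin (x1 + (y1 - \<gamma>)) x1 * vbin (x2 - \<gamma> + y2) (x2 - \<gamma>))) * E (x1 + (y1 - \<gamma>), x2 - \<gamma> + y2)"
      unfolding e E_def by (simp add: real_sqrt_mult mult_ac)
    also have "\<dots> = K (h s) * E (fst (h s))"
      by (simp add: s K_def h_def vec_add_diff le)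
    finally show ?thesis ..
  qed
  have "((\<lambda>(v, t). K (v, t) * E v) has_sum (\<Sum>p\<in>h ` S. case p of (v, t) \<Rightarrow> K (v, t) * E v)) (UNIV \<times> UNIV)"
  proof (subst has_sum_cong_neutral[where T = "h ` S"])
    show "((\<lambda>(v, t). K (v, t) * E v) has_sum (\<Sum>p\<in>h ` S. case p of (v, t) \<Rightarrow> K (v, t) * E v)) (h ` S)"
      using finS by (intro has_sum_finite) auto
  qed (use supp in \<open>(simp, clarsimp, metis, simp)\<close>)
  moreover have "(\<Sum>p\<in>h ` S. case p of (v, t) \<Rightarrow> K (v, t) * E v) = (\<Sum>s\<in>S. V s)"
    unfolding sum.reindex[OF inj] using val by (intro sum.cong) (auto simp: case_prod_unfold)
  moreover have "((\<lambda>t. K (v, t) * E v) has_sum wterm (tw.prod c1 c2) z w v) UNIV" for v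
  proof -
    have "finite (snd ` (h ` S))" using finS by simp
    moreover have "{t. K (v, t) \<noteq> 0} \<subseteq> snd ` (h ` S)"
      by (rule subsetI, rule image_eqI[of _ snd "(v, _)"], simp, rule supp, simp)
    ultimately have "finite {t. K (v, t) \<noteq> 0}" by (rule finite_subset[rotated])
    then have "(\<lambda>t. K (v, t)) summable_on {t. K (v, t) \<noteq> 0}" by (rule summable_on_finite)
    then have "(\<lambda>t. K (v, t)) summable_on UNIV"
      by (subst summable_on_cong_neutral[where T = "{t. K (v, t) \<noteq> 0}"]) auto
    then have "((\<lambda>t. K (v, t)) has_sum tw.prod c1 c2 v) UNIV"
      unfolding tw.prod_def K_def prod.case by (rule has_sum_infsum)
    from has_sum_cmult_left[OF this, of "E v"] show ?thesis
      by (simp add: wterm_def E_def mult_ac case_prod_unfold)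
  qed
  ultimately have "(wterm (tw.prod c1 c2) z w has_sum (\<Sum>s\<in>S. V s)) UNIV"
    using has_sum_SigmaD[where f = "\<lambda>(v, t). K (v, t) * E v" and A = UNIV and B = "\<lambda>_. UNIV" and g = "wterm (tw.prod c1 c2) z w"] by simp
  also have "(\<Sum>s\<in>S. V s) = (\<Sum>x\<in>?S1. \<Sum>y\<in>?S2. \<Sum>\<gamma> | \<gamma> \<le> fst y \<and> \<gamma> \<le> snd x. V (x, y, \<gamma>))"
  proof -
    let ?C = "\<lambda>x y. {\<gamma>. \<gamma> \<le> fst y \<and> \<gamma> \<le> snd x}"
    have C: "finite (?C x y)" for x y :: "(nat ^ 'n) \<times> (nat ^ 'n)" by (rule finite_subset[OF _ finite_vec_le]) auto
    have "(\<Sum>y\<in>?S2. \<Sum>\<gamma>\<in>?C x y. V (x, y, \<gamma>)) = (\<Sum>(y, \<gamma>)\<in>Sigma ?S2 (?C x). V (x, y, \<gamma>))" for x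
      using fin C by (intro sum.Sigma) auto
    then show ?thesis
      using fin C sum.Sigma[of ?S1 "\<lambda>x. Sigma ?S2 (?C x)" "\<lambda>x p. V (x, p)"]
      by (simp add: S_def case_prod_unfold)
  qed
  also have "\<dots> = twisted_prod (fin_symbol c1) (fin_symbol c2) z w"
    unfolding twisted_prod_fin[OF c1 c2] V_def wick_def prod.case sum_distrib_left ..
  finally show ?thesis .
qed

lemma extends_twisted_prod: "extends_twisted (\<lambda>(c, d). tw.prod c d)"
  unfolding extends_twisted_def prod.case by (intro ballI allI wterm_tw_prod)

section \<open>Uniqueness of the extension by density\<close>

lemma extends_twisted_unique:
  assumes "extends_twisted T" "extends_twisted T'" "c \<in> A_fin" "d \<in> A_fin"
  shows "T (c, d) = T' (c, d)"
proof -
  have "(wterm (\<lambda>x. T (c, d) x - T' (c, d) x) z w has_sum 0) UNIV" for z w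
  proof -
    let ?t = "twisted_prod (fin_symbol c) (fin_symbol d) z w"
    have "((\<lambda>x. wterm (T (c, d)) z w x + (- 1) * wterm (T' (c, d)) z w x) has_sum (?t + (- 1) * ?t)) UNIV"
      using assms unfolding extends_twisted_def by (intro has_sum_add has_sum_cmult_right) blast+
    then show ?thesis by (simp add: wterm_def algebra_simps case_prod_unfold)
  qed
  then have "(\<lambda>x. T (c, d) x - T' (c, d) x) = (\<lambda>_. 0)" by (rule wterm_unique)
  then show ?thesis by (simp add: fun_eq_iff)
qed

lemma A_fin_eq: "A_fin = finitely_supported"
  by (simp add: A_fin_def finitely_supported_def)

text \<open>Two extensions agree on pairs of finite families because power series are determined by
  their values. Density is then applied in the second variable with a finite first factor, and
  afterwards in the first variable; only separate continuity of the competitor enters.\<close>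

lemma uniquely_extendsI:
  assumes E: "solid_lcs E" "has_tails E" and F: "solid_lcs F" "has_tails F"
    and G: "solid_lcs G" "has_coordinates G"
    and fin: "finitely_supported \<subseteq> topspace E" "finitely_supported \<subseteq> topspace F"
    and cont: "Cont E F G (\<lambda>(c, d). tw.prod c d)" "separately_continuous E F G (\<lambda>(c, d). tw.prod c d)"
  shows "uniquely_extends Cont E F G"
  unfolding uniquely_extends_def
proof (intro conjI exI[of _ "\<lambda>(c, d). tw.prod c d"] allI impI ballI)
  fix T' c d
  assume T': "extends_twisted T' \<and> separately_continuous E F G T'" and c: "c \<in> topspace E" and d: "d \<in> topspace F"
  let ?T = "\<lambda>(c, d). tw.prod c d"
  have sep: "continuous_map F G (\<lambda>y. T' (x, y))" "continuous_map F G (\<lambda>y. ?T (x, y))" if "x \<in> topspace E" for x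
    using T' cont(2) that unfolding separately_continuous_def by blast+
  have sep': "continuous_map E G (\<lambda>x. T' (x, y))" "continuous_map E G (\<lambda>x. ?T (x, y))" if "y \<in> topspace F" for y
    using T' cont(2) that unfolding separately_continuous_def by blast+
  have 1: "T' (x, y) = ?T (x, y)" if x: "x \<in> finitely_supported" and y: "y \<in> topspace F" for x y
  proof -
    have xE: "x \<in> topspace E" using x fin by blast
    show ?thesis
      using continuous_maps_agree[OF F G sep[OF xE] _ y] extends_twisted_unique[OF conjunct1[OF T'] extends_twisted_prod] x
      by (simp add: A_fin_eq)
  qed
  show "T' (c, d) = ?T (c, d)"
    using continuous_maps_agree[OF E G sep'[OF d] _ c] 1 d by simp
qed (use fin cont in \<open>simp_all add: A_fin_eq extends_twisted_prod\<close>)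

section \<open>Unique extension for weights of Roumieu and Beurling type\<close>

type_synonym 'x grid = "nat \<Rightarrow> nat \<Rightarrow> 'x \<Rightarrow> ennreal"

definition weight_est_right :: "((nat ^ 'n::finite) \<times> (nat ^ 'n)) grid \<Rightarrow> ((nat ^ 'n) \<times> (nat ^ 'n)) grid \<Rightarrow>
    ((nat ^ 'n) \<times> (nat ^ 'n)) grid \<Rightarrow> bool" where
  "weight_est_right w1 w2 w3 \<longleftrightarrow> (\<forall>s i3. \<exists>i2. \<forall>j2. \<exists>i1 j3. weight_est (w1 i1 (s i1)) (w2 i2 j2) (w3 i3 j3))"

text \<open>\<open>weight_est_right\<close> with the roles of the factors exchanged: here the steps
  \<open>s\<close> of the second factor are given, and the condition serves continuity in the first
  one.\<close>

definition weight_est_left :: "((nat ^ 'n::finite) \<times> (nat ^ 'n)) grid \<Rightarrow> ((nat ^ 'n) \<times> (nat ^ 'n)) grid \<Rightarrow>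
    ((nat ^ 'n) \<times> (nat ^ 'n)) grid \<Rightarrow> bool" where
  "weight_est_left w1 w2 w3 \<longleftrightarrow> (\<forall>s i3. \<exists>i1. \<forall>j1. \<exists>i2 j3. weight_est (w1 i1 j1) (w2 i2 (s i2)) (w3 i3 j3))"

definition weight_est_ind_proj :: "((nat ^ 'n::finite) \<times> (nat ^ 'n)) grid \<Rightarrow> ((nat ^ 'n) \<times> (nat ^ 'n)) grid \<Rightarrow>
    ((nat ^ 'n) \<times> (nat ^ 'n)) grid \<Rightarrow> bool" where
  "weight_est_ind_proj w1 w2 w3 \<longleftrightarrow> (\<forall>j1 j2. \<exists>j3. \<forall>i3. \<exists>i1 i2. weight_est (w1 i1 j1) (w2 i2 j2) (w3 i3 j3))"

definition swap_grid :: "((nat ^ 'n::finite) \<times> (nat ^ 'n)) grid \<Rightarrow> ((nat ^ 'n) \<times> (nat ^ 'n)) grid" where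
  "swap_grid w i j = (\<lambda>(\<alpha>, \<beta>). w i j (\<beta>, \<alpha>))"

lemma swap_grid_tensor: "swap_grid (\<lambda>i j. tensor (f i j) (g i j)) = (\<lambda>i j. tensor (g i j) (f i j))"
  by (auto simp: fun_eq_iff swap_grid_def tensor_def mult.commute)

lemma weight_est_swap_grid:
  "weight_est (w2 i2 j2) (w1 i1 j1) (w3 i3 j3) \<Longrightarrow> weight_est (swap_grid w1 i1 j1) (swap_grid w2 i2 j2) (swap_grid w3 i3 j3)"
  unfolding swap_grid_def by (rule weight_est_swap)

lemma weight_est_left_swap: "weight_est_right w2 w1 w3 \<Longrightarrow> weight_est_left (swap_grid w1) (swap_grid w2) (swap_grid w3)"
  unfolding weight_est_left_def weight_est_right_def by (meson weight_est_swap_grid)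

lemma weight_est_right_swap: "weight_est_left w2 w1 w3 \<Longrightarrow> weight_est_right (swap_grid w1) (swap_grid w2) (swap_grid w3)"
  unfolding weight_est_left_def weight_est_right_def by (meson weight_est_swap_grid)

lemma weight_est_ind_proj_swap: "weight_est_ind_proj w2 w1 w3 \<Longrightarrow> weight_est_ind_proj (swap_grid w1) (swap_grid w2) (swap_grid w3)"
  unfolding weight_est_ind_proj_def by (meson weight_est_swap_grid)

lemma proj_ind_pair_tw:
  assumes "weight_grid w1" "weight_grid w2" "weight_grid w3" "weight_est_right w1 w2 w3" "weight_est_left w1 w2 w3"
  shows "proj_ind_pair tw_coeff tw_left tw_right w1 w2 w3"
proof (intro proj_ind_pair.intro proj_ind_pair_axioms.intro assms tw.positive_kernel_axioms)
  show "tw.est_proj_ind w1 w2 w3"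
    using assms(4) unfolding weight_est_right_def tw.est_proj_ind_def by (meson weight_est_imp_est)
  show "positive_kernel.est_proj_ind tw_coeff tw_right tw_left w2 w1 w3"
    unfolding positive_kernel.est_proj_ind_def[OF tw.positive_kernel_axioms]
      positive_kernel_swap(3)[OF tw.positive_kernel_axioms, where X = tw_left and Y = tw_right]
    using assms(5) unfolding weight_est_left_def by (meson weight_est_imp_est)
qed

lemma uniquely_extends_proj_ind:
  assumes "weight_grid w1" "weight_grid w2" "weight_grid w3" "weight_est_right w1 w2 w3" "weight_est_left w1 w2 w3"
  shows "uniquely_extends hypocontinuous (proj_ind w1) (proj_ind w2) (proj_ind w3)"
proof -
  interpret proj_ind_pair tw_coeff tw_left tw_right w1 w2 w3 by (rule proj_ind_pair_tw[OF assms])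
  show ?thesis
    using hypocontinuous
    by (intro uniquely_extendsI w1.proj_ind_lcs w1.proj_ind_tails w2.proj_ind_lcs w2.proj_ind_tails
        w3.proj_ind_lcs w3.proj_ind_coordinates w1.finitely_supported_proj_ind w2.finitely_supported_proj_ind)
      (auto simp: hypocontinuous_def)
qed

lemma uniquely_extends_ind_proj:
  assumes "weight_grid w1" "weight_grid w2" "weight_grid w3" "weight_est_ind_proj w1 w2 w3"
  shows "uniquely_extends hypocontinuous (ind_proj w1) (ind_proj w2) (ind_proj w3)"
proof -
  have "tw.est_ind_proj w1 w2 w3"
    using assms(4) unfolding weight_est_ind_proj_def tw.est_ind_proj_def by (meson weight_est_imp_est)
  then interpret ind_proj_pair tw_coeff tw_left tw_right w1 w2 w3
    by (intro ind_proj_pair.intro ind_proj_pair_axioms.intro assms tw.positive_kernel_axioms)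
  show ?thesis
    using hypocontinuous
    by (intro uniquely_extendsI w1.ind_proj_lcs w1.ind_proj_tails w2.ind_proj_lcs w2.ind_proj_tails
        w3.ind_proj_lcs w3.ind_proj_coordinates w1.finitely_supported_ind_proj w2.finitely_supported_ind_proj)
      (auto simp: hypocontinuous_def)
qed

lemma uniquely_extends_joint:
  assumes w: "weight_grid w"
    and m: "(\<forall>i. w i = w 0) \<and> (\<forall>n. \<exists>m. weight_est (w 0 n) (w 0 n) (w 0 m)) \<or>
      (\<forall>i j. w i j = w i 0) \<and> (\<forall>m. \<exists>n. weight_est (w n 0) (w n 0) (w m 0))"
    and mono: "weight_est_right w w w" "weight_est_left w w w"
  shows "uniquely_extends jointly_continuous (proj_ind w) (proj_ind w) (proj_ind w)"
proof -
  interpret proj_ind_pair tw_coeff tw_left tw_right w w w by (rule proj_ind_pair_tw[OF w w w mono])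
  interpret joint_pair tw_coeff tw_left tw_right w ..
  show ?thesis
  proof (intro uniquely_extendsI w1.proj_ind_lcs w1.proj_ind_tails w1.proj_ind_coordinates
      w1.finitely_supported_proj_ind)
    show "jointly_continuous (proj_ind w) (proj_ind w) (proj_ind w) (\<lambda>(c, d). tw.prod c d)"
      by (rule jointly_continuous) (use m weight_est_imp_est in meson)
    show "separately_continuous (proj_ind w) (proj_ind w) (proj_ind w) (\<lambda>(c, d). tw.prod c d)"
      using hypocontinuous by (simp add: hypocontinuous_def)
  qed
qed

text \<open>\<open>L s s'\<close> expresses that the weight with parameter \<open>s\<close> in the inductive limit is dominated by the one
  with parameter \<open>s'\<close>; whether this means \<open>s \<le> s'\<close> or \<open>s \<ge> s'\<close> depends on the space.\<close>

locale half_scale = half_grid "\<lambda>i j. F (\<rho> i) (\<rho> j)"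
  for L :: "real \<Rightarrow> real \<Rightarrow> bool" and \<rho> :: "nat \<Rightarrow> real" and F :: "real \<Rightarrow> real \<Rightarrow> nat ^ 'n::finite \<Rightarrow> ennreal" +
  assumes \<rho>_pos: "0 < \<rho> n"
    and total: "0 < s \<Longrightarrow> 0 < s' \<Longrightarrow> L s s' \<or> L s' s"
    and mono: "L s s' \<Longrightarrow> F r s \<alpha> \<le> F r s' \<alpha>"
    and le: "0 < s \<Longrightarrow> \<exists>j. \<forall>i \<alpha>. F (\<rho> i) (\<rho> j) \<alpha> \<le> F (\<rho> i) s \<alpha>"
    and cofinal: "0 < r \<Longrightarrow> \<exists>i. \<forall>j. decays (F r (\<rho> (Suc j))) (F (\<rho> i) (\<rho> j))"

locale half_scales = f: half_scale L \<rho> F + g: half_scale L \<rho> G for L \<rho> and F G :: "real \<Rightarrow> real \<Rightarrow> nat ^ 'n::finite \<Rightarrow> ennreal"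
begin

abbreviation "W r s \<equiv> tensor (F r s) (G r s)"
abbreviation "w i j \<equiv> W (\<rho> i) (\<rho> j)"

sublocale w: weight_grid w
  by (rule weight_grid_tensor) unfold_locales

lemma chain: "0 < s \<Longrightarrow> 0 < s' \<Longrightarrow> (\<forall>r x. W r s x \<le> W r s' x) \<or> (\<forall>r x. W r s' x \<le> W r s x)"
  using f.total[of s s'] by (auto simp: tensor_def intro!: mult_mono f.mono g.mono)

lemma w_le: assumes "0 < s" shows "\<exists>j. \<forall>i x. w i j x \<le> W (\<rho> i) s x"
proof -
  obtain j1 j2 where j: "\<And>i \<alpha>. F (\<rho> i) (\<rho> j1) \<alpha> \<le> F (\<rho> i) s \<alpha>" "\<And>i \<alpha>. G (\<rho> i) (\<rho> j2) \<alpha> \<le> G (\<rho> i) s \<alpha>"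
    using f.le[OF assms] g.le[OF assms] by blast
  have "F (\<rho> i) (\<rho> (max j1 j2)) \<alpha> \<le> F (\<rho> i) s \<alpha>" "G (\<rho> i) (\<rho> (max j1 j2)) \<alpha> \<le> G (\<rho> i) s \<alpha>" for i \<alpha>
    using order_trans[OF f.dec[OF max.cobounded1] j(1)] order_trans[OF g.dec[OF max.cobounded2] j(2)] by blast+
  then show ?thesis by (intro exI[of _ "max j1 j2"] allI) (auto simp: tensor_def intro!: mult_mono split: prod.split)
qed

lemma w_nuc: assumes "0 < r" shows "\<exists>i. \<forall>j. summably_below (W r (\<rho> (Suc j))) (w i j)"
proof -
  obtain i1 i2 where i: "\<And>j. decays (F r (\<rho> (Suc j))) (F (\<rho> i1) (\<rho> j))" "\<And>j. decays (G r (\<rho> (Suc j))) (G (\<rho> i2) (\<rho> j))"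
    using f.cofinal[OF assms] g.cofinal[OF assms] by blast
  have "decays (F r (\<rho> (Suc j))) (F (\<rho> (max i1 i2)) (\<rho> j))" "decays (G r (\<rho> (Suc j))) (G (\<rho> (max i1 i2)) (\<rho> j))" for j
    by (rule decays_mono[OF i(1)[of j]]; simp add: f.inc) (rule decays_mono[OF i(2)[of j]]; simp add: g.inc)
  then show ?thesis using summably_below_tensor by blast
qed

lemma proj_lim_ind_lim:
  assumes p: "0 < p"
  shows "(PROJLIM r. INDLIM s. wtop p (W r s)) = proj_ind w"
proof (rule w.proj_ind_eq[OF p])
  show "\<exists>r\<in>{0<..}. \<forall>s\<in>{0<..}. \<exists>j. \<forall>x. w i j x \<le> W r s x" for i
    using w_le f.\<rho>_pos by (meson greaterThan_iff)
  show "\<exists>i. \<forall>j. \<exists>s\<in>{0<..}. summably_below (W r s) (w i j)" if "r \<in> {0<..}" for r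
    using w_nuc[of r] that f.\<rho>_pos by (meson greaterThan_iff)
  show "(\<forall>x. W r s x \<le> W r s' x) \<or> (\<forall>x. W r s' x \<le> W r s x)" if "s \<in> {0<..}" "s' \<in> {0<..}" for r s s'
    using chain[of s s'] that by (meson greaterThan_iff)
qed simp_all

lemma ind_lim_proj_lim:
  assumes p: "0 < p"
  shows "(INDLIM s. PROJLIM r. wtop p (W r s)) = ind_proj w"
proof (rule w.ind_proj_eq[OF p])
  show "\<exists>j. \<forall>i. \<exists>r\<in>{0<..}. \<forall>x. w i j x \<le> W r s x" if "s \<in> {0<..}" for s
    using w_le[of s] that f.\<rho>_pos by (meson greaterThan_iff)
  show "\<exists>s\<in>{0<..}. \<forall>r\<in>{0<..}. \<exists>i. summably_below (W r s) (w i j)" for j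
    using w_nuc f.\<rho>_pos by (meson greaterThan_iff)
  show "(\<forall>r\<in>{0<..}. \<forall>x. W r s x \<le> W r s' x) \<or> (\<forall>r\<in>{0<..}. \<forall>x. W r s' x \<le> W r s x)"
    if "s \<in> {0<..}" "s' \<in> {0<..}" for s s'
    using chain[of s s'] that by (meson greaterThan_iff)
qed simp_all

lemma ind_lim_only:
  assumes p: "0 < p" and const: "\<And>r r' s. W r s = W r' s"
  shows "(INDLIM s. wtop p (W 1 s)) = proj_ind w"
proof -
  have "(PROJLIM r. INDLIM s. wtop p (W r s)) = (PROJLIM r::real. INDLIM s. wtop p (W 1 s))"
    by (intro arg_cong[where f = plim] ext arg_cong[where f = ilim] arg_cong[where f = "wtop p"] const)
  then show ?thesis
    using proj_lim_ind_lim[OF p] proj_lim_const[of "{0::real<..}" "INDLIM s. wtop p (W 1 s)"] by simp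
qed

lemma proj_lim_only:
  assumes p: "0 < p" and const: "\<And>r s s'. W r s = W r s'"
  shows "(PROJLIM r. wtop p (W r 1)) = proj_ind w"
proof -
  have "(PROJLIM r. wtop p (W r 1)) = proj_lim UNIV (\<lambda>i. wtop top (w i 0))"
  proof (rule w.proj_lim_eq[OF p])
    show "w i j = w i 0" for i j by (rule const)
    show "\<exists>r\<in>{0<..}. \<forall>x. w i 0 x \<le> W r 1 x" for i
      using const[of "\<rho> i" "\<rho> 0" 1] f.\<rho>_pos by (metis greaterThan_iff order_refl)
    show "\<exists>i. summably_below (W r 1) (w i 0)" if "r \<in> {0<..}" for r
      using w_nuc[of r] that const[of r 1] by (metis greaterThan_iff)
  qed simp
  then show ?thesis using w.proj_ind_const_ind[OF const] by simp
qed

end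

text \<open>The lower bound \<open>c\<close> cannot be 1: for a flat symbol and small
  \<open>r\<close> the geometric factor first outweighs the factorial, and the weight dips below
  1.\<close>

locale weight_scale =
  fixes \<theta> :: "real \<Rightarrow> nat ^ 'n::finite \<Rightarrow> ennreal" and \<rho> :: "nat \<Rightarrow> real"
  assumes \<rho>_pos: "0 < \<rho> n"
    and zero: "0 < r \<Longrightarrow> \<theta> r 0 = 1"
    and low: "0 < r \<Longrightarrow> \<exists>c>0. \<forall>\<alpha>. ennreal c \<le> \<theta> r \<alpha>"
    and chain: "0 < r \<Longrightarrow> 0 < r' \<Longrightarrow> (\<forall>\<alpha>. \<theta> r \<alpha> \<le> \<theta> r' \<alpha>) \<or> (\<forall>\<alpha>. \<theta> r' \<alpha> \<le> \<theta> r \<alpha>)"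
begin

abbreviation "v n \<equiv> \<theta> (\<rho> n)"
abbreviation "\<theta>i r \<alpha> \<equiv> inverse (\<theta> r \<alpha>)"
abbreviation "vi n \<equiv> \<theta>i (\<rho> n)"

lemma pos: "0 < v n \<alpha>"
  using low[OF \<rho>_pos, of n] by (metis ennreal_less_zero_iff less_le_trans)

lemma v_zero: "v n 0 = 1" by (rule zero[OF \<rho>_pos])

lemma low2: obtains c where "c > 0" "\<And>\<alpha>. ennreal c \<le> v m \<alpha>" "\<And>\<alpha>. ennreal c \<le> v n \<alpha>"
proof -
  obtain a b where "a > 0" "\<And>\<alpha>. ennreal a \<le> v m \<alpha>" "b > 0" "\<And>\<alpha>. ennreal b \<le> v n \<alpha>"
    using low[OF \<rho>_pos] by metis
  then show thesis
    by (intro that[of "min a b"]) (auto intro: order_trans[OF ennreal_leI[of _ a]] order_trans[OF ennreal_leI[of _ b]])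
qed

end

text \<open>The weights decrease along the sequence. The parameters tend to 0 for
  \<open>s > 0\<close> but to infinity for \<open>s = 0\<close>, where a larger parameter gives a
  smaller weight; order assumptions are therefore put on the weights.\<close>

locale roumieu = weight_scale \<theta> \<rho> for \<theta> :: "real \<Rightarrow> nat ^ 'n::finite \<Rightarrow> ennreal" and \<rho> +
  assumes dec: "m \<le> n \<Longrightarrow> \<theta> (\<rho> n) \<alpha> \<le> \<theta> (\<rho> m) \<alpha>"
    and fin: "\<exists>n. \<theta> (\<rho> n) \<alpha> < top"
    and below_Suc: "strongly_below (\<theta> (\<rho> (Suc n))) (\<theta> (\<rho> n))"
    and cofinal: "0 < r \<Longrightarrow> \<exists>n. \<forall>\<alpha>. \<theta> (\<rho> n) \<alpha> \<le> \<theta> r \<alpha>"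
begin

lemma below: "m = Suc n \<Longrightarrow> strongly_below (v m) (v n)"
  using below_Suc by simp

lemma decays_Suc: "decays (v (Suc n)) (v n)"
  by (rule strongly_below_decays[OF below_Suc v_zero])

definition ind_le :: "real \<Rightarrow> real \<Rightarrow> bool" where "ind_le s s' \<longleftrightarrow> (\<forall>\<alpha>. \<theta> s \<alpha> \<le> \<theta> s' \<alpha>)"

text \<open>In the Roumieu case a weight carries the inductive parameter and an inverse weight the
  projective one; in the Beurling case it is the other way round. The four combinations of such
  factors are the grids of the spaces A, its dual, B and its star version.\<close>

lemma half_scale_ind: "half_scale ind_le \<rho> (\<lambda>r s. \<theta> s)"
proof
  show "\<exists>i. \<forall>j. 0 < v j x" for x using pos by blast
  show "\<exists>j. \<forall>i::nat. v j x < top" for x using fin by blast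
  show "0 < s \<Longrightarrow> \<exists>j. \<forall>i::nat. \<forall>\<alpha>. v j \<alpha> \<le> \<theta> s \<alpha>" for s using cofinal by blast
qed (use dec pos \<rho>_pos chain decays_Suc in \<open>auto simp: ind_le_def\<close>)

lemma half_scale_proj: "half_scale ind_le \<rho> (\<lambda>r s. \<theta>i r)"
proof
  show "\<exists>i. \<forall>j::nat. 0 < vi i x" for x using fin by (simp add: zero_less_iff_neq_zero less_top)
  show "\<exists>j::nat. \<forall>i. vi i x < top" for x using pos by (simp add: zero_less_iff_neq_zero less_top[symmetric])
  show "decays (vi i) (vi (Suc i))" for i by (rule decays_inverse[OF decays_Suc])
  show "\<exists>i. \<forall>j::nat. decays (\<theta>i r) (vi i)" if r: "0 < r" for r
  proof -
    obtain n where n: "\<And>\<alpha>. v n \<alpha> \<le> \<theta> r \<alpha>" using cofinal[OF r] by blast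
    have "decays (\<theta>i r) (vi (Suc n))" by (rule decays_inverse[OF decays_mono[OF decays_Suc order_refl n]])
    then show ?thesis by blast
  qed
qed (use dec \<rho>_pos chain in \<open>auto simp: ind_le_def intro: ennreal_inverse_antimono\<close>)

sublocale A: half_scales ind_le \<rho> "\<lambda>r s. \<theta> s" "\<lambda>r s. \<theta> s"
  by (intro half_scales.intro half_scale_ind)
sublocale A': half_scales ind_le \<rho> "\<lambda>r s. \<theta>i r" "\<lambda>r s. \<theta>i r"
  by (intro half_scales.intro half_scale_proj)
sublocale B: half_scales ind_le \<rho> "\<lambda>r s. \<theta> s" "\<lambda>r s. \<theta>i r"
  by (intro half_scales.intro half_scale_ind half_scale_proj)
sublocale B': half_scales ind_le \<rho> "\<lambda>r s. \<theta>i r" "\<lambda>r s. \<theta> s"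
  by (intro half_scales.intro half_scale_ind half_scale_proj)

text \<open>The increment 2 consists of one step from the source weight to the intermediate weight
  of \<open>weight_est_tensor\<close> and one from there to the target.\<close>

lemma weight_est_A: "weight_est (tensor (v m) (v m)) (tensor (v n) (v n)) (tensor (v (max m n + 2)) (v (max m n + 2)))"
proof -
  let ?N = "max m n"
  obtain c where c: "c > 0" "\<And>\<alpha>. ennreal c \<le> v (Suc ?N) \<alpha>" using low2 by metis
  have "weight_est (tensor (v ?N) (v ?N)) (tensor (v ?N) (v ?N)) (tensor (v (?N + 2)) (v (?N + 2)))"
    by (rule weight_est_tensor[OF c below dec below]) auto
  then show ?thesis
    by (rule weight_est_mono) (auto simp: tensor_def intro!: mult_mono dec)
qed

text \<open>A larger index means a smaller weight. The decisive condition is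
  \<open>j2 + 1 < i1\<close>: in \<gamma> the first factor may grow like \<open>v i1\<close>, and
  this has to be beaten by the decay \<open>1 / v j2\<close> of the second factor. The extra steps
  make room for the intermediate weights.\<close>

lemma weight_est_B:
  assumes "i3 < i2" "j2 + 1 < i1" "i3 + 1 < i1" "j1 < j3" "j2 + 1 < j3"
  shows "weight_est (tensor (v j1) (vi i1)) (tensor (v j2) (vi i2)) (tensor (v j3) (vi i3))"
  by (rule weight_est_ratio[where m = "v (j2 + 1)" and n = "v (i3 + 1)" and k = "v (j3 - 1)" and l = "v (i1 - 1)"])
    (use assms in \<open>auto intro!: pos below dec\<close>)

lemma weight_est_A'_B:
  assumes "i3 < i2" "j2 + 1 < i1" "i3 + 1 < i1"
  shows "weight_est (tensor (vi i1) (vi i1)) (tensor (v j2) (vi i2)) (tensor (vi i3) (vi i3))"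
proof -
  obtain c where c: "c > 0" "\<And>\<alpha>. ennreal c \<le> v (j2 + 1) \<alpha>" "\<And>\<alpha>. ennreal c \<le> v (i3 + 1) \<alpha>" using low2 by metis
  show ?thesis
    by (rule weight_est_dual[OF _ _ _ _ c, where l = "v (i1 - 1)"])
      (use assms in \<open>auto intro!: pos below dec\<close>)
qed

lemma weight_est_B_right: "weight_est_right B.w B.w B.w"
  unfolding weight_est_right_def
proof (intro allI)
  fix s :: "nat \<Rightarrow> nat" and i3
  \<comment> \<open>\<open>i2\<close> is fixed before \<open>j2\<close> is known; \<open>i1\<close>
    must follow \<open>j2\<close>, and \<open>j3\<close> then exceeds the step
    \<open>s i1\<close>.\<close>
  have "weight_est (B.w (max j2 i3 + 2) (s (max j2 i3 + 2))) (B.w (i3 + 1) j2) (B.w i3 (max (s (max j2 i3 + 2)) (j2 + 1) + 1))" for j2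
    by (rule weight_est_B) auto
  then show "\<exists>i2. \<forall>j2. \<exists>i1 j3. weight_est (B.w i1 (s i1)) (B.w i2 j2) (B.w i3 j3)" by blast
qed

lemma weight_est_B_left: "weight_est_left B.w B.w B.w"
  unfolding weight_est_left_def
proof (intro allI)
  fix s :: "nat \<Rightarrow> nat" and i3
  \<comment> \<open>Here \<open>i1\<close> has to be fixed before \<open>j1\<close>. This is
    possible because \<open>i2 = i3 + 1\<close> is known at once and \<open>i1\<close> follows its
    step \<open>s i2\<close>.\<close>
  have "weight_est (B.w (max (s (i3 + 1)) i3 + 2) j1) (B.w (i3 + 1) (s (i3 + 1))) (B.w i3 (max j1 (s (i3 + 1) + 1) + 1))" for j1
    by (rule weight_est_B) auto
  then show "\<exists>i1. \<forall>j1. \<exists>i2 j3. weight_est (B.w i1 j1) (B.w i2 (s i2)) (B.w i3 j3)" by blast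
qed

lemma weight_est_C: "weight_est_ind_proj B.w B.w B.w"
  unfolding weight_est_ind_proj_def
proof (intro allI)
  fix j1 j2
  have "weight_est (B.w (max j2 i3 + 2) j1) (B.w (i3 + 1) j2) (B.w i3 (max j1 (j2 + 1) + 1))" for i3
    by (rule weight_est_B) auto
  then show "\<exists>j3. \<forall>i3. \<exists>i1 i2. weight_est (B.w i1 j1) (B.w i2 j2) (B.w i3 j3)" by blast
qed

lemma weight_est_A'_B_right: "weight_est_right A'.w B.w A'.w"
  unfolding weight_est_right_def
proof (intro allI)
  fix s :: "nat \<Rightarrow> nat" and i3
  \<comment> \<open>The dual grid depends on its projective index alone; the inductive indices
    \<open>s i1\<close> and 0 are inert.\<close>
  have "weight_est (A'.w (max j2 i3 + 2) (s (max j2 i3 + 2))) (B.w (i3 + 1) j2) (A'.w i3 0)" for j2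
    by (rule weight_est_A'_B) auto
  then show "\<exists>i2. \<forall>j2. \<exists>i1 j3. weight_est (A'.w i1 (s i1)) (B.w i2 j2) (A'.w i3 j3)" by blast
qed

lemma weight_est_A'_B_left: "weight_est_left A'.w B.w A'.w"
  unfolding weight_est_left_def
proof (intro allI)
  fix s :: "nat \<Rightarrow> nat" and i3
  have "weight_est (A'.w (max (s (i3 + 1)) i3 + 2) j1) (B.w (i3 + 1) (s (i3 + 1))) (A'.w i3 0)" for j1
    by (rule weight_est_A'_B) auto
  then show "\<exists>i1. \<forall>j1. \<exists>i2 j3. weight_est (A'.w i1 j1) (B.w i2 (s i2)) (A'.w i3 j3)" by blast
qed

lemma extends_A: "uniquely_extends jointly_continuous (proj_ind A.w) (proj_ind A.w) (proj_ind A.w)"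
  by (rule uniquely_extends_joint[OF A.w.weight_grid_axioms])
    (use weight_est_A in \<open>auto simp: weight_est_right_def weight_est_left_def\<close>)

lemma swap_grids: "swap_grid B.w = B'.w" "swap_grid A'.w = A'.w"
  by (rule swap_grid_tensor)+

lemmas extends_B =
  uniquely_extends_proj_ind[OF A'.w.weight_grid_axioms B.w.weight_grid_axioms A'.w.weight_grid_axioms
    weight_est_A'_B_right weight_est_A'_B_left]
  uniquely_extends_proj_ind[OF B'.w.weight_grid_axioms A'.w.weight_grid_axioms A'.w.weight_grid_axioms
    weight_est_right_swap[OF weight_est_A'_B_left, unfolded swap_grids] weight_est_left_swap[OF weight_est_A'_B_right, unfolded swap_grids]]
  uniquely_extends_proj_ind[OF B.w.weight_grid_axioms B.w.weight_grid_axioms B.w.weight_grid_axioms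
    weight_est_B_right weight_est_B_left]
  uniquely_extends_proj_ind[OF B'.w.weight_grid_axioms B'.w.weight_grid_axioms B'.w.weight_grid_axioms
    weight_est_right_swap[OF weight_est_B_left, unfolded swap_grids] weight_est_left_swap[OF weight_est_B_right, unfolded swap_grids]]
  uniquely_extends_ind_proj[OF B.w.weight_grid_axioms B.w.weight_grid_axioms B.w.weight_grid_axioms weight_est_C]
  uniquely_extends_ind_proj[OF B'.w.weight_grid_axioms B'.w.weight_grid_axioms B'.w.weight_grid_axioms
    weight_est_ind_proj_swap[OF weight_est_C, unfolded swap_grids]]

end

locale beurling = weight_scale \<theta> \<rho> for \<theta> :: "real \<Rightarrow> nat ^ 'n::finite \<Rightarrow> ennreal" and \<rho> +
  assumes inc: "m \<le> n \<Longrightarrow> \<theta> (\<rho> m) \<alpha> \<le> \<theta> (\<rho> n) \<alpha>"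
    and fin: "\<theta> (\<rho> n) \<alpha> < top"
    and below_Suc: "strongly_below (\<theta> (\<rho> n)) (\<theta> (\<rho> (Suc n)))"
    and cofinal: "0 < r \<Longrightarrow> \<exists>n. \<forall>\<alpha>. \<theta> r \<alpha> \<le> \<theta> (\<rho> n) \<alpha>"
begin

lemma below: "n = Suc m \<Longrightarrow> strongly_below (v m) (v n)"
  using below_Suc by simp

lemma decays_Suc: "decays (v n) (v (Suc n))"
  by (rule strongly_below_decays[OF below_Suc v_zero])

definition ind_le :: "real \<Rightarrow> real \<Rightarrow> bool" where "ind_le s s' \<longleftrightarrow> (\<forall>\<alpha>. \<theta> s' \<alpha> \<le> \<theta> s \<alpha>)"

lemma half_scale_proj: "half_scale ind_le \<rho> (\<lambda>r s. \<theta> r)"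
proof
  show "\<exists>i. \<forall>j::nat. decays (\<theta> r) (v i)" if r: "0 < r" for r
  proof -
    obtain n where n: "\<And>\<alpha>. \<theta> r \<alpha> \<le> v n \<alpha>" using cofinal[OF r] by blast
    show ?thesis using decays_mono[OF decays_Suc n order_refl] by blast
  qed
qed (use inc pos fin \<rho>_pos chain decays_Suc in \<open>auto simp: ind_le_def\<close>)

lemma half_scale_ind: "half_scale ind_le \<rho> (\<lambda>r s. \<theta>i s)"
proof
  show "0 < vi j x" for j x using fin by (simp add: zero_less_iff_neq_zero less_top)
  then show "\<exists>i::nat. \<forall>j. 0 < vi j x" for x by blast
  show "\<exists>j. \<forall>i::nat. vi j x < top" for x using pos by (simp add: zero_less_iff_neq_zero less_top[symmetric])
  show "decays (vi (Suc j)) (vi j)" for j by (rule decays_inverse[OF decays_Suc])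
  then show "\<exists>i::nat. \<forall>j. decays (vi (Suc j)) (vi j)" by blast
  show "0 < s \<Longrightarrow> \<exists>j. \<forall>i::nat. \<forall>\<alpha>. vi j \<alpha> \<le> \<theta>i s \<alpha>" for s using cofinal ennreal_inverse_antimono by blast
qed (use inc \<rho>_pos chain in \<open>auto simp: ind_le_def intro: ennreal_inverse_antimono\<close>)

sublocale A: half_scales ind_le \<rho> "\<lambda>r s. \<theta> r" "\<lambda>r s. \<theta> r"
  by (intro half_scales.intro half_scale_proj)
sublocale A': half_scales ind_le \<rho> "\<lambda>r s. \<theta>i s" "\<lambda>r s. \<theta>i s"
  by (intro half_scales.intro half_scale_ind)
sublocale B: half_scales ind_le \<rho> "\<lambda>r s. \<theta> r" "\<lambda>r s. \<theta>i s"
  by (intro half_scales.intro half_scale_ind half_scale_proj)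
sublocale B': half_scales ind_le \<rho> "\<lambda>r s. \<theta>i s" "\<lambda>r s. \<theta> r"
  by (intro half_scales.intro half_scale_ind half_scale_proj)

lemma weight_est_A: "weight_est (tensor (v (m + 2)) (v (m + 2))) (tensor (v (m + 2)) (v (m + 2))) (tensor (v m) (v m))"
proof -
  obtain c where c: "c > 0" "\<And>\<alpha>. ennreal c \<le> v (Suc m) \<alpha>" using low2 by metis
  show ?thesis by (rule weight_est_tensor[OF c below inc below]) auto
qed

text \<open>Now larger indices mean larger weights, and the condition \<open>j1 + 1 < i2\<close>
  expresses that the decay of the second factor in \<gamma> beats the growth of the first. The
  projective index to be adapted thus belongs to the second factor.\<close>

lemma weight_est_B:
  assumes "i3 < i1" "i3 + 1 < i2" "j1 + 1 < i2" "j1 + 1 < j3" "j2 < j3"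
  shows "weight_est (tensor (v i1) (vi j1)) (tensor (v i2) (vi j2)) (tensor (v i3) (vi j3))"
  by (rule weight_est_ratio[where m = "v (i2 - 1)" and n = "v (j3 - 1)" and k = "v (i3 + 1)" and l = "v (j1 + 1)"])
    (use assms in \<open>auto intro!: pos below inc\<close>)

lemma weight_est_A'_B:
  assumes "j1 + 1 < i2" "j1 + 1 < j3" "j2 < j3"
  shows "weight_est (tensor (vi j1) (vi j1)) (tensor (v i2) (vi j2)) (tensor (vi j3) (vi j3))"
proof -
  obtain c where c: "c > 0" "\<And>\<alpha>. ennreal c \<le> v (i2 - 1) \<alpha>" "\<And>\<alpha>. ennreal c \<le> v (j3 - 1) \<alpha>" using low2 by metis
  show ?thesis
    by (rule weight_est_dual[OF _ _ _ _ c, where l = "v (j1 + 1)"])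
      (use assms in \<open>auto intro!: pos below inc\<close>)
qed

lemma weight_est_B_right: "weight_est_right B.w B.w B.w"
  unfolding weight_est_right_def
proof (intro allI)
  fix s :: "nat \<Rightarrow> nat" and i3
  \<comment> \<open>Since \<open>i1 = i3 + 1\<close> and its step \<open>s i1\<close> are known at
    once, \<open>i2\<close> can be placed beyond that step before \<open>j2\<close> is
    given.\<close>
  have "weight_est (B.w (i3 + 1) (s (i3 + 1))) (B.w (max i3 (s (i3 + 1)) + 2) j2) (B.w i3 (max (s (i3 + 1) + 1) j2 + 1))" for j2
    by (rule weight_est_B) auto
  then show "\<exists>i2. \<forall>j2. \<exists>i1 j3. weight_est (B.w i1 (s i1)) (B.w i2 j2) (B.w i3 j3)" by blast
qed

lemma weight_est_B_left: "weight_est_left B.w B.w B.w"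
  unfolding weight_est_left_def
proof (intro allI)
  fix s :: "nat \<Rightarrow> nat" and i3
  \<comment> \<open>In this order \<open>i2\<close> may follow \<open>j1\<close>, and
    \<open>j3\<close> follows the step \<open>s i2\<close>.\<close>
  have "weight_est (B.w (i3 + 1) j1) (B.w (max i3 j1 + 2) (s (max i3 j1 + 2))) (B.w i3 (max (j1 + 1) (s (max i3 j1 + 2)) + 1))" for j1
    by (rule weight_est_B) auto
  then show "\<exists>i1. \<forall>j1. \<exists>i2 j3. weight_est (B.w i1 j1) (B.w i2 (s i2)) (B.w i3 j3)" by blast
qed

lemma weight_est_C: "weight_est_ind_proj B.w B.w B.w"
  unfolding weight_est_ind_proj_def
proof (intro allI)
  fix j1 j2
  have "weight_est (B.w (i3 + 1) j1) (B.w (max i3 j1 + 2) j2) (B.w i3 (max (j1 + 1) j2 + 1))" for i3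
    by (rule weight_est_B) auto
  then show "\<exists>j3. \<forall>i3. \<exists>i1 i2. weight_est (B.w i1 j1) (B.w i2 j2) (B.w i3 j3)" by blast
qed

lemma weight_est_A'_B_right: "weight_est_right A'.w B.w A'.w"
  unfolding weight_est_right_def
proof (intro allI)
  fix s :: "nat \<Rightarrow> nat" and i3
  \<comment> \<open>The dual grid depends on its inductive index alone, so \<open>i1 = 0\<close>
    stands for an inert projective index.\<close>
  have "weight_est (A'.w 0 (s 0)) (B.w (s 0 + 2) j2) (A'.w i3 (max (s 0 + 1) j2 + 1))" for j2
    by (rule weight_est_A'_B) auto
  then show "\<exists>i2. \<forall>j2. \<exists>i1 j3. weight_est (A'.w i1 (s i1)) (B.w i2 j2) (A'.w i3 j3)" by blast
qed

lemma weight_est_A'_B_left: "weight_est_left A'.w B.w A'.w"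
  unfolding weight_est_left_def
proof (intro allI)
  fix s :: "nat \<Rightarrow> nat" and i3
  have "weight_est (A'.w 0 j1) (B.w (j1 + 2) (s (j1 + 2))) (A'.w i3 (max (j1 + 1) (s (j1 + 2)) + 1))" for j1
    by (rule weight_est_A'_B) auto
  then show "\<exists>i1. \<forall>j1. \<exists>i2 j3. weight_est (A'.w i1 j1) (B.w i2 (s i2)) (A'.w i3 j3)" by blast
qed

lemma extends_A: "uniquely_extends jointly_continuous (proj_ind A.w) (proj_ind A.w) (proj_ind A.w)"
  by (rule uniquely_extends_joint[OF A.w.weight_grid_axioms])
    (use weight_est_A in \<open>auto simp: weight_est_right_def weight_est_left_def\<close>)

lemma swap_grids: "swap_grid B.w = B'.w" "swap_grid A'.w = A'.w"
  by (rule swap_grid_tensor)+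

lemmas extends_B =
  uniquely_extends_proj_ind[OF A'.w.weight_grid_axioms B.w.weight_grid_axioms A'.w.weight_grid_axioms
    weight_est_A'_B_right weight_est_A'_B_left]
  uniquely_extends_proj_ind[OF B'.w.weight_grid_axioms A'.w.weight_grid_axioms A'.w.weight_grid_axioms
    weight_est_right_swap[OF weight_est_A'_B_left, unfolded swap_grids] weight_est_left_swap[OF weight_est_A'_B_right, unfolded swap_grids]]
  uniquely_extends_proj_ind[OF B.w.weight_grid_axioms B.w.weight_grid_axioms B.w.weight_grid_axioms
    weight_est_B_right weight_est_B_left]
  uniquely_extends_proj_ind[OF B'.w.weight_grid_axioms B'.w.weight_grid_axioms B'.w.weight_grid_axioms
    weight_est_right_swap[OF weight_est_B_left, unfolded swap_grids] weight_est_left_swap[OF weight_est_B_right, unfolded swap_grids]]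
  uniquely_extends_ind_proj[OF B.w.weight_grid_axioms B.w.weight_grid_axioms B.w.weight_grid_axioms weight_est_C]
  uniquely_extends_ind_proj[OF B'.w.weight_grid_axioms B'.w.weight_grid_axioms B'.w.weight_grid_axioms
    weight_est_ind_proj_swap[OF weight_est_C, unfolded swap_grids]]

end

section \<open>The weights\<close>

lemma vtheta_mono: "s \<noteq> Num 0 \<Longrightarrow> 0 < r \<Longrightarrow> r \<le> r' \<Longrightarrow> vtheta s r \<alpha> \<le> vtheta s r' \<alpha>"
  by (cases s) (auto intro!: ennreal_leI mult_right_mono power_mono)

lemma vtheta_zero: "0 < r \<Longrightarrow> vtheta s r 0 = 1"
  by (cases s) (auto simp: midx_fact_def)

lemma vtheta_finite: "s \<noteq> Num 0 \<Longrightarrow> vtheta s r \<alpha> < top"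
  by (cases s) auto

lemma power_powr_commute: "0 < (x::real) \<Longrightarrow> (x ^ k) powr a = (x powr a) ^ (k :: nat)"
  using powr_powr[of x "real k" a] by (simp add: powr_realpow powr_power)

lemma vtheta_Flat_prod:
  assumes "0 < r"
  shows "r ^ midx_abs \<alpha> * midx_fact \<alpha> powr \<tau> = (\<Prod>i\<in>UNIV. r ^ (\<alpha> $ i) * fact (\<alpha> $ i) powr \<tau>)"
  unfolding midx_abs_def midx_fact_def
  by (simp add: power_sum prod.distrib) (simp add: prod_powr_distrib)

text \<open>For a flat symbol each factor is \<open>(fact k / x ^ k) powr \<tau>\<close>, where
  \<open>x powr \<tau> = 1 / r\<close>. The bound \<open>x ^ k / fact k \<le> exp x\<close> makes it
  at least \<open>exp (- x) powr \<tau>\<close>, independently of \<open>k\<close>.\<close>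

lemma vtheta_low:
  assumes s: "s \<in> Rflat" and r: "0 < r"
  shows "\<exists>c>0. \<forall>\<alpha> :: nat ^ 'n::finite. ennreal c \<le> vtheta s r \<alpha>"
proof (cases s)
  case (Num t)
  have "ennreal 1 \<le> vtheta s r \<alpha>" for \<alpha> :: "nat ^ 'n"
    using r by (auto simp: Num intro!: ennreal_leI)
  then show ?thesis by (intro exI[of _ 1]) auto
next
  case (Flat \<sigma>)
  define \<tau> where "\<tau> = 1 / (2 * \<sigma>)"
  have \<tau>: "\<tau> > 0" using s by (auto simp: Flat Rflat_def \<tau>_def)
  define x where "x = (1 / r) powr (1 / \<tau>)"
  have x: "x > 0" using r by (simp add: x_def)
  have xr: "x powr \<tau> = 1 / r" using r \<tau> by (simp add: x_def powr_powr)
  have "exp (- x) powr \<tau> \<le> r ^ k * fact k powr \<tau>" for k :: nat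
  proof -
    have "x ^ k / fact k \<le> exp x"
      using exp_ge_one_plus_x_over_n_power_n[of 1 x] x
        sum_le_suminf[of "\<lambda>k. x ^ k / fact k" "{k}"] summable_exp[of x]
      by (simp add: exp_def scaleR_conv_of_real divide_inverse mult.commute)
    then have "exp (- x) \<le> fact k / x ^ k"
      using x by (simp add: exp_minus field_simps)
    then have "exp (- x) powr \<tau> \<le> (fact k / x ^ k) powr \<tau>" using \<tau> by (intro powr_mono2) auto
    also have "\<dots> = fact k powr \<tau> / (x powr \<tau>) ^ k"
      using x by (simp add: powr_divide power_powr_commute)
    also have "\<dots> = r ^ k * fact k powr \<tau>" using r by (simp add: xr power_one_over)
    finally show ?thesis .
  qed
  then have "(\<Prod>i\<in>(UNIV :: 'n set). exp (- x) powr \<tau>) \<le> (\<Prod>i\<in>UNIV. r ^ (\<alpha> $ i) * fact (\<alpha> $ i) powr \<tau>)" for \<alpha> :: "nat ^ 'n"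
    by (intro prod_mono) auto
  then have "ennreal (\<Prod>i\<in>(UNIV :: 'n set). exp (- x) powr \<tau>) \<le> vtheta s r \<alpha>" for \<alpha> :: "nat ^ 'n"
    by (simp add: Flat vtheta_Flat_prod[OF r] \<tau>_def[symmetric] ennreal_leI)
  then show ?thesis by (intro exI[of _ "\<Prod>i\<in>(UNIV :: 'n set). exp (- x) powr \<tau>"]) (auto intro!: prod_pos)
qed

lemma weight_scale_vtheta:
  assumes s: "s \<in> Rflat" and \<rho>: "\<And>n. 0 < \<rho> n"
  shows "weight_scale (vtheta s :: real \<Rightarrow> nat ^ 'n::finite \<Rightarrow> ennreal) \<rho>"
proof
  show "0 < r \<Longrightarrow> 0 < r' \<Longrightarrow> (\<forall>\<alpha> :: nat ^ 'n. vtheta s r \<alpha> \<le> vtheta s r' \<alpha>) \<or> (\<forall>\<alpha> :: nat ^ 'n. vtheta s r' \<alpha> \<le> vtheta s r \<alpha>)" for r r'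
  proof (cases "s = Num 0")
    case False
    assume "0 < r" "0 < r'"
    then show ?thesis using vtheta_mono[OF False] by (metis linear)
  next
    case True
    have "vtheta s b \<alpha> \<le> vtheta s a \<alpha>" if "a \<le> b" for a b and \<alpha> :: "nat ^ 'n" using that True by auto
    then show ?thesis by (metis linear)
  qed
qed (use \<rho> vtheta_zero vtheta_low[OF s] in auto)

lemma strongly_belowI:
  fixes f g :: "nat ^ 'n::finite \<Rightarrow> real"
  assumes "0 < C" and f: "\<And>\<alpha>. 0 \<le> f \<alpha>" and g: "\<And>\<alpha>. 0 \<le> g \<alpha>"
    and 1: "\<And>\<alpha> \<beta>. 4 ^ (midx_abs \<alpha> + midx_abs \<beta>) * (f \<alpha> * f \<beta>) \<le> C * g (\<alpha> + \<beta>)"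
    and 2: "\<And>\<alpha> \<beta>. 4 ^ (midx_abs \<alpha> + midx_abs \<beta>) * f (\<alpha> + \<beta>) \<le> C * (g \<alpha> * g \<beta>)"
  shows "strongly_below (\<lambda>\<alpha>. ennreal (f \<alpha>)) (\<lambda>\<alpha>. ennreal (g \<alpha>))"
  unfolding strongly_below_def
  using assms by (intro exI[of _ C]) (auto simp: ennreal_mult'[symmetric] intro!: ennreal_leI)

section \<open>Comparison of the concrete weights\<close>

lemma powr_add_superadditive:
  assumes "1 \<le> \<kappa>" "0 \<le> a" "0 \<le> (b::real)"
  shows "a powr \<kappa> + b powr \<kappa> \<le> (a + b) powr \<kappa>"
proof (cases "a + b = 0")
  case False
  then have p: "a + b > 0" using assms by simp
  have *: "x powr \<kappa> \<le> x / (a + b) * (a + b) powr \<kappa>" if "0 \<le> x" "x \<le> a + b" for x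
  proof -
    have "(x / (a + b)) powr \<kappa> \<le> (x / (a + b)) powr 1"
      using that p assms(1) by (intro powr_mono') auto
    then show ?thesis using that p by (simp add: powr_divide field_simps)
  qed
  have "a powr \<kappa> + b powr \<kappa> \<le> a / (a + b) * (a + b) powr \<kappa> + b / (a + b) * (a + b) powr \<kappa>"
    using assms by (intro add_mono *) auto
  also have "\<dots> = (a + b) powr \<kappa>"
    unfolding distrib_right[symmetric] add_divide_distrib[symmetric] using p by simp
  finally show ?thesis .
qed (use assms in \<open>auto simp: add_nonneg_eq_0_iff\<close>)

lemma powr_add_le:
  assumes "0 \<le> \<kappa>" "0 \<le> a" "0 \<le> (b::real)"
  shows "(a + b) powr \<kappa> \<le> 2 powr \<kappa> * (a powr \<kappa> + b powr \<kappa>)"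
proof -
  have "(a + b) powr \<kappa> \<le> (2 * max a b) powr \<kappa>" using assms by (intro powr_mono2) auto
  also have "\<dots> = 2 powr \<kappa> * max a b powr \<kappa>" using assms by (simp add: powr_mult)
  also have "\<dots> \<le> 2 powr \<kappa> * (a powr \<kappa> + b powr \<kappa>)" by (intro mult_left_mono) (auto simp: max_def)
  finally show ?thesis .
qed

text \<open>Powers with exponent at least 1 are superadditive, and subadditive up to the factor 2 to
  that exponent, which explains the multiple of \<open>r\<close> in the hypothesis. The remaining
  part of \<open>r'\<close> absorbs the powers of 4 up to the constant \<open>K\<close>, spent once
  for \<alpha> and once for \<beta>.\<close>

lemma strongly_below_Num:
  assumes t: "t \<noteq> 0" and \<kappa>: "1 \<le> 1 / (2 * t)" and r: "0 < r"
    and K: "\<And>n::nat. ln 4 * n \<le> (r' - 2 powr (1 / (2 * t)) * r) * n powr (1 / (2 * t)) + K"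
  shows "strongly_below (vtheta (Num t) r) (vtheta (Num t) r' :: nat ^ 'n::finite \<Rightarrow> ennreal)"
proof -
  let ?k = "1 / (2 * t)"
  let ?e = "\<lambda>r \<alpha>. exp (r * real (midx_abs \<alpha>) powr ?k)"
  have four: "(4::real) ^ n = exp (ln 4 * n)" for n :: nat by (simp add: exp_of_nat2_mult)
  have K0: "0 \<le> K" using K[of 0] by simp
  have e: "exp x \<le> exp (2 * K) * exp y" if "x \<le> 2 * K + y" for x y :: real
    using that by (simp flip: exp_add)
  have key: "r * (real a powr ?k + real b powr ?k) + ln 4 * real (a + b) \<le> 2 * K + r' * real (a + b) powr ?k"
    "r * real (a + b) powr ?k + ln 4 * real (a + b) \<le> 2 * K + r' * (real a powr ?k + real b powr ?k)" for a b :: nat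
  proof -
    let ?A = "real a powr ?k + real b powr ?k"
    have A: "?A \<le> real (a + b) powr ?k" using powr_add_superadditive[OF \<kappa>, of "real a" "real b"] by simp
    have A2: "real (a + b) powr ?k \<le> 2 powr ?k * ?A" using powr_add_le[OF order_trans[OF zero_le_one \<kappa>], of "real a" "real b"] by simp
    have k: "ln 4 * real (a + b) \<le> (r' - 2 powr ?k * r) * ?A + 2 * K"
      using K[of a] K[of b] by (simp add: algebra_simps)
    have r2: "r * 2 powr ?k \<ge> r" using ge_one_powr_ge_zero[of 2 ?k] order_trans[OF zero_le_one \<kappa>] r by simp
    have "(r' - 2 powr ?k * r + r) * ?A \<le> r' * ?A" using r2 by (intro mult_right_mono) (auto simp: algebra_simps)
    \<comment> \<open>Otherwise the coefficient in the hypothesis would be negative and the linear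
      left side would stay below \<open>K\<close> for all \<open>n\<close>.\<close>
    moreover have "r' \<ge> 0"
    proof (rule ccontr)
      assume n: "\<not> r' \<ge> 0"
      define R where "R = r' - 2 powr ?k * r"
      have "R < 0" using n r by (simp add: R_def) (smt (verit) mult_nonneg_nonneg powr_ge_zero)
      obtain n :: nat where "real n > K" using reals_Archimedean2 by blast
      moreover have "R * real n powr ?k \<le> 0" using \<open>R < 0\<close> by (simp add: mult_nonpos_nonneg)
      moreover have "ln 4 * real n \<ge> 1 * real n" using ln_ge_iff[of 4 1] exp_le by (intro mult_right_mono) auto
      ultimately show False using K[of n] unfolding R_def[symmetric] by linarith
    qed
    then have "r' * ?A \<le> r' * real (a + b) powr ?k" using A by (rule mult_left_mono[rotated])
    ultimately show "r * ?A + ln 4 * real (a + b) \<le> 2 * K + r' * real (a + b) powr ?k"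
      using k by (simp add: algebra_simps)
    have "r * real (a + b) powr ?k \<le> r * (2 powr ?k * ?A)" using A2 r by (intro mult_left_mono) auto
    then show "r * real (a + b) powr ?k + ln 4 * real (a + b) \<le> 2 * K + r' * ?A"
      using k by (simp add: algebra_simps)
  qed
  have "strongly_below (\<lambda>\<alpha>. ennreal (?e r \<alpha>)) (\<lambda>\<alpha> :: nat ^ 'n. ennreal (?e r' \<alpha>))"
  proof (rule strongly_belowI[of "exp (2 * K)"])
    fix \<alpha> \<beta> :: "nat ^ 'n"
    let ?a = "midx_abs \<alpha>" and ?b = "midx_abs \<beta>"
    have "4 ^ (?a + ?b) * (?e r \<alpha> * ?e r \<beta>) = exp (r * (real ?a powr ?k + real ?b powr ?k) + ln 4 * real (?a + ?b))"
      unfolding four exp_add[symmetric] by (simp add: algebra_simps)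
    also have "\<dots> \<le> exp (2 * K) * ?e r' (\<alpha> + \<beta>)"
      unfolding midx_abs_add by (rule e[OF key(1)])
    finally show "4 ^ (?a + ?b) * (?e r \<alpha> * ?e r \<beta>) \<le> exp (2 * K) * ?e r' (\<alpha> + \<beta>)" .
    have "4 ^ (?a + ?b) * ?e r (\<alpha> + \<beta>) = exp (r * real (?a + ?b) powr ?k + ln 4 * real (?a + ?b))"
      unfolding four exp_add[symmetric] midx_abs_add by (simp add: algebra_simps)
    also have "\<dots> \<le> exp (2 * K) * exp (r' * (real ?a powr ?k + real ?b powr ?k))"
      by (rule e[OF key(2)])
    also have "\<dots> = exp (2 * K) * (?e r' \<alpha> * ?e r' \<beta>)" by (simp add: distrib_left exp_add)
    finally show "4 ^ (?a + ?b) * ?e r (\<alpha> + \<beta>) \<le> exp (2 * K) * (?e r' \<alpha> * ?e r' \<beta>)" .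
  qed auto
  then show ?thesis using t by (simp add: fun_eq_iff[symmetric] vtheta.simps(1)[abs_def])
qed

lemma midx_fact_mult_le:
  "midx_fact \<alpha> * midx_fact \<beta> \<le> midx_fact (\<alpha> + \<beta>)" (is ?lower)
  "midx_fact (\<alpha> + \<beta>) \<le> 2 ^ midx_abs (\<alpha> + \<beta>) * (midx_fact \<alpha> * midx_fact \<beta>)" (is ?upper)
proof -
  have id: "fact (a + b) = real ((a + b) choose a) * (fact a * fact b)" for a b :: nat
    using binomial_fact_lemma[of a "a + b"] by (metis add_diff_cancel_left' le_add1 mult.commute of_nat_fact of_nat_mult)
  have "fact a * fact b \<le> (fact (a + b) :: real)" for a b :: nat
  proof -
    have "real ((a + b) choose a) \<ge> 1" by (simp add: Suc_leI)
    then have "1 * (fact a * fact b) \<le> real ((a + b) choose a) * (fact a * fact b)"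
      by (intro mult_right_mono) auto
    then show ?thesis by (simp add: id)
  qed
  then show ?lower
    unfolding midx_fact_def prod.distrib[symmetric] by (intro prod_mono) auto
  have "fact (a + b) \<le> (2 ^ (a + b) * (fact a * fact b) :: real)" for a b :: nat
    unfolding id using binomial_le_pow2[of "a + b" a]
    by (intro mult_right_mono) (metis of_nat_le_iff of_nat_numeral of_nat_power, simp)
  then show ?upper
    unfolding midx_fact_def midx_abs_def power_sum prod.distrib[symmetric] by (intro prod_mono) auto
qed

text \<open>In the ratio of the parameters 4 absorbs the powers of 4, and
  \<open>2 powr (1 / (2 * \<sigma>))\<close> absorbs the binomial by which the factorial of a sum
  exceeds the product of factorials.\<close>

lemma strongly_below_Flat:
  assumes \<sigma>: "0 < \<sigma>" and r: "0 < r" "4 * 2 powr (1 / (2 * \<sigma>)) * r \<le> r'"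
  shows "strongly_below (vtheta (Flat \<sigma>) r) (vtheta (Flat \<sigma>) r' :: nat ^ 'n::finite \<Rightarrow> ennreal)"
proof -
  let ?t = "1 / (2 * \<sigma>)"
  let ?e = "\<lambda>r \<alpha>. r ^ midx_abs \<alpha> * midx_fact \<alpha> powr ?t"
  have t: "?t \<ge> 0" using \<sigma> by simp
  have q: "2 powr ?t \<ge> 1" using t by (simp add: ge_one_powr_ge_zero)
  then have "4 * r \<le> 4 * 2 powr ?t * r" using r by simp
  then have r4: "4 * r \<le> r'" using r by linarith
  have "strongly_below (\<lambda>\<alpha>. ennreal (?e r \<alpha>)) (\<lambda>\<alpha> :: nat ^ 'n. ennreal (?e r' \<alpha>))"
  proof (rule strongly_belowI[of 1])
    fix \<alpha> \<beta> :: "nat ^ 'n"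
    let ?n = "midx_abs \<alpha> + midx_abs \<beta>" and ?f = "midx_fact \<alpha> * midx_fact \<beta>"
    have f: "0 \<le> ?f" "0 \<le> midx_fact (\<alpha> + \<beta>)" by (intro mult_nonneg_nonneg less_imp_le[OF midx_fact_pos])+
    have fp: "midx_fact \<alpha> powr ?t * midx_fact \<beta> powr ?t = ?f powr ?t"
      using midx_fact_pos[of \<alpha>] midx_fact_pos[of \<beta>] by (simp add: powr_mult)
    have "4 ^ ?n * (?e r \<alpha> * ?e r \<beta>) = (4 * r) ^ ?n * ?f powr ?t"
      unfolding fp[symmetric] power_mult_distrib by (simp add: power_add mult_ac)
    also have "\<dots> \<le> r' ^ ?n * midx_fact (\<alpha> + \<beta>) powr ?t"
      using r r4 t f by (intro mult_mono power_mono powr_mono2 midx_fact_mult_le) auto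
    finally show "4 ^ ?n * (?e r \<alpha> * ?e r \<beta>) \<le> 1 * ?e r' (\<alpha> + \<beta>)" by (simp add: midx_abs_add)
    have "midx_fact (\<alpha> + \<beta>) powr ?t \<le> (2 ^ ?n * ?f) powr ?t"
      using midx_fact_mult_le(2)[of \<alpha> \<beta>] t f by (intro powr_mono2) (auto simp: midx_abs_add)
    also have "\<dots> = (2 powr ?t) ^ ?n * ?f powr ?t"
      using f by (simp add: powr_mult power_powr_commute)
    finally have "4 ^ ?n * (r ^ ?n * midx_fact (\<alpha> + \<beta>) powr ?t) \<le> 4 ^ ?n * (r ^ ?n * ((2 powr ?t) ^ ?n * ?f powr ?t))"
      using r by (intro mult_left_mono) auto
    also have "\<dots> = (4 * 2 powr ?t * r) ^ ?n * ?f powr ?t"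
      unfolding power_mult_distrib by (simp add: mult_ac)
    also have "\<dots> \<le> r' ^ ?n * ?f powr ?t"
      using r by (intro mult_right_mono power_mono) auto
    finally show "4 ^ ?n * ?e r (\<alpha> + \<beta>) \<le> 1 * (?e r' \<alpha> * ?e r' \<beta>)"
      unfolding fp[symmetric] by (simp add: midx_abs_add power_add mult_ac)
  qed (use r r4 in auto)
  then show ?thesis by (simp add: vtheta.simps(2)[abs_def])
qed

lemma roumieu_geometric:
  assumes s: "s \<in> Rflat" "s \<noteq> Num 0" and q: "0 < q" "q < 1"
    and b: "\<And>r. 0 < r \<Longrightarrow> strongly_below (vtheta s (q * r)) (vtheta s r :: nat ^ 'n::finite \<Rightarrow> ennreal)"
  shows "roumieu (vtheta s :: real \<Rightarrow> nat ^ 'n \<Rightarrow> ennreal) (\<lambda>n. q ^ n)"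
proof (intro roumieu.intro weight_scale_vtheta roumieu_axioms.intro s(1))
  show "m \<le> n \<Longrightarrow> vtheta s (q ^ n) \<alpha> \<le> vtheta s (q ^ m) \<alpha>" for m n and \<alpha> :: "nat ^ 'n"
    using q by (intro vtheta_mono s power_decreasing) auto
  show "strongly_below (vtheta s (q ^ Suc n)) (vtheta s (q ^ n) :: nat ^ 'n \<Rightarrow> ennreal)" for n
    using b[of "q ^ n"] q by simp
  show "\<exists>n. \<forall>\<alpha> :: nat ^ 'n. vtheta s (q ^ n) \<alpha> \<le> vtheta s r \<alpha>" if r: "0 < r" for r
  proof -
    obtain n where "q ^ n < r" using real_arch_pow_inv[OF r q(2)] by blast
    then show ?thesis using vtheta_mono[OF s(2), of "q ^ n" r] q by (intro exI[of _ n]) auto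
  qed
qed (use q s vtheta_finite in auto)

lemma beurling_geometric:
  assumes s: "s \<in> Rflat" "s \<noteq> Num 0" and q: "1 < q"
    and b: "\<And>r. 1 \<le> r \<Longrightarrow> strongly_below (vtheta s r) (vtheta s (q * r) :: nat ^ 'n::finite \<Rightarrow> ennreal)"
  shows "beurling (vtheta s :: real \<Rightarrow> nat ^ 'n \<Rightarrow> ennreal) (\<lambda>n. q ^ n)"
proof (intro beurling.intro weight_scale_vtheta beurling_axioms.intro s(1))
  show "m \<le> n \<Longrightarrow> vtheta s (q ^ m) \<alpha> \<le> vtheta s (q ^ n) \<alpha>" for m n and \<alpha> :: "nat ^ 'n"
    using q by (intro vtheta_mono s power_increasing) auto
  show "strongly_below (vtheta s (q ^ n)) (vtheta s (q ^ Suc n) :: nat ^ 'n \<Rightarrow> ennreal)" for n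
    using b[of "q ^ n"] q by simp
  show "\<exists>n. \<forall>\<alpha> :: nat ^ 'n. vtheta s r \<alpha> \<le> vtheta s (q ^ n) \<alpha>" if r: "0 < r" for r
  proof -
    obtain n where "r < q ^ n" using real_arch_pow[OF q, of r] by blast
    then show ?thesis using vtheta_mono[OF s(2) r, of "q ^ n"] by (intro exI[of _ n]) auto
  qed
qed (use q s vtheta_finite in auto)

text \<open>The weights are cut-offs at degree \<open>2 ^ n\<close>, and two indices below one
  cut-off add up to an index below the next. Unless the right side is infinite, the total degree is
  at most \<open>2 * 2 ^ n\<close>; this gives the constant.\<close>

lemma roumieu_zero: "roumieu (vtheta (Num 0) :: real \<Rightarrow> nat ^ 'n::finite \<Rightarrow> ennreal) (\<lambda>n. 2 ^ n)"
proof (intro roumieu.intro weight_scale_vtheta roumieu_axioms.intro)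
  show "m \<le> n \<Longrightarrow> vtheta (Num 0) (2 ^ n) \<alpha> \<le> vtheta (Num 0) (2 ^ m) \<alpha>" for m n and \<alpha> :: "nat ^ 'n"
    using order_trans[of "real (midx_abs \<alpha>)" "2 ^ m" "2 ^ n"] power_increasing[of m n "2::real"] by simp
  show "\<exists>n. vtheta (Num 0) (2 ^ n) \<alpha> < top" for \<alpha> :: "nat ^ 'n"
    using of_nat_less_two_power[of "midx_abs \<alpha>", where 'a = real] by (intro exI[of _ "midx_abs \<alpha>"]) auto
  show "\<exists>n. \<forall>\<alpha> :: nat ^ 'n. vtheta (Num 0) (2 ^ n) \<alpha> \<le> vtheta (Num 0) r \<alpha>" for r
  proof -
    obtain n where "r < 2 ^ n" using real_arch_pow[of 2 r] by auto
    then have "real k \<le> r \<Longrightarrow> real k \<le> 2 ^ n" for k by linarith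
    then show ?thesis by (intro exI[of _ n]) simp
  qed
  show "strongly_below (vtheta (Num 0) (2 ^ Suc n)) (vtheta (Num 0) (2 ^ n) :: nat ^ 'n \<Rightarrow> ennreal)" for n
    unfolding strongly_below_def
  proof (intro exI[of _ "4 ^ (2 * 2 ^ n)"] conjI allI)
    fix \<alpha> \<beta> :: "nat ^ 'n"
    let ?a = "midx_abs \<alpha>" and ?b = "midx_abs \<beta>"
    have nat: "real k \<le> 2 ^ n \<longleftrightarrow> k \<le> 2 ^ n" "real k \<le> 2 * 2 ^ n \<longleftrightarrow> k \<le> 2 * 2 ^ n" for k
      by (metis of_nat_le_iff of_nat_numeral of_nat_power, metis of_nat_le_iff of_nat_numeral of_nat_power of_nat_mult)
    have nat2: "real k + real l \<le> 2 ^ n \<longleftrightarrow> k + l \<le> 2 ^ n" "real k + real l \<le> 2 * 2 ^ n \<longleftrightarrow> k + l \<le> 2 * 2 ^ n" for k l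
      using nat[of "k + l"] by (simp_all only: of_nat_add)
    have *: "ennreal (4 ^ (?a + ?b)) \<le> ennreal (4 ^ (2 * 2 ^ n))" if "?a + ?b \<le> 2 * 2 ^ n"
      using that by (intro ennreal_leI power_increasing) auto
    show "ennreal (4 ^ (?a + ?b)) * (vtheta (Num 0) (2 ^ Suc n) \<alpha> * vtheta (Num 0) (2 ^ Suc n) \<beta>) \<le>
        ennreal (4 ^ (2 * 2 ^ n)) * vtheta (Num 0) (2 ^ n) (\<alpha> + \<beta>)"
      using * by (auto simp: nat nat2 midx_abs_add ennreal_mult_top)
    show "ennreal (4 ^ (?a + ?b)) * vtheta (Num 0) (2 ^ Suc n) (\<alpha> + \<beta>) \<le>
        ennreal (4 ^ (2 * 2 ^ n)) * (vtheta (Num 0) (2 ^ n) \<alpha> * vtheta (Num 0) (2 ^ n) \<beta>)"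
      using * by (auto simp: nat nat2 midx_abs_add ennreal_mult_top)
  qed simp
qed (auto simp: Rflat_def)

lemma roumieu_vtheta:
  assumes s: "s \<in> Rflat" "s < Num (1 / 2)"
  shows "\<exists>\<rho>. roumieu (vtheta s :: real \<Rightarrow> nat ^ 'n::finite \<Rightarrow> ennreal) \<rho>"
proof (cases s)
  case (Flat \<sigma>)
  have \<sigma>: "\<sigma> > 0" using s by (auto simp: Flat Rflat_def)
  define Q where "Q = 4 * 2 powr (1 / (2 * \<sigma>))"
  have Q: "Q \<ge> 4" using \<sigma> by (simp add: Q_def ge_one_powr_ge_zero)
  have "roumieu (vtheta s :: real \<Rightarrow> nat ^ 'n \<Rightarrow> ennreal) (\<lambda>n. (1 / Q) ^ n)"
    using Q by (intro roumieu_geometric s) (auto simp: Flat Q_def[symmetric] intro!: strongly_below_Flat \<sigma>)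
  then show ?thesis by blast
next
  case (Num t)
  show ?thesis
  proof (cases "t = 0")
    case True
    then show ?thesis using roumieu_zero Num by blast
  next
    case False
    then have t: "0 < t" "t < 1 / 2" using s by (auto simp: Num Rflat_def)
    define \<kappa> where "\<kappa> = 1 / (2 * t)"
    have \<kappa>: "\<kappa> > 1" using t by (simp add: \<kappa>_def)
    \<comment> \<open>With this ratio exactly half of \<open>r\<close> is left over to absorb the
      linear term.\<close>
    define Q where "Q = 2 * 2 powr \<kappa>"
    have Q: "Q \<ge> 2" using \<kappa> by (simp add: Q_def ge_one_powr_ge_zero)
    have "roumieu (vtheta s :: real \<Rightarrow> nat ^ 'n \<Rightarrow> ennreal) (\<lambda>n. (1 / Q) ^ n)"
    proof (intro roumieu_geometric s)
      fix r :: real assume r: "0 < r"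
      \<comment> \<open>Beyond this threshold \<open>r / 2 * n powr \<kappa>\<close> exceeds
        \<open>ln 4 * n\<close>. The exponent \<open>1 / (\<kappa> - 1)\<close> is where the strict
        inequality \<open>s < 1/2\<close> is used.\<close>
      define K where "K = (2 * ln 4 / r) powr (1 / (\<kappa> - 1))"
      have "ln 4 * real n \<le> (r - 2 powr \<kappa> * (1 / Q * r)) * real n powr \<kappa> + ln 4 * K" for n :: nat
      proof -
        have half: "r - 2 powr \<kappa> * (1 / Q * r) = r / 2" by (simp add: Q_def)
        show ?thesis
        proof (cases "real n \<le> K")
          case True
          then have "ln 4 * real n \<le> ln 4 * K" by (intro mult_left_mono) auto
          moreover have "r / 2 * real n powr \<kappa> \<ge> 0" using r by simp
          ultimately show ?thesis unfolding half by linarith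
        next
          case False
          have "2 * ln 4 / r = K powr (\<kappa> - 1)" using \<kappa> r by (simp add: K_def powr_powr)
          also have "\<dots> \<le> real n powr (\<kappa> - 1)" using False \<kappa> by (intro powr_mono2) (auto simp: K_def)
          finally have "r / 2 * (2 * ln 4 / r) * real n \<le> r / 2 * real n powr (\<kappa> - 1) * real n"
            using r by (intro mult_right_mono mult_left_mono) auto
          then have "ln 4 * real n \<le> r / 2 * (real n powr (\<kappa> - 1) * real n)"
            using r by simp
          also have "real n powr (\<kappa> - 1) * real n = real n powr \<kappa>"
            using powr_mult_base[of "real n" "\<kappa> - 1"] by (simp add: mult.commute)
          finally have "ln 4 * real n \<le> r / 2 * real n powr \<kappa>" .
          moreover have "0 \<le> ln 4 * K" by (simp add: K_def)
          ultimately show ?thesis unfolding half by linarith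
        qed
      qed
      then show "strongly_below (vtheta s (1 / Q * r)) (vtheta s r :: nat ^ 'n \<Rightarrow> ennreal)"
        unfolding Num using t \<kappa> Q r by (intro strongly_below_Num) (auto simp: \<kappa>_def)
    qed (use False Q in \<open>auto simp: Num\<close>)
    then show ?thesis by blast
  qed
qed

lemma beurling_vtheta:
  assumes s: "s \<in> Rflat" "Num 0 < s" "s \<le> Num (1 / 2)"
  shows "\<exists>\<rho>. beurling (vtheta s :: real \<Rightarrow> nat ^ 'n::finite \<Rightarrow> ennreal) \<rho>"
proof (cases s)
  case (Flat \<sigma>)
  have \<sigma>: "\<sigma> > 0" using s by (auto simp: Flat Rflat_def)
  define Q where "Q = 4 * 2 powr (1 / (2 * \<sigma>))"
  have Q: "Q \<ge> 4" using \<sigma> by (simp add: Q_def ge_one_powr_ge_zero)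
  have "beurling (vtheta s :: real \<Rightarrow> nat ^ 'n \<Rightarrow> ennreal) (\<lambda>n. Q ^ n)"
    using Q by (intro beurling_geometric s) (auto simp: Flat Q_def[symmetric] intro!: strongly_below_Flat \<sigma>)
  then show ?thesis by blast
next
  case (Num t)
  have t: "0 < t" "t \<le> 1 / 2" using s by (auto simp: Num less_eq_rflat_def)
  define \<kappa> where "\<kappa> = 1 / (2 * t)"
  have \<kappa>: "\<kappa> \<ge> 1" using t by (simp add: \<kappa>_def)
  \<comment> \<open>One third of \<open>Q * r\<close> is lost to subadditivity. The rest is at least
    2 and exceeds \<open>ln 4\<close>, so the linear term is absorbed for every exponent \<kappa> at
    least 1, including \<open>s = 1/2\<close>.\<close>
  define Q where "Q = 3 * 2 powr \<kappa>"
  have two: "2 powr \<kappa> \<ge> 1" using \<kappa> by (simp add: ge_one_powr_ge_zero)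
  then have Q: "Q \<ge> 3" by (simp add: Q_def)
  have "beurling (vtheta s :: real \<Rightarrow> nat ^ 'n \<Rightarrow> ennreal) (\<lambda>n. Q ^ n)"
  proof (intro beurling_geometric s)
    fix r :: real assume r: "1 \<le> r"
    have "ln 4 * real n \<le> (Q * r - 2 powr \<kappa> * r) * real n powr \<kappa> + 0" for n :: nat
    proof -
      have "real n \<le> real n powr \<kappa>"
        using powr_mono[of 1 \<kappa> "real n"] \<kappa> by (cases "n = 0") auto
      moreover have "ln 4 \<le> (2::real)"
        using ln_le_minus_one[of 2] ln_realpow[of 2 2] by simp
      moreover have "1 * 1 \<le> 2 powr \<kappa> * r" using two r by (intro mult_mono) auto
      ultimately have "ln 4 * real n \<le> (2 * (2 powr \<kappa> * r)) * real n powr \<kappa>" by (intro mult_mono) auto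
      then show ?thesis by (simp add: Q_def algebra_simps)
    qed
    then show "strongly_below (vtheta s r) (vtheta s (Q * r) :: nat ^ 'n \<Rightarrow> ennreal)"
      unfolding Num using t \<kappa> r by (intro strongly_below_Num[where K = 0]) (auto simp: \<kappa>_def)
  qed (use t Q in \<open>auto simp: Num\<close>)
  then show ?thesis by blast
qed

section \<open>Identification of the spaces with limits over grids, and conclusion\<close>

lemma wt_tensor: "wt s r = tensor (vtheta s r) (vtheta s r)"
  by (simp add: wt_def tensor_def)

lemma wt_inv_tensor:
  assumes "\<And>\<alpha> :: nat ^ 'n. vtheta s r \<alpha> \<noteq> 0"
  shows "wt_inv s r = tensor (\<lambda>\<alpha> :: nat ^ 'n::finite. inverse (vtheta s r \<alpha>)) (\<lambda>\<alpha>. inverse (vtheta s r \<alpha>))"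
  using assms by (auto simp: wt_inv_def wt_def fun_eq_iff divide_ennreal_def zero_less_iff_neq_zero intro!: ennreal_inverse_mult')

lemma wt_om_tensor: "wt_om s r2 r1 = tensor (vtheta s r2) (\<lambda>\<alpha>. inverse (vtheta s r1 \<alpha>))"
  by (simp add: wt_om_def tensor_def divide_ennreal_def)

lemma wt_om_star_tensor: "wt_om_star s r2 r1 = tensor (\<lambda>\<alpha>. inverse (vtheta s r2 \<alpha>)) (vtheta s r1)"
  by (simp add: wt_om_star_def tensor_def divide_ennreal_def mult.commute)

lemma (in weight_scale) nonzero: "0 < r \<Longrightarrow> \<theta> r \<alpha> \<noteq> 0"
  using low[of r] by (metis ennreal_less_zero_iff le_zero_eq less_irrefl)

lemma ind_lim_cong: "(\<And>r. r \<in> I \<Longrightarrow> S r = T r) \<Longrightarrow> ind_lim I S = ind_lim I T"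
  unfolding ind_lim_def ind_open_def[abs_def] ind_nhd_def by (simp cong: SUP_cong)

lemma proj_lim_cong: "(\<And>r. r \<in> I \<Longrightarrow> S r = T r) \<Longrightarrow> proj_lim I S = proj_lim I T"
  unfolding proj_lim_def by (simp cong: SUP_cong INF_cong)

lemma roumieu_extends:
  assumes "roumieu (vtheta s :: real \<Rightarrow> nat ^ 'n::finite \<Rightarrow> ennreal) \<rho>" and p: "0 < p"
  shows
    "uniquely_extends jointly_continuous
      (A_hat p s :: 'n::finite wseries topology) (A_hat p s) (A_hat p s) \<and>
    uniquely_extends hypocontinuous
      (A_hat_dual p s :: 'n wseries topology) (B_hat p s) (A_hat_dual p s) \<and>
    uniquely_extends hypocontinuous
      (B_hat_star p s :: 'n wseries topology) (A_hat_dual p s) (A_hat_dual p s) \<and>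
    uniquely_extends hypocontinuous
      (B_hat p s :: 'n wseries topology) (B_hat p s) (B_hat p s) \<and>
    uniquely_extends hypocontinuous
      (B_hat_star p s :: 'n wseries topology) (B_hat_star p s) (B_hat_star p s) \<and>
    uniquely_extends hypocontinuous
      (C_hat p s :: 'n wseries topology) (C_hat p s) (C_hat p s) \<and>
    uniquely_extends hypocontinuous
      (C_hat_star p s :: 'n wseries topology) (C_hat_star p s) (C_hat_star p s)"
proof -
  interpret roumieu "vtheta s :: real \<Rightarrow> nat ^ 'n \<Rightarrow> ennreal" \<rho> by fact
  have A: "A_hat p s = proj_ind A.w"
    unfolding A_hat_def wt_tensor by (rule A.ind_lim_only[OF p refl])
  have "A_hat_dual p s = (PROJLIM r. wtop p (tensor (\<theta>i r) (\<theta>i r)))"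
    unfolding A_hat_dual_def by (intro proj_lim_cong arg_cong[where f = "wtop p"] wt_inv_tensor) (simp add: nonzero)
  also have "\<dots> = proj_ind A'.w"
    by (rule A'.proj_lim_only[OF p refl])
  finally have A': "A_hat_dual p s = proj_ind A'.w" .
  have B: "B_hat p s = proj_ind B.w"
    unfolding B_hat_def wt_om_tensor by (rule B.proj_lim_ind_lim[OF p])
  have B': "B_hat_star p s = proj_ind B'.w"
    unfolding B_hat_star_def wt_om_star_tensor by (rule B'.proj_lim_ind_lim[OF p])
  have C: "C_hat p s = ind_proj B.w"
    unfolding C_hat_def wt_om_tensor by (rule B.ind_lim_proj_lim[OF p])
  have C': "C_hat_star p s = ind_proj B'.w"
    unfolding C_hat_star_def wt_om_star_tensor by (rule B'.ind_lim_proj_lim[OF p])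
  show ?thesis
    unfolding A A' B B' C C' by (intro conjI extends_A extends_B)
qed

lemma beurling_extends:
  assumes "beurling (vtheta s :: real \<Rightarrow> nat ^ 'n::finite \<Rightarrow> ennreal) \<rho>" and p: "0 < p"
  shows
    "uniquely_extends jointly_continuous
      (A0_hat p s :: 'n::finite wseries topology) (A0_hat p s) (A0_hat p s) \<and>
    uniquely_extends hypocontinuous
      (A0_hat_dual p s :: 'n wseries topology) (B0_hat p s) (A0_hat_dual p s) \<and>
    uniquely_extends hypocontinuous
      (B0_hat_star p s :: 'n wseries topology) (A0_hat_dual p s) (A0_hat_dual p s) \<and>
    uniquely_extends hypocontinuous
      (B0_hat p s :: 'n wseries topology) (B0_hat p s) (B0_hat p s) \<and>
    uniquely_extends hypocontinuous
      (B0_hat_star p s :: 'n wseries topology) (B0_hat_star p s) (B0_hat_star p s) \<and>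
    uniquely_extends hypocontinuous
      (C0_hat p s :: 'n wseries topology) (C0_hat p s) (C0_hat p s) \<and>
    uniquely_extends hypocontinuous
      (C0_hat_star p s :: 'n wseries topology) (C0_hat_star p s) (C0_hat_star p s)"
proof -
  interpret beurling "vtheta s :: real \<Rightarrow> nat ^ 'n \<Rightarrow> ennreal" \<rho> by fact
  have A: "A0_hat p s = proj_ind A.w"
    unfolding A0_hat_def wt_tensor by (rule A.proj_lim_only[OF p refl])
  have "A0_hat_dual p s = (INDLIM r. wtop p (tensor (\<theta>i r) (\<theta>i r)))"
    unfolding A0_hat_dual_def by (intro ind_lim_cong arg_cong[where f = "wtop p"] wt_inv_tensor) (simp add: nonzero)
  also have "\<dots> = proj_ind A'.w"
    by (rule A'.ind_lim_only[OF p refl])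
  finally have A': "A0_hat_dual p s = proj_ind A'.w" .
  have B: "B0_hat p s = proj_ind B.w"
    unfolding B0_hat_def wt_om_tensor by (rule B.proj_lim_ind_lim[OF p])
  have B': "B0_hat_star p s = proj_ind B'.w"
    unfolding B0_hat_star_def wt_om_star_tensor by (rule B'.proj_lim_ind_lim[OF p])
  have C: "C0_hat p s = ind_proj B.w"
    unfolding C0_hat_def wt_om_tensor by (rule B.ind_lim_proj_lim[OF p])
  have C': "C0_hat_star p s = ind_proj B'.w"
    unfolding C0_hat_star_def wt_om_star_tensor by (rule B'.ind_lim_proj_lim[OF p])
  show ?thesis
    unfolding A A' B B' C C' by (intro conjI extends_A extends_B)
qed

theorem theorem4p17:
  fixes s :: rflat and p :: ennreal
  assumes "s \<in> Rflat" and "0 < p"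
  shows
    "(s < Num (1/2) \<longrightarrow>
       uniquely_extends jointly_continuous
         (A_hat p s :: 'n::finite wseries topology) (A_hat p s) (A_hat p s) \<and>
       uniquely_extends hypocontinuous
         (A_hat_dual p s :: 'n wseries topology) (B_hat p s) (A_hat_dual p s) \<and>
       uniquely_extends hypocontinuous
         (B_hat_star p s :: 'n wseries topology) (A_hat_dual p s) (A_hat_dual p s) \<and>
       uniquely_extends hypocontinuous
         (B_hat p s :: 'n wseries topology) (B_hat p s) (B_hat p s) \<and>
       uniquely_extends hypocontinuous
         (B_hat_star p s :: 'n wseries topology) (B_hat_star p s) (B_hat_star p s) \<and>
       uniquely_extends hypocontinuous
         (C_hat p s :: 'n wseries topology) (C_hat p s) (C_hat p s) \<and>
       uniquely_extends hypocontinuous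
         (C_hat_star p s :: 'n wseries topology) (C_hat_star p s) (C_hat_star p s)) \<and>
     (Num 0 < s \<and> s \<le> Num (1/2) \<longrightarrow>
       uniquely_extends jointly_continuous
         (A0_hat p s :: 'n wseries topology) (A0_hat p s) (A0_hat p s) \<and>
       uniquely_extends hypocontinuous
         (A0_hat_dual p s :: 'n wseries topology) (B0_hat p s) (A0_hat_dual p s) \<and>
       uniquely_extends hypocontinuous
         (B0_hat_star p s :: 'n wseries topology) (A0_hat_dual p s) (A0_hat_dual p s) \<and>
       uniquely_extends hypocontinuous
         (B0_hat p s :: 'n wseries topology) (B0_hat p s) (B0_hat p s) \<and>
       uniquely_extends hypocontinuous
         (B0_hat_star p s :: 'n wseries topology) (B0_hat_star p s) (B0_hat_star p s) \<and>
       uniquely_extends hypocontinuous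
         (C0_hat p s :: 'n wseries topology) (C0_hat p s) (C0_hat p s) \<and>
       uniquely_extends hypocontinuous
         (C0_hat_star p s :: 'n wseries topology) (C0_hat_star p s) (C0_hat_star p s))"
proof (intro conjI[of "_ \<longrightarrow> _"] impI)
  assume "s < Num (1/2)"
  then obtain \<rho> where "roumieu (vtheta s :: real \<Rightarrow> nat ^ 'n \<Rightarrow> ennreal) \<rho>"
    using roumieu_vtheta[OF assms(1)] by blast
  from roumieu_extends[OF this assms(2)] show "uniquely_extends jointly_continuous
      (A_hat p s :: 'n::finite wseries topology) (A_hat p s) (A_hat p s) \<and>
    uniquely_extends hypocontinuous
      (A_hat_dual p s :: 'n wseries topology) (B_hat p s) (A_hat_dual p s) \<and>
    uniquely_extends hypocontinuous
      (B_hat_star p s :: 'n wseries topology) (A_hat_dual p s) (A_hat_dual p s) \<and>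
    uniquely_extends hypocontinuous
      (B_hat p s :: 'n wseries topology) (B_hat p s) (B_hat p s) \<and>
    uniquely_extends hypocontinuous
      (B_hat_star p s :: 'n wseries topology) (B_hat_star p s) (B_hat_star p s) \<and>
    uniquely_extends hypocontinuous
      (C_hat p s :: 'n wseries topology) (C_hat p s) (C_hat p s) \<and>
    uniquely_extends hypocontinuous
      (C_hat_star p s :: 'n wseries topology) (C_hat_star p s) (C_hat_star p s)" .
next
  assume "Num 0 < s \<and> s \<le> Num (1/2)"
  then obtain \<rho> where "beurling (vtheta s :: real \<Rightarrow> nat ^ 'n \<Rightarrow> ennreal) \<rho>"
    using beurling_vtheta[OF assms(1)] by blast
  from beurling_extends[OF this assms(2)] show "uniquely_extends jointly_continuous
      (A0_hat p s :: 'n wseries topology) (A0_hat p s) (A0_hat p s) \<and>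
    uniquely_extends hypocontinuous
      (A0_hat_dual p s :: 'n wseries topology) (B0_hat p s) (A0_hat_dual p s) \<and>
    uniquely_extends hypocontinuous
      (B0_hat_star p s :: 'n wseries topology) (A0_hat_dual p s) (A0_hat_dual p s) \<and>
    uniquely_extends hypocontinuous
      (B0_hat p s :: 'n wseries topology) (B0_hat p s) (B0_hat p s) \<and>
    uniquely_extends hypocontinuous
      (B0_hat_star p s :: 'n wseries topology) (B0_hat_star p s) (B0_hat_star p s) \<and>
    uniquely_extends hypocontinuous
      (C0_hat p s :: 'n wseries topology) (C0_hat p s) (C0_hat p s) \<and>
    uniquely_extends hypocontinuous
      (C0_hat_star p s :: 'n wseries topology) (C0_hat_star p s) (C0_hat_star p s)" .
qed

end
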